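(* Let $R$ be the hyperfinite ${\rm II}_1$ factor, let $\theta\in(0,1)$ be irrational, and let $u,v\in R$ be unitary operators with $R=\{u,v\}''$ and $vu=e^{2\pi i\theta}uv$. Let $f\in L^\infty(S^1,m)$ be such that the zero set of $f$ has Lebesgue measure zero and $|f|(v)$ is not a scalar operator. Then the von Neumann algebra $W^*(uf(v))$ generated by $uf(v)$ is an irreducible subfactor of $R$ with index $n$ for some positive integer $n$.
   Context: $S^1$ is the unit circle in $\mathbb{C}$ with normalized Lebesgue (Haar) measure $m$. The unitary $v$ is a Haar unitary (its distribution with respect to the trace of $R$ is $m$), so $f(v)$ is defined by Borel functional calculus for $f\in L^\infty(S^1,m)$. $W^*(T)=\{T,T^*\}''$. A subfactor $N\subseteq R$ is irreducible if $N'\cap R=\mathbb{C}1$; the index $[R:N]$ is the Jones index. *)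

theory Defs
  imports "HOL-Analysis.Analysis"
begin

section \<open>Complex Hilbert spaces\<close>

text \<open>Inner products are linear in the first and conjugate linear in the second variable. The
  real Hilbert space structure inherited from \<^class>\<open>real_inner\<close> is the underlying one, so that
  norm, topology and completeness are those of the library.\<close>

class chilbert = real_inner + complete_space +
  fixes scaleC :: "complex \<Rightarrow> 'a \<Rightarrow> 'a" (infixr "*\<^sub>C" 75)
    and cinner :: "'a \<Rightarrow> 'a \<Rightarrow> complex"
  assumes scaleC_add_right: "a *\<^sub>C (x + y) = a *\<^sub>C x + a *\<^sub>C y"
    and scaleC_add_left: "(a + b) *\<^sub>C x = a *\<^sub>C x + b *\<^sub>C x"
    and scaleC_scaleC: "a *\<^sub>C (b *\<^sub>C x) = (a * b) *\<^sub>C x"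
    and scaleC_of_real: "complex_of_real r *\<^sub>C x = r *\<^sub>R x"
    and cinner_commute: "cinner x y = cnj (cinner y x)"
    and cinner_add_left: "cinner (x + y) z = cinner x z + cinner y z"
    and cinner_scaleC_left: "cinner (a *\<^sub>C x) y = a * cinner x y"
    and inner_eq_Re_cinner: "inner x y = Re (cinner x y)"

subsection \<open>The separable Hilbert space of square summable sequences\<close>

definition square_summable :: "(nat \<Rightarrow> complex) \<Rightarrow> bool" where
  "square_summable x \<longleftrightarrow> summable (\<lambda>n. (cmod (x n))\<^sup>2)"

lemma square_summable_add:
  assumes "square_summable x" "square_summable y"
  shows "square_summable (\<lambda>n. x n + y n)"
  unfolding square_summable_def
proof (rule summable_comparison_test')
  show "summable (\<lambda>n. 2 * ((cmod (x n))\<^sup>2 + (cmod (y n))\<^sup>2))"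
    using assms unfolding square_summable_def by (intro summable_mult summable_add)
  fix n
  have "(cmod (x n + y n))\<^sup>2 \<le> (cmod (x n) + cmod (y n))\<^sup>2"
    by (intro power_mono norm_triangle_ineq norm_ge_zero)
  also have "\<dots> \<le> 2 * ((cmod (x n))\<^sup>2 + (cmod (y n))\<^sup>2)"
    using sum_squares_bound[of "cmod (x n)" "cmod (y n)"] by (simp add: power2_sum)
  finally show "norm ((cmod (x n + y n))\<^sup>2) \<le> 2 * ((cmod (x n))\<^sup>2 + (cmod (y n))\<^sup>2)" by simp
qed

lemma square_summable_scale: "square_summable x \<Longrightarrow> square_summable (\<lambda>n. a * x n)"
  unfolding square_summable_def by (simp add: norm_mult power_mult_distrib summable_mult)

lemma square_summable_uminus: "square_summable x \<Longrightarrow> square_summable (\<lambda>n. - x n)"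
  unfolding square_summable_def by simp

lemma square_summable_diff:
  "square_summable x \<Longrightarrow> square_summable y \<Longrightarrow> square_summable (\<lambda>n. x n - y n)"
  using square_summable_add[OF _ square_summable_uminus, of x y] by simp

lemma square_summable_prod:
  assumes "square_summable x" "square_summable y"
  shows "summable (\<lambda>n. x n * cnj (y n))"
proof (rule summable_comparison_test')
  show "summable (\<lambda>n. (cmod (x n))\<^sup>2 + (cmod (y n))\<^sup>2)"
    using assms unfolding square_summable_def by (intro summable_add)
  fix n
  have "2 * (cmod (x n) * cmod (y n)) \<le> (cmod (x n))\<^sup>2 + (cmod (y n))\<^sup>2"
    using sum_squares_bound[of "cmod (x n)" "cmod (y n)"] by (simp add: mult.assoc)
  moreover have "0 \<le> cmod (x n) * cmod (y n)" by simp
  ultimately show "norm (x n * cnj (y n)) \<le> (cmod (x n))\<^sup>2 + (cmod (y n))\<^sup>2"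
    by (simp only: norm_mult complex_mod_cnj)
qed

typedef ell2 = "{x. square_summable x}" morphisms ell2_coeff Abs_ell2
  by (rule exI[of _ "\<lambda>_. 0"]) (simp add: square_summable_def)

setup_lifting type_definition_ell2

instantiation ell2 :: ab_group_add
begin
lift_definition zero_ell2 :: ell2 is "\<lambda>_. 0" by (simp add: square_summable_def)
lift_definition plus_ell2 :: "ell2 \<Rightarrow> ell2 \<Rightarrow> ell2" is "\<lambda>x y n. x n + y n"
  by (rule square_summable_add)
lift_definition minus_ell2 :: "ell2 \<Rightarrow> ell2 \<Rightarrow> ell2" is "\<lambda>x y n. x n - y n"
  by (rule square_summable_diff)
lift_definition uminus_ell2 :: "ell2 \<Rightarrow> ell2" is "\<lambda>x n. - x n"
  by (rule square_summable_uminus)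
instance by standard (transfer; auto)+
end

lemma summable_ell2: "summable (\<lambda>n. (cmod (ell2_coeff x n))\<^sup>2)"
  using ell2_coeff[of x] by (simp add: square_summable_def)

lemma summable_prod_ell2: "summable (\<lambda>n. ell2_coeff x n * cnj (ell2_coeff y n))"
  using ell2_coeff[of x] ell2_coeff[of y] by (simp add: square_summable_prod)

definition l2_inner :: "ell2 \<Rightarrow> ell2 \<Rightarrow> complex" where
  "l2_inner x y = (\<Sum>n. ell2_coeff x n * cnj (ell2_coeff y n))"

lemma Re_l2_inner_self: "Re (l2_inner x x) = (\<Sum>n. (cmod (ell2_coeff x n))\<^sup>2)"
  unfolding l2_inner_def
  by (subst Re_suminf[OF summable_prod_ell2]) (simp add: complex_mult_cnj cmod_power2)

instantiation ell2 :: real_inner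
begin
lift_definition scaleR_ell2 :: "real \<Rightarrow> ell2 \<Rightarrow> ell2" is "\<lambda>r x n. complex_of_real r * x n"
  by (rule square_summable_scale)
definition inner_ell2 :: "ell2 \<Rightarrow> ell2 \<Rightarrow> real" where "inner_ell2 x y = Re (l2_inner x y)"
definition norm_ell2 :: "ell2 \<Rightarrow> real" where "norm_ell2 x = sqrt (inner x x)"
definition sgn_ell2 :: "ell2 \<Rightarrow> ell2" where "sgn_ell2 x = inverse (norm x) *\<^sub>R x"
definition dist_ell2 :: "ell2 \<Rightarrow> ell2 \<Rightarrow> real" where "dist_ell2 x y = norm (x - y)"
definition uniformity_ell2 :: "(ell2 \<times> ell2) filter" where
  "uniformity_ell2 = (INF e\<in>{0<..}. principal {(x, y). dist x y < e})"
definition open_ell2 :: "ell2 set \<Rightarrow> bool" where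
  "open_ell2 U \<longleftrightarrow> (\<forall>x\<in>U. eventually (\<lambda>(x', y). x' = x \<longrightarrow> y \<in> U) uniformity)"
instance
proof
  fix x y z :: ell2 and r s :: real and U :: "ell2 set"
  show "r *\<^sub>R (x + y) = r *\<^sub>R x + r *\<^sub>R y" by transfer (simp add: ring_distribs)
  show "(r + s) *\<^sub>R x = r *\<^sub>R x + s *\<^sub>R x" by transfer (simp add: ring_distribs)
  show "r *\<^sub>R s *\<^sub>R x = (r * s) *\<^sub>R x" by transfer (simp add: mult.assoc)
  show "1 *\<^sub>R x = x" by transfer simp
  show "sgn x = inverse (norm x) *\<^sub>R x" by (rule sgn_ell2_def)
  show "dist x y = norm (x - y)" by (rule dist_ell2_def)
  show "uniformity = (INF e\<in>{0<..}. principal {(x :: ell2, y). dist x y < e})"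
    by (rule uniformity_ell2_def)
  show "open U \<longleftrightarrow> (\<forall>x\<in>U. eventually (\<lambda>(x', y). x' = x \<longrightarrow> y \<in> U) uniformity)"
    by (rule open_ell2_def)
  show "norm x = sqrt (inner x x)" by (rule norm_ell2_def)
  have "inner x y = (\<Sum>n. Re (ell2_coeff x n * cnj (ell2_coeff y n)))" for x y :: ell2
    unfolding inner_ell2_def l2_inner_def by (rule Re_suminf[OF summable_prod_ell2])
  note inner_sum = this
  have summable_inner: "summable (\<lambda>n. Re (ell2_coeff x n * cnj (ell2_coeff y n)))" for x y :: ell2
    by (rule summable_Re[OF summable_prod_ell2])
  show "inner x y = inner y x" unfolding inner_sum by (simp add: mult.commute)
  show "inner (x + y) z = inner x z + inner y z"
    unfolding inner_sum
    by (subst suminf_add[OF summable_inner summable_inner])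
       (simp add: plus_ell2.rep_eq distrib_right)
  show "inner (r *\<^sub>R x) y = r * inner x y"
    unfolding inner_sum
    by (subst suminf_mult[OF summable_inner, symmetric])
       (simp add: scaleR_ell2.rep_eq right_diff_distrib mult.assoc)
  have self: "inner x x = (\<Sum>n. (cmod (ell2_coeff x n))\<^sup>2)"
    unfolding inner_ell2_def by (rule Re_l2_inner_self)
  show "0 \<le> inner x x" unfolding self by (intro suminf_nonneg summable_ell2) simp
  have "inner x x = 0 \<longleftrightarrow> (\<forall>n. ell2_coeff x n = 0)"
    unfolding self by (subst suminf_eq_zero_iff[OF summable_ell2]) simp_all
  then show "inner x x = 0 \<longleftrightarrow> x = 0"
    by (simp add: ell2_coeff_inject[symmetric] zero_ell2.rep_eq fun_eq_iff)
qed
end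

lemma norm_ell2_sq: "(norm x)\<^sup>2 = (\<Sum>n. (cmod (ell2_coeff x n))\<^sup>2)"
  by (simp add: power2_norm_eq_inner inner_ell2_def Re_l2_inner_self)

lemma sum_le_norm_ell2: "(\<Sum>n<k. (cmod (ell2_coeff x n))\<^sup>2) \<le> (norm x)\<^sup>2"
  unfolding norm_ell2_sq by (rule sum_le_suminf[OF summable_ell2]) auto

lemma coeff_le_norm_ell2: "cmod (ell2_coeff x n) \<le> norm x"
proof (rule power2_le_imp_le)
  have "(cmod (ell2_coeff x n))\<^sup>2 \<le> (\<Sum>k<Suc n. (cmod (ell2_coeff x k))\<^sup>2)"
    by (simp add: sum_nonneg)
  then show "(cmod (ell2_coeff x n))\<^sup>2 \<le> (norm x)\<^sup>2"
    using sum_le_norm_ell2[of x "Suc n"] by linarith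
qed simp

instance ell2 :: complete_space
proof
  fix X :: "nat \<Rightarrow> ell2"
  assume X: "Cauchy X"
  have "Cauchy (\<lambda>m. ell2_coeff (X m) k)" for k
  proof (rule metric_CauchyI)
    fix e :: real assume "0 < e"
    then obtain M where M: "\<And>m n. m \<ge> M \<Longrightarrow> n \<ge> M \<Longrightarrow> dist (X m) (X n) < e"
      using metric_CauchyD[OF X] by blast
    have "dist (ell2_coeff (X m) k) (ell2_coeff (X n) k) \<le> dist (X m) (X n)" for m n
      using coeff_le_norm_ell2[of "X m - X n" k] by (simp add: dist_norm minus_ell2.rep_eq)
    then show "\<exists>M. \<forall>m\<ge>M. \<forall>n\<ge>M. dist (ell2_coeff (X m) k) (ell2_coeff (X n) k) < e"
      using M by (meson le_less_trans)
  qed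
  then have "\<exists>a. (\<lambda>m. ell2_coeff (X m) k) \<longlonglongrightarrow> a" for k
    using Cauchy_convergent convergent_def by blast
  then obtain l where l: "\<And>k. (\<lambda>m. ell2_coeff (X m) k) \<longlonglongrightarrow> l k" by metis
  have tail: "\<exists>M. \<forall>m\<ge>M. \<forall>K. (\<Sum>k<K. (cmod (ell2_coeff (X m) k - l k))\<^sup>2) \<le> e\<^sup>2"
    if "0 < e" for e :: real
  proof -
    obtain M where M: "\<And>m n. m \<ge> M \<Longrightarrow> n \<ge> M \<Longrightarrow> dist (X m) (X n) < e"
      using metric_CauchyD[OF X \<open>0 < e\<close>] by blast
    have "(\<Sum>k<K. (cmod (ell2_coeff (X m) k - l k))\<^sup>2) \<le> e\<^sup>2" if m: "m \<ge> M" for m K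
    proof (rule LIMSEQ_le_const2)
      show "(\<lambda>n. \<Sum>k<K. (cmod (ell2_coeff (X m) k - ell2_coeff (X n) k))\<^sup>2)
          \<longlonglongrightarrow> (\<Sum>k<K. (cmod (ell2_coeff (X m) k - l k))\<^sup>2)"
        by (intro tendsto_intros l)
      have "(\<Sum>k<K. (cmod (ell2_coeff (X m) k - ell2_coeff (X n) k))\<^sup>2) \<le> e\<^sup>2" if n: "n \<ge> M" for n
      proof -
        have "(norm (X m - X n))\<^sup>2 \<le> e\<^sup>2"
          using M[OF m n] by (intro power_mono) (auto simp: dist_norm)
        then show ?thesis
          using sum_le_norm_ell2[where x = "X m - X n" and k = K] by (simp add: minus_ell2.rep_eq)
      qed
      then show "\<exists>N. \<forall>n\<ge>N. (\<Sum>k<K. (cmod (ell2_coeff (X m) k - ell2_coeff (X n) k))\<^sup>2) \<le> e\<^sup>2"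
        by blast
    qed
    then show ?thesis by blast
  qed
  have sq: "square_summable (\<lambda>k. ell2_coeff (X m) k - l k)"
    if "\<forall>K. (\<Sum>k<K. (cmod (ell2_coeff (X m) k - l k))\<^sup>2) \<le> e\<^sup>2" for m and e :: real
    unfolding square_summable_def using that
    by (intro summableI_nonneg_bounded[where x = "e\<^sup>2"]) auto
  obtain M where "\<forall>K. (\<Sum>k<K. (cmod (ell2_coeff (X M) k - l k))\<^sup>2) \<le> 1\<^sup>2"
    using tail[of 1] by auto
  from square_summable_diff[OF _ sq[OF this], of "ell2_coeff (X M)"] ell2_coeff[of "X M"]
  have "square_summable l" by simp
  then have l_coeff: "ell2_coeff (Abs_ell2 l) = l" by (simp add: Abs_ell2_inverse)
  have "X \<longlonglongrightarrow> Abs_ell2 l"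
  proof (rule metric_LIMSEQ_I)
    fix e :: real assume "0 < e"
    then obtain M where M: "\<And>m K. m \<ge> M \<Longrightarrow> (\<Sum>k<K. (cmod (ell2_coeff (X m) k - l k))\<^sup>2) \<le> (e / 2)\<^sup>2"
      using tail[of "e / 2"] by auto
    have "dist (X m) (Abs_ell2 l) < e" if "m \<ge> M" for m
    proof -
      have summable_diff: "summable (\<lambda>k. (cmod (ell2_coeff (X m) k - l k))\<^sup>2)"
        using summable_ell2[of "X m - Abs_ell2 l"] unfolding minus_ell2.rep_eq l_coeff .
      have "(norm (X m - Abs_ell2 l))\<^sup>2 \<le> (e / 2)\<^sup>2"
        unfolding norm_ell2_sq minus_ell2.rep_eq l_coeff
        by (rule suminf_le_const[OF summable_diff M[OF that]])
      moreover have "0 \<le> e / 2" using \<open>0 < e\<close> by simp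
      ultimately have "norm (X m - Abs_ell2 l) \<le> e / 2" by (rule power2_le_imp_le)
      then show ?thesis using \<open>0 < e\<close> by (simp add: dist_norm)
    qed
    then show "\<exists>no. \<forall>n\<ge>no. dist (X n) (Abs_ell2 l) < e" by blast
  qed
  then show "convergent X" unfolding convergent_def by blast
qed

instantiation ell2 :: chilbert
begin
lift_definition scaleC_ell2 :: "complex \<Rightarrow> ell2 \<Rightarrow> ell2" is "\<lambda>a x n. a * x n"
  by (rule square_summable_scale)
definition cinner_ell2 :: "ell2 \<Rightarrow> ell2 \<Rightarrow> complex" where "cinner_ell2 = l2_inner"
instance
proof
  fix x y z :: ell2 and a b :: complex and r :: real
  show "a *\<^sub>C (x + y) = a *\<^sub>C x + a *\<^sub>C y" by transfer (simp add: ring_distribs)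
  show "(a + b) *\<^sub>C x = a *\<^sub>C x + b *\<^sub>C x" by transfer (simp add: ring_distribs)
  show "a *\<^sub>C b *\<^sub>C x = (a * b) *\<^sub>C x" by transfer (simp add: mult.assoc)
  show "complex_of_real r *\<^sub>C x = r *\<^sub>R x" by transfer simp
  show "cinner x y = cnj (cinner y x)"
    unfolding cinner_ell2_def l2_inner_def
    by (subst bounded_linear.suminf[OF bounded_linear_cnj summable_prod_ell2]) (simp add: mult.commute)
  show "cinner (x + y) z = cinner x z + cinner y z"
    unfolding cinner_ell2_def l2_inner_def
    by (subst suminf_add[OF summable_prod_ell2 summable_prod_ell2])
       (simp add: plus_ell2.rep_eq ring_distribs)
  show "cinner (a *\<^sub>C x) y = a * cinner x y"
    unfolding cinner_ell2_def l2_inner_def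
    by (subst suminf_mult[OF summable_prod_ell2, symmetric]) (simp add: scaleC_ell2.rep_eq mult.assoc)
  show "inner x y = Re (cinner x y)" by (simp add: cinner_ell2_def inner_ell2_def)
qed
end


section \<open>Bounded operators\<close>

text \<open>A bounded operator is a bounded real linear map of the library that commutes with complex
  scalars; sums, composition and the operator norm are those of the library.\<close>

type_synonym 'h oper = "'h \<Rightarrow>\<^sub>L 'h"

definition bounded_ops :: "'h::chilbert oper set" where
  "bounded_ops = {T :: 'h oper. \<forall>a x. T (a *\<^sub>C x) = a *\<^sub>C T x}"

definition scalar_op :: "complex \<Rightarrow> 'h::chilbert oper" where
  "scalar_op a = Blinfun (\<lambda>x. a *\<^sub>C x)"

definition adj :: "'h::chilbert oper \<Rightarrow> 'h oper" where
  "adj T = (THE S :: 'h oper. \<forall>x y. cinner (T x) y = cinner x (S y))"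

definition unitary_op :: "'h::chilbert oper \<Rightarrow> bool" where
  "unitary_op U \<longleftrightarrow> U \<in> bounded_ops \<and>
     adj U o\<^sub>L U = id_blinfun \<and> U o\<^sub>L adj U = id_blinfun"

section \<open>Von Neumann algebras\<close>

definition commutant :: "'h::chilbert oper set \<Rightarrow> 'h oper set" where
  "commutant S = {T \<in> bounded_ops. \<forall>A\<in>S. T o\<^sub>L A = A o\<^sub>L T}"

definition von_neumann_algebra :: "'h::chilbert oper set \<Rightarrow> bool" where
  "von_neumann_algebra M \<longleftrightarrow> adj ` M \<subseteq> M \<and> commutant (commutant M) = M"

definition Wstar :: "'h::chilbert oper \<Rightarrow> 'h oper set" where
  "Wstar T = commutant (commutant {T, adj T})"

definition factor :: "'h::chilbert oper set \<Rightarrow> bool" where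
  "factor M \<longleftrightarrow> von_neumann_algebra M \<and> M \<inter> commutant M = range scalar_op"

text \<open>Every von Neumann algebra here contains the identity of the Hilbert space, so a subfactor has
  the same unit as the ambient factor.\<close>

definition irreducible_subfactor :: "'h::chilbert oper set \<Rightarrow> 'h oper set \<Rightarrow> bool" where
  "irreducible_subfactor M N \<longleftrightarrow>
     factor N \<and> N \<subseteq> M \<and> commutant N \<inter> M = range scalar_op"

section \<open>Traces and factors of type II1\<close>

text \<open>The ultraweakly continuous functionals are those of the form
  \<open>x \<mapsto> \<Sum>i. \<langle>x \<xi>\<^sub>i, \<eta>\<^sub>i\<rangle>\<close> with \<open>\<Sum>i. \<parallel>\<xi>\<^sub>i\<parallel>\<^sup>2\<close> and \<open>\<Sum>i. \<parallel>\<eta>\<^sub>i\<parallel>\<^sup>2\<close> finite.\<close>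

definition ultraweakly_continuous :: "'h::chilbert oper set \<Rightarrow> ('h oper \<Rightarrow> complex) \<Rightarrow> bool" where
  "ultraweakly_continuous M \<tau> \<longleftrightarrow>
     (\<exists>\<xi> \<eta> :: nat \<Rightarrow> 'h. summable (\<lambda>i. (norm (\<xi> i))\<^sup>2) \<and> summable (\<lambda>i. (norm (\<eta> i))\<^sup>2) \<and>
        (\<forall>x\<in>M. (\<lambda>i. cinner (blinfun_apply x (\<xi> i)) (\<eta> i)) sums \<tau> x))"

definition tracial_state :: "'h::chilbert oper set \<Rightarrow> ('h oper \<Rightarrow> complex) \<Rightarrow> bool" where
  "tracial_state M \<tau> \<longleftrightarrow>
     (\<forall>x\<in>M. \<forall>y\<in>M. \<tau> (x + y) = \<tau> x + \<tau> y) \<and>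
     (\<forall>a. \<forall>x\<in>M. \<tau> (scalar_op a o\<^sub>L x) = a * \<tau> x) \<and>
     (\<forall>x\<in>M. \<tau> (adj x o\<^sub>L x) \<in> \<real>\<^sub>\<ge>\<^sub>0) \<and>
     \<tau> id_blinfun = 1 \<and>
     (\<forall>x\<in>M. \<forall>y\<in>M. \<tau> (x o\<^sub>L y) = \<tau> (y o\<^sub>L x)) \<and>
     ultraweakly_continuous M \<tau>"

definition finite_factor :: "'h::chilbert oper set \<Rightarrow> bool" where
  "finite_factor M \<longleftrightarrow> factor M \<and> (\<exists>\<tau>. tracial_state M \<tau>)"

text \<open>The tracial state of a finite factor is unique on the factor; values outside of \<open>M\<close> carry no
  meaning.\<close>

definition vn_trace :: "'h::chilbert oper set \<Rightarrow> 'h oper \<Rightarrow> complex" where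
  "vn_trace M = (SOME \<tau>. tracial_state M \<tau>)"

text \<open>The span is the real one; for complex subspaces, having finite dimension over the reals and
  over the complex numbers is the same.\<close>

definition finite_dimensional :: "'h::chilbert oper set \<Rightarrow> bool" where
  "finite_dimensional A \<longleftrightarrow> (\<exists>B. finite B \<and> A \<subseteq> span B)"

definition II1_factor :: "'h::chilbert oper set \<Rightarrow> bool" where
  "II1_factor M \<longleftrightarrow> finite_factor M \<and> \<not> finite_dimensional M"

definition star_subalgebra :: "'h::chilbert oper set \<Rightarrow> bool" where
  "star_subalgebra A \<longleftrightarrow> A \<subseteq> bounded_ops \<and> id_blinfun \<in> A \<and>
     (\<forall>x\<in>A. \<forall>y\<in>A. x + y \<in> A \<and> x o\<^sub>L y \<in> A) \<and>
     (\<forall>a. \<forall>x\<in>A. scalar_op a o\<^sub>L x \<in> A) \<and> (\<forall>x\<in>A. adj x \<in> A)"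

definition hyperfinite :: "'h::chilbert oper set \<Rightarrow> bool" where
  "hyperfinite M \<longleftrightarrow>
     (\<exists>A :: nat \<Rightarrow> 'h oper set.
        (\<forall>n. star_subalgebra (A n) \<and> finite_dimensional (A n) \<and> A n \<subseteq> A (Suc n)) \<and>
        M = commutant (commutant (\<Union>n. A n)))"

section \<open>The Jones index\<close>

text \<open>The orthogonal projection onto the closure of \<open>M \<xi>\<close>.\<close>

definition cyclic_proj :: "'h::chilbert oper set \<Rightarrow> 'h \<Rightarrow> 'h oper" where
  "cyclic_proj M \<xi> = (THE P :: 'h oper. P \<in> bounded_ops \<and>
     (\<forall>x. P x \<in> closure ((\<lambda>T :: 'h oper. T \<xi>) ` M) \<and> (\<forall>T\<in>M. cinner (x - P x) (blinfun_apply T \<xi>) = 0)))"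

text \<open>The coupling constant \<open>dim\<^sub>N H\<close> of Murray and von Neumann of a finite factor \<open>N\<close> acting on \<open>H\<close>.
  By their theorem the quotient does not depend on the vector \<open>\<xi> \<noteq> 0\<close> at which it is evaluated.\<close>

definition coupling_constant :: "'h::chilbert oper set \<Rightarrow> 'h \<Rightarrow> ereal" where
  "coupling_constant N \<xi> =
     (if finite_factor (commutant N)
      then ereal (Re (vn_trace N (cyclic_proj (commutant N) \<xi>)) /
                  Re (vn_trace (commutant N) (cyclic_proj N \<xi>)))
      else \<infinity>)"

text \<open>\<open>\<pi>\<close> is the GNS representation of \<open>M\<close> for its trace, with cyclic vector \<open>\<Omega>\<close>: it identifies the
  Hilbert space \<open>'k\<close> with \<open>L\<^sup>2(M)\<close>, on which \<open>M\<close> acts by left multiplication.\<close>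

definition standard_representation ::
    "'h::chilbert oper set \<Rightarrow> ('h oper \<Rightarrow> 'k::chilbert oper) \<Rightarrow> 'k \<Rightarrow> bool" where
  "standard_representation M \<pi> \<Omega> \<longleftrightarrow>
     (\<forall>x\<in>M. \<pi> x \<in> bounded_ops) \<and>
     (\<forall>x\<in>M. \<forall>y\<in>M. \<pi> (x + y) = \<pi> x + \<pi> y \<and> \<pi> (x o\<^sub>L y) = \<pi> x o\<^sub>L \<pi> y) \<and>
     (\<forall>a. \<forall>x\<in>M. \<pi> (scalar_op a o\<^sub>L x) = scalar_op a o\<^sub>L \<pi> x) \<and>
     (\<forall>x\<in>M. \<pi> (adj x) = adj (\<pi> x)) \<and>
     closure ((\<lambda>x. \<pi> x \<Omega>) ` M) = UNIV \<and>
     (\<forall>x\<in>M. cinner (\<pi> x \<Omega>) \<Omega> = vn_trace M x)"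

text \<open>\<open>[M : N] = dim\<^sub>N L\<^sup>2(M)\<close> for II1 factors \<open>M\<close> such that \<open>L\<^sup>2(M)\<close> is separable (every hyperfinite
  one is): then \<open>L\<^sup>2(M)\<close> is a separable Hilbert space of infinite dimension and can be realized as
  \<^typ>\<open>ell2\<close>. All realizations are unitarily equivalent, so the choice is immaterial.\<close>

definition jones_index :: "'h::chilbert oper set \<Rightarrow> 'h oper set \<Rightarrow> ereal" where
  "jones_index M N =
     (case (SOME (\<pi>, \<Omega>). standard_representation M \<pi> (\<Omega> :: ell2)) of
        (\<pi>, \<Omega>) \<Rightarrow> coupling_constant (\<pi> ` N) \<Omega>)"

section \<open>Functional calculus for unitaries\<close>

definition circle_measure :: "complex measure" where
  "circle_measure = distr (uniform_measure lborel {0..1}) borel (\<lambda>t. exp (2 * of_real pi * \<i> * of_real t))"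

text \<open>Representatives of the elements of \<open>L\<^sup>\<infinity>(S\<^sup>1, m)\<close>: Borel functions that are essentially bounded
  (values off the circle are irrelevant, as it has full measure).\<close>

definition Linfty_circle :: "(complex \<Rightarrow> complex) set" where
  "Linfty_circle = {f \<in> borel_measurable circle_measure. \<exists>C. AE z in circle_measure. cmod (f z) \<le> C}"

text \<open>The measure \<open>E \<mapsto> \<langle>1\<^sub>E(v) \<xi>, \<xi>\<rangle>\<close> on the circle, determined by its Fourier coefficients.\<close>

definition spectral_measure :: "'h::chilbert oper \<Rightarrow> 'h \<Rightarrow> complex measure" where
  "spectral_measure v \<xi> = (THE \<mu>. sets \<mu> = sets borel \<and> finite_measure \<mu> \<and>
     emeasure \<mu> (- sphere 0 1) = 0 \<and>
     (\<forall>n::nat. (\<integral>z. z ^ n \<partial>\<mu>) = cinner ((blinfun_apply v ^^ n) \<xi>) \<xi>))"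

definition borel_calculus :: "(complex \<Rightarrow> complex) \<Rightarrow> 'h::chilbert oper \<Rightarrow> 'h oper" where
  "borel_calculus f v = (THE T :: 'h oper. T \<in> bounded_ops \<and>
     (\<forall>\<xi>. cinner (T \<xi>) \<xi> = (\<integral>z. f z \<partial>spectral_measure v \<xi>)))"

end

theory Submission
  imports Defs "HOL-Probability.Probability"
begin

text \<open>Let \<open>\<lambda> = e\<^sup>2\<^sup>\<pi>\<^sup>i\<^sup>\<theta>\<close> and \<open>N = W\<^sup>*(u f(v))\<close>. The polar part \<open>w = u (f / |f|)(v)\<close> and \<open>|f|\<^sup>2(v)\<close> lie in \<open>N\<close>, and
  \<open>v w = \<lambda> w v\<close>; moreover \<open>v\<close> normalizes \<open>N\<close>. On \<open>L\<^sup>2(R)\<close>, which has the orthonormal basis \<open>u\<^sup>m v\<^sup>n \<Omega>\<close>, the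
  conjugations by \<open>v\<close> and by \<open>w\<close> commute with the projection \<open>E\<close> onto the closure of \<open>N \<Omega>\<close>, and \<open>v\<^sup>j \<Omega>\<close> is up to
  scalars their only joint eigenvector for its eigenvalues \<open>1\<close> and \<open>\<lambda>\<^sup>-\<^sup>j\<close>. Hence \<open>E v\<^sup>j \<Omega>\<close> is \<open>v\<^sup>j \<Omega>\<close> or \<open>0\<close>. The
  exponents of the first kind form a group \<open>n \<int>\<close>, with \<open>n \<noteq> 0\<close> because \<open>|f|\<^sup>2(v)\<close> is not a scalar, and the
  corresponding \<open>v\<^sup>j\<close> commute with \<open>N'\<close>. An operator of \<open>R\<close> commuting with \<open>N\<close> is therefore fixed by the
  conjugations by \<open>v\<^sup>n\<close> and \<open>w\<close>, so its only Fourier coefficient is the constant one. Since the vectors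
  \<open>w\<^sup>m v\<^sup>j \<Omega>\<close> are total, the conjugates of \<open>E\<close> by right multiplication with \<open>1, v, \<dots>, v\<^sup>n\<^sup>-\<^sup>1\<close> add up to the
  identity of \<open>N'\<close>, so that every trace of \<open>N'\<close> takes the value \<open>1 / n\<close> at \<open>E\<close>.

  That \<open>f(v)\<close> depends only on the class of \<open>f\<close> follows from the trace: a null set for Haar measure may be
  taken invariant under the rotation, and then its spectral projection is central of trace zero.\<close>

section \<open>Complex Hilbert spaces\<close>

text \<open>The definitions fix spectral measures, the functional calculus and cyclic projections by
  definite descriptions, traces and the standard representation by choice. So existence has to be
  supplied throughout, and the index must come out the same for whichever trace and representation
  were chosen; hence the evaluation of \<open>E\<close> against every trace of the commutant.

  Conjugation by \<open>v\<close> multiplies the generator \<open>u f(v)\<close> by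
  \<open>\<lambda>\<close>, which is why \<open>v\<close> normalizes \<open>N\<close>. The joint
  eigenvalues are simple because conjugation by \<open>v\<close> acts on \<open>u^m v^n\<close> by
  \<open>\<lambda>^m\<close>, conjugation by \<open>w\<close> acts on \<open>v^n\<close> by
  \<open>\<lambda>^(-n)\<close>, and \<open>\<lambda>\<close> is not a root of unity.

  The main obstacle: a vector \<open>v^j \<Omega>\<close> in the closure of
  \<open>N \<Omega>\<close> is only a 2-norm limit of elements of \<open>N\<close>, whose operator
  norms may be unbounded. Instead of placing \<open>v^j\<close> in \<open>N\<close>, the argument
  shows that it commutes with \<open>N'\<close>, by matrix coefficients between vectors at which
  right multiplication is bounded. Polar parts and absolute values are taken of the function
  \<open>f\<close> rather than of operators.\<close>

no_notation HLD_nxt (infixr "\<cdot>" 65)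
notation blinfun_apply (infixr "\<cdot>" 80)

instance chilbert \<subseteq> banach ..

lemma scaleC_zero_left [simp]: "0 *\<^sub>C (x::'h::chilbert) = 0"
  using scaleC_of_real[of 0 x] by simp

lemma scaleC_one [simp]: "1 *\<^sub>C (x::'h::chilbert) = x"
  using scaleC_of_real[of 1 x] by simp

lemma scaleC_zero_right [simp]: "a *\<^sub>C (0::'h::chilbert) = 0"
  using scaleC_add_right[of a 0 0] by simp

lemma scaleC_minus_one: "(-1) *\<^sub>C (x::'h::chilbert) = - x"
  using scaleC_of_real[of "-1" x] by simp

lemma scaleC_minus_right: "a *\<^sub>C (- x::'h::chilbert) = - (a *\<^sub>C x)"
  using scaleC_add_right[of a x "-x"] by (simp add: add_eq_0_iff)

lemma scaleC_minus_left: "(- a) *\<^sub>C (x::'h::chilbert) = - (a *\<^sub>C x)"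
  using scaleC_add_left[of a "-a" x] by (simp add: add_eq_0_iff)

lemma scaleC_diff_right: "a *\<^sub>C (x - y::'h::chilbert) = a *\<^sub>C x - a *\<^sub>C y"
  using scaleC_add_right[of a x "-y"] by (simp add: scaleC_minus_right)

lemma scaleC_diff_left: "(a - b) *\<^sub>C (x::'h::chilbert) = a *\<^sub>C x - b *\<^sub>C x"
  using scaleC_add_left[of a "-b" x] by (simp add: scaleC_minus_left)

lemma scaleC_scaleR: "a *\<^sub>C (r *\<^sub>R (x::'h::chilbert)) = r *\<^sub>R (a *\<^sub>C x)"
  by (simp add: scaleC_of_real[symmetric] scaleC_scaleC mult.commute)

lemma cinner_add_right: "cinner x (y + z) = cinner x y + cinner x (z::'h::chilbert)"
  by (metis cinner_add_left cinner_commute complex_cnj_add)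

lemma cinner_scaleC_right: "cinner x (a *\<^sub>C y) = cnj a * cinner x (y::'h::chilbert)"
  by (metis cinner_commute cinner_scaleC_left complex_cnj_mult)

lemma cinner_scaleR_left: "cinner (r *\<^sub>R x) y = of_real r * cinner x (y::'h::chilbert)"
  by (metis cinner_scaleC_left scaleC_of_real)

lemma cinner_scaleR_right: "cinner x (r *\<^sub>R y) = of_real r * cinner x (y::'h::chilbert)"
  by (metis cinner_scaleC_right complex_cnj_complex_of_real scaleC_of_real)

lemma cinner_zero_left [simp]: "cinner 0 (y::'h::chilbert) = 0"
  using cinner_add_left[of 0 0 y] by simp

lemma cinner_zero_right [simp]: "cinner (y::'h::chilbert) 0 = 0"
  using cinner_add_right[of y 0 0] by simp

lemma cinner_minus_left: "cinner (- x) y = - cinner x (y::'h::chilbert)"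
  using cinner_add_left[of x "-x" y] by (simp add: add_eq_0_iff)

lemma cinner_minus_right: "cinner x (- y) = - cinner x (y::'h::chilbert)"
  using cinner_add_right[of x y "-y"] by (simp add: add_eq_0_iff)

lemma cinner_diff_left: "cinner (x - y) z = cinner x z - cinner y (z::'h::chilbert)"
  using cinner_add_left[of x "-y" z] by (simp add: cinner_minus_left)

lemma cinner_diff_right: "cinner z (x - y) = cinner z x - cinner z (y::'h::chilbert)"
  using cinner_add_right[of z x "-y"] by (simp add: cinner_minus_right)

lemma cinner_sum_left: "cinner (\<Sum>i\<in>I. f i) (y::'h::chilbert) = (\<Sum>i\<in>I. cinner (f i) y)"
  by (induction I rule: infinite_finite_induct) (auto simp: cinner_add_left)

lemma cinner_sum_right: "cinner (y::'h::chilbert) (\<Sum>i\<in>I. f i) = (\<Sum>i\<in>I. cinner y (f i))"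
  by (induction I rule: infinite_finite_induct) (auto simp: cinner_add_right)

lemma cinner_self: "cinner x (x::'h::chilbert) = of_real ((norm x)\<^sup>2)"
proof -
  have "cinner x x = cnj (cinner x x)" by (rule cinner_commute)
  then have "Im (cinner x x) = 0" by (metis complex_cnj_cancel_iff complex_is_Real_iff Reals_cnj_iff)
  moreover have "Re (cinner x x) = (norm x)\<^sup>2"
    by (simp add: inner_eq_Re_cinner[symmetric] power2_norm_eq_inner)
  ultimately show ?thesis by (simp add: complex_eq_iff)
qed

lemma norm_scaleC [simp]: "norm (a *\<^sub>C (x::'h::chilbert)) = cmod a * norm x"
proof -
  have "of_real ((norm (a *\<^sub>C x))\<^sup>2) = (a * cnj a) * cinner x x"
    unfolding cinner_self[symmetric] by (simp add: cinner_scaleC_left cinner_scaleC_right)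
  also have "\<dots> = of_real ((cmod a * norm x)\<^sup>2)"
    by (simp add: cinner_self complex_norm_square[symmetric] power_mult_distrib)
  finally have "(norm (a *\<^sub>C x))\<^sup>2 = (cmod a * norm x)\<^sup>2" using of_real_eq_iff by blast
  then show ?thesis by (simp add: power2_eq_iff_nonneg)
qed

text \<open>A unimodular factor \<open>c\<close> turns \<open>cinner x y\<close> into its absolute
  value, and the real Cauchy-Schwarz inequality applies to \<open>c *\<^sub>C x\<close>.\<close>

lemma cmod_cinner_le: "cmod (cinner x y) \<le> norm x * norm (y::'h::chilbert)"
proof (cases "cinner x y = 0")
  case False
  define c where "c = cnj (cinner x y) / cmod (cinner x y)"
  have c: "cmod c = 1" using False by (simp add: c_def norm_divide)
  have "c * cinner x y = of_real (cmod (cinner x y))"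
    using False by (simp add: c_def complex_norm_square[symmetric] mult.commute power2_eq_square)
  then have "cmod (cinner x y) = Re (cinner (c *\<^sub>C x) y)" by (simp add: cinner_scaleC_left)
  also have "\<dots> \<le> norm (c *\<^sub>C x) * norm y"
    unfolding inner_eq_Re_cinner[symmetric] by (rule norm_cauchy_schwarz)
  finally show ?thesis using c by simp
qed simp

lemma bounded_bilinear_cinner: "bounded_bilinear (cinner :: 'h::chilbert \<Rightarrow> 'h \<Rightarrow> complex)"
proof
  show "\<exists>K. \<forall>a b::'h. norm (cinner a b) \<le> norm a * norm b * K"
    by (rule exI[of _ 1]) (simp add: cmod_cinner_le)
qed (simp_all add: cinner_add_left cinner_add_right cinner_scaleR_left cinner_scaleR_right scaleR_conv_of_real)

lemma tendsto_cinner [tendsto_intros]: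
  fixes a b :: "'h::chilbert"
  shows "(f \<longlongrightarrow> a) F \<Longrightarrow> (g \<longlongrightarrow> b) F \<Longrightarrow> ((\<lambda>x. cinner (f x) (g x)) \<longlongrightarrow> cinner a b) F"
  by (rule bounded_bilinear.tendsto[OF bounded_bilinear_cinner])

lemma tendsto_scaleC_right [tendsto_intros]:
  fixes a :: "'h::chilbert"
  assumes "(f \<longlongrightarrow> a) F" shows "((\<lambda>x. c *\<^sub>C f x) \<longlongrightarrow> c *\<^sub>C a) F"
proof -
  have "bounded_linear (\<lambda>x::'h. c *\<^sub>C x)"
    by (rule bounded_linear_intro[of _ "cmod c"])
      (simp_all add: scaleC_add_right scaleC_scaleR mult.commute)
  then show ?thesis using assms by (rule bounded_linear.tendsto)
qed

lemma cinner_ext_left: "(\<And>y. cinner x y = cinner z (y::'h::chilbert)) \<Longrightarrow> x = z"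
proof -
  assume "\<And>y. cinner x y = cinner z y"
  then have "cinner (x - z) (x - z) = 0" by (simp add: cinner_diff_left)
  then show ?thesis by (simp add: cinner_self)
qed

lemma cinner_ext_right: "(\<And>y. cinner y x = cinner (y::'h::chilbert) z) \<Longrightarrow> x = z"
  by (rule cinner_ext_left) (metis cinner_commute)

lemma cinner_self_eq_0 [simp]: "cinner x x = 0 \<longleftrightarrow> (x::'h::chilbert) = 0"
  by (simp add: cinner_self)

lemma cinner_eq_0_commute: "cinner x (y::'h::chilbert) = 0 \<longleftrightarrow> cinner y x = 0"
  by (metis cinner_commute complex_cnj_zero_iff)

lemma norm_diff_sq:
  "(norm (x - y::'h::chilbert))\<^sup>2 = (norm x)\<^sup>2 + (norm y)\<^sup>2 - 2 * Re (cinner x y)"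
  by (simp add: power2_norm_eq_inner inner_diff_left inner_diff_right inner_commute
      flip: inner_eq_Re_cinner)

subsection \<open>Orthogonal projections\<close>

definition csubspace :: "'h::chilbert set \<Rightarrow> bool" where
  "csubspace S \<longleftrightarrow> 0 \<in> S \<and> (\<forall>x\<in>S. \<forall>y\<in>S. x + y \<in> S) \<and> (\<forall>a. \<forall>x\<in>S. a *\<^sub>C x \<in> S)"

lemma csubspaceD:
  assumes "csubspace S"
  shows "0 \<in> S" "x \<in> S \<Longrightarrow> y \<in> S \<Longrightarrow> x + y \<in> S" "x \<in> S \<Longrightarrow> a *\<^sub>C x \<in> S"
    "x \<in> S \<Longrightarrow> y \<in> S \<Longrightarrow> x - y \<in> S"
proof -
  show "x \<in> S \<Longrightarrow> y \<in> S \<Longrightarrow> x - y \<in> S"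
    using assms unfolding csubspace_def by (metis add_uminus_conv_diff scaleC_minus_one)
qed (use assms in \<open>auto simp: csubspace_def\<close>)

lemma csubspace_closure:
  assumes S: "csubspace S" shows "csubspace (closure S)"
  unfolding csubspace_def
proof (intro conjI ballI allI)
  show "0 \<in> closure S" using csubspaceD(1)[OF S] closure_subset by blast
  fix x assume "x \<in> closure S"
  then obtain X where X: "\<And>n. X n \<in> S" "X \<longlonglongrightarrow> x" unfolding closure_sequential by blast
  { fix y assume "y \<in> closure S"
    then obtain Y where Y: "\<And>n. Y n \<in> S" "Y \<longlonglongrightarrow> y" unfolding closure_sequential by blast
    show "x + y \<in> closure S" unfolding closure_sequential
      by (rule exI[of _ "\<lambda>n. X n + Y n"]) (auto intro!: tendsto_intros X Y csubspaceD(2)[OF S]) }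
  fix a show "a *\<^sub>C x \<in> closure S" unfolding closure_sequential
    by (rule exI[of _ "\<lambda>n. a *\<^sub>C X n"]) (auto intro!: tendsto_intros X csubspaceD(3)[OF S])
qed

lemma closest_point_exists:
  fixes S :: "'h::chilbert set"
  assumes S: "csubspace S" "closed S"
  shows "\<exists>p\<in>S. \<forall>s\<in>S. norm (x - p) \<le> norm (x - s)"
proof -
  define d where "d = (INF s\<in>S. norm (x - s))"
  have ne: "S \<noteq> {}" using csubspaceD(1)[OF S(1)] by auto
  have bdd: "bdd_below ((\<lambda>s. norm (x - s)) ` S)" by (rule bdd_belowI[of _ 0]) auto
  have dle: "d \<le> norm (x - s)" if "s \<in> S" for s
    unfolding d_def using bdd that by (rule cINF_lower)
  have d0: "0 \<le> d" unfolding d_def using ne by (intro cINF_greatest) auto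
  have "\<exists>s\<in>S. norm (x - s) < d + inverse (Suc n)" for n
    using cINF_less_iff[OF ne bdd, of "d + inverse (Suc n)"] unfolding d_def by simp
  then obtain s where s: "\<And>n. s n \<in> S" "\<And>n. norm (x - s n) < d + inverse (Suc n)" by metis
  have lim: "(\<lambda>n. norm (x - s n)) \<longlonglongrightarrow> d"
  proof (rule tendsto_sandwich[OF always_eventually always_eventually])
    show "\<forall>n. d \<le> norm (x - s n)" using dle s by auto
    show "\<forall>n. norm (x - s n) \<le> d + inverse (real (Suc n))" using s(2) less_imp_le by auto
    show "(\<lambda>n. d + inverse (real (Suc n))) \<longlonglongrightarrow> d"
      using tendsto_add[OF tendsto_const[of d] LIMSEQ_inverse_real_of_nat] by simp
  qed auto
  \<comment> \<open>Parallelogram law: the midpoint of \<open>s m\<close> and \<open>s n\<close>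
    lies in \<open>S\<close>, so its distance from \<open>x\<close> is at least \<open>d\<close>. As
    both distances tend to \<open>d\<close>, the minimizing sequence is Cauchy.\<close>
  have par: "(norm (s m - s n))\<^sup>2 \<le> 2 * (norm (x - s m))\<^sup>2 + 2 * (norm (x - s n))\<^sup>2 - 4 * d\<^sup>2" for m n
  proof -
    have "(1/2) *\<^sub>R (s m + s n) \<in> S"
      using csubspaceD(3)[OF S(1), of "s m + s n" "of_real (1/2)"] csubspaceD(2)[OF S(1) s(1) s(1)]
      unfolding scaleC_of_real by blast
    from dle[OF this] have "d\<^sup>2 \<le> (norm (x - (1/2) *\<^sub>R (s m + s n)))\<^sup>2"
      using d0 by (intro power_mono)
    moreover have "(norm (s m - s n))\<^sup>2 + 4 * (norm (x - (1/2) *\<^sub>R (s m + s n)))\<^sup>2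
        = 2 * (norm (x - s m))\<^sup>2 + 2 * (norm (x - s n))\<^sup>2"
      by (simp add: power2_norm_eq_inner inner_diff_left inner_diff_right inner_add_left
          inner_add_right inner_commute algebra_simps)
    ultimately show ?thesis by linarith
  qed
  have "Cauchy s"
  proof (rule metric_CauchyI)
    fix e :: real assume e: "0 < e"
    have "(\<lambda>n. 2 * (norm (x - s n))\<^sup>2) \<longlonglongrightarrow> 2 * d\<^sup>2" by (intro tendsto_intros lim)
    moreover have "2 * d\<^sup>2 < 2 * d\<^sup>2 + e\<^sup>2 / 2" using e by simp
    ultimately have "\<forall>\<^sub>F n in sequentially. 2 * (norm (x - s n))\<^sup>2 < 2 * d\<^sup>2 + e\<^sup>2 / 2"
      by (rule order_tendstoD(2))
    then obtain M where M: "\<And>n. n \<ge> M \<Longrightarrow> 2 * (norm (x - s n))\<^sup>2 < 2 * d\<^sup>2 + e\<^sup>2 / 2"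
      unfolding eventually_sequentially by blast
    have "dist (s m) (s n) < e" if "m \<ge> M" "n \<ge> M" for m n
    proof -
      have "(norm (s m - s n))\<^sup>2 < e\<^sup>2" using par[of m n] M[OF that(1)] M[OF that(2)] by linarith
      then show ?thesis using e by (simp add: dist_norm power2_less_imp_less)
    qed
    then show "\<exists>M. \<forall>m\<ge>M. \<forall>n\<ge>M. dist (s m) (s n) < e" by blast
  qed
  then obtain p where p: "s \<longlonglongrightarrow> p" using Cauchy_convergent convergent_def by blast
  have "p \<in> S" using S(2) s(1) p by (metis closed_sequentially)
  moreover have "norm (x - p) = d"
    using LIMSEQ_unique[OF lim] tendsto_norm[OF tendsto_diff[OF tendsto_const[of x] p]] by metis
  ultimately show ?thesis using dle by auto
qed

text \<open>With \<open>a *\<^sub>C s\<close> the component of \<open>x - p\<close> along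
  \<open>s\<close>, replacing \<open>p\<close> by \<open>p + a *\<^sub>C s\<close> lowers the
  squared distance by \<open>|a|^2 |s|^2\<close>; minimality forces \<open>a = 0\<close>.\<close>

lemma minimal_distance_orthogonal:
  fixes S :: "'h::chilbert set"
  assumes S: "csubspace S" "p \<in> S" and min: "\<And>s. s \<in> S \<Longrightarrow> norm (x - p) \<le> norm (x - s)" and s: "s \<in> S"
  shows "cinner (x - p) s = 0"
proof (cases "s = 0")
  case False
  define a where "a = cinner (x - p) s / of_real ((norm s)\<^sup>2)"
  have ns: "(norm s)\<^sup>2 > 0" using False by simp
  have "p + a *\<^sub>C s \<in> S" using S s by (intro csubspaceD(2,3))
  from min[OF this] have "(norm (x - p))\<^sup>2 \<le> (norm ((x - p) - a *\<^sub>C s))\<^sup>2"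
    by (intro power_mono) (auto simp: algebra_simps)
  also have "\<dots> = (norm (x - p))\<^sup>2 + (cmod a)\<^sup>2 * (norm s)\<^sup>2 - 2 * Re (cnj a * cinner (x - p) s)"
    by (simp add: norm_diff_sq cinner_scaleC_right power_mult_distrib)
  also have "cnj a * cinner (x - p) s = of_real ((cmod a)\<^sup>2 * (norm s)\<^sup>2)"
  proof -
    have "cinner (x - p) s = a * of_real ((norm s)\<^sup>2)" using ns by (simp add: a_def)
    then have "cnj a * cinner (x - p) s = (a * cnj a) * of_real ((norm s)\<^sup>2)" by simp
    then show ?thesis by (simp only: complex_norm_square[symmetric] of_real_mult)
  qed
  finally have "(cmod a)\<^sup>2 * (norm s)\<^sup>2 \<le> 0" by (simp add: mult.commute)
  then have "(cmod a)\<^sup>2 \<le> 0" using ns by (simp add: mult_le_0_iff)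
  then have "a = 0" by simp
  then show ?thesis using ns by (simp add: a_def)
qed simp

lemma projection_theorem:
  fixes S :: "'h::chilbert set"
  assumes "csubspace S" "closed S"
  shows "\<exists>p\<in>S. \<forall>s\<in>S. cinner (x - p) s = 0"
  using closest_point_exists[OF assms, of x] minimal_distance_orthogonal[OF assms(1)] by metis

section \<open>Bounded operators and adjoints\<close>

lemma bounded_opsD: "T \<in> bounded_ops \<Longrightarrow> T \<cdot> (a *\<^sub>C x) = a *\<^sub>C T \<cdot> x"
  by (simp add: bounded_ops_def)

lemma bounded_opsI:
  "(\<And>a x. T \<cdot> (a *\<^sub>C x) = a *\<^sub>C T \<cdot> x) \<Longrightarrow> T \<in> bounded_ops"
  by (simp add: bounded_ops_def)

lemma scalar_op_apply [simp]: "scalar_op a \<cdot> x = a *\<^sub>C (x::'h::chilbert)"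
proof -
  have "bounded_linear (\<lambda>x::'h. a *\<^sub>C x)"
    by (rule bounded_linear_intro[of _ "cmod a"])
      (simp_all add: scaleC_add_right scaleC_scaleR mult.commute)
  then show ?thesis unfolding scalar_op_def by (simp add: bounded_linear_Blinfun_apply)
qed

lemma bounded_ops_intros [simp, intro]:
  fixes A B :: "'h::chilbert oper"
  shows "id_blinfun \<in> (bounded_ops :: 'h oper set)" "scalar_op a \<in> (bounded_ops :: 'h oper set)"
    "(0::'h oper) \<in> bounded_ops"
    "A \<in> bounded_ops \<Longrightarrow> B \<in> bounded_ops \<Longrightarrow> A + B \<in> bounded_ops"
    "A \<in> bounded_ops \<Longrightarrow> B \<in> bounded_ops \<Longrightarrow> A - B \<in> bounded_ops"
    "A \<in> bounded_ops \<Longrightarrow> B \<in> bounded_ops \<Longrightarrow> A o\<^sub>L B \<in> bounded_ops"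
  by (auto simp: bounded_ops_def scaleC_scaleC mult.commute blinfun.add_left blinfun.diff_left
      scaleC_add_right scaleC_diff_right)

text \<open>A vector \<open>e\<close> orthogonal to the kernel determines \<open>f\<close>:
  subtracting from \<open>x\<close> the multiple of \<open>e\<close> with the same value leaves a
  kernel vector. The coefficient of \<open>e\<close> is conjugated because \<open>cinner\<close> is
  conjugate linear in its second variable.\<close>

lemma riesz_representation:
  fixes f :: "'h::chilbert \<Rightarrow> complex"
  assumes add: "\<And>x y. f (x + y) = f x + f y" and scale: "\<And>a x. f (a *\<^sub>C x) = a * f x"
    and bdd: "\<And>x. cmod (f x) \<le> C * norm x"
  shows "\<exists>y. \<forall>x. f x = cinner x y"
proof (cases "\<forall>x. f x = 0")
  case True then show ?thesis by (auto intro: exI[of _ 0])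
next
  case False
  then obtain z where z: "f z \<noteq> 0" by blast
  have fdiff: "f (x - y) = f x - f y" for x y
    using add[of x "(-1) *\<^sub>C y"] scale[of "-1" y] by (simp add: scaleC_minus_one)
  have f0: "f 0 = 0" using add[of 0 0] by simp
  have bl: "bounded_linear f"
    by (rule bounded_linear_intro[of f C])
      (use add scale bdd in \<open>auto simp: scaleC_of_real[symmetric] scaleR_conv_of_real mult.commute\<close>)
  define K where "K = {x. f x = 0}"
  have K: "csubspace K" unfolding csubspace_def K_def using add scale f0 by auto
  have "closed K"
  proof -
    have "K = f -` {0}" by (auto simp: K_def)
    then show ?thesis
      using continuous_closed_vimage[of "{0}" f] linear_continuous_at[OF bl] by auto
  qed
  from projection_theorem[OF K this, of z]
  obtain p where p: "p \<in> K" "\<And>s. s \<in> K \<Longrightarrow> cinner (z - p) s = 0" by blast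
  define e where "e = z - p"
  have fe: "f e \<noteq> 0" using z p(1) by (simp add: e_def fdiff K_def)
  then have ne: "cinner e e \<noteq> 0" using f0 by auto
  have "f x = cinner x ((cnj (f e) / cinner e e) *\<^sub>C e)" for x
  proof -
    have "f (x - (f x / f e) *\<^sub>C e) = 0" using fe by (simp add: fdiff scale)
    then have "cinner e (x - (f x / f e) *\<^sub>C e) = 0" using p(2) by (simp add: e_def K_def)
    then have "cinner (x - (f x / f e) *\<^sub>C e) e = 0" by (simp add: cinner_eq_0_commute)
    then have *: "cinner x e = (f x / f e) * cinner e e" by (simp add: cinner_diff_left cinner_scaleC_left)
    have "cnj (cinner e e) = cinner e e" by (metis cinner_commute)
    then show ?thesis using fe ne * by (simp add: cinner_scaleC_right)
  qed
  then show ?thesis by blast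
qed

text \<open>The form is conjugate linear in \<open>y\<close>, so Riesz is applied to
  \<open>y \<mapsto> cnj (B x y)\<close>; testing against \<open>y = t x\<close> gives the norm
  bound. Adjoints and weak limits of operators both come from here.\<close>

lemma bounded_form_operator:
  fixes B :: "'h::chilbert \<Rightarrow> 'h \<Rightarrow> complex"
  assumes "\<And>x y z. B (x + y) z = B x z + B y z" "\<And>a x y. B (a *\<^sub>C x) y = a * B x y"
    and "\<And>x y z. B z (x + y) = B z x + B z y" "\<And>a x y. B x (a *\<^sub>C y) = cnj a * B x y"
    and bdd: "\<And>x y. cmod (B x y) \<le> C * norm x * norm y" and C: "0 \<le> C"
  shows "\<exists>T\<in>bounded_ops. (\<forall>x y. B x y = cinner (T \<cdot> x) y) \<and> norm T \<le> C"
proof -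
  have "\<exists>t. \<forall>y. cnj (B x y) = cinner y t" for x
    by (rule riesz_representation[of _ "C * norm x"]) (use assms in auto)
  then obtain t where t: "\<And>x y. cnj (B x y) = cinner y (t x)" by metis
  have t': "B x y = cinner (t x) y" for x y using t[of x y] by (metis cinner_commute complex_cnj_cnj)
  have add: "t (x + y) = t x + t y" for x y
    by (rule cinner_ext_left) (simp add: t'[symmetric] assms cinner_add_left)
  have scale: "t (a *\<^sub>C x) = a *\<^sub>C t x" for a x
    by (rule cinner_ext_left) (simp add: t'[symmetric] assms cinner_scaleC_left)
  have nt: "norm (t x) \<le> C * norm x" for x
  proof (cases "t x = 0")
    case False
    have "(norm (t x))\<^sup>2 = cmod (B x (t x))" unfolding t' cinner_self by (simp del: of_real_power)
    also have "\<dots> \<le> C * norm x * norm (t x)" by (rule bdd)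
    finally show ?thesis using False by (simp add: power2_eq_square)
  qed (use C in simp)
  have bl: "bounded_linear t"
    by (rule bounded_linear_intro[of t C])
      (use add scale nt in \<open>auto simp: scaleC_of_real[symmetric] mult.commute\<close>)
  show ?thesis
  proof (intro bexI[of _ "Blinfun t"] conjI allI)
    show "norm (Blinfun t) \<le> C"
      by (rule norm_blinfun_bound) (use nt C bl in \<open>auto simp: bounded_linear_Blinfun_apply\<close>)
  qed (use bl scale t' in \<open>auto simp: bounded_linear_Blinfun_apply intro: bounded_opsI\<close>)
qed

text \<open>Discharges the definite description in \<open>adj\<close>: adjoints are computed by
  exhibiting a candidate.\<close>

lemma adj_unique:
  assumes "\<And>x y. cinner (T \<cdot> x) y = cinner x (S \<cdot> y)"
  shows "adj T = S"
  unfolding adj_def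
proof (rule the_equality)
  fix S' :: "'a oper" assume "\<forall>x y. cinner (T \<cdot> x) y = cinner x (S' \<cdot> y)"
  then have "S' \<cdot> y = S \<cdot> y" for y
    using assms by (metis cinner_ext_right)
  then show "S' = S" by (rule blinfun_eqI)
qed (use assms in auto)

lemma adj_props:
  fixes T :: "'h::chilbert oper"
  assumes T: "T \<in> bounded_ops"
  shows "adj T \<in> bounded_ops"
    and "cinner (T \<cdot> x) y = cinner x (adj T \<cdot> y)"
    and "norm (adj T) \<le> norm T"
proof -
  have "\<exists>S\<in>bounded_ops. (\<forall>y x. cinner y (T \<cdot> x) = cinner (S \<cdot> y) x) \<and> norm S \<le> norm T"
  proof (rule bounded_form_operator)
    fix x y :: 'h
    have "cmod (cinner x (T \<cdot> y)) \<le> norm x * norm (T \<cdot> y)" by (rule cmod_cinner_le)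
    also have "\<dots> \<le> norm x * (norm T * norm y)" by (intro mult_left_mono norm_blinfun) auto
    finally show "cmod (cinner x (T \<cdot> y)) \<le> norm T * norm x * norm y" by (simp add: mult.commute mult.left_commute)
  qed (use T in \<open>auto simp: cinner_add_left cinner_add_right cinner_scaleC_left cinner_scaleC_right
      blinfun.add_right bounded_opsD\<close>)
  then obtain S where S: "S \<in> bounded_ops" "norm S \<le> norm T"
    "\<And>y x. cinner y (T \<cdot> x) = cinner (S \<cdot> y) x" by blast
  have *: "cinner (T \<cdot> x) y = cinner x (S \<cdot> y)" for x y
    using S(3)[of y x] by (metis cinner_commute)
  have "adj T = S" by (rule adj_unique) (rule *)
  with S(1,2) * show "adj T \<in> bounded_ops" "norm (adj T) \<le> norm T"
    "cinner (T \<cdot> x) y = cinner x (adj T \<cdot> y)" by auto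
qed

lemma adj_closed [simp, intro]: "T \<in> bounded_ops \<Longrightarrow> adj T \<in> bounded_ops"
  by (rule adj_props)

lemma cinner_adj_right:
  "T \<in> bounded_ops \<Longrightarrow> cinner x (adj T \<cdot> y) = cinner (T \<cdot> x) y"
  by (simp add: adj_props)

lemma cinner_adj_left:
  "T \<in> bounded_ops \<Longrightarrow> cinner (adj T \<cdot> x) y = cinner x (T \<cdot> y)"
  by (metis adj_props(2) cinner_commute)

lemma adj_adj [simp]: "T \<in> bounded_ops \<Longrightarrow> adj (adj T) = T"
  by (rule adj_unique) (simp add: cinner_adj_left)

lemma adj_compose: "A \<in> bounded_ops \<Longrightarrow> B \<in> bounded_ops \<Longrightarrow> adj (A o\<^sub>L B) = adj B o\<^sub>L adj A"
  by (rule adj_unique) (simp add: cinner_adj_right)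

lemma adj_add: "A \<in> bounded_ops \<Longrightarrow> B \<in> bounded_ops \<Longrightarrow> adj (A + B) = adj A + adj B"
  by (rule adj_unique) (simp add: cinner_adj_right blinfun.add_left cinner_add_left cinner_add_right)

lemma adj_diff: "A \<in> bounded_ops \<Longrightarrow> B \<in> bounded_ops \<Longrightarrow> adj (A - B) = adj A - adj B"
  by (rule adj_unique) (simp add: cinner_adj_right blinfun.diff_left cinner_diff_left cinner_diff_right)

lemma adj_scalar_op [simp]: "adj (scalar_op a :: 'h::chilbert oper) = scalar_op (cnj a)"
  by (rule adj_unique) (simp add: cinner_scaleC_left cinner_scaleC_right)

lemma adj_id [simp]: "adj (id_blinfun :: 'h::chilbert oper) = id_blinfun"
  by (rule adj_unique) simp

lemma adj_zero [simp]: "adj (0 :: 'h::chilbert oper) = 0"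
  by (rule adj_unique) simp

lemma norm_adj: "T \<in> bounded_ops \<Longrightarrow> norm (adj T) = norm T"
  by (metis adj_adj adj_closed adj_props(3) order_antisym)

lemma scalar_op_commute: "T \<in> bounded_ops \<Longrightarrow> T o\<^sub>L scalar_op a = scalar_op a o\<^sub>L T"
  by (rule blinfun_eqI) (simp add: bounded_opsD)

lemma scalar_op_compose: "scalar_op a o\<^sub>L scalar_op b = (scalar_op (a * b) :: 'h::chilbert oper)"
  by (rule blinfun_eqI) (simp add: scaleC_scaleC)

lemma scalar_op_1 [simp]: "scalar_op 1 = (id_blinfun :: 'h::chilbert oper)"
  by (rule blinfun_eqI) simp

lemma blinfun_compose_id [simp]: "id_blinfun o\<^sub>L A = A" "A o\<^sub>L id_blinfun = A"
  by (rule blinfun_eqI, simp)+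

lemma blinfun_compose_assoc: "(A o\<^sub>L B) o\<^sub>L C = A o\<^sub>L (B o\<^sub>L C)"
  by (rule blinfun_eqI) simp

lemma blinfun_pull:
  "A o\<^sub>L B = C o\<^sub>L D \<Longrightarrow> A \<cdot> B \<cdot> x = C \<cdot> D \<cdot> x"
  by (metis blinfun_apply_blinfun_compose)

lemma compose_distribs:
  "(A + B) o\<^sub>L C = (A o\<^sub>L C) + (B o\<^sub>L C)" "A o\<^sub>L (D + E) = (A o\<^sub>L D) + (A o\<^sub>L E)"
  "(A - B) o\<^sub>L C = (A o\<^sub>L C) - (B o\<^sub>L C)" "A o\<^sub>L (D - E) = (A o\<^sub>L D) - (A o\<^sub>L E)"
  by (rule blinfun_eqI, simp add: blinfun.add_left blinfun.add_right blinfun.diff_left blinfun.diff_right)+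

text \<open>Over complex scalars the quadratic form determines the sesquilinear one even without
  self-adjointness. \<open>borel_calculus\<close> is specified by quadratic forms only, so its
  uniqueness, norm bounds and limits all pass through this identity.\<close>

lemma cinner_polarization:
  fixes T :: "'h::chilbert oper"
  assumes T: "T \<in> bounded_ops"
  shows "cinner (T x) y = (cinner (T (x + y)) (x + y) - cinner (T (x - y)) (x - y)
      + \<i> * cinner (T (x + \<i> *\<^sub>C y)) (x + \<i> *\<^sub>C y) - \<i> * cinner (T (x - \<i> *\<^sub>C y)) (x - \<i> *\<^sub>C y)) / 4"
proof -
  note simps = blinfun.add_right blinfun.diff_right bounded_opsD[OF T] cinner_add_left cinner_add_right
    cinner_diff_left cinner_diff_right cinner_scaleC_left cinner_scaleC_right
  define p q r s where "p = cinner (T x) x" and "q = cinner (T x) y"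
    and "r = cinner (T y) x" and "s = cinner (T y) y"
  have "cinner (T (x + y)) (x + y) = p + q + r + s"
    "cinner (T (x - y)) (x - y) = p - q - r + s"
    "cinner (T (x + \<i> *\<^sub>C y)) (x + \<i> *\<^sub>C y) = p - \<i> * q + \<i> * r + s"
    "cinner (T (x - \<i> *\<^sub>C y)) (x - \<i> *\<^sub>C y) = p + \<i> * q - \<i> * r + s"
    unfolding simps p_def q_def r_def s_def by (simp_all add: complex_eq_iff)
  then show ?thesis unfolding q_def[symmetric] by (simp add: complex_eq_iff)
qed

lemma oper_eqI_quadratic:
  fixes S T :: "'h::chilbert oper"
  assumes "S \<in> bounded_ops" "T \<in> bounded_ops" "\<And>x. cinner (S \<cdot> x) x = cinner (T \<cdot> x) x"
  shows "S = T"
proof (rule blinfun_eqI, rule cinner_ext_left)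
  fix x y show "cinner (S \<cdot> x) y = cinner (T \<cdot> x) y"
    unfolding cinner_polarization[OF assms(1), of x y] cinner_polarization[OF assms(2), of x y] assms(3) ..
qed

text \<open>For vectors of norm at most 1 the four polarized vectors have norm at most 2, so each of
  the four terms is at most \<open>4 * C\<close>, and their sum is divided by 4. The constant is not
  sharp; what matters below is a bound uniform along a sequence of operators.\<close>

lemma norm_oper_quadratic_bound:
  fixes T :: "'h::chilbert oper"
  assumes T: "T \<in> bounded_ops" and C: "0 \<le> C" "\<And>x. cmod (cinner (T \<cdot> x) x) \<le> C * (norm x)\<^sup>2"
  shows "norm T \<le> 4 * C"
proof (rule norm_blinfun_bound)
  show "0 \<le> 4 * C" using C by simp
  fix x :: 'h
  have key: "cmod (cinner (T x) y) \<le> 4 * C" if x: "norm x \<le> 1" and y: "norm y \<le> 1" for x y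
  proof -
    have n: "cmod (cinner (T z) z) \<le> C * 4" if "norm z \<le> 2" for z
      using C(2)[of z] mult_left_mono[OF power_mono[OF that, of 2] C(1)] by simp
    have b: "norm (x + y) \<le> 2" "norm (x - y) \<le> 2" "norm (x + \<i> *\<^sub>C y) \<le> 2" "norm (x - \<i> *\<^sub>C y) \<le> 2"
      using norm_triangle_ineq[of x y] norm_triangle_ineq4[of x y] norm_triangle_ineq[of x "\<i> *\<^sub>C y"]
        norm_triangle_ineq4[of x "\<i> *\<^sub>C y"] x y by auto
    have tri: "cmod (a - b + \<i> * c - \<i> * d) \<le> cmod a + cmod b + cmod c + cmod d" for a b c d
      using norm_triangle_ineq4[of "a - b + \<i> * c" "\<i> * d"] norm_triangle_ineq[of "a - b" "\<i> * c"]
        norm_triangle_ineq4[of a b] by (simp add: norm_mult)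
    show ?thesis
      unfolding cinner_polarization[OF T, of x y] norm_divide
      using order_trans[OF tri, of _ _ _ _ "16 * C"] n[OF b(1)] n[OF b(2)] n[OF b(3)] n[OF b(4)]
      by (simp add: divide_le_eq)
  qed
  show "norm (T x) \<le> 4 * C * norm x"
  proof (cases "x = 0 \<or> T x = 0")
    case False
    then have "cmod (cinner (T (x /\<^sub>R norm x)) (T x /\<^sub>R norm (T x))) \<le> 4 * C"
      by (intro key) auto
    then have "cmod (cinner (T x) (T x)) / (norm x * norm (T x)) \<le> 4 * C"
      by (simp add: blinfun.scaleR_right cinner_scaleR_left cinner_scaleR_right norm_mult norm_inverse divide_inverse mult_ac)
    moreover have "cmod (cinner (T x) (T x)) = norm (T x) * norm (T x)"
      by (simp add: cinner_self power2_eq_square norm_mult)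
    ultimately show ?thesis using False by (simp add: divide_le_eq mult.commute)
  qed (use C in auto)
qed

text \<open>Polarization upgrades convergence of the quadratic forms to convergence of all matrix
  coefficients; the limit is a bounded sesquilinear form, hence an operator.\<close>

lemma weak_limit_operator:
  fixes T :: "nat \<Rightarrow> 'h::chilbert oper"
  assumes T: "\<And>k. T k \<in> bounded_ops" "\<And>k. norm (T k) \<le> C"
    and lim: "\<And>x. (\<lambda>k. cinner (T k \<cdot> x) x) \<longlonglongrightarrow> q x"
  shows "\<exists>S\<in>bounded_ops. norm S \<le> C \<and> (\<forall>x. cinner (S \<cdot> x) x = q x) \<and>
    (\<forall>x y. (\<lambda>k. cinner (T k \<cdot> x) y) \<longlonglongrightarrow> cinner (S \<cdot> x) y)"
proof -
  have C: "0 \<le> C" using T(2)[of 0] norm_ge_zero order_trans by blast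
  have "\<exists>l. (\<lambda>k. cinner (T k \<cdot> x) y) \<longlonglongrightarrow> l" for x y
    unfolding cinner_polarization[OF T(1), of _ x y]
    by (rule exI[of _ "(q (x + y) - q (x - y) + \<i> * q (x + \<i> *\<^sub>C y) - \<i> * q (x - \<i> *\<^sub>C y)) / 4"])
      (intro tendsto_intros lim, simp)
  then obtain B where B: "\<And>x y. (\<lambda>k. cinner (T k \<cdot> x) y) \<longlonglongrightarrow> B x y" by metis
  have "\<exists>S\<in>bounded_ops. (\<forall>x y. B x y = cinner (S \<cdot> x) y) \<and> norm S \<le> C"
  proof (rule bounded_form_operator)
    fix x y z :: 'h and a
    show "B (x + y) z = B x z + B y z"
      by (rule LIMSEQ_unique[OF B]) (simp add: blinfun.add_right cinner_add_left, intro tendsto_intros B)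
    show "B z (x + y) = B z x + B z y"
      by (rule LIMSEQ_unique[OF B]) (simp add: cinner_add_right, intro tendsto_intros B)
    show "B (a *\<^sub>C x) y = a * B x y"
      by (rule LIMSEQ_unique[OF B]) (simp add: bounded_opsD T cinner_scaleC_left, intro tendsto_intros B)
    show "B x (a *\<^sub>C y) = cnj a * B x y"
      by (rule LIMSEQ_unique[OF B]) (simp add: cinner_scaleC_right, intro tendsto_intros B)
    show "cmod (B x y) \<le> C * norm x * norm y"
    proof (rule LIMSEQ_le_const2[OF tendsto_norm[OF B]], intro exI allI impI)
      fix k
      have "cmod (cinner (T k x) y) \<le> norm (T k x) * norm y" by (rule cmod_cinner_le)
      also have "\<dots> \<le> (norm (T k) * norm x) * norm y" by (intro mult_right_mono norm_blinfun) auto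
      also have "\<dots> \<le> (C * norm x) * norm y" using T(2) by (intro mult_right_mono) auto
      finally show "cmod (cinner (T k x) y) \<le> C * norm x * norm y" .
    qed
  qed (rule C)
  then obtain S where S: "S \<in> bounded_ops" "\<And>x y. B x y = cinner (S \<cdot> x) y" "norm S \<le> C" by blast
  show ?thesis
  proof (intro bexI[of _ S] conjI allI)
    fix x show "cinner (S \<cdot> x) x = q x" using LIMSEQ_unique[OF B lim] S(2) by metis
  qed (use S B in auto)
qed

lemma closure_eq_UNIV_if_total:
  fixes S :: "'h::chilbert set"
  assumes S: "csubspace S" and total: "\<And>\<zeta>. (\<And>s. s \<in> S \<Longrightarrow> cinner \<zeta> s = 0) \<Longrightarrow> \<zeta> = 0"
  shows "closure S = UNIV"
proof -
  have "z \<in> closure S" for z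
  proof -
    obtain p where p: "p \<in> closure S" "\<And>s. s \<in> closure S \<Longrightarrow> cinner (z - p) s = 0"
      using projection_theorem[OF csubspace_closure[OF S] closed_closure] by blast
    have "z - p = 0" by (rule total) (intro p(2) subsetD[OF closure_subset])
    then show ?thesis using p(1) by simp
  qed
  then show ?thesis by blast
qed

definition ortho_proj :: "'h::chilbert set \<Rightarrow> 'h oper \<Rightarrow> bool" where
  "ortho_proj K P \<longleftrightarrow> P \<in> bounded_ops \<and>
     (\<forall>x. P \<cdot> x \<in> K \<and> (\<forall>k\<in>K. cinner (x - P \<cdot> x) k = 0))"

lemma ortho_projD:
  assumes "ortho_proj K P"
  shows "P \<in> bounded_ops" "P \<cdot> x \<in> K" "k \<in> K \<Longrightarrow> cinner (x - P \<cdot> x) k = 0"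
  using assms by (auto simp: ortho_proj_def)

lemma orthogonal_decomposition_unique:
  fixes K :: "'h::chilbert set"
  assumes K: "csubspace K" and p: "p \<in> K" "\<And>k. k \<in> K \<Longrightarrow> cinner (x - p) k = 0"
    and q: "q \<in> K" "\<And>k. k \<in> K \<Longrightarrow> cinner (x - q) k = 0"
  shows "p = q"
proof -
  have "q - p \<in> K" using K p q by (simp add: csubspaceD)
  from p(2)[OF this] q(2)[OF this] have "cinner ((x - p) - (x - q)) (q - p) = 0"
    unfolding cinner_diff_left by simp
  then show ?thesis by simp
qed

lemma ortho_proj_eqI:
  assumes "csubspace K" "ortho_proj K P" "p \<in> K" "\<And>k. k \<in> K \<Longrightarrow> cinner (x - p) k = 0"
  shows "P \<cdot> x = p"
  using orthogonal_decomposition_unique[OF assms(1) ortho_projD(2)[OF assms(2)] ortho_projD(3)[OF assms(2)] assms(3,4)]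
  by blast

lemma ortho_proj_exists:
  fixes K :: "'h::chilbert set"
  assumes K: "csubspace K" "closed K"
  shows "\<exists>P. ortho_proj K P"
proof -
  obtain p where p: "\<And>x. p x \<in> K" "\<And>x k. k \<in> K \<Longrightarrow> cinner (x - p x) k = 0"
    using projection_theorem[OF K] by metis
  have eq: "p x = q" if "q \<in> K" "\<And>k. k \<in> K \<Longrightarrow> cinner (x - q) k = 0" for x q
    using orthogonal_decomposition_unique[OF K(1) p that] by blast
  have add: "p (x + y) = p x + p y" for x y
  proof (rule eq)
    fix k assume "k \<in> K"
    then have "cinner ((x - p x) + (y - p y)) k = 0" unfolding cinner_add_left using p(2) by simp
    then show "cinner (x + y - (p x + p y)) k = 0" by (simp add: algebra_simps)
  qed (use p K in \<open>auto intro: csubspaceD\<close>)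
  have scale: "p (a *\<^sub>C x) = a *\<^sub>C p x" for a x
  proof (rule eq)
    fix k assume "k \<in> K"
    then have "cinner (a *\<^sub>C (x - p x)) k = 0" unfolding cinner_scaleC_left using p(2) by simp
    then show "cinner (a *\<^sub>C x - a *\<^sub>C p x) k = 0" by (simp add: scaleC_diff_right)
  qed (use p K in \<open>auto intro: csubspaceD\<close>)
  have nrm: "norm (p x) \<le> norm x" for x
  proof (cases "p x = 0")
    case False
    have "cinner x (p x) = cinner (p x) (p x)" using p(2)[OF p(1), of x] by (simp add: cinner_diff_left)
    then have "norm (p x) * norm (p x) = cmod (cinner x (p x))"
      by (simp add: cinner_self norm_mult power2_eq_square)
    also have "\<dots> \<le> norm x * norm (p x)" by (rule cmod_cinner_le)
    finally show ?thesis using False by simp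
  qed simp
  have "bounded_linear p"
    by (rule bounded_linear_intro[of p 1]) (use add scale nrm in \<open>auto simp: scaleC_of_real[symmetric]\<close>)
  then have "ortho_proj K (Blinfun p)"
    using p scale by (auto simp: ortho_proj_def bounded_linear_Blinfun_apply intro!: bounded_opsI)
  then show ?thesis ..
qed

lemma ortho_proj_fixed:
  "csubspace K \<Longrightarrow> ortho_proj K P \<Longrightarrow> x \<in> K \<Longrightarrow> P \<cdot> x = x"
  by (rule ortho_proj_eqI) auto

lemma ortho_proj_cinner:
  assumes K: "csubspace K" and P: "ortho_proj K P"
  shows "cinner (P \<cdot> x) y = cinner x (P \<cdot> y)"
    and "cinner (P \<cdot> x) (P \<cdot> y) = cinner x (P \<cdot> y)"
proof -
  have 1: "cinner (P \<cdot> x) (P \<cdot> y) = cinner x (P \<cdot> y)" for x y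
    using ortho_projD(3)[OF P ortho_projD(2)[OF P], of x y] by (simp add: cinner_diff_left)
  show "cinner (P \<cdot> x) (P \<cdot> y) = cinner x (P \<cdot> y)" by (rule 1)
  show "cinner (P \<cdot> x) y = cinner x (P \<cdot> y)"
    using 1[of y x] 1[of x y] by (metis cinner_commute)
qed

text \<open>Invariance under the adjoint as well makes the orthogonal complement of \<open>K\<close>
  invariant, so \<open>T\<close> carries the decomposition of \<open>x\<close> into that of
  \<open>T x\<close>.\<close>

lemma ortho_proj_commute:
  fixes T :: "'h::chilbert oper"
  assumes K: "csubspace K" and P: "ortho_proj K P" and T: "T \<in> bounded_ops"
    and inv: "\<And>k. k \<in> K \<Longrightarrow> T k \<in> K" "\<And>k. k \<in> K \<Longrightarrow> adj T k \<in> K"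
  shows "P o\<^sub>L T = T o\<^sub>L P"
proof (rule blinfun_eqI)
  fix x
  have "P (T x) = T (P x)"
  proof (rule ortho_proj_eqI[OF K P])
    show "T (P x) \<in> K" using inv(1) ortho_projD(2)[OF P] by blast
    fix k assume "k \<in> K"
    then have "cinner (x - P x) (adj T k) = 0" using inv(2) ortho_projD(3)[OF P] by blast
    then show "cinner (T x - T (P x)) k = 0" by (simp add: cinner_adj_right[OF T] blinfun.diff_right)
  qed
  then show "(P o\<^sub>L T) x = (T o\<^sub>L P) x" by simp
qed

lemma blinfun_closure_invariant:
  assumes "\<And>s. s \<in> S \<Longrightarrow> T \<cdot> s \<in> closure S'" "x \<in> closure S"
  shows "T \<cdot> x \<in> closure S'"
proof -
  obtain X where X: "\<And>n. X n \<in> S" "X \<longlonglongrightarrow> x" using assms(2) unfolding closure_sequential by blast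
  have "(\<lambda>n. T (X n)) \<longlonglongrightarrow> T x" by (intro tendsto_intros X)
  moreover have "T (X n) \<in> closure S'" for n using X assms by blast
  ultimately show ?thesis by (metis closed_closure closed_sequentially)
qed

subsection \<open>Square summable sequences of vectors\<close>

text \<open>The tensor product of the Hilbert space with square summable sequences. An ultraweakly
  continuous trace is a sum of infinitely many vector functionals, so approximation in trace norm
  asks one operator to be close at infinitely many vectors at once, that is, at a single vector of
  the amplified space.\<close>

typedef (overloaded) 'h hseq = "{x :: nat \<Rightarrow> 'h::chilbert. summable (\<lambda>n. (norm (x n))\<^sup>2)}"
  morphisms hseq_nth Abs_hseq
  by (rule exI[of _ "\<lambda>_. 0"]) simp

setup_lifting type_definition_hseq

lemma hseq_summable_add:
  fixes x y :: "nat \<Rightarrow> 'h::real_normed_vector"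
  assumes "summable (\<lambda>n. (norm (x n))\<^sup>2)" "summable (\<lambda>n. (norm (y n))\<^sup>2)"
  shows "summable (\<lambda>n. (norm (x n + y n))\<^sup>2)"
proof (rule summable_comparison_test')
  show "summable (\<lambda>n. 2 * ((norm (x n))\<^sup>2 + (norm (y n))\<^sup>2))"
    using assms by (intro summable_mult summable_add)
  fix n
  have "(norm (x n + y n))\<^sup>2 \<le> (norm (x n) + norm (y n))\<^sup>2"
    by (intro power_mono norm_triangle_ineq norm_ge_zero)
  also have "\<dots> \<le> 2 * ((norm (x n))\<^sup>2 + (norm (y n))\<^sup>2)"
    using sum_squares_bound[of "norm (x n)" "norm (y n)"] by (simp add: power2_sum)
  finally show "norm ((norm (x n + y n))\<^sup>2) \<le> 2 * ((norm (x n))\<^sup>2 + (norm (y n))\<^sup>2)" by simp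
qed

lemma hseq_summable_scale:
  fixes x :: "nat \<Rightarrow> 'h::real_normed_vector"
  assumes "summable (\<lambda>n. (norm (x n))\<^sup>2)" "\<And>n. norm (y n) \<le> C * norm (x n)"
  shows "summable (\<lambda>n. (norm (y n))\<^sup>2)"
proof (rule summable_comparison_test')
  show "summable (\<lambda>n. C\<^sup>2 * (norm (x n))\<^sup>2)" using assms by (intro summable_mult)
  show "norm ((norm (y n))\<^sup>2) \<le> C\<^sup>2 * (norm (x n))\<^sup>2" for n
    using power_mono[OF assms(2), of n 2] by (simp add: power_mult_distrib)
qed

lemma hseq_summable_mult:
  fixes x :: "nat \<Rightarrow> 'h::real_normed_vector" and y :: "nat \<Rightarrow> 'k::real_normed_vector"
  assumes "summable (\<lambda>n. (norm (x n))\<^sup>2)" "summable (\<lambda>n. (norm (y n))\<^sup>2)"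
  shows "summable (\<lambda>n. norm (x n) * norm (y n))"
proof (rule summable_comparison_test')
  show "summable (\<lambda>n. (norm (x n))\<^sup>2 + (norm (y n))\<^sup>2)" using assms by (intro summable_add)
  fix n show "norm (norm (x n) * norm (y n)) \<le> (norm (x n))\<^sup>2 + (norm (y n))\<^sup>2"
    using sum_squares_bound[of "norm (x n)" "norm (y n)"] mult_nonneg_nonneg[OF norm_ge_zero norm_ge_zero, of "x n" "y n"]
    by (simp only: mult.assoc real_norm_def abs_of_nonneg)
qed

instantiation hseq :: (chilbert) ab_group_add
begin
lift_definition zero_hseq :: "'a hseq" is "\<lambda>_. 0" by simp
lift_definition plus_hseq :: "'a hseq \<Rightarrow> 'a hseq \<Rightarrow> 'a hseq" is "\<lambda>x y n. x n + y n"
  by (rule hseq_summable_add)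
lift_definition uminus_hseq :: "'a hseq \<Rightarrow> 'a hseq" is "\<lambda>x n. - x n" by simp
lift_definition minus_hseq :: "'a hseq \<Rightarrow> 'a hseq \<Rightarrow> 'a hseq" is "\<lambda>x y n. x n - y n"
  using hseq_summable_add[where y = "\<lambda>n. - y n" for y] by simp
instance by standard (transfer; auto)+
end

lemma summable_hseq: "summable (\<lambda>n. (norm (hseq_nth x n))\<^sup>2)"
  using hseq_nth[of x] by simp

lemma summable_cinner_hseq:
  "summable (\<lambda>n. cinner (hseq_nth x n) (hseq_nth y n))"
  by (rule summable_comparison_test'[OF hseq_summable_mult[OF summable_hseq[of x] summable_hseq[of y]]])
    (rule cmod_cinner_le)

definition hseq_inner :: "'h::chilbert hseq \<Rightarrow> 'h hseq \<Rightarrow> complex" where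
  "hseq_inner x y = (\<Sum>n. cinner (hseq_nth x n) (hseq_nth y n))"

lemma Re_hseq_inner:
  "Re (hseq_inner x y) = (\<Sum>n. inner (hseq_nth x n) (hseq_nth y n))"
  unfolding hseq_inner_def inner_eq_Re_cinner by (rule Re_suminf[OF summable_cinner_hseq])

lemma summable_inner_hseq: "summable (\<lambda>n. inner (hseq_nth x n) (hseq_nth y n))"
  unfolding inner_eq_Re_cinner by (rule summable_Re[OF summable_cinner_hseq])

instantiation hseq :: (chilbert) real_inner
begin
lift_definition scaleR_hseq :: "real \<Rightarrow> 'a hseq \<Rightarrow> 'a hseq" is "\<lambda>r x n. r *\<^sub>R x n"
  by (erule hseq_summable_scale) (rule norm_scaleR[THEN eq_refl])
definition inner_hseq :: "'a hseq \<Rightarrow> 'a hseq \<Rightarrow> real" where "inner_hseq x y = Re (hseq_inner x y)"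
definition norm_hseq :: "'a hseq \<Rightarrow> real" where "norm_hseq x = sqrt (inner x x)"
definition sgn_hseq :: "'a hseq \<Rightarrow> 'a hseq" where "sgn_hseq x = inverse (norm x) *\<^sub>R x"
definition dist_hseq :: "'a hseq \<Rightarrow> 'a hseq \<Rightarrow> real" where "dist_hseq x y = norm (x - y)"
definition uniformity_hseq :: "('a hseq \<times> 'a hseq) filter" where
  "uniformity_hseq = (INF e\<in>{0<..}. principal {(x, y). dist x y < e})"
definition open_hseq :: "'a hseq set \<Rightarrow> bool" where
  "open_hseq U \<longleftrightarrow> (\<forall>x\<in>U. eventually (\<lambda>(x', y). x' = x \<longrightarrow> y \<in> U) uniformity)"
instance
proof
  fix x y z :: "'a hseq" and r s :: real and U :: "'a hseq set"
  show "r *\<^sub>R (x + y) = r *\<^sub>R x + r *\<^sub>R y" by transfer (simp add: scaleR_add_right)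
  show "(r + s) *\<^sub>R x = r *\<^sub>R x + s *\<^sub>R x" by transfer (simp add: scaleR_add_left)
  show "r *\<^sub>R s *\<^sub>R x = (r * s) *\<^sub>R x" by transfer simp
  show "1 *\<^sub>R x = x" by transfer simp
  show "sgn x = inverse (norm x) *\<^sub>R x" by (rule sgn_hseq_def)
  show "dist x y = norm (x - y)" by (rule dist_hseq_def)
  show "uniformity = (INF e\<in>{0<..}. principal {(x :: 'a hseq, y). dist x y < e})"
    by (rule uniformity_hseq_def)
  show "open U \<longleftrightarrow> (\<forall>x\<in>U. eventually (\<lambda>(x', y). x' = x \<longrightarrow> y \<in> U) uniformity)"
    by (rule open_hseq_def)
  show "norm x = sqrt (inner x x)" by (rule norm_hseq_def)
  show "inner x y = inner y x" unfolding inner_hseq_def Re_hseq_inner by (simp add: inner_commute)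
  show "inner (x + y) z = inner x z + inner y z"
    unfolding inner_hseq_def Re_hseq_inner
    by (subst suminf_add[OF summable_inner_hseq summable_inner_hseq]) (simp add: plus_hseq.rep_eq inner_add_left)
  show "inner (r *\<^sub>R x) y = r * inner x y"
    unfolding inner_hseq_def Re_hseq_inner
    by (subst suminf_mult[OF summable_inner_hseq, symmetric]) (simp add: scaleR_hseq.rep_eq)
  show "0 \<le> inner x x" unfolding inner_hseq_def Re_hseq_inner
    by (intro suminf_nonneg summable_inner_hseq) simp
  have "inner x x = 0 \<longleftrightarrow> (\<forall>n. hseq_nth x n = 0)"
    unfolding inner_hseq_def Re_hseq_inner by (subst suminf_eq_zero_iff[OF summable_inner_hseq]) simp_all
  then show "inner x x = 0 \<longleftrightarrow> x = 0"
    by (simp add: hseq_nth_inject[symmetric] zero_hseq.rep_eq fun_eq_iff)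
qed
end

lemma norm_hseq_sq: "(norm x)\<^sup>2 = (\<Sum>n. (norm (hseq_nth x n))\<^sup>2)"
  unfolding power2_norm_eq_inner inner_hseq_def by (rule Re_hseq_inner)

lemma sum_le_norm_hseq: "(\<Sum>n<k. (norm (hseq_nth x n))\<^sup>2) \<le> (norm x)\<^sup>2"
  unfolding norm_hseq_sq by (rule sum_le_suminf[OF summable_hseq]) auto

lemma nth_le_norm_hseq: "norm (hseq_nth x n) \<le> norm x"
proof (rule power2_le_imp_le)
  have "(norm (hseq_nth x n))\<^sup>2 \<le> (\<Sum>k<Suc n. (norm (hseq_nth x k))\<^sup>2)"
    by (simp add: sum_nonneg)
  then show "(norm (hseq_nth x n))\<^sup>2 \<le> (norm x)\<^sup>2"
    using sum_le_norm_hseq[of x "Suc n"] by linarith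
qed simp

instance hseq :: (chilbert) complete_space
proof
  fix X :: "nat \<Rightarrow> 'a hseq"
  assume X: "Cauchy X"
  have "Cauchy (\<lambda>m. hseq_nth (X m) k)" for k
  proof (rule metric_CauchyI)
    fix e :: real assume "0 < e"
    then obtain M where M: "\<And>m n. m \<ge> M \<Longrightarrow> n \<ge> M \<Longrightarrow> dist (X m) (X n) < e"
      using metric_CauchyD[OF X] by blast
    have "dist (hseq_nth (X m) k) (hseq_nth (X n) k) \<le> dist (X m) (X n)" for m n
      using nth_le_norm_hseq[of "X m - X n" k] by (simp add: dist_norm minus_hseq.rep_eq)
    then show "\<exists>M. \<forall>m\<ge>M. \<forall>n\<ge>M. dist (hseq_nth (X m) k) (hseq_nth (X n) k) < e"
      using M by (meson le_less_trans)
  qed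
  then have "\<exists>a. (\<lambda>m. hseq_nth (X m) k) \<longlonglongrightarrow> a" for k
    using Cauchy_convergent convergent_def by blast
  then obtain l where l: "\<And>k. (\<lambda>m. hseq_nth (X m) k) \<longlonglongrightarrow> l k" by metis
  \<comment> \<open>Estimates on finite partial sums survive the coordinatewise limit. Being uniform
    in \<open>K\<close>, they give both square summability of \<open>l\<close> and convergence in
    norm.\<close>
  have tail: "\<exists>M. \<forall>m\<ge>M. \<forall>K. (\<Sum>k<K. (norm (hseq_nth (X m) k - l k))\<^sup>2) \<le> e\<^sup>2"
    if "0 < e" for e :: real
  proof -
    obtain M where M: "\<And>m n. m \<ge> M \<Longrightarrow> n \<ge> M \<Longrightarrow> dist (X m) (X n) < e"
      using metric_CauchyD[OF X \<open>0 < e\<close>] by blast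
    have "(\<Sum>k<K. (norm (hseq_nth (X m) k - l k))\<^sup>2) \<le> e\<^sup>2" if m: "m \<ge> M" for m K
    proof (rule LIMSEQ_le_const2)
      show "(\<lambda>n. \<Sum>k<K. (norm (hseq_nth (X m) k - hseq_nth (X n) k))\<^sup>2)
          \<longlonglongrightarrow> (\<Sum>k<K. (norm (hseq_nth (X m) k - l k))\<^sup>2)"
        by (intro tendsto_intros l)
      have "(\<Sum>k<K. (norm (hseq_nth (X m) k - hseq_nth (X n) k))\<^sup>2) \<le> e\<^sup>2" if n: "n \<ge> M" for n
      proof -
        have "(norm (X m - X n))\<^sup>2 \<le> e\<^sup>2"
          using M[OF m n] by (intro power_mono) (auto simp: dist_norm)
        then show ?thesis
          using sum_le_norm_hseq[where x = "X m - X n" and k = K] by (simp add: minus_hseq.rep_eq)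
      qed
      then show "\<exists>N. \<forall>n\<ge>N. (\<Sum>k<K. (norm (hseq_nth (X m) k - hseq_nth (X n) k))\<^sup>2) \<le> e\<^sup>2"
        by blast
    qed
    then show ?thesis by blast
  qed
  have sq: "summable (\<lambda>k. (norm (hseq_nth (X m) k - l k))\<^sup>2)"
    if "\<forall>K. (\<Sum>k<K. (norm (hseq_nth (X m) k - l k))\<^sup>2) \<le> e\<^sup>2" for m and e :: real
    using that by (intro summableI_nonneg_bounded[where x = "e\<^sup>2"]) auto
  obtain M where M: "\<forall>K. (\<Sum>k<K. (norm (hseq_nth (X M) k - l k))\<^sup>2) \<le> 1\<^sup>2"
    using tail[of 1] by auto
  have "summable (\<lambda>k. (norm (l k - hseq_nth (X M) k + hseq_nth (X M) k))\<^sup>2)"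
    using sq[OF M] by (intro hseq_summable_add summable_hseq) (simp add: norm_minus_commute)
  then have l_nth: "hseq_nth (Abs_hseq l) = l" by (simp add: Abs_hseq_inverse)
  have "X \<longlonglongrightarrow> Abs_hseq l"
  proof (rule metric_LIMSEQ_I)
    fix e :: real assume "0 < e"
    then obtain M where M: "\<And>m K. m \<ge> M \<Longrightarrow> (\<Sum>k<K. (norm (hseq_nth (X m) k - l k))\<^sup>2) \<le> (e / 2)\<^sup>2"
      using tail[of "e / 2"] by auto
    have "dist (X m) (Abs_hseq l) < e" if "m \<ge> M" for m
    proof -
      have summable_diff: "summable (\<lambda>k. (norm (hseq_nth (X m) k - l k))\<^sup>2)"
        using summable_hseq[of "X m - Abs_hseq l"] unfolding minus_hseq.rep_eq l_nth .
      have "(norm (X m - Abs_hseq l))\<^sup>2 \<le> (e / 2)\<^sup>2"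
        unfolding norm_hseq_sq minus_hseq.rep_eq l_nth
        by (rule suminf_le_const[OF summable_diff M[OF that]])
      moreover have "0 \<le> e / 2" using \<open>0 < e\<close> by simp
      ultimately have "norm (X m - Abs_hseq l) \<le> e / 2" by (rule power2_le_imp_le)
      then show ?thesis using \<open>0 < e\<close> by (simp add: dist_norm)
    qed
    then show "\<exists>no. \<forall>n\<ge>no. dist (X n) (Abs_hseq l) < e" by blast
  qed
  then show "convergent X" unfolding convergent_def by blast
qed

instantiation hseq :: (chilbert) chilbert
begin
lift_definition scaleC_hseq :: "complex \<Rightarrow> 'a hseq \<Rightarrow> 'a hseq" is "\<lambda>a x n. a *\<^sub>C x n"
  by (erule hseq_summable_scale) (rule norm_scaleC[THEN eq_refl])
definition cinner_hseq :: "'a hseq \<Rightarrow> 'a hseq \<Rightarrow> complex" where "cinner_hseq = hseq_inner"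
instance
proof
  fix x y z :: "'a hseq" and a b :: complex and r :: real
  show "a *\<^sub>C (x + y) = a *\<^sub>C x + a *\<^sub>C y" by transfer (simp add: scaleC_add_right)
  show "(a + b) *\<^sub>C x = a *\<^sub>C x + b *\<^sub>C x" by transfer (simp add: scaleC_add_left)
  show "a *\<^sub>C b *\<^sub>C x = (a * b) *\<^sub>C x" by transfer (simp add: scaleC_scaleC)
  show "complex_of_real r *\<^sub>C x = r *\<^sub>R x" by transfer (simp add: scaleC_of_real)
  show "cinner x y = cnj (cinner y x)"
    unfolding cinner_hseq_def hseq_inner_def
    by (subst bounded_linear.suminf[OF bounded_linear_cnj summable_cinner_hseq]) (metis cinner_commute)
  show "cinner (x + y) z = cinner x z + cinner y z"
    unfolding cinner_hseq_def hseq_inner_def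
    by (subst suminf_add[OF summable_cinner_hseq summable_cinner_hseq])
       (simp add: plus_hseq.rep_eq cinner_add_left)
  show "cinner (a *\<^sub>C x) y = a * cinner x y"
    unfolding cinner_hseq_def hseq_inner_def
    by (subst suminf_mult[OF summable_cinner_hseq, symmetric]) (simp add: scaleC_hseq.rep_eq cinner_scaleC_left)
  show "inner x y = Re (cinner x y)" by (simp add: cinner_hseq_def inner_hseq_def)
qed
end

lift_definition hseq_amplify :: "'h::chilbert oper \<Rightarrow> 'h hseq \<Rightarrow> 'h hseq" is "\<lambda>T x n. T \<cdot> (x n)"
  by (erule hseq_summable_scale) (rule norm_blinfun)

lift_definition hseq_single :: "nat \<Rightarrow> 'h::chilbert \<Rightarrow> 'h hseq" is "\<lambda>j x n. if n = j then x else 0"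
proof -
  fix j :: nat and x :: 'h
  show "summable (\<lambda>n. (norm (if n = j then x else 0))\<^sup>2)"
    by (rule summable_finite[of "{j}"]) auto
qed

lemma norm_hseq_amplify: "norm (hseq_amplify T x) \<le> norm T * norm x"
proof (rule power2_le_imp_le)
  have s: "summable (\<lambda>n. (norm T)\<^sup>2 * (norm (hseq_nth x n))\<^sup>2)" by (intro summable_mult summable_hseq)
  have "(norm (hseq_amplify T x))\<^sup>2 \<le> (\<Sum>n. (norm T)\<^sup>2 * (norm (hseq_nth x n))\<^sup>2)"
    unfolding norm_hseq_sq hseq_amplify.rep_eq
  proof (rule suminf_le[OF _ _ s])
    show "summable (\<lambda>n. (norm (T \<cdot> (hseq_nth x n)))\<^sup>2)"
      using summable_hseq[of "hseq_amplify T x"] by (simp add: hseq_amplify.rep_eq)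
    show "(norm (T \<cdot> (hseq_nth x n)))\<^sup>2 \<le> (norm T)\<^sup>2 * (norm (hseq_nth x n))\<^sup>2" for n
      unfolding power_mult_distrib[symmetric] by (intro power_mono norm_blinfun) simp
  qed
  also have "\<dots> = (norm T * norm x)\<^sup>2"
    by (simp add: suminf_mult[OF summable_hseq] norm_hseq_sq power_mult_distrib)
  finally show "(norm (hseq_amplify T x))\<^sup>2 \<le> (norm T * norm x)\<^sup>2" .
qed simp

definition amplify :: "'h::chilbert oper \<Rightarrow> 'h hseq oper" where
  "amplify T = Blinfun (hseq_amplify T)"

lemma hseq_eqI: "(\<And>n. hseq_nth x n = hseq_nth y n) \<Longrightarrow> x = y"
  by (simp add: hseq_nth_inject[symmetric] fun_eq_iff)

lemma amplify_apply: "hseq_nth (amplify T \<cdot> x) n = T \<cdot> (hseq_nth x n)"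
proof -
  have "bounded_linear (hseq_amplify T)"
    by (rule bounded_linear_intro[of _ "norm T"])
      (auto intro!: hseq_eqI norm_hseq_amplify[THEN order_trans] simp: plus_hseq.rep_eq scaleR_hseq.rep_eq
        hseq_amplify.rep_eq blinfun.add_right blinfun.scaleR_right mult.commute)
  then show ?thesis by (simp add: amplify_def bounded_linear_Blinfun_apply hseq_amplify.rep_eq)
qed

lemma cinner_hseq: "cinner x y = (\<Sum>n. cinner (hseq_nth x n) (hseq_nth y n))"
  by (simp add: cinner_hseq_def hseq_inner_def)

lemma amplify_bounded_ops: "T \<in> bounded_ops \<Longrightarrow> amplify T \<in> bounded_ops"
  by (auto intro!: bounded_opsI hseq_eqI simp: amplify_apply scaleC_hseq.rep_eq bounded_opsD)

lemma adj_amplify: "T \<in> bounded_ops \<Longrightarrow> adj (amplify T) = amplify (adj T)"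
  by (rule adj_unique) (simp add: cinner_hseq amplify_apply cinner_adj_right)

text \<open>Finitely supported sequences are dense, so an identity of bounded operators on the
  amplified space only has to be checked on sequences with a single entry.\<close>

lemma hseq_truncate_tendsto: "(\<lambda>n. \<Sum>j<n. hseq_single j (hseq_nth x j)) \<longlonglongrightarrow> x"
proof -
  have nth_sum: "hseq_nth (\<Sum>j\<in>J. hseq_single j (hseq_nth x j)) i = (if i \<in> J then hseq_nth x i else 0)"
    if "finite J" for J i
    using that by induction (auto simp: zero_hseq.rep_eq plus_hseq.rep_eq hseq_single.rep_eq)
  define d where "d n = x - (\<Sum>j<n. hseq_single j (hseq_nth x j))" for n
  have "(norm (d n))\<^sup>2 = (\<Sum>i. (norm (hseq_nth x (i + n)))\<^sup>2)" for n
  proof -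
    have d: "hseq_nth (d n) i = (if i < n then 0 else hseq_nth x i)" for i
      by (simp add: d_def minus_hseq.rep_eq nth_sum)
    have "(norm (d n))\<^sup>2 = (\<Sum>i. (norm (hseq_nth (d n) (i + n)))\<^sup>2) + (\<Sum>i<n. (norm (hseq_nth (d n) i))\<^sup>2)"
      unfolding norm_hseq_sq by (rule suminf_split_initial_segment[OF summable_hseq])
    then show ?thesis by (simp add: d)
  qed
  moreover have "(\<lambda>n. \<Sum>i. (norm (hseq_nth x (i + n)))\<^sup>2) \<longlonglongrightarrow> 0"
    by (rule suminf_exist_split2[OF summable_hseq])
  ultimately have "(\<lambda>n. sqrt ((norm (d n))\<^sup>2)) \<longlonglongrightarrow> sqrt 0" by (intro tendsto_real_sqrt) simp
  then have "d \<longlonglongrightarrow> 0" by (simp add: tendsto_norm_zero_iff)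
  then have "(\<lambda>n. x - d n) \<longlonglongrightarrow> x - 0" by (intro tendsto_intros)
  then show ?thesis by (simp add: d_def)
qed

section \<open>The double commutant\<close>

lemma commutantI:
  "T \<in> bounded_ops \<Longrightarrow> (\<And>A. A \<in> S \<Longrightarrow> T o\<^sub>L A = A o\<^sub>L T) \<Longrightarrow> T \<in> commutant S"
  by (simp add: commutant_def)

lemma commutantD: "T \<in> commutant S \<Longrightarrow> T \<in> bounded_ops"
  "T \<in> commutant S \<Longrightarrow> A \<in> S \<Longrightarrow> T o\<^sub>L A = A o\<^sub>L T"
  by (simp_all add: commutant_def)

lemma commutant_apply:
  "T \<in> commutant S \<Longrightarrow> A \<in> S \<Longrightarrow> T \<cdot> A \<cdot> x = A \<cdot> T \<cdot> x"
  by (metis commutantD(2) blinfun_apply_blinfun_compose)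

lemma commutant_antimono: "S \<subseteq> S' \<Longrightarrow> commutant S' \<subseteq> commutant S"
  by (auto simp: commutant_def)

lemma double_commutant_subset: "S \<subseteq> bounded_ops \<Longrightarrow> S \<subseteq> commutant (commutant S)"
  by (fastforce simp: commutant_def)

lemma commutant_bounded_ops: "commutant S \<subseteq> bounded_ops"
  by (auto simp: commutant_def)

lemma triple_commutant: "S \<subseteq> bounded_ops \<Longrightarrow> commutant (commutant (commutant S)) = commutant S"
  by (meson commutant_antimono commutant_bounded_ops double_commutant_subset subset_antisym)

lemma commutant_algebra:
  fixes A B :: "'h::chilbert oper"
  shows "id_blinfun \<in> (commutant S :: 'h oper set)" "(0 :: 'h oper) \<in> commutant S"
    "A \<in> commutant S \<Longrightarrow> B \<in> commutant S \<Longrightarrow> A + B \<in> commutant S"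
    "A \<in> commutant S \<Longrightarrow> B \<in> commutant S \<Longrightarrow> A - B \<in> commutant S"
    "A \<in> commutant S \<Longrightarrow> B \<in> commutant S \<Longrightarrow> A o\<^sub>L B \<in> commutant S"
    "S \<subseteq> bounded_ops \<Longrightarrow> scalar_op a \<in> (commutant S :: 'h oper set)"
proof -
  show "A \<in> commutant S \<Longrightarrow> B \<in> commutant S \<Longrightarrow> A o\<^sub>L B \<in> commutant S"
    by (auto intro!: commutantI blinfun_eqI simp: commutantD(1) commutant_apply)
  show "S \<subseteq> bounded_ops \<Longrightarrow> scalar_op a \<in> (commutant S :: 'h oper set)"
    by (rule commutantI) (auto simp: scalar_op_commute subset_iff)
qed (auto simp: commutant_def compose_distribs)

lemma commutant_adj:
  fixes S :: "'h::chilbert oper set"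
  assumes S: "S \<subseteq> bounded_ops" "\<And>A. A \<in> S \<Longrightarrow> adj A \<in> S" and T: "T \<in> commutant S"
  shows "adj T \<in> commutant S"
proof (rule commutantI)
  show "adj T \<in> bounded_ops" using commutantD(1)[OF T] by simp
  fix A assume A: "A \<in> S"
  then have "adj (T o\<^sub>L adj A) = adj (adj A o\<^sub>L T)" using commutantD(2)[OF T S(2)] by metis
  moreover have "A \<in> bounded_ops" "T \<in> bounded_ops" using A S commutantD(1)[OF T] by auto
  ultimately show "adj T o\<^sub>L A = A o\<^sub>L adj T" by (simp add: adj_compose)
qed

text \<open>Moving \<open>A\<close> to the other side of the inner product as \<open>adj A\<close>
  leaves only matrix coefficients of \<open>T k\<close>, so commutation passes to the weak
  limit.\<close>

lemma weak_limit_commutant: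
  fixes T :: "nat \<Rightarrow> 'h::chilbert oper"
  assumes T: "\<And>k. T k \<in> commutant S" and S: "S \<subseteq> bounded_ops" and L: "L \<in> bounded_ops"
    and lim: "\<And>x y. (\<lambda>k. cinner (T k \<cdot> x) y) \<longlonglongrightarrow> cinner (L \<cdot> x) y"
  shows "L \<in> commutant S"
proof (rule commutantI[OF L], rule blinfun_eqI, rule cinner_ext_left)
  fix A x y assume A: "A \<in> S"
  then have Ab: "A \<in> bounded_ops" using S by auto
  have "cinner (T k \<cdot> A \<cdot> x) y = cinner (T k \<cdot> x) (adj A \<cdot> y)" for k
    using commutant_apply[OF T A] by (simp add: cinner_adj_right[OF Ab])
  then have "cinner (L \<cdot> A \<cdot> x) y = cinner (L \<cdot> x) (adj A \<cdot> y)"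
    using lim[of "A \<cdot> x" y] lim[of x "adj A \<cdot> y"] by (simp add: LIMSEQ_unique)
  then show "cinner ((L o\<^sub>L A) \<cdot> x) y = cinner ((A o\<^sub>L L) \<cdot> x) y"
    by (simp add: cinner_adj_right[OF Ab])
qed

text \<open>The algebra need not contain the identity: that it is nondegenerate is what puts \<open>\<zeta>\<close> into the
  closure of its orbit.\<close>

theorem amplified_density:
  fixes A :: "'h::chilbert oper set" and \<zeta> :: "nat \<Rightarrow> 'h"
  assumes A: "A \<subseteq> bounded_ops" "0 \<in> A" "\<And>a b. a \<in> A \<Longrightarrow> b \<in> A \<Longrightarrow> a + b \<in> A"
    "\<And>a b. a \<in> A \<Longrightarrow> b \<in> A \<Longrightarrow> a o\<^sub>L b \<in> A" "\<And>a c. a \<in> A \<Longrightarrow> scalar_op c o\<^sub>L a \<in> A"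
    "\<And>a. a \<in> A \<Longrightarrow> adj a \<in> A"
    and nondeg: "\<And>\<eta>. (\<And>a. a \<in> A \<Longrightarrow> a \<cdot> \<eta> = 0) \<Longrightarrow> \<eta> = 0"
    and x: "x \<in> commutant (commutant A)"
    and \<zeta>: "summable (\<lambda>i. (norm (\<zeta> i))\<^sup>2)" and e: "0 < e"
  shows "\<exists>a\<in>A. summable (\<lambda>i. (norm ((x - a) \<cdot> (\<zeta> i)))\<^sup>2) \<and>
    (\<Sum>i. (norm ((x - a) \<cdot> (\<zeta> i)))\<^sup>2) < e"
proof -
  define Z where "Z = Abs_hseq \<zeta>"
  have Z: "hseq_nth Z = \<zeta>" using \<zeta> by (simp add: Z_def Abs_hseq_inverse)
  define S where "S = (\<lambda>a. (amplify a) \<cdot> Z) ` A"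
  define K where "K = closure S"
  have "csubspace S"
    unfolding csubspace_def
  proof (intro conjI ballI allI)
    show "0 \<in> S" unfolding S_def using A(2)
      by (intro image_eqI[of _ _ 0]) (auto intro!: hseq_eqI simp: amplify_apply zero_hseq.rep_eq)
    fix s assume "s \<in> S"
    then obtain a where a: "a \<in> A" "s = (amplify a) \<cdot> Z" by (auto simp: S_def)
    { fix t assume "t \<in> S"
      then obtain b where b: "b \<in> A" "t = (amplify b) \<cdot> Z" by (auto simp: S_def)
      show "s + t \<in> S" unfolding S_def using a b A(3)
        by (intro image_eqI[of _ _ "a + b"]) (auto intro!: hseq_eqI simp: amplify_apply plus_hseq.rep_eq blinfun.add_left) }
    show "c *\<^sub>C s \<in> S" for c unfolding S_def using a A(5)
      by (intro image_eqI[of _ _ "scalar_op c o\<^sub>L a"]) (auto intro!: hseq_eqI simp: amplify_apply scaleC_hseq.rep_eq)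
  qed
  then have K: "csubspace K" "closed K" by (auto simp: K_def csubspace_closure)
  have SK: "S \<subseteq> K" unfolding K_def by (rule closure_subset)
  obtain P where P: "ortho_proj K P" using ortho_proj_exists[OF K] by blast
  have inv: "amplify a \<cdot> k \<in> K" if a: "a \<in> A" and k: "k \<in> K" for a k
    unfolding K_def
  proof (rule blinfun_closure_invariant[OF _ k[unfolded K_def]])
    fix s assume "s \<in> S"
    then obtain b where b: "b \<in> A" "s = (amplify b) \<cdot> Z" by (auto simp: S_def)
    have "amplify a \<cdot> s \<in> S" unfolding S_def using a b A(4)
      by (intro image_eqI[of _ _ "a o\<^sub>L b"]) (auto intro!: hseq_eqI simp: amplify_apply)
    then show "amplify a \<cdot> s \<in> closure S" using SK by (auto simp: K_def)
  qed
  have Pa: "P \<cdot> amplify a \<cdot> z = (amplify a) \<cdot> P \<cdot> z" if "a \<in> A" for a z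
  proof -
    have "a \<in> bounded_ops" "adj a \<in> A" using that A by auto
    then have "P o\<^sub>L amplify a = amplify a o\<^sub>L P"
      using that by (intro ortho_proj_commute[OF K(1) P]) (auto simp: amplify_bounded_ops adj_amplify inv)
    then show ?thesis by (metis blinfun_apply_blinfun_compose)
  qed
  have PZ: "P \<cdot> Z = Z"
  proof -
    have "hseq_nth (Z - P \<cdot> Z) i = 0" for i
    proof (rule nondeg)
      fix a assume a: "a \<in> A"
      then have "amplify a \<cdot> Z \<in> K" using SK by (auto simp: S_def)
      then have "amplify a \<cdot> (Z - P \<cdot> Z) = 0"
        using Pa[OF a, of Z] ortho_proj_fixed[OF K(1) P] by (simp add: blinfun.diff_right)
      then show "a \<cdot> (hseq_nth (Z - P \<cdot> Z) i) = 0"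
        by (metis amplify_apply zero_hseq.rep_eq)
    qed
    then have "Z - P \<cdot> Z = 0" by (intro hseq_eqI) (simp add: zero_hseq.rep_eq)
    then show ?thesis by simp
  qed
  \<comment> \<open>Von Neumann's argument: every matrix entry of the projection \<open>P\<close> is
    an operator commuting with \<open>A\<close>, hence with \<open>x\<close>, so \<open>P\<close>
    commutes with the amplification of \<open>x\<close> on single entries.\<close>
  have single: "P \<cdot> amplify x \<cdot> (hseq_single j \<eta>)
      = (amplify x) \<cdot> P \<cdot> (hseq_single j \<eta>)" for j \<eta>
  proof (rule hseq_eqI)
    fix i
    define p where "p \<eta> = hseq_nth (P \<cdot> (hseq_single j \<eta>)) i" for \<eta>
    have lin: "hseq_single j (a + b) = hseq_single j a + hseq_single j b"
      "hseq_single j (c *\<^sub>C a) = c *\<^sub>C hseq_single j a" for a b :: 'h and c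
      by (auto intro!: hseq_eqI simp: hseq_single.rep_eq plus_hseq.rep_eq scaleC_hseq.rep_eq)
    have amp: "amplify a \<cdot> (hseq_single j b) = hseq_single j (a \<cdot> b)" for a b
      by (auto intro!: hseq_eqI simp: amplify_apply hseq_single.rep_eq)
    have p_scale: "p (c *\<^sub>C a) = c *\<^sub>C p a" for c a
      by (simp add: p_def lin bounded_opsD[OF ortho_projD(1)[OF P]] scaleC_hseq.rep_eq)
    have p_bl: "bounded_linear p"
    proof (rule bounded_linear_intro[of p "norm P"])
      fix a b r
      show "p (a + b) = p a + p b" by (simp add: p_def lin blinfun.add_right plus_hseq.rep_eq)
      show "p (r *\<^sub>R a) = r *\<^sub>R p a" unfolding scaleC_of_real[symmetric] by (rule p_scale)
      have "norm (hseq_single j a) = norm a"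
      proof -
        have "(norm (hseq_single j a))\<^sup>2 = (\<Sum>n. if n = j then (norm a)\<^sup>2 else 0)"
          unfolding norm_hseq_sq by (rule suminf_cong) (simp add: hseq_single.rep_eq)
        also have "\<dots> = (\<Sum>n\<in>{j}. if n = j then (norm a)\<^sup>2 else 0)" by (rule suminf_finite) auto
        finally show ?thesis by (simp add: power2_eq_iff_nonneg)
      qed
      then show "norm (p a) \<le> norm a * norm P"
        using nth_le_norm_hseq[of "P \<cdot> (hseq_single j a)" i] norm_blinfun[of P "hseq_single j a"]
        by (simp add: p_def mult.commute)
    qed
    have "Blinfun p \<in> commutant A"
    proof (rule commutantI)
      show "Blinfun p \<in> bounded_ops" by (rule bounded_opsI) (simp add: bounded_linear_Blinfun_apply[OF p_bl] p_scale)
      fix a assume a: "a \<in> A"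
      show "Blinfun p o\<^sub>L a = a o\<^sub>L Blinfun p"
        by (rule blinfun_eqI)
          (simp add: bounded_linear_Blinfun_apply[OF p_bl] p_def amp[symmetric] Pa[OF a] amplify_apply)
    qed
    then have "x \<cdot> (p \<eta>) = p (x \<cdot> \<eta>)"
      using commutant_apply[OF x] bounded_linear_Blinfun_apply[OF p_bl] by metis
    then show "hseq_nth (P \<cdot> amplify x \<cdot> (hseq_single j \<eta>)) i
      = hseq_nth (amplify x \<cdot> P \<cdot> (hseq_single j \<eta>)) i"
      by (simp add: amp amplify_apply p_def)
  qed
  have "P \<cdot> amplify x \<cdot> Z = (amplify x) \<cdot> P \<cdot> Z"
  proof (rule LIMSEQ_unique)
    show "(\<lambda>n. P \<cdot> amplify x \<cdot> (\<Sum>j<n. hseq_single j (hseq_nth Z j)))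
        \<longlonglongrightarrow> P \<cdot> amplify x \<cdot> Z"
      by (intro tendsto_intros hseq_truncate_tendsto)
    show "(\<lambda>n. P \<cdot> amplify x \<cdot> (\<Sum>j<n. hseq_single j (hseq_nth Z j)))
        \<longlonglongrightarrow> (amplify x) \<cdot> P \<cdot> Z"
      unfolding blinfun.sum_right single
      unfolding blinfun.sum_right[symmetric]
      by (intro tendsto_intros hseq_truncate_tendsto)
  qed
  then have "amplify x \<cdot> Z \<in> K" using PZ ortho_projD(2)[OF P] by metis
  moreover have "sqrt e > 0" using e by simp
  ultimately obtain a where a: "a \<in> A" "dist (amplify a \<cdot> Z) (amplify x \<cdot> Z) < sqrt e"
    unfolding K_def S_def closure_approachable by blast
  define D where "D = (amplify x) \<cdot> Z - (amplify a) \<cdot> Z"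
  have D: "hseq_nth D i = (x - a) \<cdot> (\<zeta> i)" for i
    by (simp add: D_def minus_hseq.rep_eq amplify_apply Z blinfun.diff_left)
  have "(norm D)\<^sup>2 < (sqrt e)\<^sup>2"
    using a(2) by (intro power_strict_mono) (auto simp: D_def dist_norm norm_minus_commute)
  then show ?thesis
    using a(1) summable_hseq[of D] e unfolding norm_hseq_sq D by (intro bexI[of _ a]) auto
qed

section \<open>Traces on factors\<close>

lemma von_neumann_algebraD:
  assumes "von_neumann_algebra M"
  shows "M \<subseteq> bounded_ops" "commutant (commutant M) = M" "x \<in> M \<Longrightarrow> adj x \<in> M"
    "id_blinfun \<in> M" "scalar_op a \<in> M" "0 \<in> M" "x \<in> M \<Longrightarrow> y \<in> M \<Longrightarrow> x + y \<in> M"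
    "x \<in> M \<Longrightarrow> y \<in> M \<Longrightarrow> x - y \<in> M" "x \<in> M \<Longrightarrow> y \<in> M \<Longrightarrow> x o\<^sub>L y \<in> M"
proof -
  show M: "commutant (commutant M) = M" using assms by (simp add: von_neumann_algebra_def)
  show "x \<in> M \<Longrightarrow> adj x \<in> M" using assms by (auto simp: von_neumann_algebra_def)
  note c = commutant_algebra[where S = "commutant M", unfolded M]
  show "M \<subseteq> bounded_ops" using commutant_bounded_ops M by blast
  show "id_blinfun \<in> M" "scalar_op a \<in> M" "0 \<in> M" "x \<in> M \<Longrightarrow> y \<in> M \<Longrightarrow> x + y \<in> M"
    "x \<in> M \<Longrightarrow> y \<in> M \<Longrightarrow> x - y \<in> M" "x \<in> M \<Longrightarrow> y \<in> M \<Longrightarrow> x o\<^sub>L y \<in> M"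
    using c(1-5) c(6)[OF commutant_bounded_ops] by auto
qed

lemma tendsto_zero_unique_if_le:
  fixes t :: real
  assumes "\<And>k::nat. t \<le> f k" "f \<longlonglongrightarrow> 0" shows "t \<le> 0"
  by (rule LIMSEQ_le_const[OF assms(2)]) (use assms(1) in auto)

locale factor_trace =
  fixes M :: "'h::chilbert oper set" and \<tau> :: "'h oper \<Rightarrow> complex"
  assumes fac: "factor M" and tr: "tracial_state M \<tau>"
begin

lemma vN: "von_neumann_algebra M" using fac by (simp add: factor_def)

lemmas M_bounded_ops = von_neumann_algebraD(1)[OF vN]
lemmas M_double_commutant = von_neumann_algebraD(2)[OF vN]
lemmas M_closed [simp, intro] = von_neumann_algebraD(3-9)[OF vN]

lemma M_bounded [simp, intro]: "x \<in> M \<Longrightarrow> x \<in> bounded_ops" using M_bounded_ops by auto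

lemma tr_add: "x \<in> M \<Longrightarrow> y \<in> M \<Longrightarrow> \<tau> (x + y) = \<tau> x + \<tau> y"
  and tr_scale: "x \<in> M \<Longrightarrow> \<tau> (scalar_op a o\<^sub>L x) = a * \<tau> x"
  and tr_pos: "x \<in> M \<Longrightarrow> \<tau> (adj x o\<^sub>L x) \<in> \<real>\<^sub>\<ge>\<^sub>0"
  and tr_id: "\<tau> id_blinfun = 1"
  and tr_comm: "x \<in> M \<Longrightarrow> y \<in> M \<Longrightarrow> \<tau> (x o\<^sub>L y) = \<tau> (y o\<^sub>L x)"
  using tr by (auto simp: tracial_state_def)

lemma tr_zero [simp]: "\<tau> 0 = 0"
  using tr_add[of 0 0] by simp

lemma tr_scalar: "\<tau> (scalar_op a) = a"
  using tr_scale[of id_blinfun a] by (simp add: tr_id)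

lemma tr_diff: "x \<in> M \<Longrightarrow> y \<in> M \<Longrightarrow> \<tau> (x - y) = \<tau> x - \<tau> y"
  using tr_add[of "x - y" y] by simp

text \<open>Positivity at \<open>adj (x + c) o\<^sub>L (x + c)\<close> makes the sum of the mixed
  terms real; \<open>c = 1\<close> compares the imaginary parts and \<open>c = \<i>\<close> the real
  parts.\<close>

lemma tr_adj: assumes x: "x \<in> M" shows "\<tau> (adj x) = cnj (\<tau> x)"
proof -
  have im: "Im (\<tau> (adj y o\<^sub>L y)) = 0" if "y \<in> M" for y
    using tr_pos[OF that] by (auto simp: complex_nonneg_Reals_iff)
  have "Im (c * \<tau> (adj x) + cnj c * \<tau> x) = 0" for c
  proof -
    define s where "s = (scalar_op c :: 'h oper)"
    have s: "s \<in> M" "adj s = scalar_op (cnj c)" "s \<in> bounded_ops" by (auto simp: s_def)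
    have e: "adj (x + s) o\<^sub>L (x + s) = (adj x o\<^sub>L x) + (scalar_op c o\<^sub>L adj x) + (scalar_op (cnj c) o\<^sub>L x) + scalar_op (cnj c * c)"
      using x s(3) by (simp add: adj_add compose_distribs s(2))
        (simp add: s_def scalar_op_compose scalar_op_commute add_ac)
    have "\<tau> (adj (x + s) o\<^sub>L (x + s)) = \<tau> (adj x o\<^sub>L x) + c * \<tau> (adj x) + cnj c * \<tau> x + cnj c * c"
      unfolding e using x by (simp add: tr_add tr_scale tr_scalar)
    moreover have "Im (\<tau> (adj (x + s) o\<^sub>L (x + s))) = 0" using x s by (intro im) auto
    moreover have "Im (\<tau> (adj x o\<^sub>L x)) = 0" using x by (rule im)
    ultimately show ?thesis by (simp add: complex_eq_iff)
  qed
  from this[of 1] this[of \<i>] show ?thesis by (simp add: complex_eq_iff)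
qed

text \<open>The squared norm of \<open>x\<close> in the Hilbert space of the trace; only a seminorm
  until \<open>\<tau>\<close> is known to be faithful.\<close>

definition tsq :: "'h oper \<Rightarrow> real" where "tsq x = Re (\<tau> (adj x o\<^sub>L x))"

lemma tsq_eq: "x \<in> M \<Longrightarrow> \<tau> (adj x o\<^sub>L x) = of_real (tsq x)"
  using tr_pos[of x] by (auto simp: tsq_def complex_nonneg_Reals_iff complex_eq_iff)

lemma tsq_nonneg: "x \<in> M \<Longrightarrow> 0 \<le> tsq x"
  using tr_pos[of x] by (auto simp: tsq_def complex_nonneg_Reals_iff)

lemma tsq_adj: "x \<in> M \<Longrightarrow> tsq (adj x) = tsq x"
  unfolding tsq_def using tr_comm[OF _ M_closed(1), of x x] by simp

lemma tsq_id: "tsq id_blinfun = 1"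
  by (simp add: tsq_def tr_id)

lemma tsq_diff_scaled:
  assumes "x \<in> M" "y \<in> M"
  shows "tsq (x - (scalar_op t o\<^sub>L y)) = tsq x - 2 * Re (cnj t * \<tau> (adj y o\<^sub>L x)) + (cmod t)\<^sup>2 * tsq y"
proof -
  have e: "adj (x - (scalar_op t o\<^sub>L y)) o\<^sub>L (x - (scalar_op t o\<^sub>L y))
    = (adj x o\<^sub>L x) - (scalar_op t o\<^sub>L (adj x o\<^sub>L y)) - ((scalar_op (cnj t) o\<^sub>L (adj y o\<^sub>L x)) - (scalar_op (cnj t * t) o\<^sub>L (adj y o\<^sub>L y)))"
    using assms by (intro blinfun_eqI) (simp add: adj_diff adj_compose blinfun.diff_left blinfun.diff_right bounded_opsD scaleC_scaleC scaleC_diff_right)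
  have "\<tau> (adj x o\<^sub>L y) = cnj (\<tau> (adj y o\<^sub>L x))"
    using assms tr_adj[of "adj y o\<^sub>L x"] by (simp add: adj_compose)
  then have "\<tau> (adj (x - (scalar_op t o\<^sub>L y)) o\<^sub>L (x - (scalar_op t o\<^sub>L y)))
    = of_real (tsq x) - cnj (cnj t * \<tau> (adj y o\<^sub>L x)) - (cnj t * \<tau> (adj y o\<^sub>L x)) + of_real ((cmod t)\<^sup>2 * tsq y)"
    unfolding e using assms
    by (simp add: tr_diff tr_scale tsq_eq complex_norm_square mult.commute del: of_real_power)
  then show ?thesis unfolding tsq_def[of "x - (scalar_op t o\<^sub>L y)"] by simp
qed

lemma tsq_parallelogram:
  assumes "x \<in> M" "y \<in> M" shows "tsq (x + y) + tsq (x - y) = 2 * tsq x + 2 * tsq y"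
proof -
  have *: "x + y = x - (scalar_op (-1) o\<^sub>L y)" "x - y = x - (scalar_op 1 o\<^sub>L y)"
    by (auto intro!: blinfun_eqI simp: blinfun.add_left blinfun.diff_left blinfun.minus_left scaleC_minus_one)
  show ?thesis
    unfolding * tsq_diff_scaled[OF assms, of 1] tsq_diff_scaled[OF assms, of "-1"] by simp
qed

text \<open>The case \<open>tsq y = 0\<close> is treated separately because faithfulness of the
  trace is itself derived from this inequality.\<close>

lemma tr_cauchy_schwarz:
  assumes "x \<in> M" "y \<in> M" shows "(cmod (\<tau> (adj y o\<^sub>L x)))\<^sup>2 \<le> tsq x * tsq y"
proof -
  define g where "g = \<tau> (adj y o\<^sub>L x)"
  have *: "0 \<le> tsq x - 2 * s * (cmod g)\<^sup>2 + s\<^sup>2 * (cmod g)\<^sup>2 * tsq y" for s :: real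
  proof -
    have "0 \<le> tsq (x - (scalar_op (of_real s * g) o\<^sub>L y))" using assms by (intro tsq_nonneg) auto
    also have "\<dots> = tsq x - 2 * Re (cnj (of_real s * g) * g) + (cmod (of_real s * g))\<^sup>2 * tsq y"
      unfolding g_def by (rule tsq_diff_scaled[OF assms])
    also have "cnj (of_real s * g) * g = of_real (s * (cmod g)\<^sup>2)"
      by (simp only: complex_norm_square of_real_mult) simp
    finally show ?thesis by (simp add: norm_mult power_mult_distrib mult.assoc)
  qed
  show ?thesis
  proof (cases "tsq y = 0 \<or> g = 0")
    case True
    have "g = 0"
    proof (rule ccontr)
      assume "g \<noteq> 0"
      then have "(cmod g)\<^sup>2 \<noteq> 0" "tsq y = 0" using True by auto
      \<comment> \<open>For \<open>tsq y = 0\<close> the inequality is affine in \<open>s\<close>,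
        and this \<open>s\<close> makes its right hand side equal to \<open>-1\<close>.\<close>
      then show False using *[of "(tsq x + 1) / (2 * (cmod g)\<^sup>2)"] by simp
    qed
    then show ?thesis using assms by (simp add: g_def[symmetric] tsq_nonneg)
  next
    case False
    then have p: "tsq y > 0" using tsq_nonneg[OF assms(2)] by simp
    have "0 \<le> tsq x - (cmod g)\<^sup>2 / tsq y"
      using *[of "inverse (tsq y)"] p by (simp add: field_simps power2_eq_square)
    then show ?thesis using p by (simp add: g_def[symmetric] field_simps)
  qed
qed

lemma uw_sequences:
  obtains \<xi> \<eta> :: "nat \<Rightarrow> 'h" where "summable (\<lambda>i. (norm (\<xi> i))\<^sup>2)" "summable (\<lambda>i. (norm (\<eta> i))\<^sup>2)"
    "\<And>x. x \<in> M \<Longrightarrow> (\<lambda>i. cinner (x \<cdot> (\<xi> i)) (\<eta> i)) sums \<tau> x"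
proof -
  have "ultraweakly_continuous M \<tau>" using tr by (simp add: tracial_state_def)
  then show thesis unfolding ultraweakly_continuous_def using that by blast
qed

lemma cmod_cinner_oper_le:
  "cmod (cinner (x \<cdot> \<xi>) \<eta>) \<le> norm (x :: 'h oper) * (norm \<xi> * norm \<eta>)"
proof -
  have "cmod (cinner (x \<cdot> \<xi>) \<eta>) \<le> norm (x \<cdot> \<xi>) * norm \<eta>" by (rule cmod_cinner_le)
  also have "\<dots> \<le> (norm x * norm \<xi>) * norm \<eta>" by (intro mult_right_mono norm_blinfun) simp
  finally show ?thesis by (simp add: mult.assoc)
qed

lemma tr_bounded: "\<exists>C\<ge>0. \<forall>x\<in>M. cmod (\<tau> x) \<le> C * norm x"
proof -
  obtain \<xi> \<eta> :: "nat \<Rightarrow> 'h" where s: "summable (\<lambda>i. (norm (\<xi> i))\<^sup>2)" "summable (\<lambda>i. (norm (\<eta> i))\<^sup>2)"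
    "\<And>x. x \<in> M \<Longrightarrow> (\<lambda>i. cinner (x \<cdot> (\<xi> i)) (\<eta> i)) sums \<tau> x" by (rule uw_sequences) blast
  have sm: "summable (\<lambda>i. norm (\<xi> i) * norm (\<eta> i))" using s by (intro hseq_summable_mult)
  define C where "C = (\<Sum>i. norm (\<xi> i) * norm (\<eta> i))"
  have "cmod (\<tau> x) \<le> C * norm x" if x: "x \<in> M" for x
  proof -
    have "cmod (\<Sum>i. cinner (x \<cdot> (\<xi> i)) (\<eta> i)) \<le> (\<Sum>i. norm x * (norm (\<xi> i) * norm (\<eta> i)))"
      by (intro norm_suminf_le summable_mult sm cmod_cinner_oper_le)
    also have "\<dots> = C * norm x" unfolding C_def suminf_mult[OF sm] by (rule mult.commute)
    finally show ?thesis using s(3)[OF x] by (simp add: sums_iff)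
  qed
  moreover have "0 \<le> C" unfolding C_def by (intro suminf_nonneg sm) simp
  ultimately show ?thesis by blast
qed

text \<open>The uniform norm bound dominates the series for \<open>\<tau>\<close> by a summable
  sequence, so the limit may be taken term by term.\<close>

lemma tr_weak_tendsto:
  assumes T: "\<And>k. T k \<in> M" "\<And>k. norm (T k) \<le> C" and L: "L \<in> M"
    and lim: "\<And>x y. (\<lambda>k::nat. cinner (T k \<cdot> x) y) \<longlonglongrightarrow> cinner (L \<cdot> x) y"
  shows "(\<lambda>k. \<tau> (T k)) \<longlonglongrightarrow> \<tau> L"
proof -
  obtain \<xi> \<eta> :: "nat \<Rightarrow> 'h" where s: "summable (\<lambda>i. (norm (\<xi> i))\<^sup>2)" "summable (\<lambda>i. (norm (\<eta> i))\<^sup>2)"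
    "\<And>x. x \<in> M \<Longrightarrow> (\<lambda>i. cinner (x \<cdot> (\<xi> i)) (\<eta> i)) sums \<tau> x" by (rule uw_sequences) blast
  have sm: "summable (\<lambda>i. C * (norm (\<xi> i) * norm (\<eta> i)))" using s by (intro hseq_summable_mult summable_mult)
  have "(\<lambda>k. \<Sum>i. cinner (T k \<cdot> (\<xi> i)) (\<eta> i)) \<longlonglongrightarrow> (\<Sum>i. cinner (L \<cdot> (\<xi> i)) (\<eta> i))"
  proof (rule tannerys_theorem[OF lim _ sm, THEN conjunct2, THEN conjunct2])
    have "cmod (cinner (T k \<cdot> (\<xi> i)) (\<eta> i)) \<le> C * (norm (\<xi> i) * norm (\<eta> i))" for i k
      by (rule order_trans[OF cmod_cinner_oper_le]) (intro mult_right_mono T, simp)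
    then show "\<forall>\<^sub>F (i, k) in at_top \<times>\<^sub>F at_top. cmod (cinner (T k \<cdot> (\<xi> i)) (\<eta> i)) \<le> C * (norm (\<xi> i) * norm (\<eta> i))"
      by (auto intro!: always_eventually)
  qed simp
  then show ?thesis using s(3)[OF T(1)] s(3)[OF L] by (simp add: sums_iff)
qed

text \<open>The trace is given by two sequences of vectors, but closeness at the single sequence
  \<open>\<xi> i + \<eta> i\<close> is enough: \<open>4 * inner p q\<close> is at most
  \<open>|p + q|^2\<close> for any vectors, and this bounds every term of
  \<open>tsq (x - a)\<close>.\<close>

lemma tr_density:
  assumes A: "A \<subseteq> M" "0 \<in> A" "\<And>a b. a \<in> A \<Longrightarrow> b \<in> A \<Longrightarrow> a + b \<in> A"
    "\<And>a b. a \<in> A \<Longrightarrow> b \<in> A \<Longrightarrow> a o\<^sub>L b \<in> A" "\<And>a c. a \<in> A \<Longrightarrow> scalar_op c o\<^sub>L a \<in> A"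
    "\<And>a. a \<in> A \<Longrightarrow> adj a \<in> A"
    and nondeg: "\<And>\<eta>. (\<And>a. a \<in> A \<Longrightarrow> a \<cdot> \<eta> = 0) \<Longrightarrow> \<eta> = 0"
    and x: "x \<in> commutant (commutant A)" "x \<in> M" and e: "0 < e"
  shows "\<exists>a\<in>A. tsq (x - a) < e"
proof -
  obtain \<xi> \<eta> :: "nat \<Rightarrow> 'h" where s: "summable (\<lambda>i. (norm (\<xi> i))\<^sup>2)" "summable (\<lambda>i. (norm (\<eta> i))\<^sup>2)"
    "\<And>x. x \<in> M \<Longrightarrow> (\<lambda>i. cinner (x \<cdot> (\<xi> i)) (\<eta> i)) sums \<tau> x" by (rule uw_sequences) blast
  have "summable (\<lambda>i. (norm (\<xi> i + \<eta> i))\<^sup>2)" using s by (intro hseq_summable_add)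
  with A(1) M_bounded_ops e
  have "\<exists>a\<in>A. summable (\<lambda>i. (norm ((x - a) \<cdot> (\<xi> i + \<eta> i)))\<^sup>2) \<and>
    (\<Sum>i. (norm ((x - a) \<cdot> (\<xi> i + \<eta> i)))\<^sup>2) < e"
    by (intro amplified_density[OF _ A(2-6) nondeg x(1)]) auto
  then obtain a where a: "a \<in> A" "summable (\<lambda>i. (norm ((x - a) \<cdot> (\<xi> i + \<eta> i)))\<^sup>2)"
    "(\<Sum>i. (norm ((x - a) \<cdot> (\<xi> i + \<eta> i)))\<^sup>2) < e" by blast
  define y where "y = x - a"
  have y: "y \<in> M" using a x A by (auto simp: y_def)
  have le: "Re (cinner ((adj y o\<^sub>L y) \<cdot> (\<xi> i)) (\<eta> i)) \<le> (norm (y \<cdot> (\<xi> i + \<eta> i)))\<^sup>2" for i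
  proof -
    have "Re (cinner ((adj y o\<^sub>L y) \<cdot> (\<xi> i)) (\<eta> i)) = inner (y \<cdot> (\<xi> i)) (y \<cdot> (\<eta> i))"
      using y by (simp add: cinner_adj_left inner_eq_Re_cinner)
    also have "\<dots> \<le> (norm (y \<cdot> (\<xi> i) + y \<cdot> (\<eta> i)))\<^sup>2"
      using inner_ge_zero[of "y \<cdot> (\<xi> i) - y \<cdot> (\<eta> i)"]
        inner_ge_zero[of "y \<cdot> (\<xi> i) + y \<cdot> (\<eta> i)"]
      by (simp add: power2_norm_eq_inner inner_add_left inner_add_right inner_diff_left inner_diff_right inner_commute)
    finally show ?thesis by (simp add: blinfun.add_right)
  qed
  have r: "(\<lambda>i. Re (cinner ((adj y o\<^sub>L y) \<cdot> (\<xi> i)) (\<eta> i))) sums tsq y"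
    unfolding tsq_def using y by (intro sums_Re s(3)) auto
  have "tsq y \<le> (\<Sum>i. (norm (y \<cdot> (\<xi> i + \<eta> i)))\<^sup>2)"
    using suminf_le[OF le _ a(2)[folded y_def]] r by (simp add: sums_iff)
  then show ?thesis using a y_def by force
qed

text \<open>The vectors annihilated by the null ideal of the trace form an \<open>M\<close>- and \<open>M'\<close>-invariant subspace,
  whose projection is central.\<close>

lemma tr_faithful:
  assumes x: "x \<in> M" "tsq x = 0" shows "x = 0"
proof -
  define I where "I = {x \<in> M. tsq x = 0}"
  have mult: "y o\<^sub>L x \<in> I" if "y \<in> M" "x \<in> I" for x y
  proof -
    have x: "x \<in> M" "tsq x = 0" using that by (auto simp: I_def)
    have "(cmod (\<tau> (adj x o\<^sub>L (adj y o\<^sub>L (y o\<^sub>L x)))))\<^sup>2 \<le> tsq (adj y o\<^sub>L (y o\<^sub>L x)) * tsq x"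
      using x that by (intro tr_cauchy_schwarz) auto
    moreover have "adj x o\<^sub>L (adj y o\<^sub>L (y o\<^sub>L x)) = adj (y o\<^sub>L x) o\<^sub>L (y o\<^sub>L x)"
      using x that by (intro blinfun_eqI) (simp add: adj_compose)
    ultimately have "tsq (y o\<^sub>L x) = 0" using x by (simp add: tsq_def)
    then show ?thesis using x that by (auto simp: I_def)
  qed
  have adjI: "adj x \<in> I" if "x \<in> I" for x using that by (auto simp: I_def tsq_adj)
  \<comment> \<open>Invariance of \<open>tsq\<close> under the adjoint turns the left ideal
    \<open>I\<close> into a two-sided one; this makes the annihilated subspace invariant under
    \<open>M\<close>.\<close>
  have mult': "x o\<^sub>L y \<in> I" if "y \<in> M" "x \<in> I" for x y
    using adjI[OF mult[OF M_closed(1)[OF that(1)] adjI[OF that(2)]]] that by (simp add: adj_compose I_def)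
  have add: "a + b \<in> I" if "a \<in> I" "b \<in> I" for a b
    using tsq_parallelogram[of a b] tsq_nonneg[of "a + b"] tsq_nonneg[of "a - b"] that by (auto simp: I_def)
  define K where "K = {\<eta>. \<forall>a\<in>I. a \<cdot> \<eta> = 0}"
  have K: "csubspace K" unfolding csubspace_def K_def
    by (auto simp: blinfun.add_right I_def bounded_opsD)
  have "K = (\<Inter>a\<in>I. blinfun_apply a -` {0})" by (auto simp: K_def)
  moreover have "closed (blinfun_apply a -` {0})" for a :: "'h oper"
    by (rule continuous_closed_vimage) (auto intro: linear_continuous_at blinfun.bounded_linear_right)
  ultimately have cK: "closed K" by auto
  obtain Q where Q: "ortho_proj K Q" using ortho_proj_exists[OF K cK] by blast
  have invM: "y \<cdot> k \<in> K" if "y \<in> M" "k \<in> K" for y k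
  proof -
    have "(a o\<^sub>L y) \<cdot> k = 0" if "a \<in> I" for a
      using mult'[OF \<open>y \<in> M\<close> that] \<open>k \<in> K\<close> by (simp only: K_def mem_Collect_eq)
    then show ?thesis by (simp add: K_def)
  qed
  have invM': "b \<cdot> k \<in> K" if "b \<in> commutant M" "k \<in> K" for b k
  proof -
    have "a \<cdot> b \<cdot> k = 0" if a: "a \<in> I" for a
    proof -
      have "b \<cdot> a \<cdot> k = a \<cdot> b \<cdot> k"
        using a by (intro commutant_apply[OF \<open>b \<in> commutant M\<close>]) (simp add: I_def)
      then show ?thesis using a \<open>k \<in> K\<close> by (simp add: K_def)
    qed
    then show ?thesis by (simp add: K_def)
  qed
  have "Q \<in> commutant M"
    by (intro commutantI ortho_projD(1)[OF Q] ortho_proj_commute[OF K Q]) (auto intro: invM)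
  moreover have "Q \<in> commutant (commutant M)"
  proof (intro commutantI ortho_projD(1)[OF Q] ortho_proj_commute[OF K Q])
    fix b assume b: "b \<in> commutant M"
    then show "b \<in> bounded_ops" by (rule commutantD)
    have "adj b \<in> commutant M" using b M_bounded_ops by (intro commutant_adj) auto
    then show "\<And>k. k \<in> K \<Longrightarrow> b \<cdot> k \<in> K" "\<And>k. k \<in> K \<Longrightarrow> (adj b) \<cdot> k \<in> K"
      using b invM' by auto
  qed
  ultimately have "Q \<in> M \<inter> commutant M" using M_double_commutant by auto
  then obtain c where c: "Q = scalar_op c" using fac by (auto simp: factor_def)
  show ?thesis
  proof (cases "c = 0")
    case False
    have "\<eta> \<in> K" for \<eta>
    proof -
      have "c *\<^sub>C \<eta> \<in> K" using ortho_projD(2)[OF Q, of \<eta>] c by simp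
      then have "inverse c *\<^sub>C (c *\<^sub>C \<eta>) \<in> K" by (rule csubspaceD(3)[OF K])
      then show ?thesis using False by (simp add: scaleC_scaleC)
    qed
    then show ?thesis using x by (intro blinfun_eqI) (auto simp: K_def I_def)
  next
    case True
    have nd: "\<eta> = 0" if "\<And>a. a \<in> I \<Longrightarrow> a \<cdot> \<eta> = 0" for \<eta>
    proof -
      have "\<eta> \<in> K" using that by (simp add: K_def)
      then have "Q \<cdot> \<eta> = \<eta>" by (rule ortho_proj_fixed[OF K Q])
      then show ?thesis using c True by simp
    qed
    \<comment> \<open>\<open>Q = 0\<close> says that \<open>I\<close> acts nondegenerately, so the
      density statement for algebras without unit approximates the identity by elements of trace
      norm zero, against \<open>tsq id_blinfun = 1\<close>. The bound 1/2 absorbs the factor 2 from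
      the parallelogram law.\<close>
    have "\<exists>a\<in>I. tsq (id_blinfun - a) < 1/2"
    proof (rule tr_density)
      show "0 \<in> I" using tsq_nonneg[of 0] by (auto simp: I_def tsq_def)
      show "\<And>a b. a \<in> I \<Longrightarrow> b \<in> I \<Longrightarrow> a o\<^sub>L b \<in> I" using mult by (auto simp: I_def)
      show "\<And>a c. a \<in> I \<Longrightarrow> scalar_op c o\<^sub>L a \<in> I" using mult by auto
      show "id_blinfun \<in> commutant (commutant I)" by (rule commutant_algebra)
    qed (use add adjI nd in \<open>auto simp: I_def\<close>)
    then obtain a where a: "a \<in> I" "tsq (id_blinfun - a) < 1/2" by blast
    have aM: "a \<in> M" "tsq a = 0" using a by (auto simp: I_def)
    have "tsq ((id_blinfun - a) + a) \<le> 2 * tsq (id_blinfun - a) + 2 * tsq a"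
      using tsq_parallelogram[of "id_blinfun - a" a] tsq_nonneg[of "(id_blinfun - a) - a"] aM by auto
    then show ?thesis using a(2) aM by (simp add: tsq_id)
  qed
qed

text \<open>Iterating the Cauchy-Schwarz inequality avoids the square root of the positive operator
  \<open>\<parallel>x\<parallel>\<^sup>2 - x\<^sup>* x\<close>.\<close>

lemma tsq_mult_le:
  assumes x: "x \<in> M" and y: "y \<in> M" shows "tsq (x o\<^sub>L y) \<le> (norm x)\<^sup>2 * tsq y"
proof -
  \<comment> \<open>\<open>a k\<close> is the power of \<open>adj x o\<^sub>L x\<close> with
    exponent \<open>2 ^ k\<close>. Cauchy-Schwarz shows that \<open>q k / tsq y\<close> is at least
    squared in each step, so it grows at least like \<open>r ^ (2 ^ k)\<close>, while the norm
    bounds \<open>q k\<close> by a constant times \<open>((norm x)\<^sup>2) ^ (2 ^ k)\<close>;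
    letting \<open>k\<close> grow compares the two bases.\<close>
  define a where "a = rec_nat (adj x o\<^sub>L x) (\<lambda>_ b. b o\<^sub>L b)"
  have a0: "a 0 = adj x o\<^sub>L x" and aS: "a (Suc k) = a k o\<^sub>L a k" for k by (simp_all add: a_def)
  have a: "a k \<in> M \<and> adj (a k) = a k \<and> norm (a k) \<le> ((norm x)\<^sup>2) ^ (2 ^ k)" for k
  proof (induction k)
    case 0
    have "norm (adj x o\<^sub>L x) \<le> norm (adj x) * norm x" by (rule norm_blinfun_compose)
    then show ?case using x by (auto simp: a0 adj_compose norm_adj power2_eq_square)
  next
    case (Suc k)
    have "norm (a k o\<^sub>L a k) \<le> norm (a k) * norm (a k)" by (rule norm_blinfun_compose)
    also have "\<dots> \<le> ((norm x)\<^sup>2) ^ (2 ^ k) * ((norm x)\<^sup>2) ^ (2 ^ k)"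
      using Suc by (intro mult_mono) auto
    finally show ?case using Suc by (auto simp: aS adj_compose power_add[symmetric] mult_2)
  qed
  define q where "q k = cmod (\<tau> (adj y o\<^sub>L (a k o\<^sub>L y)))" for k
  have qS: "(q k)\<^sup>2 \<le> tsq y * q (Suc k)" for k
  proof -
    have "(q k)\<^sup>2 \<le> tsq (a k o\<^sub>L y) * tsq y"
      unfolding q_def using a[of k] y by (intro tr_cauchy_schwarz) auto
    also have "tsq (a k o\<^sub>L y) = Re (\<tau> (adj y o\<^sub>L (a (Suc k) o\<^sub>L y)))"
    proof -
      have "adj (a k o\<^sub>L y) o\<^sub>L (a k o\<^sub>L y) = adj y o\<^sub>L (a (Suc k) o\<^sub>L y)"
        using a[of k] y by (intro blinfun_eqI) (simp add: adj_compose aS)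
      then show ?thesis by (simp add: tsq_def)
    qed
    also have "\<dots> \<le> q (Suc k)" unfolding q_def by (rule complex_Re_le_cmod)
    finally show ?thesis using tsq_nonneg[OF y] by (simp add: mult.commute[of _ "tsq y"] mult_left_mono)
  qed
  obtain C where C: "C \<ge> 0" "\<And>z. z \<in> M \<Longrightarrow> cmod (\<tau> z) \<le> C * norm z" using tr_bounded by blast
  define D where "D = C * (norm y)\<^sup>2"
  have qD: "q k \<le> D * ((norm x)\<^sup>2) ^ (2 ^ k)" for k
  proof -
    have "norm (adj y o\<^sub>L (a k o\<^sub>L y)) \<le> norm y * (norm (a k) * norm y)"
    proof -
      have "norm (adj y o\<^sub>L (a k o\<^sub>L y)) \<le> norm (adj y) * norm (a k o\<^sub>L y)" by (rule norm_blinfun_compose)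
      also have "\<dots> \<le> norm (adj y) * (norm (a k) * norm y)" by (intro mult_left_mono norm_blinfun_compose) simp
      finally show ?thesis using y by (simp add: norm_adj)
    qed
    also have "\<dots> \<le> norm y * (((norm x)\<^sup>2) ^ (2 ^ k) * norm y)" using a[of k] by (intro mult_mono) auto
    finally have "C * norm (adj y o\<^sub>L (a k o\<^sub>L y)) \<le> C * (norm y * (((norm x)\<^sup>2) ^ (2 ^ k) * norm y))"
      using C(1) by (intro mult_left_mono)
    moreover have "q k \<le> C * norm (adj y o\<^sub>L (a k o\<^sub>L y))" unfolding q_def using a[of k] y by (intro C(2)) auto
    ultimately show ?thesis by (simp add: D_def power2_eq_square mult_ac)
  qed
  have q0: "q 0 = tsq (x o\<^sub>L y)"
  proof -
    have "adj y o\<^sub>L (a 0 o\<^sub>L y) = adj (x o\<^sub>L y) o\<^sub>L (x o\<^sub>L y)"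
      using x y by (intro blinfun_eqI) (simp add: adj_compose a0)
    then show ?thesis using x y by (simp add: q_def tsq_eq tsq_nonneg)
  qed
  show ?thesis
  proof (cases "tsq y = 0")
    case True
    then show ?thesis using qS[of 0] q0 by simp
  next
    case False
    then have t: "0 < tsq y" using tsq_nonneg[OF y] by simp
    define r where "r = q 0 / tsq y"
    have r0: "0 \<le> r" using t by (simp add: r_def q_def)
    have low: "tsq y * r ^ (2 ^ k) \<le> q k" for k
    proof (induction k)
      case 0 then show ?case using t by (simp add: r_def)
    next
      case (Suc k)
      have "(tsq y * r ^ (2 ^ k))\<^sup>2 \<le> (q k)\<^sup>2" using Suc t r0 by (intro power_mono) auto
      also have "\<dots> \<le> tsq y * q (Suc k)" by (rule qS)
      finally have "tsq y * (tsq y * r ^ (2 ^ Suc k)) \<le> tsq y * q (Suc k)"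
        by (simp add: power2_eq_square power_add[symmetric] mult_2 mult_ac)
      then show ?case using t by simp
    qed
    have "r \<le> (norm x)\<^sup>2"
    proof (rule ccontr)
      assume "\<not> r \<le> (norm x)\<^sup>2"
      then have rx: "(norm x)\<^sup>2 < r" by simp
      then have rp: "0 < r" using zero_le_power2[of "norm x"] by linarith
      define s where "s = (norm x)\<^sup>2 / r"
      have s: "0 \<le> s" "s < 1" using rx rp by (auto simp: s_def)
      have "tsq y \<le> D * s ^ k" for k
      proof -
        have "tsq y * r ^ (2 ^ k) \<le> D * ((norm x)\<^sup>2) ^ (2 ^ k)" using low[of k] qD[of k] by linarith
        then have "tsq y \<le> D * s ^ (2 ^ k)" using rp by (simp add: s_def power_divide pos_le_divide_eq)
        also have "s ^ (2 ^ k) \<le> s ^ k" using s by (intro power_decreasing) (auto simp: less_imp_le)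
        finally show ?thesis using C(1) by (simp add: D_def mult_left_mono)
      qed
      moreover have "(\<lambda>k. D * s ^ k) \<longlonglongrightarrow> D * 0" using s by (intro tendsto_intros LIMSEQ_power_zero) auto
      ultimately have "tsq y \<le> 0" using tendsto_zero_unique_if_le[of "tsq y" "\<lambda>k. D * s ^ k"] by simp
      then show False using t by simp
    qed
    then show ?thesis using t by (simp add: r_def q0 divide_le_eq)
  qed
qed

end

section \<open>Bounded Borel functions on the circle\<close>

abbreviation unit_circle :: "complex set" where "unit_circle \<equiv> sphere 0 1"

text \<open>The bound is imposed on the circle only: spectral measures live there, and nontrivial
  powers \<open>z powi k\<close> are unbounded off it.\<close>

definition bdd_borel :: "(complex \<Rightarrow> complex) \<Rightarrow> real \<Rightarrow> bool" where
  "bdd_borel f C \<longleftrightarrow> f \<in> borel_measurable borel \<and> (\<forall>z\<in>unit_circle. cmod (f z) \<le> C)"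

lemma bdd_borelD: "bdd_borel f C \<Longrightarrow> f \<in> borel_measurable borel"
  "bdd_borel f C \<Longrightarrow> z \<in> unit_circle \<Longrightarrow> cmod (f z) \<le> C"
  by (auto simp: bdd_borel_def)

lemma borel_measurable_powi [measurable]: "(\<lambda>z::complex. z powi k) \<in> borel_measurable borel"
  by (cases "0 \<le> k") (auto simp: power_int_def)

lemma bdd_borel_powi: "bdd_borel (\<lambda>z. z powi k) 1"
  by (auto simp: bdd_borel_def norm_power_int)

lemma bdd_borel_lin:
  "bdd_borel f C \<Longrightarrow> bdd_borel g D \<Longrightarrow> bdd_borel (\<lambda>z. a * f z + g z) (cmod a * C + D)"
  unfolding bdd_borel_def
  by (auto simp: norm_mult intro!: norm_triangle_le add_mono mult_left_mono)

lemma bdd_borel_nonneg: "bdd_borel f C \<Longrightarrow> 0 \<le> C"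
  using order_trans[OF norm_ge_zero bdd_borelD(2)[of f C 1]] by (simp add: dist_norm)

lemma bdd_borel_mult:
  assumes f: "bdd_borel f C" and g: "bdd_borel g D" shows "bdd_borel (\<lambda>z. f z * g z) (C * D)"
  unfolding bdd_borel_def
proof (intro conjI ballI)
  show "(\<lambda>z. f z * g z) \<in> borel_measurable borel" using f g by (auto simp: bdd_borel_def)
  fix z assume z: "z \<in> unit_circle"
  show "cmod (f z * g z) \<le> C * D" unfolding norm_mult
    by (intro mult_mono bdd_borelD(2)[OF f z] bdd_borelD(2)[OF g z] bdd_borel_nonneg[OF f]) simp
qed

lemma borel_measurable_cnj_comp [measurable]:
  "f \<in> borel_measurable M \<Longrightarrow> (\<lambda>z. cnj (f z)) \<in> borel_measurable M"
  by (rule measurable_compose[OF _ borel_measurable_continuous_onI]) (auto intro: continuous_intros)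

lemma bdd_borel_cnj: "bdd_borel f C \<Longrightarrow> bdd_borel (\<lambda>z. cnj (f z)) C"
  unfolding bdd_borel_def by auto

lemma inverse_unimodular: "cmod z = 1 \<Longrightarrow> inverse z = cnj z"
  using complex_norm_square[of z] by (intro inverse_unique) simp

section \<open>Trigonometric polynomials and the induction over bounded Borel functions\<close>

inductive trig_poly :: "(complex \<Rightarrow> complex) \<Rightarrow> bool" where
  trig_powi: "trig_poly (\<lambda>z. z powi k)"
| trig_lin: "trig_poly f \<Longrightarrow> trig_poly g \<Longrightarrow> trig_poly (\<lambda>z. a * f z + g z)"

lemma trig_poly_bdd: "trig_poly t \<Longrightarrow> \<exists>C. bdd_borel t C"
proof (induction rule: trig_poly.induct)
  case (trig_lin f g a) then show ?case using bdd_borel_lin by blast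
qed (use bdd_borel_powi in blast)

lemma trig_poly_add: "trig_poly f \<Longrightarrow> trig_poly g \<Longrightarrow> trig_poly (\<lambda>z. f z + g z)"
  using trig_lin[of f g 1] by simp

lemma trig_poly_zero: "trig_poly (\<lambda>z. 0)"
  using trig_lin[OF trig_powi trig_powi, of "-1" 0 0] by simp

lemma trig_poly_scale: "trig_poly f \<Longrightarrow> trig_poly (\<lambda>z. a * f z)"
  using trig_lin[OF _ trig_poly_zero, of f a] by simp

text \<open>Equality is asked for on the circle because exponents of \<open>powi\<close> do not add
  at \<open>0\<close>: there \<open>0 powi 1 * 0 powi (-1) = 0\<close> while
  \<open>0 powi 0 = 1\<close>.\<close>

lemma trig_poly_mult:
  assumes "trig_poly f" "trig_poly g"
  shows "\<exists>t. trig_poly t \<and> (\<forall>z\<in>unit_circle. t z = f z * g z)"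
  using assms(1)
proof (induction rule: trig_poly.induct)
  case (trig_powi k)
  show ?case using assms(2)
  proof (induction rule: trig_poly.induct)
    case (trig_powi j)
    have "z powi (k + j) = z powi k * z powi j" if "z \<in> unit_circle" for z :: complex
      using that by (intro power_int_add) auto
    then show ?case using trig_poly.trig_powi by blast
  next
    case (trig_lin f g a)
    then obtain s t where st: "trig_poly s" "trig_poly t" "\<forall>z\<in>unit_circle. s z = z powi k * f z"
      "\<forall>z\<in>unit_circle. t z = z powi k * g z" by blast
    have "\<forall>z\<in>unit_circle. a * s z + t z = z powi k * (a * f z + g z)"
      using st by (auto simp: algebra_simps)
    then show ?case using trig_poly.trig_lin[OF st(1,2), of a] by blast
  qed
next
  case (trig_lin f1 f2 a)
  then obtain s t where st: "trig_poly s" "trig_poly t" "\<forall>z\<in>unit_circle. s z = f1 z * g z"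
    "\<forall>z\<in>unit_circle. t z = f2 z * g z" by blast
  have "\<forall>z\<in>unit_circle. a * s z + t z = (a * f1 z + f2 z) * g z"
    using st by (auto simp: algebra_simps)
  then show ?case using trig_poly.trig_lin[OF st(1,2), of a] by blast
qed

lemma trig_poly_of_real_polynomial:
  fixes g :: "complex \<Rightarrow> real"
  assumes "real_polynomial_function g"
  shows "\<exists>t. trig_poly t \<and> (\<forall>z\<in>unit_circle. t z = of_real (g z))"
  using assms
proof (induction rule: real_polynomial_function.induct)
  case (linear f)
  \<comment> \<open>A real linear \<open>f\<close> is a combination of \<open>Re z\<close> and
    \<open>Im z\<close>, hence of \<open>z\<close> and \<open>cnj z\<close>, and on the circle
    \<open>cnj z = z powi (-1)\<close>.\<close>
  define a b :: complex where "a = (of_real (f 1) - \<i> * of_real (f \<i>)) / 2"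
    and "b = (of_real (f 1) + \<i> * of_real (f \<i>)) / 2"
  have "a * z powi 1 + b * z powi (-1) = of_real (f z)" if z: "z \<in> unit_circle" for z
  proof -
    have "z = Re z *\<^sub>R 1 + Im z *\<^sub>R \<i>" by (simp add: complex_eq_iff)
    then have "f z = f (Re z *\<^sub>R 1 + Im z *\<^sub>R \<i>)" by (rule arg_cong)
    also have "\<dots> = Re z * f 1 + Im z * f \<i>"
      using linear by (simp add: linear_simps)
    finally have fz: "f z = Re z * f 1 + Im z * f \<i>" .
    have "cmod z = 1" using z by simp
    then have "z powi (-1) = cnj z" by (simp add: power_int_minus inverse_unimodular)
    then have "a * z powi 1 + b * z powi (-1) = a * z + b * cnj z" by simp
    also have "\<dots> = of_real (f z)" by (simp add: a_def b_def fz complex_eq_iff field_simps)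
    finally show ?thesis .
  qed
  moreover have "trig_poly (\<lambda>z. a * z powi 1 + b * z powi (-1))"
    by (intro trig_lin trig_poly_scale trig_powi)
  ultimately show ?case by blast
next
  case (const c)
  show ?case using trig_poly_scale[OF trig_powi, of "of_real c" 0] by (intro exI conjI) auto
next
  case (add f g)
  then obtain s t where "trig_poly s" "trig_poly t" "\<forall>z\<in>unit_circle. s z = of_real (f z)"
    "\<forall>z\<in>unit_circle. t z = of_real (g z)" by blast
  then show ?case using trig_poly_add[of s t] by (intro exI[of _ "\<lambda>z. s z + t z"]) auto
next
  case (mult f g)
  then obtain s t where st: "trig_poly s" "trig_poly t" "\<forall>z\<in>unit_circle. s z = of_real (f z)"
    "\<forall>z\<in>unit_circle. t z = of_real (g z)" by blast
  then obtain r where "trig_poly r" "\<forall>z\<in>unit_circle. r z = s z * t z" using trig_poly_mult by blast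
  then show ?case using st by (intro exI[of _ r]) auto
qed

text \<open>This principle replaces computations with spectral projections: it turns identities for the powers of
  \<open>v\<close> into identities for its Borel functional calculus.\<close>

lemma bounded_borel_circle_induct:
  fixes P :: "(complex \<Rightarrow> complex) \<Rightarrow> bool"
  assumes pow: "\<And>k. P (\<lambda>z. z powi k)"
    and lin: "\<And>f g a C D. bdd_borel f C \<Longrightarrow> bdd_borel g D \<Longrightarrow> P f \<Longrightarrow> P g \<Longrightarrow> P (\<lambda>z. a * f z + g z)"
    and lim: "\<And>F f C. (\<And>k::nat. P (F k)) \<Longrightarrow> (\<And>k. bdd_borel (F k) C) \<Longrightarrow> bdd_borel f C \<Longrightarrow>
      (\<And>z. z \<in> unit_circle \<Longrightarrow> (\<lambda>k. F k z) \<longlonglongrightarrow> f z) \<Longrightarrow> P f"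
    and f: "bdd_borel f C"
  shows "P f"
proof -
  have trig: "P t" if "trig_poly t" for t using that
  proof (induction rule: trig_poly.induct)
    case (trig_lin f g a) then show ?case using lin trig_poly_bdd by blast
  qed (rule pow)
  have P0: "P (\<lambda>z. 0)" by (rule trig[OF trig_poly_zero])
  have ind0: "indicator {} = (\<lambda>z::complex. 0::complex)" by auto
  have padd: "P (\<lambda>z. f z + g z)" if "bdd_borel f C" "bdd_borel g D" "P f" "P g" for f g C D
    using lin[OF that, of 1] by simp
  have scale: "P (\<lambda>z. a * f z)" if "bdd_borel f C" "P f" for f C a
    using lin[OF that(1) _ that(2) P0, of 0] by (simp add: bdd_borel_def)
  \<comment> \<open>Uniform approximation by Stone-Weierstrass; the errors are at most 1, whence the
    common bound \<open>C + 1\<close>.\<close>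
  have cont: "P (\<lambda>z. of_real (g z))" if g: "continuous_on UNIV g" "\<And>z. \<bar>g z\<bar> \<le> C" for g :: "complex \<Rightarrow> real" and C
  proof -
    have "\<exists>t. trig_poly t \<and> (\<forall>z\<in>unit_circle. cmod (of_real (g z) - t z) < inverse (Suc k))" for k
    proof -
      have gc: "continuous_on unit_circle g" using g(1) continuous_on_subset by blast
      obtain p where p: "real_polynomial_function p" "\<And>z. z \<in> unit_circle \<Longrightarrow> \<bar>g z - p z\<bar> < inverse (Suc k)"
        by (rule Stone_Weierstrass_real_polynomial_function[OF compact_sphere gc, of "inverse (Suc k)"]) auto
      obtain t where t: "trig_poly t" "\<forall>z\<in>unit_circle. t z = of_real (p z)"
        using trig_poly_of_real_polynomial[OF p(1)] by blast
      have "cmod (of_real (g z) - t z) < inverse (Suc k)" if "z \<in> unit_circle" for z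
      proof -
        have "of_real (g z) - t z = of_real (g z - p z)" using t(2) that by simp
        then show ?thesis using p(2)[OF that] by (simp only: norm_of_real)
      qed
      then show ?thesis using t by blast
    qed
    then obtain T where T: "\<And>k. trig_poly (T k)"
      "\<And>k z. z \<in> unit_circle \<Longrightarrow> cmod (of_real (g z) - T k z) < inverse (Suc k)" by metis
    show ?thesis
    proof (rule lim)
      show "P (T k)" for k by (rule trig[OF T(1)])
      have C: "0 \<le> C" using g(2)[of 0] by linarith
      show "bdd_borel (T k) (C + 1)" for k
        unfolding bdd_borel_def
      proof (intro conjI ballI)
        show "T k \<in> borel_measurable borel" using trig_poly_bdd[OF T(1)] bdd_borelD by blast
        fix z assume z: "z \<in> unit_circle"
        have "cmod (T k z) \<le> cmod (of_real (g z)) + cmod (of_real (g z) - T k z)"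
          by (metis norm_triangle_sub norm_minus_commute)
        also have "\<dots> \<le> C + inverse (Suc k)" using g(2)[of z] T(2)[OF z, of k] by simp
        also have "inverse (real (Suc k)) \<le> 1" by (simp add: field_simps)
        finally show "cmod (T k z) \<le> C + 1" by simp
      qed
      have "g \<in> borel_measurable borel" using g(1) by (rule borel_measurable_continuous_onI)
      then show "bdd_borel (\<lambda>z. complex_of_real (g z)) (C + 1)"
        using order_trans[OF g(2), of "C + 1"] by (simp add: bdd_borel_def)
      fix z assume z: "z \<in> unit_circle"
      have "(\<lambda>k. of_real (g z) - T k z) \<longlonglongrightarrow> 0"
      proof (rule Lim_null_comparison[OF _ LIMSEQ_inverse_real_of_nat])
        show "\<forall>\<^sub>F k in sequentially. cmod (of_real (g z) - T k z) \<le> inverse (real (Suc k))"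
          by (rule always_eventually, rule allI, rule less_imp_le, rule T(2)[OF z])
      qed
      from tendsto_diff[OF tendsto_const[of "of_real (g z)"] this]
      show "(\<lambda>k. T k z) \<longlonglongrightarrow> of_real (g z)" by simp
    qed
  qed
  have bi: "bdd_borel (indicator A :: complex \<Rightarrow> complex) 1" if "A \<in> sets borel" for A
    using that by (auto simp: bdd_borel_def indicator_def)
  have closed: "P (indicator K)" if K: "closed K" for K
  proof (cases "K = {}")
    case False
    \<comment> \<open>Continuous functions decreasing to the indicator of the closed set
      \<open>K\<close>.\<close>
    define g where "g k z = max 0 (1 - real k * infdist z K)" for k z
    have g: "continuous_on UNIV (g k)" "\<bar>g k z\<bar> \<le> 1" for k z
      unfolding g_def by (intro continuous_intros) (auto simp: max_def infdist_nonneg)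
    show ?thesis
    proof (rule lim)
      show "P (\<lambda>z. of_real (g k z))" for k using g by (rule cont)
      show "bdd_borel (\<lambda>z. of_real (g k z)) 1" for k
        using g borel_measurable_continuous_onI[OF g(1)] by (auto simp: bdd_borel_def)
      show "bdd_borel (indicator K) 1" using K by (intro bi) auto
      fix z
      show "(\<lambda>k. complex_of_real (g k z)) \<longlonglongrightarrow> indicator K z"
      proof (cases "z \<in> K")
        case True
        then have "g k z = 1" for k by (simp add: g_def)
        then show ?thesis using True by simp
      next
        case zK: False
        then have d: "infdist z K > 0" using K False infdist_pos_not_in_closed by blast
        obtain N where N: "1 < real N * infdist z K" using reals_Archimedean3[OF d] by blast
        have "g k z = 0" if "k \<ge> N" for k
        proof -
          have "real N * infdist z K \<le> real k * infdist z K" using d that by (intro mult_right_mono) auto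
          then show ?thesis using N by (simp add: g_def)
        qed
        then have "\<forall>\<^sub>F k in sequentially. complex_of_real (g k z) = 0"
          by (auto simp: eventually_sequentially)
        then show ?thesis using zK by (simp add: tendsto_eventually)
      qed
    qed
  qed (simp only: ind0 P0)
  \<comment> \<open>Closed sets are stable under intersection and generate the Borel sets, so
    complements and disjoint countable unions suffice (Dynkin).\<close>
  have sets: "P (indicator A)" if "A \<in> sets borel" for A
  proof -
    have "Int_stable (Collect closed :: complex set set)" by (simp add: Int_stable_def closed_Int)
    moreover have "Collect closed \<subseteq> Pow (UNIV :: complex set)" by simp
    moreover have "A \<in> sigma_sets UNIV (Collect closed)" using that by (simp add: borel_eq_closed)
    ultimately show ?thesis
    proof (induction A rule: sigma_sets_induct_disjoint)
      case (compl A)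
      have A: "A \<in> sets borel" using compl by (simp add: borel_eq_closed)
      have "P (\<lambda>z. (-1) * indicator A z + z powi 0)"
        by (rule lin[OF bi[OF A] bdd_borel_powi compl(2) pow])
      also have "(\<lambda>z. (-1) * indicator A z + z powi 0) = (indicator (UNIV - A) :: complex \<Rightarrow> complex)"
        by (auto simp: indicator_def)
      finally show ?case .
    next
      case (union A)
      have A: "A i \<in> sets borel" for i using union by (auto simp: borel_eq_closed)
      have fin: "P (indicator (\<Union>i<n. A i))" for n
      proof (induction n)
        case (Suc n)
        have "P (\<lambda>z. indicator (\<Union>i<n. A i) z + indicator (A n) z)"
          using A union Suc by (intro padd[OF bi bi]) auto
        also have "(\<lambda>z. indicator (\<Union>i<n. A i) z + indicator (A n) z) = (indicator (\<Union>i<Suc n. A i) :: complex \<Rightarrow> complex)"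
        proof
          fix z
          have "z \<in> A i \<Longrightarrow> i < n \<Longrightarrow> z \<notin> A n" for i
            using union(1) unfolding disjoint_family_on_def by (metis UNIV_I disjoint_iff less_irrefl)
          then show "indicator (\<Union>i<n. A i) z + indicator (A n) z = (indicator (\<Union>i<Suc n. A i) z :: complex)"
            by (auto simp: indicator_def less_Suc_eq)
        qed
        finally show ?case .
      qed (simp only: lessThan_0 UN_empty2 UN_empty ind0 P0)
      show ?case
      proof (rule lim)
        show "P (indicator (\<Union>i<n. A i))" for n by (rule fin)
        show "bdd_borel (indicator (\<Union>i<n. A i)) 1" for n using A by (intro bi) auto
        show "bdd_borel (indicator (\<Union>i. A i)) 1" using A by (intro bi) auto
        show "(\<lambda>n. indicator (\<Union>i<n. A i) z) \<longlonglongrightarrow> (indicator (\<Union>i. A i) z :: complex)" for z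
          by (rule LIMSEQ_indicator_UN)
      qed
    qed (use closed in \<open>simp_all add: ind0 P0\<close>)
  qed
  have nonneg: "P (\<lambda>z. of_real (g z))" if g: "g \<in> borel_measurable borel" "\<And>z. 0 \<le> g z" "\<And>z. g z \<le> C"
    for g :: "complex \<Rightarrow> real" and C
  proof -
    have bd: "bdd_borel (\<lambda>z. of_real (u z)) D" if "u \<in> borel_measurable borel" "\<And>z. 0 \<le> u z" "\<And>z. u z \<le> D"
      for u :: "complex \<Rightarrow> real" and D using that by (auto simp: bdd_borel_def)
    \<comment> \<open>The bound is quantified inside the induction because the constituents of a
      function obey bounds of their own, such as \<open>C / c\<close> for a scalar multiple.\<close>
    have "\<forall>C. (\<forall>z. g z \<le> C) \<longrightarrow> P (\<lambda>z. of_real (g z))" using g(1,2)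
    proof (induction rule: borel_measurable_induct_real)
      case (set A)
      have "(\<lambda>z. of_real (indicator A z)) = (indicator A :: complex \<Rightarrow> complex)" by (auto simp: indicator_def)
      then show ?case using sets[OF set] by simp
    next
      case (mult u c)
      show ?case
      proof (intro allI impI)
        fix C assume C: "\<forall>z. c * u z \<le> C"
        show "P (\<lambda>z. of_real (c * u z))"
        proof (cases "c = 0")
          case False
          then have u: "u z \<le> C / c" for z using C mult by (simp add: field_simps)
          then show ?thesis using scale[OF bd, of u "C / c" "of_real c"] mult by auto
        qed (use P0 in simp)
      qed
    next
      case (add u v)
      show ?case
      proof (intro allI impI)
        fix C assume C: "\<forall>z. v z + u z \<le> C"
        have u: "u z \<le> C" and v: "v z \<le> C" for z
          using C[rule_format, of z] add(2)[of z] add(4)[of z] by linarith+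
        then have "P (\<lambda>z. of_real (v z) + of_real (u z))"
          using add u v by (intro padd[OF bd[of v C] bd[of u C]]) blast+
        then show "P (\<lambda>z. of_real (v z + u z))" by simp
      qed
    next
      case (seq U)
      show ?case
      proof (intro allI impI)
        fix C assume C: "\<forall>z. g z \<le> C"
        have U: "U i z \<le> C" for i z
        proof -
          have "U i z \<le> g z" using seq(3,4) by (intro incseq_le) (auto simp: incseq_def le_fun_def)
          then show ?thesis using C order_trans by blast
        qed
        show "P (\<lambda>z. of_real (g z))"
        proof (rule lim)
          show "P (\<lambda>z. of_real (U i z))" for i using seq(5) U by blast
          show "bdd_borel (\<lambda>z. of_real (U i z)) C" for i using seq(1,2) U by (intro bd) auto
          show "bdd_borel (\<lambda>z. of_real (g z)) C" using g(1,2) C by (intro bd) auto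
          show "(\<lambda>i. complex_of_real (U i z)) \<longlonglongrightarrow> of_real (g z)" for z
            using seq(4)[of z] by (intro tendsto_of_real) simp
        qed
      qed
    qed
    then show ?thesis using g(3) by blast
  qed
  \<comment> \<open>The reduction to nonnegative functions works with global bounds, so
    \<open>f\<close> is cut off outside the circle.\<close>
  define h where "h z = (if z \<in> unit_circle then f z else 0)" for z
  have C0: "0 \<le> C" using f by (rule bdd_borel_nonneg)
  have hm [measurable]: "h \<in> borel_measurable borel"
    unfolding h_def using bdd_borelD(1)[OF f] by (intro measurable_If_set) auto
  have hC: "cmod (h z) \<le> C" for z using bdd_borelD(2)[OF f, of z] C0 by (simp add: h_def)
  have RI: "\<bar>Re (h z)\<bar> \<le> C" "\<bar>Im (h z)\<bar> \<le> C" for z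
    using hC[of z] abs_Re_le_cmod[of "h z"] abs_Im_le_cmod[of "h z"] by linarith+
  have nn: "P (\<lambda>z. of_real (max 0 (g z))) \<and> bdd_borel (\<lambda>z. of_real (max 0 (g z))) C"
    if "g \<in> borel_measurable borel" "\<And>z. \<bar>g z\<bar> \<le> C" for g :: "complex \<Rightarrow> real"
  proof
    have le: "max 0 (g z) \<le> C" for z using that(2)[of z] C0 by auto
    show "P (\<lambda>z. of_real (max 0 (g z)))" using that(1) le by (intro nonneg[where C = C]) auto
    show "bdd_borel (\<lambda>z. of_real (max 0 (g z))) C" using that(1) le by (auto simp: bdd_borel_def)
  qed
  have re: "P (\<lambda>z. of_real (g z)) \<and> (\<exists>D. bdd_borel (\<lambda>z. of_real (g z)) D)"
    if g: "g \<in> borel_measurable borel" "\<And>z. \<bar>g z\<bar> \<le> C" for g :: "complex \<Rightarrow> real"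
  proof -
    have 1: "P (\<lambda>z. of_real (max 0 (g z)))" "bdd_borel (\<lambda>z. of_real (max 0 (g z))) C"
      using nn[of g] g by auto
    have 2: "P (\<lambda>z. of_real (max 0 (- g z)))" "bdd_borel (\<lambda>z. of_real (max 0 (- g z))) C"
      using nn[of "\<lambda>z. - g z"] g by auto
    have "(\<lambda>z. complex_of_real (g z)) = (\<lambda>z. (-1) * of_real (max 0 (- g z)) + of_real (max 0 (g z)))"
      by (auto simp: max_def complex_eq_iff)
    moreover have "P (\<lambda>z. (-1) * of_real (max 0 (- g z)) + of_real (max 0 (g z)))"
      using 1 2 by (intro lin)
    ultimately show ?thesis using bdd_borel_lin[OF 2(2) 1(2), of "-1"] by auto
  qed
  have "P (\<lambda>z. \<i> * of_real (Im (h z)) + of_real (Re (h z)))"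
  proof -
    have "P (\<lambda>z. of_real (Im (h z))) \<and> (\<exists>D. bdd_borel (\<lambda>z. of_real (Im (h z))) D)"
      "P (\<lambda>z. of_real (Re (h z))) \<and> (\<exists>D. bdd_borel (\<lambda>z. of_real (Re (h z))) D)"
      by (rule re, measurable, rule RI)+
    then show ?thesis using lin by blast
  qed
  also have "(\<lambda>z. \<i> * of_real (Im (h z)) + of_real (Re (h z))) = h"
    by (auto simp: complex_eq_iff)
  finally have "P h" .
  \<comment> \<open>The limit rule looks at the circle only, so the constant sequence
    \<open>h\<close> transfers the property to \<open>f\<close>, which may differ from
    \<open>h\<close> elsewhere.\<close>
  show ?thesis
  proof (rule lim)
    show "P h" by fact
    show "bdd_borel h C" using hC by (simp add: bdd_borel_def)
    show "(\<lambda>k. h z) \<longlonglongrightarrow> f z" if "z \<in> unit_circle" for z using that by (simp add: h_def)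
  qed (rule f)
qed

section \<open>Finite measures on the circle and their moments\<close>

definition circle_supported :: "complex measure \<Rightarrow> bool" where
  "circle_supported \<mu> \<longleftrightarrow> sets \<mu> = sets borel \<and> finite_measure \<mu> \<and> emeasure \<mu> (- unit_circle) = 0"

lemma circle_supportedD:
  assumes "circle_supported \<mu>"
  shows "sets \<mu> = sets borel" "finite_measure \<mu>" "space \<mu> = UNIV" "AE z in \<mu>. z \<in> unit_circle"
proof -
  show s: "sets \<mu> = sets borel" and "finite_measure \<mu>" using assms by (auto simp: circle_supported_def)
  show sp: "space \<mu> = UNIV" using sets_eq_imp_space_eq[OF s] by simp
  show "AE z in \<mu>. z \<in> unit_circle"
    using assms s sp by (intro AE_I[of _ _ "- unit_circle"]) (auto simp: circle_supported_def)
qed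

lemma circle_integrable:
  assumes mu: "circle_supported \<mu>" and f: "bdd_borel f C"
  shows "integrable \<mu> f" "cmod (\<integral>z. f z \<partial>\<mu>) \<le> C * measure \<mu> UNIV"
proof -
  interpret finite_measure \<mu> using mu by (rule circle_supportedD)
  have m: "f \<in> borel_measurable \<mu>"
    using bdd_borelD(1)[OF f] measurable_cong_sets[OF circle_supportedD(1)[OF mu] refl] by blast
  have ae: "AE z in \<mu>. cmod (f z) \<le> C"
    using circle_supportedD(4)[OF mu] by eventually_elim (rule bdd_borelD(2)[OF f])
  show i: "integrable \<mu> f" using ae m by (rule integrable_const_bound)
  have "cmod (\<integral>z. f z \<partial>\<mu>) \<le> (\<integral>z. cmod (f z) \<partial>\<mu>)" by (rule integral_norm_bound)
  also have "\<dots> \<le> (\<integral>z. C \<partial>\<mu>)" using i ae by (intro integral_mono_AE) auto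
  finally show "cmod (\<integral>z. f z \<partial>\<mu>) \<le> C * measure \<mu> UNIV"
    using circle_supportedD(3)[OF mu] by (simp add: mult.commute)
qed

lemma circle_integral_tendsto:
  assumes mu: "circle_supported \<mu>" and F: "\<And>k::nat. bdd_borel (F k) C" and f: "bdd_borel f C"
    and lim: "\<And>z. z \<in> unit_circle \<Longrightarrow> (\<lambda>k. F k z) \<longlonglongrightarrow> f z"
  shows "(\<lambda>k. \<integral>z. F k z \<partial>\<mu>) \<longlonglongrightarrow> (\<integral>z. f z \<partial>\<mu>)"
proof (rule integral_dominated_convergence[where w = "\<lambda>_. C"])
  interpret finite_measure \<mu> using mu by (rule circle_supportedD)
  show "f \<in> borel_measurable \<mu>" "\<And>k. F k \<in> borel_measurable \<mu>"
    using circle_integrable(1)[OF mu f] circle_integrable(1)[OF mu F] by auto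
  show "integrable \<mu> (\<lambda>_. C)" by simp
  show "AE z in \<mu>. (\<lambda>k. F k z) \<longlonglongrightarrow> f z"
    using circle_supportedD(4)[OF mu] by eventually_elim (rule lim)
  show "AE z in \<mu>. norm (F k z) \<le> C" for k
    using circle_supportedD(4)[OF mu] by eventually_elim (rule bdd_borelD(2)[OF F])
qed

lemma circle_integral_lin:
  assumes mu: "circle_supported \<mu>" and "bdd_borel f C" "bdd_borel g D"
  shows "(\<integral>z. a * f z + g z \<partial>\<mu>) = a * (\<integral>z. f z \<partial>\<mu>) + (\<integral>z. g z \<partial>\<mu>)"
  using circle_integrable(1)[OF mu assms(2)] circle_integrable(1)[OF mu assms(3)] by simp

lemma powi_cnj_circle:
  fixes z :: complex assumes "z \<in> unit_circle" shows "z powi (- k) = cnj (z powi k)"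
proof -
  have "cmod (z powi k) = 1" using assms by (simp add: norm_power_int)
  then show ?thesis by (simp add: power_int_minus inverse_unimodular)
qed

lemma circle_moment_minus:
  assumes mu: "circle_supported \<mu>"
  shows "(\<integral>z. z powi (- k) \<partial>\<mu>) = cnj (\<integral>z. z powi k \<partial>\<mu>)"
proof -
  have "(\<integral>z. z powi (- k) \<partial>\<mu>) = (\<integral>z. cnj (z powi k) \<partial>\<mu>)"
  proof (rule integral_cong_AE)
    show "AE z in \<mu>. z powi (- k) = cnj (z powi k)"
      using circle_supportedD(4)[OF mu] by eventually_elim (rule powi_cnj_circle)
    have "(\<lambda>z. z powi k) \<in> borel_measurable \<mu>" for k
      using circle_integrable(1)[OF mu bdd_borel_powi] by auto
    then show "(\<lambda>z. z powi (- k)) \<in> borel_measurable \<mu>" "(\<lambda>z. cnj (z powi k)) \<in> borel_measurable \<mu>"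
      using borel_measurable_cnj_comp by blast+
  qed
  also have "\<dots> = cnj (\<integral>z. z powi k \<partial>\<mu>)"
    using circle_integrable(1)[OF mu bdd_borel_powi] by (rule integral_bounded_linear[OF bounded_linear_cnj])
  finally show ?thesis .
qed

text \<open>Spectral measures are specified by nonnegative powers alone; on the circle negative
  powers are conjugates, so a hermitian sequence of moments is determined at all integers.\<close>

lemma circle_moments_int:
  assumes mu: "circle_supported \<mu>" and c: "\<And>n::nat. (\<integral>z. z ^ n \<partial>\<mu>) = c (int n)"
    and "\<And>k. c (- k) = cnj (c k)"
  shows "(\<integral>z. z powi k \<partial>\<mu>) = c k"
proof (cases k)
  case (nonneg n) then show ?thesis using c by simp
next
  case (neg n)
  then show ?thesis using circle_moment_minus[OF mu, of "int (Suc n)"] c[of "Suc n"] assms(3)[of "int (Suc n)"]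
    by (simp del: of_nat_Suc power_Suc)
qed

lemma circle_integral_indicator:
  assumes mu: "circle_supported \<mu>" and E: "E \<in> sets borel"
  shows "(\<integral>z. indicator E z \<partial>\<mu>) = complex_of_real (measure \<mu> E)"
proof -
  have "has_bochner_integral \<mu> (\<lambda>z. indicator E z *\<^sub>R (1::complex)) (measure \<mu> E *\<^sub>R 1)"
    using E circle_supportedD(1)[OF mu] finite_measure.emeasure_finite[OF circle_supportedD(2)[OF mu]]
    by (intro has_bochner_integral_indicator) (auto simp: less_top)
  moreover have "(\<lambda>z. indicator E z *\<^sub>R (1::complex)) = indicator E" by (auto simp: indicator_def)
  ultimately show ?thesis by (simp add: has_bochner_integral_integral_eq scaleR_conv_of_real)
qed

text \<open>Uniqueness in the trigonometric moment problem: the functions with equal integrals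
  contain all powers and are closed under linear combinations and bounded limits, so the induction
  principle reaches indicators.\<close>

lemma circle_measure_eqI:
  assumes mu: "circle_supported \<mu>" and nu: "circle_supported \<nu>"
    and m: "\<And>n::nat. (\<integral>z. z ^ n \<partial>\<mu>) = (\<integral>z. z ^ n \<partial>\<nu>)"
  shows "\<mu> = \<nu>"
proof (rule measure_eqI)
  show "sets \<mu> = sets \<nu>" using mu nu by (simp add: circle_supportedD)
  have k: "(\<integral>z. z powi k \<partial>\<mu>) = (\<integral>z. z powi k \<partial>\<nu>)" for k
    by (rule circle_moments_int[OF mu, where c = "\<lambda>k. \<integral>z. z powi k \<partial>\<nu>"])
      (use m circle_moment_minus[OF nu] in auto)
  fix A assume "A \<in> sets \<mu>"
  then have A: "A \<in> sets borel" using mu by (simp add: circle_supportedD)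
  have bA: "bdd_borel (indicator A) 1" using A by (auto simp: bdd_borel_def indicator_def)
  have eq: "(\<integral>z. f z \<partial>\<mu>) = (\<integral>z. f z \<partial>\<nu>)" if f: "bdd_borel f C" for f C
  proof (rule bounded_borel_circle_induct[where f = f])
    fix f g a C D assume "bdd_borel f C" "bdd_borel g D" "(\<integral>z. f z \<partial>\<mu>) = (\<integral>z. f z \<partial>\<nu>)" "(\<integral>z. g z \<partial>\<mu>) = (\<integral>z. g z \<partial>\<nu>)"
    then show "(\<integral>z. a * f z + g z \<partial>\<mu>) = (\<integral>z. a * f z + g z \<partial>\<nu>)"
      by (simp add: circle_integral_lin[OF mu] circle_integral_lin[OF nu])
  next
    fix F :: "nat \<Rightarrow> complex \<Rightarrow> complex" and f C
    assume F: "\<And>k. (\<integral>z. F k z \<partial>\<mu>) = (\<integral>z. F k z \<partial>\<nu>)" and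
      F': "\<And>k. bdd_borel (F k) C" "bdd_borel f C" "\<And>z. z \<in> unit_circle \<Longrightarrow> (\<lambda>k. F k z) \<longlonglongrightarrow> f z"
    from circle_integral_tendsto[OF mu F'] circle_integral_tendsto[OF nu F']
    show "(\<integral>z. f z \<partial>\<mu>) = (\<integral>z. f z \<partial>\<nu>)" unfolding F by (rule LIMSEQ_unique)
  qed (rule k, rule f)
  have "measure \<mu> A = measure \<nu> A"
    using eq[OF bA] unfolding circle_integral_indicator[OF mu A] circle_integral_indicator[OF nu A] by simp
  then show "emeasure \<mu> A = emeasure \<nu> A"
    using finite_measure.emeasure_eq_measure[OF circle_supportedD(2)[OF mu]]
      finite_measure.emeasure_eq_measure[OF circle_supportedD(2)[OF nu]] by simp
qed

section \<open>Unitary operators\<close>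

lemma unitary_opD:
  assumes "unitary_op (U :: 'h::chilbert oper)"
  shows "U \<in> bounded_ops" "adj U o\<^sub>L U = id_blinfun" "U o\<^sub>L adj U = id_blinfun"
    "adj U \<cdot> U \<cdot> x = x" "U \<cdot> adj U \<cdot> x = x"
proof -
  show *: "U \<in> bounded_ops" "adj U o\<^sub>L U = id_blinfun" "U o\<^sub>L adj U = id_blinfun"
    using assms by (auto simp: unitary_op_def)
  show "adj U \<cdot> U \<cdot> x = x" "U \<cdot> adj U \<cdot> x = x"
    using *(2,3) by (metis blinfun_apply_blinfun_compose id_blinfun.rep_eq id_apply)+
qed

lemma unitary_op_adj: "unitary_op U \<Longrightarrow> unitary_op (adj U)"
  by (auto simp: unitary_op_def)

lemma unitary_op_compose:
  assumes "unitary_op U" "unitary_op V" shows "unitary_op (U o\<^sub>L V)"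
  unfolding unitary_op_def
  using unitary_opD[OF assms(1)] unitary_opD[OF assms(2)]
  by (auto simp: adj_compose intro!: blinfun_eqI)

lemma unitary_op_id: "unitary_op id_blinfun"
  by (auto simp: unitary_op_def)

lemma unitary_cinner:
  "unitary_op U \<Longrightarrow> cinner (U \<cdot> x) (U \<cdot> y) = cinner x y"
  by (simp add: adj_props(2)[OF unitary_opD(1)] unitary_opD)

definition upow :: "'h::chilbert oper \<Rightarrow> int \<Rightarrow> 'h oper" where
  "upow v k = (if 0 \<le> k then (((o\<^sub>L) v) ^^ nat k) id_blinfun else (((o\<^sub>L) (adj v)) ^^ nat (- k)) id_blinfun)"

lemma upow_0 [simp]: "upow v 0 = id_blinfun" by (simp add: upow_def)

lemma upow_succ:
  assumes v: "unitary_op v" shows "upow v (k + 1) = v o\<^sub>L upow v k"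
proof (cases "0 \<le> k")
  case True
  then have "nat (k + 1) = Suc (nat k)" by simp
  then show ?thesis using True by (simp add: upow_def)
next
  case False
  then have "nat (- k) = Suc (nat (- (k + 1)))" by simp
  then have "upow v k = adj v o\<^sub>L upow v (k + 1)"
    using False by (cases "k = - 1") (auto simp: upow_def)
  then show ?thesis using v by (auto intro!: blinfun_eqI simp: unitary_opD)
qed

lemma upow_pred: "unitary_op v \<Longrightarrow> upow v (k - 1) = adj v o\<^sub>L upow v k"
  using upow_succ[of v "k - 1"] by (auto intro!: blinfun_eqI simp: unitary_opD)

lemma upow_1 [simp]: "unitary_op v \<Longrightarrow> upow v 1 = v"
  using upow_succ[of v 0] by simp

lemma upow_minus_1 [simp]: "unitary_op v \<Longrightarrow> upow v (- 1) = adj v"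
  using upow_pred[of v 0] by simp

lemma upow_induct [consumes 1, case_names zero succ pred]:
  assumes v: "unitary_op v" and "P 0 (id_blinfun :: 'h::chilbert oper)"
    and "\<And>k. P k (upow v k) \<Longrightarrow> P (k + 1) (v o\<^sub>L upow v k)"
    and "\<And>k. P k (upow v k) \<Longrightarrow> P (k - 1) (adj v o\<^sub>L upow v k)"
  shows "P k (upow v k)"
proof (induction k rule: int_induct[where k = 0])
  case base then show ?case using assms(2) by simp
next
  case (step1 i) then show ?case using assms(3) by (simp add: upow_succ[OF v])
next
  case (step2 i) then show ?case using assms(4) by (simp add: upow_pred[OF v])
qed

lemma upow_unitary: assumes v: "unitary_op v" shows "unitary_op (upow v k)"
  using v by (induction k rule: upow_induct) (auto intro: unitary_op_id unitary_op_compose unitary_op_adj v)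

lemma upow_bounded_ops: "unitary_op v \<Longrightarrow> upow v k \<in> bounded_ops"
  using upow_unitary unitary_opD by blast

lemma upow_add: "unitary_op v \<Longrightarrow> upow v (j + k) = upow v j o\<^sub>L upow v k"
proof (induction j rule: int_induct[where k = 0])
  case (step1 i)
  have eq: "i + 1 + k = i + k + 1" by simp
  show ?case unfolding eq using step1 upow_succ[of v "i + k"] upow_succ[of v i]
    by (auto intro!: blinfun_eqI)
next
  case (step2 i)
  have eq: "i - 1 + k = i + k - 1" by simp
  show ?case unfolding eq using step2 upow_pred[of v "i + k"] upow_pred[of v i]
    by (auto intro!: blinfun_eqI)
qed simp

lemma upow_apply_add:
  "unitary_op v \<Longrightarrow> (upow v j) \<cdot> upow v k \<cdot> x = (upow v (j + k)) \<cdot> x"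
  by (simp add: upow_add)

lemma adj_upow: assumes v: "unitary_op v" shows "adj (upow v k) = upow v (- k)"
proof (rule adj_unique)
  fix x y
  have "cinner (upow v k \<cdot> x) y
    = cinner (upow v (- k) \<cdot> upow v k \<cdot> x) (upow v (- k) \<cdot> y)"
    by (rule unitary_cinner[OF upow_unitary[OF v], symmetric])
  then show "cinner (upow v k \<cdot> x) y = cinner x (upow v (- k) \<cdot> y)"
    by (simp add: upow_apply_add[OF v])
qed

lemma upow_funpow: "unitary_op v \<Longrightarrow> (upow v (int n)) \<cdot> x = (blinfun_apply v ^^ n) x"
proof (induction n)
  case (Suc n)
  then show ?case using upow_succ[of v "int n"] by (simp add: add.commute)
qed simp

lemma upow_commutant:
  assumes v: "unitary_op v" and "v \<in> commutant S" "adj v \<in> commutant S"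
  shows "upow v k \<in> commutant S"
  using v by (induction k rule: upow_induct) (auto intro: commutant_algebra assms)

lemma (in factor_trace) upow_M: "unitary_op a \<Longrightarrow> a \<in> M \<Longrightarrow> upow a k \<in> M"
  using upow_commutant[of a "commutant M"] by (simp add: M_double_commutant)

lemma commutes_adj_unitary:
  assumes v: "unitary_op v" and c: "T o\<^sub>L v = v o\<^sub>L T" shows "T o\<^sub>L adj v = adj v o\<^sub>L T"
proof (rule blinfun_eqI)
  fix x
  have c': "T \<cdot> v \<cdot> y = v \<cdot> T \<cdot> y" for y
    using c by (metis blinfun_apply_blinfun_compose)
  have "adj v \<cdot> T \<cdot> v \<cdot> adj v \<cdot> x = T \<cdot> adj v \<cdot> x"
    unfolding c' using v by (simp add: unitary_opD)
  then show "(T o\<^sub>L adj v) \<cdot> x = (adj v o\<^sub>L T) \<cdot> x" using v by (simp add: unitary_opD)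
qed

section \<open>Spectral measures\<close>

definition circle_exp :: "real \<Rightarrow> complex" where
  "circle_exp t = exp (2 * of_real pi * \<i> * of_real t)"

lemma circle_exp_cis: "circle_exp t = cis (2 * pi * t)"
  by (simp add: circle_exp_def cis_conv_exp mult_ac)

lemma circle_exp_simps:
  "cmod (circle_exp t) = 1" "circle_exp (s + t) = circle_exp s * circle_exp t" "circle_exp 0 = 1"
  "cnj (circle_exp t) = circle_exp (- t)" "circle_exp t ^ n = circle_exp (real n * t)"
  by (simp_all add: circle_exp_cis cis_mult cis_cnj Complex.DeMoivre distrib_left mult_ac)

lemma circle_exp_powi: "circle_exp t powi k = circle_exp (of_int k * t)"
  by (simp add: circle_exp_cis cis_power_int mult_ac)

lemma circle_exp_continuous: "isCont circle_exp t"
  unfolding circle_exp_def by (intro continuous_intros)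

lemma circle_exp_measurable [measurable]: "circle_exp \<in> borel_measurable borel"
  by (intro borel_measurable_continuous_onI continuous_at_imp_continuous_on) (simp add: circle_exp_continuous)

lemma has_bochner_integral_circle_exp:
  "has_bochner_integral lborel (\<lambda>t. indicator {0..1} t *\<^sub>R circle_exp (of_int m * t)) (if m = 0 then 1 else 0)"
proof (cases "m = 0")
  case True
  have "has_bochner_integral lborel (\<lambda>t. indicator {0..1::real} t *\<^sub>R (1::complex)) (measure lborel {0..1::real} *\<^sub>R 1)"
    by (rule has_bochner_integral_indicator) auto
  then show ?thesis using True by (simp add: circle_exp_simps)
next
  case False
  define a where "a = 2 * of_real pi * \<i> * complex_of_int m"
  have a: "a \<noteq> 0" using False by (simp add: a_def)
  have e: "circle_exp (of_int m * t) = exp (of_real t * a)" for t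
    by (simp add: circle_exp_def a_def mult_ac)
  have "has_bochner_integral lborel (\<lambda>t. indicator {0..1} t *\<^sub>R exp (of_real t * a)) (exp (of_real 1 * a) / a - exp (of_real 0 * a) / a)"
  proof (rule has_bochner_integral_FTC_Icc)
    fix t :: real
    have "((\<lambda>t. exp (t * a) / a) has_field_derivative exp (of_real t * a)) (at (of_real t))"
      using a by (auto intro!: derivative_eq_intros)
    then have "((\<lambda>t. exp (of_real t * a) / a) has_vector_derivative exp (of_real t * a)) (at t)"
      by (rule has_vector_derivative_real_field)
    then show "((\<lambda>t. exp (of_real t * a) / a) has_vector_derivative exp (of_real t * a)) (at t within {0..1})"
      by (rule has_vector_derivative_at_within)
  qed (auto intro!: continuous_intros)
  moreover have "exp (of_real 1 * a) = 1"
  proof -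
    have "circle_exp 1 = 1" by (simp add: circle_exp_cis)
    then show ?thesis using circle_exp_powi[of 1 m] e[of 1] by simp
  qed
  ultimately show ?thesis using False by (simp add: e)
qed

text \<open>Herglotz: the densities are the Cesaro means \<open>N\<^sup>-\<^sup>1 \<parallel>\<Sum>\<^sub>j\<^sub><\<^sub>N z\<^sup>-\<^sup>j v\<^sup>j \<xi>\<parallel>\<^sup>2\<close> of the Fourier series with coefficients
  \<open>\<langle>v\<^sup>n \<xi>, \<xi>\<rangle>\<close>.\<close>

lemma spectral_measure_exists_unit:
  fixes v :: "'h::chilbert oper"
  assumes v: "unitary_op v" and xi: "norm \<xi> = 1"
  shows "\<exists>\<mu>. circle_supported \<mu> \<and> (\<forall>n::nat. (\<integral>z. z ^ n \<partial>\<mu>) = cinner (upow v (int n) \<cdot> \<xi>) \<xi>)"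
proof -
  define S where "S N t = (\<Sum>j<N. circle_exp (- (of_nat j * t)) *\<^sub>C (upow v (int j)) \<cdot> \<xi>)" for N :: nat and t
  define p where "p N t = indicator {0..1} t * ((norm (S N t))\<^sup>2 / real N)" for N t
  define A where "A n = cinner (upow v (int n) \<cdot> \<xi>) \<xi>" for n :: nat
  have p_nonneg: "0 \<le> p N t" for N t by (simp add: p_def)
  \<comment> \<open>Integration keeps the pairs with \<open>j = n + k\<close>; exactly
    \<open>N - n\<close> of them have both indices below \<open>N\<close>, which produces the Fejer
    weight. Truncated subtraction covers the case \<open>n > N\<close>.\<close>
  have has_int: "has_bochner_integral lborel (\<lambda>t. p N t *\<^sub>R circle_exp (real n * t)) (of_real (real (N - n) / real N) * A n)"
    for N n
  proof -
    define a where "a j k = cinner (upow v (int j) \<cdot> \<xi>) (upow v (int k) \<cdot> \<xi>)" for j k :: nat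
    have "of_real ((norm (S N t))\<^sup>2) = (\<Sum>k<N. \<Sum>j<N. a j k * circle_exp (of_int (int k - int j) * t))" for t
    proof -
      have "of_real ((norm (S N t))\<^sup>2) = cinner (S N t) (S N t)" by (simp add: cinner_self)
      also have "\<dots> = (\<Sum>k<N. \<Sum>j<N. circle_exp (- (of_nat j * t)) * cnj (circle_exp (- (of_nat k * t))) * a j k)"
        by (simp add: S_def cinner_sum_left cinner_sum_right cinner_scaleC_left cinner_scaleC_right a_def
            sum_distrib_left mult_ac)
      also have "\<dots> = (\<Sum>k<N. \<Sum>j<N. a j k * circle_exp (of_int (int k - int j) * t))"
        by (intro sum.cong refl) (simp add: circle_exp_simps(4) circle_exp_simps(2)[symmetric] algebra_simps)
      finally show ?thesis .
    qed
    then have eq: "p N t *\<^sub>R circle_exp (real n * t)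
      = (\<Sum>k<N. \<Sum>j<N. (a j k / of_nat N) * (indicator {0..1} t *\<^sub>R circle_exp (of_int (int n + int k - int j) * t)))" for t
    proof -
      have "p N t *\<^sub>R circle_exp (real n * t) = indicator {0..1} t *\<^sub>R (of_real ((norm (S N t))\<^sup>2) * circle_exp (real n * t)) / of_nat N"
        by (simp add: p_def scaleR_conv_of_real)
      also have "of_real ((norm (S N t))\<^sup>2) * circle_exp (real n * t) = (\<Sum>k<N. \<Sum>j<N. a j k * circle_exp (of_int (int n + int k - int j) * t))"
        unfolding \<open>\<And>t. of_real ((norm (S N t))\<^sup>2) = _ t\<close> sum_distrib_right
        by (intro sum.cong refl) (simp add: mult.assoc circle_exp_simps(2)[symmetric] algebra_simps)
      finally show ?thesis by (simp add: scaleR_sum_right sum_divide_distrib)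
    qed
    have "has_bochner_integral lborel (\<lambda>t. p N t *\<^sub>R circle_exp (real n * t))
      (\<Sum>k<N. \<Sum>j<N. (a j k / of_nat N) * (if int n + int k - int j = 0 then 1 else 0))"
      unfolding eq by (intro has_bochner_integral_sum has_bochner_integral_mult_right has_bochner_integral_circle_exp)
    moreover have "(\<Sum>k<N. \<Sum>j<N. (a j k / of_nat N) * (if int n + int k - int j = 0 then 1 else 0)) = of_real (real (N - n) / real N) * A n"
    proof -
      have "(\<Sum>j<N. (a j k / of_nat N) * (if int n + int k - int j = 0 then 1 else 0)) = (if k < N - n then A n / of_nat N else 0)"
        if "k < N" for k
      proof -
        have aA: "a (n + k) k = A n"
        proof -
          have "a (n + k) k = cinner (upow v (int k) \<cdot> upow v (int n) \<cdot> \<xi>) (upow v (int k) \<cdot> \<xi>)"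
            by (simp add: a_def upow_apply_add[OF v] add.commute)
          then show ?thesis by (simp add: unitary_cinner[OF upow_unitary[OF v]] A_def)
        qed
        have "(\<Sum>j<N. (a j k / of_nat N) * (if int n + int k - int j = 0 then 1 else 0)) = (\<Sum>j<N. if j = n + k then A n / of_nat N else 0)"
          by (intro sum.cong refl) (auto simp: aA)
        also have "\<dots> = (if k < N - n then A n / of_nat N else 0)" by (auto simp: sum.delta)
        finally show ?thesis .
      qed
      then have "(\<Sum>k<N. \<Sum>j<N. (a j k / of_nat N) * (if int n + int k - int j = 0 then 1 else 0)) = (\<Sum>k<N. if k < N - n then A n / of_nat N else 0)"
        by (intro sum.cong refl) auto
      also have "\<dots> = (\<Sum>k<N - n. A n / of_nat N)"
        by (rule sum.mono_neutral_cong_right) auto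
      finally show ?thesis by simp
    qed
    ultimately show ?thesis by simp
  qed
  have A0: "A 0 = 1" using xi by (simp add: A_def cinner_self)
  have p_meas [measurable]: "p N \<in> borel_measurable borel" for N
  proof -
    have "continuous_on UNIV (S N)"
      unfolding S_def
    proof (intro continuous_on_sum)
      fix j
      have bl: "bounded_linear (\<lambda>c. c *\<^sub>C (upow v (int j)) \<cdot> \<xi>)"
        by (rule bounded_linear_intro[of _ "norm (upow v (int j) \<cdot> \<xi>)"])
          (simp_all add: scaleC_add_left scaleR_conv_of_real scaleC_scaleC[symmetric] scaleC_of_real scaleC_scaleR mult.commute)
      have "continuous_on UNIV (\<lambda>t. circle_exp (- (of_nat j * t)))"
        unfolding circle_exp_def by (intro continuous_intros)
      then show "continuous_on UNIV (\<lambda>t. circle_exp (- (of_nat j * t)) *\<^sub>C (upow v (int j)) \<cdot> \<xi>)"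
        by (rule bounded_linear.continuous_on[OF bl])
    qed
    then have "continuous_on UNIV (\<lambda>t. (norm (S N t))\<^sup>2 / real N)"
      by (cases "N = 0") (auto intro!: continuous_intros)
    then have "(\<lambda>t. (norm (S N t))\<^sup>2 / real N) \<in> borel_measurable borel" by (rule borel_measurable_continuous_onI)
    then show ?thesis unfolding p_def by measurable
  qed
  \<comment> \<open>Shifted by one because \<open>p 0\<close> is zero by division by zero and hence
    not a probability density.\<close>
  define M where "M k = density lborel (\<lambda>t. ennreal (p (Suc k) t))" for k
  have M_int: "(\<integral>t. circle_exp (real n * t) \<partial>M k) = of_real (real (Suc k - n) / real (Suc k)) * A n" for k n
  proof -
    have "(\<integral>t. circle_exp (real n * t) \<partial>M k) = (\<integral>t. p (Suc k) t *\<^sub>R circle_exp (real n * t) \<partial>lborel)"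
      unfolding M_def by (rule integral_density) (auto simp: p_nonneg)
    then show ?thesis using has_int[of "Suc k" n] by (simp only: has_bochner_integral_integral_eq)
  qed
  have pint: "has_bochner_integral lborel (p (Suc k)) 1" for k
  proof -
    have "has_bochner_integral lborel (\<lambda>t. Re (p (Suc k) t *\<^sub>R circle_exp (real 0 * t))) (Re (of_real (real (Suc k - 0) / real (Suc k)) * A 0))"
      by (rule has_bochner_integral_bounded_linear[OF bounded_linear_Re has_int])
    then show ?thesis by (simp add: circle_exp_simps A0)
  qed
  have M_em: "emeasure (M k) B = (\<integral>\<^sup>+t. ennreal (p (Suc k) t) * indicator B t \<partial>lborel)" if "B \<in> sets borel" for k B
    unfolding M_def using that by (intro emeasure_density) auto
  have tot: "emeasure (M k) B = 1" if B: "B \<in> sets borel" "{0..1} \<subseteq> B" for k B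
  proof -
    have "emeasure (M k) B = (\<integral>\<^sup>+t. ennreal (p (Suc k) t) \<partial>lborel)"
      unfolding M_em[OF B(1)] using B(2) by (intro nn_integral_cong) (auto simp: p_def indicator_def)
    also have "\<dots> = 1"
      using pint[of k] p_nonneg by (subst nn_integral_eq_integral) (auto simp: has_bochner_integral_iff)
    finally show ?thesis .
  qed
  have rd: "real_distribution (M k)" for k
  proof -
    have "prob_space (M k)" by (rule prob_spaceI) (simp add: tot M_def[of k, THEN arg_cong[where f = space]] )
    then show ?thesis unfolding real_distribution_def real_distribution_axioms_def by (simp add: M_def)
  qed
  have "tight M"
    unfolding tight_def
  proof (intro conjI allI impI rd)
    fix e :: real assume e: "0 < e"
    \<comment> \<open>All mass sits on \<open>[0, 1]\<close>; the half-open interval starts at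
      \<open>-1\<close> so as to contain the endpoint 0.\<close>
    have "measure (M k) {-1<..1} = 1" for k
      using tot[of "{-1<..1}" k] by (simp add: measure_def subset_iff)
    then show "\<exists>a b. a < b \<and> (\<forall>n. 1 - e < measure (M n) {a<..b})"
      using e by (intro exI[of _ "-1"] exI[of _ 1]) auto
  qed
  \<comment> \<open>Helly selection on the real line. The integrals of the bounded continuous
    functions \<open>circle_exp (real n * t)\<close> converge along the subsequence, and only the
    limit measure is carried to the circle.\<close>
  then obtain r L where r: "strict_mono (r :: nat \<Rightarrow> nat)" "real_distribution L" "weak_conv_m (M \<circ> id \<circ> r) L"
    using tight_imp_convergent_subsubsequence[OF _ strict_mono_id] by blast
  interpret L: real_distribution L by fact
  have L_int: "(\<integral>t. circle_exp (real n * t) \<partial>L) = A n" for n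
  proof (rule LIMSEQ_unique)
    show "(\<lambda>k. \<integral>t. circle_exp (real n * t) \<partial>(M \<circ> id \<circ> r) k) \<longlonglongrightarrow> (\<integral>t. circle_exp (real n * t) \<partial>L)"
    proof (rule weak_conv_imp_integral_bdd_continuous_conv[OF _ r(2,3)])
      show "real_distribution ((M \<circ> id \<circ> r) k)" for k using rd by simp
      show "isCont (\<lambda>t. circle_exp (real n * t)) t" for t
        unfolding circle_exp_def by (intro continuous_intros)
      show "cmod (circle_exp (real n * t)) \<le> 1" for t by (simp add: circle_exp_simps)
    qed
    have "(\<lambda>k. real (Suc k - n) / real (Suc k)) \<longlonglongrightarrow> 1"
    proof (rule Lim_transform_eventually)
      show "(\<lambda>k. 1 - real n * inverse (real (Suc k))) \<longlonglongrightarrow> 1"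
        using tendsto_diff[OF tendsto_const[of 1] tendsto_mult[OF tendsto_const[of "real n"] LIMSEQ_inverse_real_of_nat]]
        by simp
      show "\<forall>\<^sub>F k in sequentially. 1 - real n * inverse (real (Suc k)) = real (Suc k - n) / real (Suc k)"
        using eventually_ge_at_top[of n] by eventually_elim (simp add: of_nat_diff field_simps)
    qed
    then have "(\<lambda>k. real (Suc (r k) - n) / real (Suc (r k))) \<longlonglongrightarrow> 1"
      using LIMSEQ_subseq_LIMSEQ[OF _ r(1)] by (fastforce simp: comp_def)
    then have "(\<lambda>k. of_real (real (Suc (r k) - n) / real (Suc (r k))) * A n) \<longlonglongrightarrow> of_real 1 * A n"
      by (intro tendsto_intros)
    then show "(\<lambda>k. \<integral>t. circle_exp (real n * t) \<partial>(M \<circ> id \<circ> r) k) \<longlonglongrightarrow> A n"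
      by (simp only: comp_def id_apply M_int) simp
  qed
  define \<mu> where "\<mu> = distr L borel circle_exp"
  have m: "circle_exp \<in> borel_measurable L" by simp
  show ?thesis
  proof (intro exI[of _ \<mu>] conjI allI)
    have "emeasure \<mu> (- unit_circle) = 0"
    proof -
      have "circle_exp -` (- unit_circle) \<inter> space L = {}" by (auto simp: circle_exp_simps)
      then show ?thesis unfolding \<mu>_def using m by (simp add: emeasure_distr)
    qed
    then show "circle_supported \<mu>"
      unfolding circle_supported_def \<mu>_def using m by (auto intro: L.finite_measure_distr)
    fix n :: nat
    have "(\<integral>z. z ^ n \<partial>\<mu>) = (\<integral>t. circle_exp t ^ n \<partial>L)" unfolding \<mu>_def using m by (intro integral_distr) auto
    also have "\<dots> = A n" using L_int[of n] by (simp add: circle_exp_simps)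
    finally show "(\<integral>z. z ^ n \<partial>\<mu>) = cinner (upow v (int n) \<cdot> \<xi>) \<xi>" by (simp add: A_def)
  qed
qed

lemma spectral_measure_exists:
  fixes v :: "'h::chilbert oper"
  assumes v: "unitary_op v"
  shows "\<exists>\<mu>. circle_supported \<mu> \<and> (\<forall>n::nat. (\<integral>z. z ^ n \<partial>\<mu>) = cinner (upow v (int n) \<cdot> \<xi>) \<xi>)"
proof (cases "\<xi> = 0")
  case True
  have "circle_supported (null_measure borel)"
    by (auto simp: circle_supported_def intro!: finite_measureI)
  then show ?thesis using True by (intro exI[of _ "null_measure borel"]) auto
next
  case False
  define \<eta> where "\<eta> = \<xi> /\<^sub>R norm \<xi>"
  have "norm \<eta> = 1" using False by (simp add: \<eta>_def)
  from spectral_measure_exists_unit[OF v this]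
  obtain \<mu> where mu: "circle_supported \<mu>" "\<And>n::nat. (\<integral>z. z ^ n \<partial>\<mu>) = cinner (upow v (int n) \<cdot> \<eta>) \<eta>"
    by blast
  define \<nu> where "\<nu> = density \<mu> (\<lambda>_. ennreal ((norm \<xi>)\<^sup>2))"
  interpret finite_measure \<mu> using mu(1) by (rule circle_supportedD)
  have em: "emeasure \<nu> B = ennreal ((norm \<xi>)\<^sup>2) * emeasure \<mu> B" if "B \<in> sets borel" for B
    unfolding \<nu>_def using that circle_supportedD(1)[OF mu(1)] by (intro emeasure_density_const) simp
  have sets: "sets \<nu> = sets borel" using circle_supportedD(1)[OF mu(1)] by (simp add: \<nu>_def)
  have "emeasure \<nu> UNIV \<noteq> \<infinity>" using em[of UNIV] emeasure_finite[of UNIV]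
    by (simp add: ennreal_mult_eq_top_iff)
  then have "finite_measure \<nu>" using sets_eq_imp_space_eq[OF sets] by (intro finite_measureI) auto
  moreover have "emeasure \<nu> (- unit_circle) = 0" using em[of "- unit_circle"] mu(1) by (simp add: circle_supported_def)
  ultimately have nu: "circle_supported \<nu>" using sets by (simp add: circle_supported_def)
  have "(\<integral>z. z ^ n \<partial>\<nu>) = cinner (upow v (int n) \<cdot> \<xi>) \<xi>" for n :: nat
  proof -
    have "(\<integral>z. z ^ n \<partial>\<nu>) = (\<integral>z. (norm \<xi>)\<^sup>2 *\<^sub>R z ^ n \<partial>\<mu>)"
      unfolding \<nu>_def using circle_supportedD(1)[OF mu(1)] by (intro integral_density) (auto cong: measurable_cong_sets)
    also have "\<dots> = of_real ((norm \<xi>)\<^sup>2) * cinner (upow v (int n) \<cdot> \<eta>) \<eta>"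
      by (simp add: mu(2) scaleR_conv_of_real)
    also have "\<dots> = cinner (upow v (int n) \<cdot> (norm \<xi> *\<^sub>R \<eta>)) (norm \<xi> *\<^sub>R \<eta>)"
      by (simp add: blinfun.scaleR_right cinner_scaleR_left cinner_scaleR_right power2_eq_square)
    also have "norm \<xi> *\<^sub>R \<eta> = \<xi>" using False by (simp add: \<eta>_def)
    finally show ?thesis .
  qed
  then show ?thesis using nu by blast
qed

lemma spectral_measure_props:
  fixes v :: "'h::chilbert oper"
  assumes v: "unitary_op v"
  shows "circle_supported (spectral_measure v \<xi>)"
    and "(\<integral>z. z powi k \<partial>spectral_measure v \<xi>) = cinner (upow v k \<cdot> \<xi>) \<xi>"
proof -
  obtain \<mu> where mu: "circle_supported \<mu>" "\<And>n::nat. (\<integral>z. z ^ n \<partial>\<mu>) = cinner (upow v (int n) \<cdot> \<xi>) \<xi>"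
    using spectral_measure_exists[OF v] by blast
  have "spectral_measure v \<xi> = \<mu>"
    unfolding spectral_measure_def
  proof (rule the_equality)
    show "sets \<mu> = sets borel \<and> finite_measure \<mu> \<and> emeasure \<mu> (- sphere 0 1) = 0 \<and>
      (\<forall>n::nat. (\<integral>z. z ^ n \<partial>\<mu>) = cinner ((blinfun_apply v ^^ n) \<xi>) \<xi>)"
      using mu by (simp add: circle_supported_def upow_funpow[OF v])
    fix \<nu> :: "complex measure"
    assume "sets \<nu> = sets borel \<and> finite_measure \<nu> \<and> emeasure \<nu> (- sphere 0 1) = 0 \<and>
      (\<forall>n::nat. (\<integral>z. z ^ n \<partial>\<nu>) = cinner ((blinfun_apply v ^^ n) \<xi>) \<xi>)"
    then show "\<nu> = \<mu>"
      using mu by (intro circle_measure_eqI) (auto simp: circle_supported_def upow_funpow[OF v])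
  qed
  then show c: "circle_supported (spectral_measure v \<xi>)" using mu by simp
  show "(\<integral>z. z powi k \<partial>spectral_measure v \<xi>) = cinner (upow v k \<cdot> \<xi>) \<xi>"
  proof (rule circle_moments_int[OF c])
    show "(\<integral>z. z ^ n \<partial>spectral_measure v \<xi>) = cinner (upow v (int n) \<cdot> \<xi>) \<xi>" for n
      using mu(2) \<open>spectral_measure v \<xi> = \<mu>\<close> by simp
    show "cinner (upow v (- k) \<cdot> \<xi>) \<xi> = cnj (cinner (upow v k \<cdot> \<xi>) \<xi>)" for k
      unfolding adj_upow[OF v, symmetric] by (metis cinner_adj_left cinner_commute upow_bounded_ops[OF v])
  qed
qed

text \<open>\<open>u\<close> is an arbitrary map because only its relation to \<open>v\<close>
  enters; so the lemma serves for operators and for their powers, with the two unitaries in either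
  role.\<close>

lemma upow_scaled_commute:
  fixes v :: "'h::chilbert oper"
  assumes v: "unitary_op v" and l0: "l \<noteq> 0"
    and vu: "\<And>x. v \<cdot> (u x) = l *\<^sub>C u (v \<cdot> x)"
  shows "upow v k \<cdot> (u x) = (l powi k) *\<^sub>C u (upow v k \<cdot> x)"
proof -
  note vb = unitary_opD(1)[OF v]
  have vu': "adj v \<cdot> (u x) = inverse l *\<^sub>C u (adj v \<cdot> x)" for x
  proof -
    have "adj v \<cdot> v \<cdot> (u ((adj v) \<cdot> x)) = l *\<^sub>C (adj v) \<cdot> (u x)"
      unfolding vu by (simp add: bounded_opsD[OF adj_closed[OF vb]] unitary_opD[OF v])
    then show ?thesis using l0 by (simp add: unitary_opD[OF v] scaleC_scaleC)
  qed
  show ?thesis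
  proof (induction k rule: int_induct[where k = 0])
    case (step1 i)
    then show ?case using l0
      by (simp add: upow_succ[OF v] bounded_opsD[OF vb] vu scaleC_scaleC power_int_add mult.commute)
  next
    case (step2 i)
    then show ?case using l0
      by (simp add: upow_pred[OF v] bounded_opsD[OF adj_closed[OF vb]] vu' scaleC_scaleC power_int_diff field_simps)
  qed simp
qed

section \<open>The Borel functional calculus of a unitary\<close>

locale unitary_calculus =
  fixes v :: "'h::chilbert oper"
  assumes v: "unitary_op v"
begin

abbreviation spm :: "'h \<Rightarrow> complex measure" where "spm \<equiv> spectral_measure v"

abbreviation calc :: "(complex \<Rightarrow> complex) \<Rightarrow> 'h oper" where "calc f \<equiv> borel_calculus f v"

lemmas spm_supported = spectral_measure_props(1)[OF v]

lemma measure_spm_UNIV: "measure (spm \<xi>) UNIV = (norm \<xi>)\<^sup>2"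
proof -
  interpret finite_measure "spm \<xi>" using circle_supportedD(2)[OF spm_supported] .
  have "complex_of_real (measure (spm \<xi>) UNIV) = (\<integral>z. z powi 0 \<partial>spm \<xi>)"
    using circle_supportedD(3)[OF spm_supported] by (simp add: scaleR_conv_of_real)
  also have "\<dots> = of_real ((norm \<xi>)\<^sup>2)" unfolding spectral_measure_props(2)[OF v] by (simp add: cinner_self)
  finally show ?thesis using of_real_eq_iff by blast
qed

lemma calc_form_bound: "bdd_borel f C \<Longrightarrow> cmod (\<integral>z. f z \<partial>spm \<xi>) \<le> C * (norm \<xi>)\<^sup>2"
  using circle_integrable(2)[OF spm_supported, of f C \<xi>] by (simp add: measure_spm_UNIV)

lemma spm_integral_lin:
  "bdd_borel f C \<Longrightarrow> bdd_borel g D \<Longrightarrow> (\<integral>z. a * f z + g z \<partial>spm \<xi>) = a * (\<integral>z. f z \<partial>spm \<xi>) + (\<integral>z. g z \<partial>spm \<xi>)"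
  by (rule circle_integral_lin[OF spm_supported])

lemma upow_double_commutant: "upow v k \<in> commutant (commutant {v})"
proof (rule upow_commutant[OF v])
  show "v \<in> commutant (commutant {v})" using double_commutant_subset[of "{v}"] unitary_opD(1)[OF v] by auto
  show "adj v \<in> commutant (commutant {v})"
  proof (rule commutantI)
    fix T assume "T \<in> commutant {v}"
    then have "T o\<^sub>L v = v o\<^sub>L T" by (rule commutantD(2)) simp
    from commutes_adj_unitary[OF v this] show "adj v o\<^sub>L T = T o\<^sub>L adj v" ..
  qed (simp add: unitary_opD(1)[OF v])
qed

text \<open>The calculus is built by the induction principle: uniformly bounded operators with
  convergent quadratic forms have a weak limit, and membership in the double commutant survives
  it.\<close>

lemma calc_exists:
  assumes f: "bdd_borel f C"
  shows "\<exists>T\<in>commutant (commutant {v}). \<forall>\<xi>. cinner (T \<cdot> \<xi>) \<xi> = (\<integral>z. f z \<partial>spm \<xi>)"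
proof (rule bounded_borel_circle_induct[where f = f])
  show "\<exists>T\<in>commutant (commutant {v}). \<forall>\<xi>. cinner (T \<cdot> \<xi>) \<xi> = (\<integral>z. z powi k \<partial>spm \<xi>)" for k
    using upow_double_commutant spectral_measure_props(2)[OF v] by metis
next
  fix f g a C D
  assume fg: "bdd_borel f C" "bdd_borel g D"
  assume "\<exists>T\<in>commutant (commutant {v}). \<forall>\<xi>. cinner (T \<cdot> \<xi>) \<xi> = (\<integral>z. f z \<partial>spm \<xi>)"
    and "\<exists>T\<in>commutant (commutant {v}). \<forall>\<xi>. cinner (T \<cdot> \<xi>) \<xi> = (\<integral>z. g z \<partial>spm \<xi>)"
  then obtain S T where ST: "S \<in> commutant (commutant {v})" "T \<in> commutant (commutant {v})"
    "\<And>\<xi>. cinner (S \<cdot> \<xi>) \<xi> = (\<integral>z. f z \<partial>spm \<xi>)"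
    "\<And>\<xi>. cinner (T \<cdot> \<xi>) \<xi> = (\<integral>z. g z \<partial>spm \<xi>)" by blast
  show "\<exists>T\<in>commutant (commutant {v}). \<forall>\<xi>. cinner (T \<cdot> \<xi>) \<xi> = (\<integral>z. a * f z + g z \<partial>spm \<xi>)"
  proof (intro bexI[of _ "(scalar_op a o\<^sub>L S) + T"] allI)
    show "(scalar_op a o\<^sub>L S) + T \<in> commutant (commutant {v})"
      using ST by (intro commutant_algebra commutant_bounded_ops)
    show "cinner (((scalar_op a o\<^sub>L S) + T) \<cdot> \<xi>) \<xi> = (\<integral>z. a * f z + g z \<partial>spm \<xi>)" for \<xi>
      by (simp add: blinfun.add_left cinner_add_left cinner_scaleC_left ST spm_integral_lin[OF fg])
  qed
next
  fix F :: "nat \<Rightarrow> complex \<Rightarrow> complex" and f C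
  assume "\<And>k. \<exists>T\<in>commutant (commutant {v}). \<forall>\<xi>. cinner (T \<cdot> \<xi>) \<xi> = (\<integral>z. F k z \<partial>spm \<xi>)"
  then obtain T where T: "\<And>k. T k \<in> commutant (commutant {v})"
    "\<And>k \<xi>. cinner (T k \<cdot> \<xi>) \<xi> = (\<integral>z. F k z \<partial>spm \<xi>)" by metis
  assume F: "\<And>k. bdd_borel (F k) C" "bdd_borel f C" "\<And>z. z \<in> unit_circle \<Longrightarrow> (\<lambda>k. F k z) \<longlonglongrightarrow> f z"
  have Tb: "T k \<in> bounded_ops" for k using T(1) commutant_bounded_ops by blast
  have "norm (T k) \<le> 4 * C" for k
    by (rule norm_oper_quadratic_bound[OF Tb bdd_borel_nonneg[OF F(2)]]) (simp add: T calc_form_bound F)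
  moreover have "(\<lambda>k. cinner (T k \<cdot> \<xi>) \<xi>) \<longlonglongrightarrow> (\<integral>z. f z \<partial>spm \<xi>)" for \<xi>
    unfolding T(2) by (rule circle_integral_tendsto[OF spm_supported F])
  ultimately have "\<exists>S\<in>bounded_ops. norm S \<le> 4 * C \<and> (\<forall>x. cinner (S \<cdot> x) x = (\<integral>z. f z \<partial>spm x)) \<and>
    (\<forall>x y. (\<lambda>k. cinner (T k \<cdot> x) y) \<longlonglongrightarrow> cinner (S \<cdot> x) y)"
    by (intro weak_limit_operator Tb)
  then obtain S where S: "S \<in> bounded_ops" "\<And>x. cinner (S \<cdot> x) x = (\<integral>z. f z \<partial>spm x)"
    "\<And>x y. (\<lambda>k. cinner (T k \<cdot> x) y) \<longlonglongrightarrow> cinner (S \<cdot> x) y" by blast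
  have "S \<in> commutant (commutant {v})"
    by (rule weak_limit_commutant[OF T(1) commutant_bounded_ops S(1,3)])
  then show "\<exists>T\<in>commutant (commutant {v}). \<forall>\<xi>. cinner (T \<cdot> \<xi>) \<xi> = (\<integral>z. f z \<partial>spm \<xi>)"
    using S by blast
qed (rule f)

lemma calc_eqI:
  assumes "T \<in> bounded_ops" "\<And>\<xi>. cinner (T \<cdot> \<xi>) \<xi> = (\<integral>z. f z \<partial>spm \<xi>)"
  shows "calc f = T"
  unfolding borel_calculus_def
proof (rule the_equality)
  fix S assume "S \<in> bounded_ops \<and> (\<forall>\<xi>. cinner (S \<cdot> \<xi>) \<xi> = (\<integral>z. f z \<partial>spm \<xi>))"
  then show "S = T" using assms by (intro oper_eqI_quadratic) auto
qed (use assms in auto)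

lemma calc_double_commutant: "bdd_borel f C \<Longrightarrow> calc f \<in> commutant (commutant {v})"
  and calc_quadratic: "bdd_borel f C \<Longrightarrow> cinner (calc f \<cdot> \<xi>) \<xi> = (\<integral>z. f z \<partial>spm \<xi>)"
proof -
  assume "bdd_borel f C"
  then obtain T where T: "T \<in> commutant (commutant {v})"
    "\<And>\<xi>. cinner (T \<cdot> \<xi>) \<xi> = (\<integral>z. f z \<partial>spm \<xi>)" using calc_exists by blast
  have "calc f = T" using T commutant_bounded_ops by (intro calc_eqI) auto
  with T show "calc f \<in> commutant (commutant {v})"
    "cinner (calc f \<cdot> \<xi>) \<xi> = (\<integral>z. f z \<partial>spm \<xi>)" by auto
qed

lemma calc_bounded_ops: "bdd_borel f C \<Longrightarrow> calc f \<in> bounded_ops"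
  using calc_double_commutant commutant_bounded_ops by blast

lemma calc_norm_le: "bdd_borel f C \<Longrightarrow> norm (calc f) \<le> 4 * C"
  using norm_oper_quadratic_bound[OF calc_bounded_ops bdd_borel_nonneg] calc_form_bound calc_quadratic by metis

lemma calc_tendsto:
  assumes F: "\<And>k::nat. bdd_borel (F k) C" "bdd_borel f C" "\<And>z. z \<in> unit_circle \<Longrightarrow> (\<lambda>k. F k z) \<longlonglongrightarrow> f z"
  shows "(\<lambda>k. cinner (calc (F k) \<cdot> x) y) \<longlonglongrightarrow> cinner (calc f \<cdot> x) y"
proof -
  have q: "(\<lambda>k. cinner (calc (F k) \<cdot> \<xi>) \<xi>) \<longlonglongrightarrow> cinner (calc f \<cdot> \<xi>) \<xi>" for \<xi>
    unfolding calc_quadratic[OF F(1)] calc_quadratic[OF F(2)]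
    by (rule circle_integral_tendsto[OF spm_supported F])
  show ?thesis
    unfolding cinner_polarization[OF calc_bounded_ops[OF F(1)], of _ x y]
      cinner_polarization[OF calc_bounded_ops[OF F(2)], of x y]
    by (intro tendsto_intros q) simp
qed

lemma calc_commute:
  assumes f: "bdd_borel f C" and T: "T \<in> bounded_ops" "T o\<^sub>L v = v o\<^sub>L T"
  shows "calc f o\<^sub>L T = T o\<^sub>L calc f"
  by (rule commutantD(2)[OF calc_double_commutant[OF f]]) (use T in \<open>auto intro: commutantI\<close>)

lemma calc_powi: "calc (\<lambda>z. z powi k) = upow v k"
  by (rule calc_eqI) (simp_all add: upow_bounded_ops[OF v] spectral_measure_props(2)[OF v])

lemma calc_lin:
  assumes "bdd_borel f C" "bdd_borel g D"
  shows "calc (\<lambda>z. a * f z + g z) = (scalar_op a o\<^sub>L calc f) + calc g"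
proof (rule calc_eqI)
  show "(scalar_op a o\<^sub>L calc f) + calc g \<in> bounded_ops"
    using calc_bounded_ops[OF assms(1)] calc_bounded_ops[OF assms(2)] by auto
  show "cinner (((scalar_op a o\<^sub>L calc f) + calc g) \<cdot> \<xi>) \<xi> = (\<integral>z. a * f z + g z \<partial>spm \<xi>)" for \<xi>
    by (simp add: blinfun.add_left cinner_add_left cinner_scaleC_left calc_quadratic[OF assms(1)]
        calc_quadratic[OF assms(2)] spm_integral_lin[OF assms])
qed

lemma bdd_borel_const: "bdd_borel (\<lambda>z. c) (cmod c)"
  by (simp add: bdd_borel_def)

lemma calc_const: "calc (\<lambda>z. c) = scalar_op c"
proof (rule calc_eqI)
  interpret finite_measure "spm \<xi>" for \<xi> using circle_supportedD(2)[OF spm_supported] .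
  show "cinner (scalar_op c \<cdot> \<xi>) \<xi> = (\<integral>z. c \<partial>spm \<xi>)" for \<xi>
    using circle_supportedD(3)[OF spm_supported] measure_spm_UNIV
    by (simp add: cinner_scaleC_left cinner_self scaleR_conv_of_real mult.commute)
qed simp

lemma calc_adj:
  assumes f: "bdd_borel f C" shows "adj (calc f) = calc (\<lambda>z. cnj (f z))"
proof (rule calc_eqI[symmetric])
  show "adj (calc f) \<in> bounded_ops" using calc_bounded_ops[OF f] by simp
  show "cinner (adj (calc f) \<cdot> \<xi>) \<xi> = (\<integral>z. cnj (f z) \<partial>spm \<xi>)" for \<xi>
  proof -
    have "(\<integral>z. cnj (f z) \<partial>spm \<xi>) = cnj (cinner (calc f \<cdot> \<xi>) \<xi>)"
      unfolding calc_quadratic[OF f] by simp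
    then show ?thesis
      unfolding cinner_adj_left[OF calc_bounded_ops[OF f]] using cinner_commute by metis
  qed
qed

lemma oper_eqI_weak_limit:
  assumes "\<And>x y. (\<lambda>k. cinner (T k \<cdot> x) y) \<longlonglongrightarrow> cinner (A \<cdot> x) y"
    and "\<And>x y. (\<lambda>k. cinner (T k \<cdot> x) y) \<longlonglongrightarrow> cinner ((B :: 'h oper) \<cdot> x) y"
  shows "A = B"
  by (rule blinfun_eqI, rule cinner_ext_left) (rule LIMSEQ_unique[OF assms])

text \<open>Multiplicativity is invisible in the quadratic forms. For powers it is the addition of
  exponents; from there it is extended in one factor at a time, first in \<open>g\<close> and then
  in \<open>f\<close>.\<close>

lemma calc_mult:
  assumes f: "bdd_borel f C" and g: "bdd_borel g D"
  shows "calc (\<lambda>z. f z * g z) = calc f o\<^sub>L calc g"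
proof -
  have step: "calc (\<lambda>z. z powi k * g z) = upow v k o\<^sub>L calc g" if g: "bdd_borel g D" for g D k
  proof (rule bounded_borel_circle_induct[where f = g])
    fix j
    have "calc (\<lambda>z. z powi k * z powi j) = upow v (k + j)"
    proof (rule calc_eqI)
      fix \<xi>
      have "(\<integral>z. z powi k * z powi j \<partial>spm \<xi>) = (\<integral>z. z powi (k + j) \<partial>spm \<xi>)"
      proof (rule integral_cong_AE)
        show "AE z in spm \<xi>. z powi k * z powi j = z powi (k + j)"
          using circle_supportedD(4)[OF spm_supported[of \<xi>]] by eventually_elim (subst power_int_add, auto)
      qed (use circle_integrable(1)[OF spm_supported bdd_borel_powi] in \<open>auto intro!: borel_measurable_times\<close>)
      then show "cinner ((upow v (k + j)) \<cdot> \<xi>) \<xi> = (\<integral>z. z powi k * z powi j \<partial>spm \<xi>)"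
        by (simp add: spectral_measure_props(2)[OF v])
    qed (rule upow_bounded_ops[OF v])
    then show "calc (\<lambda>z. z powi k * z powi j) = upow v k o\<^sub>L calc (\<lambda>z. z powi j)"
      by (simp add: calc_powi upow_add[OF v])
  next
    fix f g a C D
    assume fg: "bdd_borel f C" "bdd_borel g D"
    assume *: "calc (\<lambda>z. z powi k * f z) = upow v k o\<^sub>L calc f" "calc (\<lambda>z. z powi k * g z) = upow v k o\<^sub>L calc g"
    have "calc (\<lambda>z. a * (z powi k * f z) + z powi k * g z) = (scalar_op a o\<^sub>L (upow v k o\<^sub>L calc f)) + (upow v k o\<^sub>L calc g)"
      unfolding *[symmetric] by (rule calc_lin[OF bdd_borel_mult[OF bdd_borel_powi fg(1)] bdd_borel_mult[OF bdd_borel_powi fg(2)]])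
    also have "\<dots> = upow v k o\<^sub>L calc (\<lambda>z. a * f z + g z)"
      unfolding calc_lin[OF fg] using bounded_opsD[OF upow_bounded_ops[OF v]]
      by (intro blinfun_eqI) (simp add: blinfun.add_left blinfun.add_right)
    finally show "calc (\<lambda>z. z powi k * (a * f z + g z)) = upow v k o\<^sub>L calc (\<lambda>z. a * f z + g z)"
      by (simp add: algebra_simps)
  next
    fix F :: "nat \<Rightarrow> complex \<Rightarrow> complex" and f C
    assume IH: "\<And>j. calc (\<lambda>z. z powi k * F j z) = upow v k o\<^sub>L calc (F j)"
    assume F: "\<And>k. bdd_borel (F k) C" "bdd_borel f C" "\<And>z. z \<in> unit_circle \<Longrightarrow> (\<lambda>k. F k z) \<longlonglongrightarrow> f z"
    show "calc (\<lambda>z. z powi k * f z) = upow v k o\<^sub>L calc f"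
    proof (rule oper_eqI_weak_limit)
      show "(\<lambda>j. cinner ((calc (\<lambda>z. z powi k * F j z)) \<cdot> x) y) \<longlonglongrightarrow> cinner ((calc (\<lambda>z. z powi k * f z)) \<cdot> x) y" for x y
        by (rule calc_tendsto) (auto intro!: bdd_borel_mult[OF bdd_borel_powi F(1)] bdd_borel_mult[OF bdd_borel_powi F(2)] tendsto_intros F(3))
      show "(\<lambda>j. cinner ((calc (\<lambda>z. z powi k * F j z)) \<cdot> x) y) \<longlonglongrightarrow> cinner ((upow v k o\<^sub>L calc f) \<cdot> x) y" for x y
        unfolding IH using calc_tendsto[OF F, of x "adj (upow v k) \<cdot> y"]
        by (simp add: cinner_adj_right upow_bounded_ops[OF v])
    qed
  qed (rule g)
  show ?thesis
  proof (rule bounded_borel_circle_induct[where f = f])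
    show "calc (\<lambda>z. z powi k * g z) = calc (\<lambda>z. z powi k) o\<^sub>L calc g" for k
      unfolding calc_powi by (rule step[OF g])
  next
    fix f1 f2 a C1 C2
    assume fg: "bdd_borel f1 C1" "bdd_borel f2 C2"
    assume *: "calc (\<lambda>z. f1 z * g z) = calc f1 o\<^sub>L calc g" "calc (\<lambda>z. f2 z * g z) = calc f2 o\<^sub>L calc g"
    have "calc (\<lambda>z. a * (f1 z * g z) + f2 z * g z) = (scalar_op a o\<^sub>L (calc f1 o\<^sub>L calc g)) + (calc f2 o\<^sub>L calc g)"
      unfolding *[symmetric] by (rule calc_lin[OF bdd_borel_mult[OF fg(1) g] bdd_borel_mult[OF fg(2) g]])
    also have "\<dots> = calc (\<lambda>z. a * f1 z + f2 z) o\<^sub>L calc g"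
      unfolding calc_lin[OF fg] by (intro blinfun_eqI) (simp add: blinfun.add_left)
    finally show "calc (\<lambda>z. (a * f1 z + f2 z) * g z) = calc (\<lambda>z. a * f1 z + f2 z) o\<^sub>L calc g"
      by (simp add: algebra_simps)
  next
    fix F :: "nat \<Rightarrow> complex \<Rightarrow> complex" and f C
    assume IH: "\<And>j. calc (\<lambda>z. F j z * g z) = calc (F j) o\<^sub>L calc g"
    assume F: "\<And>k. bdd_borel (F k) C" "bdd_borel f C" "\<And>z. z \<in> unit_circle \<Longrightarrow> (\<lambda>k. F k z) \<longlonglongrightarrow> f z"
    show "calc (\<lambda>z. f z * g z) = calc f o\<^sub>L calc g"
    proof (rule oper_eqI_weak_limit)
      show "(\<lambda>j. cinner ((calc (\<lambda>z. F j z * g z)) \<cdot> x) y) \<longlonglongrightarrow> cinner ((calc (\<lambda>z. f z * g z)) \<cdot> x) y" for x y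
        by (rule calc_tendsto) (auto intro!: bdd_borel_mult[OF F(1) g] bdd_borel_mult[OF F(2) g] tendsto_intros F(3))
      show "(\<lambda>j. cinner ((calc (\<lambda>z. F j z * g z)) \<cdot> x) y) \<longlonglongrightarrow> cinner ((calc f o\<^sub>L calc g) \<cdot> x) y" for x y
        unfolding IH using calc_tendsto[OF F, of "calc g \<cdot> x" y] by simp
    qed
  qed (rule f)
qed

lemma calc_cong_AE:
  assumes "f \<in> borel_measurable borel" "g \<in> borel_measurable borel" "\<And>\<xi>. AE z in spm \<xi>. f z = g z"
  shows "calc f = calc g"
proof -
  have m: "h \<in> borel_measurable (spm \<xi>)" if "h \<in> borel_measurable borel" for h :: "complex \<Rightarrow> complex" and \<xi>
    using that measurable_cong_sets[OF circle_supportedD(1)[OF spm_supported] refl] by blast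
  have "(\<integral>z. f z \<partial>spm \<xi>) = (\<integral>z. g z \<partial>spm \<xi>)" for \<xi>
    by (rule integral_cong_AE[OF m[OF assms(1)] m[OF assms(2)] assms(3)])
  then show ?thesis by (simp add: borel_calculus_def)
qed

lemma calc_norm_sq:
  assumes f: "bdd_borel f C"
  shows "cinner (calc f \<cdot> \<xi>) (calc f \<cdot> \<xi>) = (\<integral>z. of_real ((cmod (f z))\<^sup>2) \<partial>spm \<xi>)"
proof -
  have "cinner (calc f \<cdot> \<xi>) (calc f \<cdot> \<xi>) = cinner ((calc (\<lambda>z. cnj (f z)) o\<^sub>L calc f) \<cdot> \<xi>) \<xi>"
    unfolding calc_adj[OF f, symmetric] by (simp add: cinner_adj_left calc_bounded_ops[OF f])
  also have "\<dots> = (\<integral>z. cnj (f z) * f z \<partial>spm \<xi>)"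
    unfolding calc_mult[OF bdd_borel_cnj[OF f] f, symmetric]
    by (rule calc_quadratic[OF bdd_borel_mult[OF bdd_borel_cnj[OF f] f]])
  also have "(\<lambda>z. cnj (f z) * f z) = (\<lambda>z. of_real ((cmod (f z))\<^sup>2))"
    unfolding complex_norm_square by (simp add: mult.commute)
  finally show ?thesis .
qed

text \<open>The squared norm of \<open>f(v) \<xi>\<close> is the integral of \<open>|f|^2\<close>
  for the spectral measure of \<open>\<xi>\<close>, so kernels of functions of \<open>v\<close> can
  be read off from zero sets.\<close>

lemma calc_apply_eq_0D:
  assumes f: "bdd_borel f C" and 0: "calc f \<cdot> \<xi> = 0"
  shows "AE z in spm \<xi>. f z = 0"
proof -
  have b: "bdd_borel (\<lambda>z. cnj (f z) * f z) (C * C)" by (rule bdd_borel_mult[OF bdd_borel_cnj[OF f] f])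
  have eq: "cnj (f z) * f z = of_real ((cmod (f z))\<^sup>2)" for z unfolding complex_norm_square by (rule mult.commute)
  have i: "integrable (spm \<xi>) (\<lambda>z. complex_of_real ((cmod (f z))\<^sup>2))"
    using circle_integrable(1)[OF spm_supported b] unfolding eq .
  then have i': "integrable (spm \<xi>) (\<lambda>z. (cmod (f z))\<^sup>2)" using integrable_Re[OF i] by simp
  have "complex_of_real (\<integral>z. (cmod (f z))\<^sup>2 \<partial>spm \<xi>) = (\<integral>z. of_real ((cmod (f z))\<^sup>2) \<partial>spm \<xi>)"
    by (rule integral_complex_of_real[symmetric])
  also have "\<dots> = 0" using calc_norm_sq[OF f, of \<xi>] 0 by simp
  finally have "(\<integral>z. (cmod (f z))\<^sup>2 \<partial>spm \<xi>) = 0" using of_real_eq_0_iff by blast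
  then have "AE z in spm \<xi>. (cmod (f z))\<^sup>2 = 0"
    using integral_nonneg_eq_0_iff_AE[OF i'] by simp
  then show ?thesis by simp
qed

text \<open>The relation says that conjugation by \<open>adj u\<close> sends \<open>v\<close> to
  \<open>l v\<close>; by the induction principle it composes every function of \<open>v\<close> with
  the rotation by \<open>l\<close>.\<close>

lemma calc_rotate:
  assumes u: "unitary_op u" and l: "cmod l = 1" and comm: "v o\<^sub>L u = scalar_op l o\<^sub>L (u o\<^sub>L v)"
    and f: "bdd_borel f C"
  shows "adj u o\<^sub>L (calc f o\<^sub>L u) = calc (\<lambda>z. f (l * z))"
proof -
  note ub = unitary_opD(1)[OF u] note vb = unitary_opD(1)[OF v]
  have l0: "l \<noteq> 0" using l by auto
  have rot: "l * z \<in> unit_circle" if "z \<in> unit_circle" for z using that l by (simp add: norm_mult)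
  have bl: "bdd_borel (\<lambda>z. f (l * z)) C" if "bdd_borel f C" for f C
    unfolding bdd_borel_def
  proof (intro conjI ballI)
    show "(\<lambda>z. f (l * z)) \<in> borel_measurable borel"
      using bdd_borelD(1)[OF that] by (intro measurable_compose[of "\<lambda>z. l * z" borel borel f borel]) auto
    show "cmod (f (l * z)) \<le> C" if "z \<in> unit_circle" for z using bdd_borelD(2)[OF \<open>bdd_borel f C\<close> rot[OF that]] .
  qed
  have vu: "v \<cdot> u \<cdot> x = l *\<^sub>C u \<cdot> v \<cdot> x" for x
    using arg_cong[OF comm, of "\<lambda>T. T \<cdot> x"] by simp
  have pu: "upow v k \<cdot> u \<cdot> x = (l powi k) *\<^sub>C u \<cdot> upow v k \<cdot> x" for k x
    by (rule upow_scaled_commute[where u = "blinfun_apply u", OF v l0 vu])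
  show ?thesis
  proof (rule bounded_borel_circle_induct[where f = f])
    fix k
    show "adj u o\<^sub>L (calc (\<lambda>z. z powi k) o\<^sub>L u) = calc (\<lambda>z. (l * z) powi k)"
    proof -
      have "calc (\<lambda>z. (l powi k) * z powi k + 0) = (scalar_op (l powi k) o\<^sub>L calc (\<lambda>z. z powi k)) + calc (\<lambda>z. 0)"
        by (rule calc_lin[OF bdd_borel_powi bdd_borel_const])
      then have "calc (\<lambda>z. (l * z) powi k) = scalar_op (l powi k) o\<^sub>L upow v k"
        unfolding calc_powi calc_const by (intro blinfun_eqI) (simp add: power_int_mult_distrib blinfun.add_left)
      then show ?thesis unfolding calc_powi
        by (intro blinfun_eqI) (simp add: pu bounded_opsD[OF adj_closed[OF ub]] unitary_opD[OF u])
    qed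
  next
    fix f g a C D
    assume fg: "bdd_borel f C" "bdd_borel g D"
    assume *: "adj u o\<^sub>L (calc f o\<^sub>L u) = calc (\<lambda>z. f (l * z))" "adj u o\<^sub>L (calc g o\<^sub>L u) = calc (\<lambda>z. g (l * z))"
    show "adj u o\<^sub>L (calc (\<lambda>z. a * f z + g z) o\<^sub>L u) = calc (\<lambda>z. a * f (l * z) + g (l * z))"
      unfolding calc_lin[OF fg] calc_lin[OF bl[OF fg(1)] bl[OF fg(2)]] *[symmetric]
      by (intro blinfun_eqI) (simp add: blinfun.add_left blinfun.add_right bounded_opsD[OF adj_closed[OF ub]])
  next
    fix F :: "nat \<Rightarrow> complex \<Rightarrow> complex" and f C
    assume IH: "\<And>j. adj u o\<^sub>L (calc (F j) o\<^sub>L u) = calc (\<lambda>z. F j (l * z))"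
    assume F: "\<And>k. bdd_borel (F k) C" "bdd_borel f C" "\<And>z. z \<in> unit_circle \<Longrightarrow> (\<lambda>k. F k z) \<longlonglongrightarrow> f z"
    show "adj u o\<^sub>L (calc f o\<^sub>L u) = calc (\<lambda>z. f (l * z))"
    proof (rule oper_eqI_weak_limit)
      show "(\<lambda>j. cinner ((calc (\<lambda>z. F j (l * z))) \<cdot> x) y) \<longlonglongrightarrow> cinner ((calc (\<lambda>z. f (l * z))) \<cdot> x) y" for x y
        by (rule calc_tendsto[OF bl[OF F(1)] bl[OF F(2)]]) (intro F(3) rot)
      show "(\<lambda>j. cinner ((calc (\<lambda>z. F j (l * z))) \<cdot> x) y) \<longlonglongrightarrow> cinner ((adj u o\<^sub>L (calc f o\<^sub>L u)) \<cdot> x) y" for x y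
        unfolding IH[symmetric] using calc_tendsto[OF F, of "u \<cdot> x" "u \<cdot> y"]
        by (simp add: cinner_adj_left[OF ub])
    qed
  qed (rule f)
qed

end

section \<open>Haar measure on the circle\<close>

lemma circle_measure_integral:
  fixes f :: "complex \<Rightarrow> complex"
  assumes f: "f \<in> borel_measurable borel"
  shows "(\<integral>z. f z \<partial>circle_measure) = (\<integral>t. indicator {0..1} t *\<^sub>R f (circle_exp t) \<partial>lborel)"
proof -
  have m: "circle_exp \<in> borel_measurable (uniform_measure lborel {0..1})" by simp
  have "(\<integral>z. f z \<partial>circle_measure) = (\<integral>t. f (circle_exp t) \<partial>uniform_measure lborel {0..1})"
    unfolding circle_measure_def circle_exp_def[symmetric, abs_def] using m f by (intro integral_distr) auto
  also have "uniform_measure lborel {0..1::real} = density lborel (\<lambda>t. ennreal (indicator {0..1} t))"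
    by (simp add: uniform_measure_def divide_ennreal_def ennreal_indicator)
  also have "(\<integral>t. f (circle_exp t) \<partial>density lborel (\<lambda>t. ennreal (indicator {0..1} t))) = (\<integral>t. indicator {0..1} t *\<^sub>R f (circle_exp t) \<partial>lborel)"
    using f by (intro integral_density measurable_compose[OF circle_exp_measurable]) auto
  finally show ?thesis .
qed

lemma prob_space_circle_measure: "prob_space circle_measure"
proof -
  interpret prob_space "uniform_measure lborel {0..1::real}"
    by (rule prob_space_uniform_measure) auto
  show ?thesis unfolding circle_measure_def circle_exp_def[symmetric, abs_def] by (rule prob_space_distr) simp
qed

lemma circle_supported_circle_measure: "circle_supported circle_measure"
proof -
  interpret prob_space circle_measure by (rule prob_space_circle_measure)
  have m: "circle_exp \<in> borel_measurable (uniform_measure lborel {0..1})" by simp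
  have "circle_exp -` (- unit_circle) = {}" by (auto simp: circle_exp_simps)
  then have "emeasure circle_measure (- unit_circle) = 0"
    unfolding circle_measure_def circle_exp_def[symmetric, abs_def] using m by (simp add: emeasure_distr)
  then show ?thesis by (simp add: circle_supported_def finite_measure_axioms) (simp add: circle_measure_def)
qed

lemma circle_measure_moment: "(\<integral>z. z powi k \<partial>circle_measure) = (if k = 0 then 1 else 0)"
  using has_bochner_integral_circle_exp[of k]
  by (simp only: circle_measure_integral[OF borel_measurable_powi] circle_exp_powi has_bochner_integral_integral_eq)

text \<open>Rotation multiplies the moment of order \<open>n\<close> by \<open>c ^ n\<close>, and
  the moments with \<open>n > 0\<close> vanish, so the rotated measure has the same moments.\<close>

lemma circle_measure_rotate:
  assumes c: "cmod c = 1" and E: "E \<in> sets borel"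
  shows "emeasure circle_measure ((\<lambda>z. c * z) -` E) = emeasure circle_measure E"
proof -
  interpret prob_space circle_measure by (rule prob_space_circle_measure)
  note s = circle_supportedD(1)[OF circle_supported_circle_measure]
  note sp = circle_supportedD(3)[OF circle_supported_circle_measure]
  have m: "(\<lambda>z. c * z) \<in> borel_measurable circle_measure"
    unfolding measurable_cong_sets[OF s refl] by simp
  define \<nu> where "\<nu> = distr circle_measure borel (\<lambda>z. c * z)"
  have eq: "emeasure \<nu> B = emeasure circle_measure ((\<lambda>z. c * z) -` B)" if "B \<in> sets borel" for B
    unfolding \<nu>_def using m that sp by (simp add: emeasure_distr)
  have "(\<lambda>z. c * z) -` (- unit_circle) = - unit_circle" using c by (auto simp: norm_mult)
  then have "emeasure \<nu> (- unit_circle) = 0"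
    using eq[of "- unit_circle"] circle_supported_circle_measure by (simp add: circle_supported_def)
  then have nu: "circle_supported \<nu>"
    unfolding circle_supported_def using finite_measure_distr[OF m] by (simp add: \<nu>_def)
  have "\<nu> = circle_measure"
  proof (rule circle_measure_eqI[OF nu circle_supported_circle_measure])
    fix n :: nat
    have "(\<integral>z. z ^ n \<partial>\<nu>) = (\<integral>z. (c * z) ^ n \<partial>circle_measure)" unfolding \<nu>_def using m by (intro integral_distr) auto
    also have "\<dots> = c ^ n * (\<integral>z. z ^ n \<partial>circle_measure)" by (simp add: power_mult_distrib)
    also have "\<dots> = (\<integral>z. z ^ n \<partial>circle_measure)" using circle_measure_moment[of "int n"] by (cases "n = 0") auto
    finally show "(\<integral>z. z ^ n \<partial>\<nu>) = (\<integral>z. z ^ n \<partial>circle_measure)" .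
  qed
  then show ?thesis using eq[OF E] by simp
qed

section \<open>Factors generated by a pair of rotation unitaries\<close>

locale rotation_factor = factor_trace R \<tau> + unitary_calculus v
  for R :: "'h::chilbert oper set" and \<tau> and v :: "'h oper" +
  fixes u :: "'h oper" and l :: complex
  assumes u: "unitary_op u" and uR: "u \<in> R" and vR: "v \<in> R"
    and R_eq: "R = commutant (commutant {u, v})"
    and rel: "v o\<^sub>L u = scalar_op l o\<^sub>L (u o\<^sub>L v)"
    and l1: "cmod l = 1" and l_powi: "\<And>k::int. k \<noteq> 0 \<Longrightarrow> l powi k \<noteq> 1"
begin

lemma l_nonzero: "l \<noteq> 0" using l1 by auto

lemma upow_rel:
  "upow v k \<cdot> upow u j \<cdot> x = (l powi (j * k)) *\<^sub>C (upow u j) \<cdot> upow v k \<cdot> x"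
proof -
  have vu: "v \<cdot> u \<cdot> x = l *\<^sub>C u \<cdot> v \<cdot> x" for x
    using arg_cong[OF rel, of "\<lambda>T. T \<cdot> x"] by simp
  then have uv: "u \<cdot> v \<cdot> x = inverse l *\<^sub>C v \<cdot> u \<cdot> x" for x
    using l_nonzero by (simp add: scaleC_scaleC)
  have "upow u j \<cdot> v \<cdot> x = (inverse l powi j) *\<^sub>C v \<cdot> upow u j \<cdot> x" for x
    using upow_scaled_commute[OF u, of "inverse l" "blinfun_apply v"] uv l_nonzero by simp
  then have "v \<cdot> upow u j \<cdot> x = (l powi j) *\<^sub>C (upow u j) \<cdot> v \<cdot> x" for x
    using l_nonzero by (simp add: scaleC_scaleC power_int_inverse)
  then have "upow v k \<cdot> upow u j \<cdot> x = ((l powi j) powi k) *\<^sub>C (upow u j) \<cdot> upow v k \<cdot> x"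
    using upow_scaled_commute[OF v, of "l powi j" "blinfun_apply (upow u j)"] l_nonzero by simp
  then show ?thesis by (simp add: power_int_mult)
qed

text \<open>Conjugation by \<open>v\<close> multiplies the monomial by \<open>l powi m\<close>,
  conjugation by \<open>adj u\<close> multiplies it by \<open>l powi n\<close>. The trace is
  invariant under both, and nontrivial powers of \<open>l\<close> differ from 1.\<close>

lemma tr_fourier: "\<tau> (upow u m o\<^sub>L upow v n) = (if m = 0 \<and> n = 0 then 1 else 0)"
proof -
  define x where "x = upow u m o\<^sub>L upow v n"
  have x: "x \<in> R" unfolding x_def by (intro M_closed upow_M u v uR vR)
  have "\<tau> x = 0" if m: "m \<noteq> 0"
  proof -
    have "v o\<^sub>L (x o\<^sub>L adj v) = scalar_op (l powi m) o\<^sub>L x"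
    proof (rule blinfun_eqI)
      fix y
      have "upow v n \<cdot> adj v \<cdot> y = (upow v (n - 1)) \<cdot> y"
        using upow_apply_add[OF v, of n "-1" y] v by simp
      moreover have "v \<cdot> upow v (n - 1) \<cdot> y = (upow v n) \<cdot> y"
        using upow_apply_add[OF v, of 1 "n - 1" y] v by simp
      ultimately show "(v o\<^sub>L (x o\<^sub>L adj v)) \<cdot> y = (scalar_op (l powi m) o\<^sub>L x) \<cdot> y"
        using upow_rel[of 1 m "upow v (n - 1) \<cdot> y"] v by (simp add: x_def)
    qed
    then have "\<tau> (v o\<^sub>L (x o\<^sub>L adj v)) = l powi m * \<tau> x" using x by (simp add: tr_scale)
    moreover have "\<tau> (v o\<^sub>L (x o\<^sub>L adj v)) = \<tau> ((x o\<^sub>L adj v) o\<^sub>L v)" using x vR by (intro tr_comm) auto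
    moreover have "(x o\<^sub>L adj v) o\<^sub>L v = x" using v by (auto intro!: blinfun_eqI simp: unitary_opD)
    ultimately show ?thesis using l_powi[OF m] by simp
  qed
  moreover have "\<tau> x = 0" if n: "n \<noteq> 0"
  proof -
    have "adj u o\<^sub>L (x o\<^sub>L u) = scalar_op (l powi n) o\<^sub>L x"
    proof (rule blinfun_eqI)
      fix y
      have "upow v n \<cdot> u \<cdot> y = (l powi n) *\<^sub>C u \<cdot> upow v n \<cdot> y"
        using upow_rel[of n 1 y] u by simp
      moreover have "adj u \<cdot> upow u m \<cdot> u \<cdot> z = (upow u m) \<cdot> z" for z
        using upow_apply_add[OF u, of "-1" m] upow_apply_add[OF u, of "m - 1" 1 z] u by simp
      ultimately show "(adj u o\<^sub>L (x o\<^sub>L u)) \<cdot> y = (scalar_op (l powi n) o\<^sub>L x) \<cdot> y"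
        using bounded_opsD[OF upow_bounded_ops[OF u]] bounded_opsD[OF adj_closed[OF unitary_opD(1)[OF u]]] by (simp add: x_def)
    qed
    then have "\<tau> (adj u o\<^sub>L (x o\<^sub>L u)) = l powi n * \<tau> x" using x by (simp add: tr_scale)
    moreover have "\<tau> (adj u o\<^sub>L (x o\<^sub>L u)) = \<tau> ((x o\<^sub>L u) o\<^sub>L adj u)" using x uR by (intro tr_comm) auto
    moreover have "(x o\<^sub>L u) o\<^sub>L adj u = x" using u by (auto intro!: blinfun_eqI simp: unitary_opD)
    ultimately show ?thesis using l_powi[OF n] by simp
  qed
  moreover have "\<tau> x = 1" if "m = 0" "n = 0" using that by (simp add: x_def tr_id)
  ultimately show ?thesis unfolding x_def by auto
qed

lemma calc_R: "bdd_borel f C \<Longrightarrow> calc f \<in> R"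
proof -
  assume "bdd_borel f C"
  then have "calc f \<in> commutant (commutant {v})" by (rule calc_double_commutant)
  also have "\<dots> \<subseteq> R" unfolding R_eq by (intro commutant_antimono) auto
  finally show ?thesis .
qed

text \<open>Here \<open>v\<close> is found to be a Haar unitary: the traces of its powers are the
  moments of Haar measure. The norm bound on the calculus allows limits to be taken under the
  trace.\<close>

lemma tr_calc:
  assumes f: "bdd_borel f C" shows "\<tau> (calc f) = (\<integral>z. f z \<partial>circle_measure)"
proof (rule bounded_borel_circle_induct[where f = f])
  show "\<tau> (calc (\<lambda>z. z powi k)) = (\<integral>z. z powi k \<partial>circle_measure)" for k
    unfolding calc_powi circle_measure_moment using tr_fourier[of 0 k] by simp
next
  fix f g a C D
  assume fg: "bdd_borel f C" "bdd_borel g D"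
  assume "\<tau> (calc f) = (\<integral>z. f z \<partial>circle_measure)" "\<tau> (calc g) = (\<integral>z. g z \<partial>circle_measure)"
  then show "\<tau> (calc (\<lambda>z. a * f z + g z)) = (\<integral>z. a * f z + g z \<partial>circle_measure)"
    using calc_R[OF fg(1)] calc_R[OF fg(2)]
    by (simp add: calc_lin[OF fg] circle_integral_lin[OF circle_supported_circle_measure fg] tr_add tr_scale)
next
  fix F :: "nat \<Rightarrow> complex \<Rightarrow> complex" and f C
  assume IH: "\<And>j. \<tau> (calc (F j)) = (\<integral>z. F j z \<partial>circle_measure)"
  assume F: "\<And>k. bdd_borel (F k) C" "bdd_borel f C" "\<And>z. z \<in> unit_circle \<Longrightarrow> (\<lambda>k. F k z) \<longlonglongrightarrow> f z"
  have "(\<lambda>k. \<tau> (calc (F k))) \<longlonglongrightarrow> \<tau> (calc f)"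
    by (rule tr_weak_tendsto[OF calc_R[OF F(1)] calc_norm_le[OF F(1)] calc_R[OF F(2)]]) (rule calc_tendsto[OF F])
  moreover have "(\<lambda>k. \<tau> (calc (F k))) \<longlonglongrightarrow> (\<integral>z. f z \<partial>circle_measure)"
    unfolding IH by (rule circle_integral_tendsto[OF circle_supported_circle_measure F])
  ultimately show "\<tau> (calc f) = (\<integral>z. f z \<partial>circle_measure)" by (rule LIMSEQ_unique)
qed (rule f)

text \<open>A null set is enlarged to an invariant one, whose spectral projection is central, hence a scalar of
  trace zero.\<close>

lemma spectral_measure_abs_cont:
  assumes E: "E \<in> sets borel" "emeasure circle_measure E = 0"
  shows "emeasure (spm \<xi>) E = 0"
proof -
  \<comment> \<open>The union of all rotates of \<open>E\<close> by powers of \<open>l\<close>;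
    there are countably many, so it is still a null set.\<close>
  define E' where "E' = (\<Union>k::int. (\<lambda>z. l powi k * z) -` E)"
  have lk: "cmod (l powi k) = 1" for k using l1 by (simp add: norm_power_int)
  have Ek: "(\<lambda>z. l powi k * z) -` E \<in> sets borel" for k
    using measurable_sets_borel[of "\<lambda>z. l powi k * z" borel E] E(1) by simp
  have E': "E' \<in> sets borel" unfolding E'_def using Ek by (intro sets.countable_UN') auto
  have "emeasure circle_measure E' = 0"
  proof -
    have "(\<lambda>z. l powi k * z) -` E \<in> null_sets circle_measure" for k
      using circle_measure_rotate[OF lk E(1), of k] Ek E(2) circle_supportedD(1)[OF circle_supported_circle_measure]
      by (simp add: null_sets_def)
    then have "E' \<in> null_sets circle_measure" unfolding E'_def by (intro null_sets_UN') auto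
    then show ?thesis by auto
  qed
  have inv: "l * z \<in> E' \<longleftrightarrow> z \<in> E'" for z
  proof
    assume "l * z \<in> E'"
    then obtain k where "l powi k * (l * z) \<in> E" by (auto simp: E'_def)
    then have "l powi (k + 1) * z \<in> E" using l_nonzero by (simp add: power_int_add mult.assoc)
    then show "z \<in> E'" unfolding E'_def by blast
  next
    assume "z \<in> E'"
    then obtain k where "l powi k * z \<in> E" by (auto simp: E'_def)
    then have "l powi (k - 1) * (l * z) \<in> E" using l_nonzero by (simp add: power_int_diff)
    then show "l * z \<in> E'" unfolding E'_def by blast
  qed
  define f :: "complex \<Rightarrow> complex" where "f = indicator E'"
  have f: "bdd_borel f 1" using E' by (auto simp: f_def bdd_borel_def indicator_def)
  have frot: "(\<lambda>z. f (l * z)) = f" using inv by (auto simp: f_def indicator_def)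
  define p where "p = calc f"
  have pR: "p \<in> R" unfolding p_def by (rule calc_R[OF f])
  \<comment> \<open>Invariance of \<open>E'\<close> under the rotation by \<open>l\<close> is
    commutation of its spectral projection with \<open>u\<close>.\<close>
  have "adj u o\<^sub>L (p o\<^sub>L u) = p" unfolding p_def calc_rotate[OF u l1 rel f] frot ..
  then have "u \<cdot> adj u \<cdot> p \<cdot> u \<cdot> x = u \<cdot> p \<cdot> x" for x
    by (metis blinfun_apply_blinfun_compose)
  then have pu: "p o\<^sub>L u = u o\<^sub>L p" by (intro blinfun_eqI) (simp add: unitary_opD[OF u])
  have pv: "p o\<^sub>L v = v o\<^sub>L p" unfolding p_def by (rule calc_commute[OF f unitary_opD(1)[OF v] refl])
  have "p \<in> commutant {u, v}" using pu pv pR by (intro commutantI) auto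
  moreover have "commutant R = commutant {u, v}"
    unfolding R_eq using unitary_opD(1)[OF u] unitary_opD(1)[OF v] by (intro triple_commutant) auto
  ultimately have "p \<in> R \<inter> commutant R" using pR by simp
  then obtain c where c: "p = scalar_op c" using fac by (auto simp: factor_def)
  have ind: "(\<integral>z. f z \<partial>\<mu>) = of_real (measure \<mu> E')" if "circle_supported \<mu>" for \<mu>
    unfolding f_def by (rule circle_integral_indicator[OF that E'])
  have "c = \<tau> p" using c tr_scalar by simp
  also have "\<dots> = of_real (measure circle_measure E')"
    unfolding p_def tr_calc[OF f] by (rule ind[OF circle_supported_circle_measure])
  also have "\<dots> = 0" using \<open>emeasure circle_measure E' = 0\<close> by (simp add: measure_def)
  finally have "p \<cdot> \<xi> = 0" using c by simp
  then have "complex_of_real (measure (spm \<xi>) E') = 0"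
    unfolding ind[OF spm_supported, symmetric] calc_quadratic[OF f, symmetric] p_def by simp
  then have "emeasure (spm \<xi>) E' = 0"
    using finite_measure.emeasure_eq_measure[OF circle_supportedD(2)[OF spm_supported]] by simp
  moreover have "E \<subseteq> E'" unfolding E'_def by (auto intro!: exI[of _ 0])
  ultimately show ?thesis
    using emeasure_mono[of E E' "spm \<xi>"] E' circle_supportedD(1)[OF spm_supported] by simp
qed

lemma AE_spm:
  assumes "AE z in circle_measure. P z" shows "AE z in spm \<xi>. P z"
proof -
  obtain E where E: "{z \<in> space circle_measure. \<not> P z} \<subseteq> E" "emeasure circle_measure E = 0" "E \<in> sets circle_measure"
    using AE_E[OF assms] by blast
  have s: "E \<in> sets borel" using E(3) circle_supportedD(1)[OF circle_supported_circle_measure] by simp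
  show ?thesis
  proof (rule AE_I)
    show "{z \<in> space (spm \<xi>). \<not> P z} \<subseteq> E"
      using E(1) circle_supportedD(3)[OF circle_supported_circle_measure] by auto
    show "emeasure (spm \<xi>) E = 0" using s E(2) by (rule spectral_measure_abs_cont)
    show "E \<in> sets (spm \<xi>)" using s circle_supportedD(1)[OF spm_supported] by simp
  qed
qed

end

section \<open>The von Neumann algebra generated by a weighted rotation\<close>

lemma Wstar_props:
  fixes T :: "'h::chilbert oper"
  assumes T: "T \<in> bounded_ops"
  shows "von_neumann_algebra (Wstar T)" "T \<in> Wstar T" "adj T \<in> Wstar T"
    "commutant (Wstar T) = commutant {T, adj T}"
proof -
  have b: "{T, adj T} \<subseteq> bounded_ops" using T by auto
  show "commutant (Wstar T) = commutant {T, adj T}" unfolding Wstar_def by (rule triple_commutant[OF b])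
  have "{T, adj T} \<subseteq> Wstar T" unfolding Wstar_def by (rule double_commutant_subset[OF b])
  then show "T \<in> Wstar T" "adj T \<in> Wstar T" by auto
  have "adj y \<in> commutant {T, adj T}" if "y \<in> commutant {T, adj T}" for y
    by (rule commutant_adj[OF b _ that]) (use T in auto)
  then have "adj x \<in> Wstar T" if "x \<in> Wstar T" for x
    unfolding Wstar_def by (intro commutant_adj[OF commutant_bounded_ops]) (use that in \<open>auto simp: Wstar_def\<close>)
  moreover have "commutant (commutant (Wstar T)) = Wstar T"
    unfolding Wstar_def by (rule triple_commutant[OF commutant_bounded_ops])
  ultimately show "von_neumann_algebra (Wstar T)" by (auto simp: von_neumann_algebra_def)
qed

text \<open>Conjugation by \<open>v\<close> only rescales \<open>T\<close> and \<open>adj T\<close>,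
  so it preserves their commutant and with it the double commutant.\<close>

lemma unitary_conjugate_Wstar:
  fixes T :: "'h::chilbert oper"
  assumes v: "unitary_op v" and T: "T \<in> bounded_ops" and c: "c \<noteq> 0" "v o\<^sub>L T = scalar_op c o\<^sub>L (T o\<^sub>L v)"
    and d: "d \<noteq> 0" "v o\<^sub>L adj T = scalar_op d o\<^sub>L (adj T o\<^sub>L v)" and x: "x \<in> Wstar T"
  shows "v o\<^sub>L (x o\<^sub>L adj v) \<in> Wstar T" "adj v o\<^sub>L (x o\<^sub>L v) \<in> Wstar T"
proof -
  note vb = unitary_opD(1)[OF v]
  have xb: "x \<in> bounded_ops" using x commutant_bounded_ops by (auto simp: Wstar_def)
  have rel: "v \<cdot> A \<cdot> z = a *\<^sub>C A \<cdot> v \<cdot> z"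
    "adj v \<cdot> A \<cdot> z = inverse a *\<^sub>C A \<cdot> adj v \<cdot> z"
    if "a \<noteq> 0" "v o\<^sub>L A = scalar_op a o\<^sub>L (A o\<^sub>L v)" for A a z
  proof -
    show *: "v \<cdot> A \<cdot> z = a *\<^sub>C A \<cdot> v \<cdot> z" for z
      using arg_cong[OF that(2), of "\<lambda>T. T \<cdot> z"] by simp
    have "adj v \<cdot> v \<cdot> A \<cdot> adj v \<cdot> z = a *\<^sub>C (adj v) \<cdot> A \<cdot> z"
      unfolding * by (simp add: bounded_opsD[OF adj_closed[OF vb]] unitary_opD[OF v])
    then show "adj v \<cdot> A \<cdot> z = inverse a *\<^sub>C A \<cdot> adj v \<cdot> z"
      using that(1) by (simp add: unitary_opD[OF v] scaleC_scaleC)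
  qed
  have comm: "adj v o\<^sub>L (y o\<^sub>L v) \<in> commutant {T, adj T}" "v o\<^sub>L (y o\<^sub>L adj v) \<in> commutant {T, adj T}"
    if y: "y \<in> commutant {T, adj T}" for y
  proof -
    have yb: "y \<in> bounded_ops" using y by (rule commutantD)
    have "(adj v o\<^sub>L (y o\<^sub>L v)) o\<^sub>L A = A o\<^sub>L (adj v o\<^sub>L (y o\<^sub>L v)) \<and> (v o\<^sub>L (y o\<^sub>L adj v)) o\<^sub>L A = A o\<^sub>L (v o\<^sub>L (y o\<^sub>L adj v))"
      if "A = T \<and> a = c \<or> A = adj T \<and> a = d" for A a
    proof -
      have a: "a \<noteq> 0" "v o\<^sub>L A = scalar_op a o\<^sub>L (A o\<^sub>L v)" and A: "A \<in> {T, adj T}" "A \<in> bounded_ops" using that c d T by auto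
      have yA: "y \<cdot> A \<cdot> z = A \<cdot> y \<cdot> z" for z
        using y A(1) by (rule commutant_apply)
      show ?thesis
        by (intro conjI blinfun_eqI)
          (simp_all add: rel[OF a] yA bounded_opsD[OF A(2)] bounded_opsD[OF yb] bounded_opsD[OF vb]
            bounded_opsD[OF adj_closed[OF vb]] scaleC_scaleC a(1))
    qed
    then show "adj v o\<^sub>L (y o\<^sub>L v) \<in> commutant {T, adj T}" "v o\<^sub>L (y o\<^sub>L adj v) \<in> commutant {T, adj T}"
      using yb vb by (auto intro!: commutantI)
  qed
  show "v o\<^sub>L (x o\<^sub>L adj v) \<in> Wstar T"
    unfolding Wstar_def
  proof (rule commutantI)
    fix y assume y: "y \<in> commutant {T, adj T}"
    have "x \<cdot> (adj v o\<^sub>L (y o\<^sub>L v)) \<cdot> z = (adj v o\<^sub>L (y o\<^sub>L v)) \<cdot> x \<cdot> z" for z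
      using x comm(1)[OF y] unfolding Wstar_def by (rule commutant_apply)
    from this[of "adj v \<cdot> z" for z]
    have "v \<cdot> x \<cdot> adj v \<cdot> y \<cdot> z = y \<cdot> v \<cdot> x \<cdot> adj v \<cdot> z" for z
      by (simp add: unitary_opD[OF v])
    then show "(v o\<^sub>L (x o\<^sub>L adj v)) o\<^sub>L y = y o\<^sub>L (v o\<^sub>L (x o\<^sub>L adj v))" by (intro blinfun_eqI) simp
  qed (use xb vb in auto)
  show "adj v o\<^sub>L (x o\<^sub>L v) \<in> Wstar T"
    unfolding Wstar_def
  proof (rule commutantI)
    fix y assume y: "y \<in> commutant {T, adj T}"
    have "x \<cdot> (v o\<^sub>L (y o\<^sub>L adj v)) \<cdot> z = (v o\<^sub>L (y o\<^sub>L adj v)) \<cdot> x \<cdot> z" for z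
      using x comm(2)[OF y] unfolding Wstar_def by (rule commutant_apply)
    from this[of "v \<cdot> z" for z]
    have "adj v \<cdot> x \<cdot> v \<cdot> y \<cdot> z = y \<cdot> adj v \<cdot> x \<cdot> v \<cdot> z" for z
      by (simp add: unitary_opD[OF v])
    then show "(adj v o\<^sub>L (x o\<^sub>L v)) o\<^sub>L y = y o\<^sub>L (adj v o\<^sub>L (x o\<^sub>L v))" by (intro blinfun_eqI) simp
  qed (use xb vb in auto)
qed

section \<open>Absolute values through polynomial approximation\<close>

context unitary_calculus
begin

text \<open>Boundedness is carried through the induction because the algebraic rules of the calculus
  require it.\<close>

lemma calc_real_polynomial_commute:
  assumes f: "bdd_borel f C" and T: "T \<in> bounded_ops"
    and comm: "T o\<^sub>L calc (\<lambda>z. of_real ((cmod (f z))\<^sup>2)) = calc (\<lambda>z. of_real ((cmod (f z))\<^sup>2)) o\<^sub>L T"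
    and p: "real_polynomial_function p"
  shows "(\<exists>D. bdd_borel (\<lambda>z. of_real (p ((cmod (f z))\<^sup>2))) D) \<and>
    calc (\<lambda>z. of_real (p ((cmod (f z))\<^sup>2))) o\<^sub>L T = T o\<^sub>L calc (\<lambda>z. of_real (p ((cmod (f z))\<^sup>2)))"
  using p
proof (induction rule: real_polynomial_function.induct)
  case (linear p)
  have p: "p x = x * p 1" for x using linear_simps(5)[OF linear, of x 1] by simp
  have b0: "bdd_borel (\<lambda>z. of_real ((cmod (f z))\<^sup>2)) (C * C)"
    using bdd_borel_mult[OF f bdd_borel_cnj[OF f]] by (simp only: complex_norm_square)
  have e: "(\<lambda>z. complex_of_real (p ((cmod (f z))\<^sup>2))) = (\<lambda>z. of_real (p 1) * of_real ((cmod (f z))\<^sup>2) + 0)"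
    by (subst p) (simp add: mult.commute)
  have "calc (\<lambda>z. of_real (p 1) * of_real ((cmod (f z))\<^sup>2) + 0) = (scalar_op (of_real (p 1)) o\<^sub>L calc (\<lambda>z. of_real ((cmod (f z))\<^sup>2))) + calc (\<lambda>z. 0)"
    by (rule calc_lin[OF b0 bdd_borel_const])
  also have "\<dots> o\<^sub>L T = T o\<^sub>L \<dots>"
    using blinfun_pull[OF comm] bounded_opsD[OF T] by (intro blinfun_eqI) (simp add: calc_const blinfun.add_left)
  finally show ?case using bdd_borel_lin[OF b0 bdd_borel_const] unfolding e by blast
next
  case (const c)
  show ?case using bdd_borel_const calc_const scalar_op_commute[OF T] by metis
next
  case (add p q)
  then obtain D E where DE: "bdd_borel (\<lambda>z. of_real (p ((cmod (f z))\<^sup>2))) D" "bdd_borel (\<lambda>z. of_real (q ((cmod (f z))\<^sup>2))) E" by blast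
  show ?case
    using add calc_lin[OF DE, of 1] bdd_borel_lin[OF DE, of 1] by (auto simp: compose_distribs)
next
  case (mult p q)
  then obtain D E where DE: "bdd_borel (\<lambda>z. of_real (p ((cmod (f z))\<^sup>2))) D" "bdd_borel (\<lambda>z. of_real (q ((cmod (f z))\<^sup>2))) E" by blast
  have "(calc (\<lambda>z. of_real (p ((cmod (f z))\<^sup>2))) o\<^sub>L calc (\<lambda>z. of_real (q ((cmod (f z))\<^sup>2)))) o\<^sub>L T
    = T o\<^sub>L (calc (\<lambda>z. of_real (p ((cmod (f z))\<^sup>2))) o\<^sub>L calc (\<lambda>z. of_real (q ((cmod (f z))\<^sup>2))))"
    using blinfun_pull[OF conjunct2[OF mult.IH(1)]] blinfun_pull[OF conjunct2[OF mult.IH(2)]]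
    by (intro blinfun_eqI) simp
  then show ?case
    using calc_mult[OF DE] bdd_borel_mult[OF DE] by auto
qed

text \<open>Approximating the square root by polynomials on \<open>[0, C^2]\<close> makes
  \<open>|f|\<close> a uniform limit, on the circle, of polynomials in \<open>|f|^2\<close>.
  Whatever commutes with \<open>|f|^2(v)\<close> therefore commutes with its root
  \<open>|f|(v)\<close>.\<close>

lemma calc_abs_commute:
  assumes f: "bdd_borel f C" and T: "T \<in> bounded_ops"
    and comm: "T o\<^sub>L calc (\<lambda>z. of_real ((cmod (f z))\<^sup>2)) = calc (\<lambda>z. of_real ((cmod (f z))\<^sup>2)) o\<^sub>L T"
  shows "calc (\<lambda>z. of_real (cmod (f z))) o\<^sub>L T = T o\<^sub>L calc (\<lambda>z. of_real (cmod (f z)))"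
proof -
  have C: "0 \<le> C" using f by (rule bdd_borel_nonneg)
  have h: "bdd_borel (\<lambda>z. complex_of_real (cmod (f z))) (C + 1)"
    using f by (auto simp: bdd_borel_def intro: add_increasing2)
  have "\<exists>p. real_polynomial_function p \<and> (\<forall>x\<in>{0..C\<^sup>2}. \<bar>sqrt x - p x\<bar> < inverse (Suc k))" for k
  proof -
    have "compact {0..C\<^sup>2}" "continuous_on {0..C\<^sup>2} sqrt" by (auto intro!: continuous_intros)
    then obtain p where "real_polynomial_function p" "\<And>x. x \<in> {0..C\<^sup>2} \<Longrightarrow> \<bar>sqrt x - p x\<bar> < inverse (Suc k)"
      by (rule Stone_Weierstrass_real_polynomial_function[where e = "inverse (Suc k)"]) auto
    then show ?thesis by blast
  qed
  then obtain p where p: "\<And>k. real_polynomial_function (p k)"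
    "\<And>k x. x \<in> {0..C\<^sup>2} \<Longrightarrow> \<bar>sqrt x - p k x\<bar> < inverse (Suc k)" by metis
  define F where "F k z = complex_of_real (p k ((cmod (f z))\<^sup>2))" for k z
  have close: "\<bar>cmod (f z) - p k ((cmod (f z))\<^sup>2)\<bar> < inverse (Suc k)" if "z \<in> unit_circle" for k z
  proof -
    have "cmod (f z) \<le> C" by (rule bdd_borelD(2)[OF f that])
    then have "(cmod (f z))\<^sup>2 \<in> {0..C\<^sup>2}" by (auto intro: power_mono)
    from p(2)[OF this, of k] show ?thesis by simp
  qed
  have F: "bdd_borel (F k) (C + 1)" for k
    unfolding bdd_borel_def
  proof (intro conjI ballI)
    show "F k \<in> borel_measurable borel"
      using calc_real_polynomial_commute[OF f T comm p(1)] bdd_borelD(1) unfolding F_def by blast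
    fix z assume z: "z \<in> unit_circle"
    have "\<bar>p k ((cmod (f z))\<^sup>2)\<bar> \<le> cmod (f z) + inverse (Suc k)" using close[OF z, of k] norm_ge_zero[of "f z"] by linarith
    also have "inverse (real (Suc k)) \<le> 1" by (simp add: field_simps)
    finally show "cmod (F k z) \<le> C + 1" using bdd_borelD(2)[OF f z] unfolding F_def by simp
  qed
  have lim: "(\<lambda>k. F k z) \<longlonglongrightarrow> of_real (cmod (f z))" if z: "z \<in> unit_circle" for z
  proof -
    have "(\<lambda>k. cmod (f z) - p k ((cmod (f z))\<^sup>2)) \<longlonglongrightarrow> 0"
    proof (rule Lim_null_comparison[OF _ LIMSEQ_inverse_real_of_nat])
      show "\<forall>\<^sub>F k in sequentially. norm (cmod (f z) - p k ((cmod (f z))\<^sup>2)) \<le> inverse (real (Suc k))"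
        using close[OF z] by (intro always_eventually) (auto intro: less_imp_le)
    qed
    from tendsto_diff[OF tendsto_const[of "cmod (f z)"] this]
    show ?thesis unfolding F_def by (intro tendsto_of_real) simp
  qed
  have "calc (\<lambda>z. of_real (cmod (f z))) \<in> commutant {T}"
  proof (rule weak_limit_commutant)
    show "calc (F k) \<in> commutant {T}" for k
      using calc_real_polynomial_commute[OF f T comm p(1), of k] calc_bounded_ops[OF F]
      unfolding F_def[symmetric, abs_def] by (intro commutantI) auto
    show "(\<lambda>k. cinner (calc (F k) \<cdot> x) y) \<longlonglongrightarrow> cinner ((calc (\<lambda>z. of_real (cmod (f z)))) \<cdot> x) y" for x y
      by (rule calc_tendsto[OF F h lim])
  qed (use T calc_bounded_ops[OF h] in auto)
  then show ?thesis by (rule commutantD(2)) simp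
qed

lemma AE_spm_False: "AE z in spm \<xi>. False \<Longrightarrow> \<xi> = 0"
proof -
  interpret finite_measure "spm \<xi>" using circle_supportedD(2)[OF spm_supported] .
  assume "AE z in spm \<xi>. False"
  then obtain E where "UNIV \<subseteq> E" "emeasure (spm \<xi>) E = 0"
    using circle_supportedD(3)[OF spm_supported] by (auto elim: AE_E)
  then have "emeasure (spm \<xi>) UNIV = 0" by (simp add: top.extremum_unique)
  then show "\<xi> = 0" using measure_spm_UNIV[of \<xi>] by (simp add: measure_def)
qed

end

text \<open>For \<open>N = W\<^sup>*(u f(v))\<close>, \<open>w\<close> is the polar part \<open>u (f / |f|)(v)\<close> and \<open>k\<close> is \<open>|f|\<^sup>2(v)\<close>.\<close>

locale rotation_subalgebra = rotation_factor R \<tau> v u l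
  for R :: "'h::chilbert oper set" and \<tau> and v u :: "'h oper" and l :: complex +
  fixes N :: "'h oper set" and w k :: "'h oper"
  assumes N_vN: "von_neumann_algebra N" and N_R: "N \<subseteq> R"
    and N_conj: "x \<in> N \<Longrightarrow> v o\<^sub>L (x o\<^sub>L adj v) \<in> N" "x \<in> N \<Longrightarrow> adj v o\<^sub>L (x o\<^sub>L v) \<in> N"
    and w: "unitary_op w" "w \<in> N" "v o\<^sub>L w = scalar_op l o\<^sub>L (w o\<^sub>L v)"
    and k: "k \<in> N" "v o\<^sub>L k = k o\<^sub>L v" "k \<notin> range scalar_op"

section \<open>The polar decomposition of the generator\<close>

context rotation_factor
begin

text \<open>The polar decomposition takes place on functions, as \<open>f = g * h\<close> with
  \<open>g\<close> unimodular and \<open>h = |f|\<close>. That \<open>f\<close> is nonzero almost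
  everywhere becomes injectivity of \<open>|f|(v)\<close>, which puts \<open>w\<close> into the
  generated algebra.\<close>

lemma rotation_subalgebra_Wstar_bdd:
  assumes f: "bdd_borel f C" and nz: "AE z in circle_measure. f z \<noteq> 0"
    and ns: "calc (\<lambda>z. of_real (cmod (f z))) \<notin> range scalar_op"
  shows "\<exists>w k. rotation_subalgebra R \<tau> v u l (Wstar (u o\<^sub>L calc f)) w k"
proof -
  define T where "T = u o\<^sub>L calc f"
  note ub = unitary_opD(1)[OF u] and vb = unitary_opD(1)[OF v] and Fb = calc_bounded_ops[OF f]
  have Tb: "T \<in> bounded_ops" using ub Fb by (auto simp: T_def)
  have TR: "T \<in> R" using uR calc_R[OF f] by (auto simp: T_def)
  have N_R: "Wstar T \<subseteq> R"
  proof -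
    have "{T, adj T} \<subseteq> R" using TR by auto
    then have "commutant R \<subseteq> commutant {T, adj T}" by (rule commutant_antimono)
    then have "commutant (commutant {T, adj T}) \<subseteq> commutant (commutant R)" by (rule commutant_antimono)
    then show ?thesis by (simp add: Wstar_def M_double_commutant)
  qed
  have vu: "v \<cdot> u \<cdot> x = l *\<^sub>C u \<cdot> v \<cdot> x" for x
    using arg_cong[OF rel, of "\<lambda>T. T \<cdot> x"] by simp
  have calc_v: "calc g \<cdot> v \<cdot> x = v \<cdot> calc g \<cdot> x" if "bdd_borel g D" for g D x
    using calc_commute[OF that vb refl] by (rule blinfun_pull)
  have vT: "v o\<^sub>L T = scalar_op l o\<^sub>L (T o\<^sub>L v)"
    by (intro blinfun_eqI) (simp add: T_def vu calc_v[OF f])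
  have vT': "v o\<^sub>L adj T = scalar_op (cnj l) o\<^sub>L (adj T o\<^sub>L v)"
  proof (rule blinfun_eqI)
    fix x
    have "adj (v o\<^sub>L T) = adj (scalar_op l o\<^sub>L (T o\<^sub>L v))" using vT by simp
    then have e: "adj T o\<^sub>L adj v = (adj v o\<^sub>L adj T) o\<^sub>L scalar_op (cnj l)"
      using vb Tb by (simp add: adj_compose)
    have "adj T \<cdot> x = cnj l *\<^sub>C (adj v) \<cdot> adj T \<cdot> v \<cdot> x"
      using arg_cong[OF e, of "\<lambda>A. A \<cdot> v \<cdot> x"]
      by (simp add: unitary_opD[OF v] bounded_opsD[OF adj_closed[OF vb]] bounded_opsD[OF adj_closed[OF Tb]])
    from arg_cong[OF this, of "blinfun_apply v"]
    show "(v o\<^sub>L adj T) \<cdot> x = (scalar_op (cnj l) o\<^sub>L (adj T o\<^sub>L v)) \<cdot> x"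
      by (simp add: unitary_opD[OF v] bounded_opsD[OF vb])
  qed
  \<comment> \<open>The value 1 at the zeros of \<open>f\<close> makes \<open>g\<close> unimodular
    everywhere, so that \<open>G\<close> is unitary without any exceptional set.\<close>
  define g where "g z = (if f z = 0 then 1 else f z / of_real (cmod (f z)))" for z
  define h where "h z = complex_of_real (cmod (f z))" for z
  have fm [measurable]: "f \<in> borel_measurable borel" using f by (rule bdd_borelD)
  have gn: "cmod (g z) = 1" for z by (simp add: g_def norm_divide)
  have "g \<in> borel_measurable borel" unfolding g_def by measurable
  then have g: "bdd_borel g 1" using gn by (simp add: bdd_borel_def)
  have h: "bdd_borel h C" unfolding bdd_borel_def h_def using bdd_borelD(2)[OF f] by simp
  define G H w K where "G = calc g" and "H = calc h" and "w = u o\<^sub>L G" and "K = adj T o\<^sub>L T"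
  note Gb = calc_bounded_ops[OF g, folded G_def] and Hb = calc_bounded_ops[OF h, folded H_def]
  have GG: "G o\<^sub>L adj G = id_blinfun" "adj G o\<^sub>L G = id_blinfun"
  proof -
    have gg: "g z * cnj (g z) = 1" for z using complex_norm_square[of "g z"] gn by simp
    then have gg': "cnj (g z) * g z = 1" for z by (simp add: mult.commute)
    show "G o\<^sub>L adj G = id_blinfun"
      unfolding G_def calc_adj[OF g] calc_mult[OF g bdd_borel_cnj[OF g], symmetric] gg calc_const by simp
    show "adj G o\<^sub>L G = id_blinfun"
      unfolding G_def calc_adj[OF g] calc_mult[OF bdd_borel_cnj[OF g] g, symmetric] gg' calc_const by simp
  qed
  have w: "unitary_op w" unfolding w_def using u GG Gb by (intro unitary_op_compose) (auto simp: unitary_op_def)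
  have F: "calc f = G o\<^sub>L H"
  proof -
    have "f = (\<lambda>z. g z * h z)" by (auto simp: g_def h_def)
    then show ?thesis unfolding G_def H_def calc_mult[OF g h, symmetric] by simp
  qed
  have TwH: "T \<cdot> x = w \<cdot> H \<cdot> x" for x by (simp add: T_def F w_def)
  have K: "K = calc (\<lambda>z. of_real ((cmod (f z))\<^sup>2))"
  proof -
    have "K = adj (calc f) o\<^sub>L calc f"
      unfolding K_def T_def using ub Fb by (intro blinfun_eqI) (simp add: adj_compose unitary_opD[OF u])
    also have "\<dots> = calc (\<lambda>z. cnj (f z) * f z)"
      unfolding calc_adj[OF f] by (rule calc_mult[OF bdd_borel_cnj[OF f] f, symmetric])
    finally show ?thesis unfolding complex_norm_square by (simp add: mult.commute)
  qed
  note N = Wstar_props[OF Tb]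
  have wN: "w \<in> Wstar T"
    unfolding Wstar_def
  proof (rule commutantI)
    show "w \<in> bounded_ops" using w by (rule unitary_opD)
    fix y assume y: "y \<in> commutant {T, adj T}"
    have yb: "y \<in> bounded_ops" using y by (rule commutantD)
    have yT: "y \<cdot> T \<cdot> x = T \<cdot> y \<cdot> x"
      "y \<cdot> adj T \<cdot> x = (adj T) \<cdot> y \<cdot> x" for x
      using commutant_apply[OF y] by auto
    have "y o\<^sub>L K = K o\<^sub>L y" unfolding K_def by (intro blinfun_eqI) (simp add: yT)
    then have "H o\<^sub>L y = y o\<^sub>L H" unfolding H_def h_def[abs_def] K by (intro calc_abs_commute[OF f yb])
    then have yH: "y \<cdot> H \<cdot> x = H \<cdot> y \<cdot> x" for x
      using blinfun_pull[of H y y H] by simp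
    \<comment> \<open>Both \<open>T = w H\<close> and \<open>H\<close> commute with
      \<open>y\<close>, so the commutator \<open>D\<close> vanishes on the range of
      \<open>H\<close>. Equivalently \<open>adj D\<close> maps into the kernel of the self-adjoint
      \<open>H\<close>, which is trivial since spectral measures do not charge the zeros of
      \<open>f\<close>.\<close>
    define D where "D = (w o\<^sub>L y) - (y o\<^sub>L w)"
    have Db: "D \<in> bounded_ops" unfolding D_def using yb unitary_opD(1)[OF w] by auto
    have DH: "D \<cdot> H \<cdot> x = 0" for x
      by (simp add: D_def blinfun.diff_left yH TwH[symmetric] yT)
    have Hs: "adj H = H" unfolding H_def calc_adj[OF h] by (simp add: h_def[abs_def])
    have "adj D \<cdot> \<eta> = 0" for \<eta>
    proof -
      have "H \<cdot> adj D \<cdot> \<eta> = 0"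
      proof (rule cinner_ext_right)
        fix x
        have "cinner x (adj H \<cdot> adj D \<cdot> \<eta>) = 0"
          by (simp add: cinner_adj_right Hb Db DH)
        then show "cinner x (H \<cdot> adj D \<cdot> \<eta>) = cinner x 0" by (simp add: Hs)
      qed
      then have "AE z in spm (adj D \<cdot> \<eta>). h z = 0" unfolding H_def by (rule calc_apply_eq_0D[OF h])
      moreover have "AE z in spm (adj D \<cdot> \<eta>). f z \<noteq> 0" by (rule AE_spm[OF nz])
      ultimately have "AE z in spm (adj D \<cdot> \<eta>). False" by eventually_elim (simp add: h_def)
      then show ?thesis by (rule AE_spm_False)
    qed
    then have "D \<cdot> x = 0" for x
      by (intro cinner_ext_left) (simp add: adj_props(2)[OF Db])
    then have "D = 0" by (intro blinfun_eqI) simp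
    then show "w o\<^sub>L y = y o\<^sub>L w" by (simp add: D_def)
  qed
  have "rotation_subalgebra R \<tau> v u l (Wstar T) w K"
  proof unfold_locales
    fix x assume "x \<in> Wstar T"
    then show "v o\<^sub>L (x o\<^sub>L adj v) \<in> Wstar T" "adj v o\<^sub>L (x o\<^sub>L v) \<in> Wstar T"
      using l_nonzero by (auto intro!: unitary_conjugate_Wstar[OF v Tb _ vT _ vT'])
  next
    show "v o\<^sub>L w = scalar_op l o\<^sub>L (w o\<^sub>L v)"
      by (intro blinfun_eqI) (simp add: w_def vu G_def calc_v[OF g])
    show "K \<in> Wstar T" unfolding K_def using N by (intro von_neumann_algebraD(9)[OF N(1)])
    have b: "bdd_borel (\<lambda>z. of_real ((cmod (f z))\<^sup>2)) (C * C)"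
      using bdd_borel_mult[OF f bdd_borel_cnj[OF f]] by (simp only: complex_norm_square)
    show "v o\<^sub>L K = K o\<^sub>L v" unfolding K by (rule calc_commute[OF b vb refl, symmetric])
    show "K \<notin> range scalar_op"
    proof
      assume "K \<in> range scalar_op"
      then obtain c where c: "K = scalar_op c" by blast
      \<comment> \<open>If \<open>|f|^2(v)\<close> were the scalar \<open>c\<close>, then
        \<open>|f|^2 - c\<close> would vanish almost everywhere for every spectral measure;
        \<open>|f|\<close> would be constantly \<open>sqrt (cmod c)\<close> there, and
        \<open>|f|(v)\<close> a scalar.\<close>
      have b': "bdd_borel (\<lambda>z. (-1) * c + of_real ((cmod (f z))\<^sup>2)) (cmod (-1) * cmod c + C * C)"
        by (rule bdd_borel_lin[OF bdd_borel_const b])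
      have "calc (\<lambda>z. (-1) * c + of_real ((cmod (f z))\<^sup>2)) = (scalar_op (-1) o\<^sub>L scalar_op c) + scalar_op c"
        unfolding calc_lin[OF bdd_borel_const b] calc_const K[symmetric] c ..
      then have z: "(calc (\<lambda>z. (-1) * c + of_real ((cmod (f z))\<^sup>2))) \<cdot> \<xi> = 0" for \<xi>
        by (simp add: blinfun.add_left scaleC_minus_one)
      have "calc h = calc (\<lambda>z. of_real (sqrt (cmod c)))"
      proof (rule calc_cong_AE)
        fix \<xi>
        show "AE z in spm \<xi>. h z = of_real (sqrt (cmod c))"
          using calc_apply_eq_0D[OF b' z]
        proof eventually_elim
          case (elim z)
          then have "c = of_real ((cmod (f z))\<^sup>2)" by (simp add: algebra_simps)
          then have "cmod c = (cmod (f z))\<^sup>2" by (simp del: of_real_power)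
          then show ?case by (simp add: h_def)
        qed
      qed (use h in \<open>auto simp: bdd_borel_def\<close>)
      then have "calc (\<lambda>z. of_real (cmod (f z))) \<in> range scalar_op" unfolding h_def[abs_def] calc_const by simp
      with ns show False ..
    qed
  qed (rule N(1) N_R w wN)+
  then show ?thesis unfolding T_def by blast
qed

text \<open>Elements of \<open>Linfty_circle\<close> are bounded only almost everywhere. Cutting off
  changes \<open>f\<close> on a null set for Haar measure, hence on a null set for every spectral
  measure, and the calculus does not notice.\<close>

lemma rotation_subalgebra_Wstar:
  assumes f: "f \<in> Linfty_circle" and nz: "AE z in circle_measure. f z \<noteq> 0"
    and ns: "calc (\<lambda>z. of_real (cmod (f z))) \<notin> range scalar_op"
  shows "\<exists>w k. rotation_subalgebra R \<tau> v u l (Wstar (u o\<^sub>L calc f)) w k"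
proof -
  obtain C where C: "AE z in circle_measure. cmod (f z) \<le> C" and "f \<in> borel_measurable circle_measure"
    using f by (auto simp: Linfty_circle_def)
  then have fm [measurable]: "f \<in> borel_measurable borel"
    using measurable_cong_sets[OF circle_supportedD(1)[OF circle_supported_circle_measure] refl] by blast
  define g where "g z = (if cmod (f z) \<le> \<bar>C\<bar> then f z else 0)" for z
  have gm [measurable]: "g \<in> borel_measurable borel" unfolding g_def by measurable
  have g: "bdd_borel g \<bar>C\<bar>" using gm by (auto simp: bdd_borel_def g_def)
  have fg: "AE z in circle_measure. f z = g z" using C by eventually_elim (auto simp: g_def)
  have 1: "calc f = calc g" using AE_spm[OF fg] by (intro calc_cong_AE) auto
  have fg': "AE z in circle_measure. complex_of_real (cmod (f z)) = of_real (cmod (g z))"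
    using fg by eventually_elim simp
  have 2: "calc (\<lambda>z. of_real (cmod (f z))) = calc (\<lambda>z. of_real (cmod (g z)))"
    using AE_spm[OF fg'] by (intro calc_cong_AE) auto
  have "AE z in circle_measure. g z \<noteq> 0" using fg nz by eventually_elim simp
  from rotation_subalgebra_Wstar_bdd[OF g this] ns show ?thesis unfolding 1 2 by blast
qed

end

section \<open>Density of trigonometric polynomials in the rotation factor\<close>

context rotation_factor
begin

inductive_set rot_alg :: "'h oper set" where
  monomial: "scalar_op c o\<^sub>L (upow u m o\<^sub>L upow v n) \<in> rot_alg"
| add: "x \<in> rot_alg \<Longrightarrow> y \<in> rot_alg \<Longrightarrow> x + y \<in> rot_alg"

lemma monomial_R: "scalar_op c o\<^sub>L (upow u m o\<^sub>L upow v n) \<in> R"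
  by (intro M_closed upow_M u v uR vR)

lemma rot_alg_R: "x \<in> rot_alg \<Longrightarrow> x \<in> R"
  by (induction rule: rot_alg.induct) (auto intro: monomial_R)

lemma monomial_mult:
  "(scalar_op a o\<^sub>L (upow u m o\<^sub>L upow v n)) o\<^sub>L (scalar_op b o\<^sub>L (upow u p o\<^sub>L upow v q))
    = scalar_op (a * b * l powi (p * n)) o\<^sub>L (upow u (m + p) o\<^sub>L upow v (n + q))"
proof (rule blinfun_eqI)
  fix x
  note ub = bounded_opsD[OF upow_bounded_ops[OF u]] and vb = bounded_opsD[OF upow_bounded_ops[OF v]]
  show "((scalar_op a o\<^sub>L (upow u m o\<^sub>L upow v n)) o\<^sub>L (scalar_op b o\<^sub>L (upow u p o\<^sub>L upow v q))) \<cdot> x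
    = (scalar_op (a * b * l powi (p * n)) o\<^sub>L (upow u (m + p) o\<^sub>L upow v (n + q))) \<cdot> x"
    by (simp add: ub vb upow_rel scaleC_scaleC upow_apply_add[OF u] upow_apply_add[OF v] mult.assoc)
qed

lemma monomial_adj:
  "adj (scalar_op a o\<^sub>L (upow u m o\<^sub>L upow v n)) = scalar_op (cnj a * l powi (m * n)) o\<^sub>L (upow u (- m) o\<^sub>L upow v (- n))"
proof -
  have "adj (scalar_op a o\<^sub>L (upow u m o\<^sub>L upow v n)) = (upow v (- n) o\<^sub>L upow u (- m)) o\<^sub>L scalar_op (cnj a)"
    using upow_bounded_ops[OF u] upow_bounded_ops[OF v] by (simp add: adj_compose adj_upow[OF u] adj_upow[OF v])
  also have "\<dots> = scalar_op (cnj a * l powi (m * n)) o\<^sub>L (upow u (- m) o\<^sub>L upow v (- n))"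
    by (intro blinfun_eqI)
      (simp add: upow_rel bounded_opsD[OF upow_bounded_ops[OF u]] bounded_opsD[OF upow_bounded_ops[OF v]] scaleC_scaleC mult.commute)
  finally show ?thesis .
qed

lemma rot_alg_mult:
  assumes "x \<in> rot_alg" "y \<in> rot_alg" shows "x o\<^sub>L y \<in> rot_alg"
  using assms(1)
proof (induction rule: rot_alg.induct)
  case (monomial a m n)
  show ?case using assms(2)
  proof (induction rule: rot_alg.induct)
    case (monomial b p q) show ?case unfolding monomial_mult by (rule rot_alg.monomial)
  next
    case (add x y) then show ?case by (simp add: compose_distribs rot_alg.add)
  qed
next
  case (add x y) then show ?case by (simp add: compose_distribs rot_alg.add)
qed

lemma rot_alg_adj: "x \<in> rot_alg \<Longrightarrow> adj x \<in> rot_alg"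
proof (induction rule: rot_alg.induct)
  case (monomial a m n) show ?case unfolding monomial_adj by (rule rot_alg.monomial)
next
  case (add x y)
  then show ?case using rot_alg_R by (simp add: adj_add rot_alg.add)
qed

lemma scalar_rot_alg: "scalar_op c \<in> rot_alg"
  using rot_alg.monomial[of c 0 0] by simp

lemma rot_alg_density:
  assumes x: "x \<in> R" and e: "0 < e" shows "\<exists>a\<in>rot_alg. tsq (x - a) < e"
proof (rule tr_density)
  show "rot_alg \<subseteq> R" using rot_alg_R by auto
  have "scalar_op 0 = (0 :: 'h oper)" by (intro blinfun_eqI) simp
  then show "0 \<in> rot_alg" using scalar_rot_alg[of 0] by simp
  have id: "id_blinfun \<in> rot_alg" using scalar_rot_alg[of 1] by simp
  show "\<eta> = 0" if "\<And>a. a \<in> rot_alg \<Longrightarrow> a \<cdot> \<eta> = 0" for \<eta> using that[OF id] by simp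
  have "u \<in> rot_alg" "v \<in> rot_alg"
    using rot_alg.monomial[of 1 1 0] rot_alg.monomial[of 1 0 1] u v by simp_all
  then have "commutant rot_alg \<subseteq> commutant {u, v}" by (intro commutant_antimono) auto
  then have "R \<subseteq> commutant (commutant rot_alg)" unfolding R_eq by (rule commutant_antimono)
  then show "x \<in> commutant (commutant rot_alg)" using x by auto
qed (auto intro: x e rot_alg_mult rot_alg_adj rot_alg.add scalar_rot_alg)

lemma tr_orthonormal:
  "\<tau> (adj (upow u p o\<^sub>L upow v q) o\<^sub>L (upow u m o\<^sub>L upow v n)) = (if p = m \<and> q = n then 1 else 0)"
proof -
  have "adj (upow u p o\<^sub>L upow v q) o\<^sub>L (upow u m o\<^sub>L upow v n) = upow v (- q) o\<^sub>L (upow u (m - p) o\<^sub>L upow v n)"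
    using upow_bounded_ops[OF u] upow_bounded_ops[OF v]
    by (intro blinfun_eqI) (simp add: adj_compose adj_upow[OF u] adj_upow[OF v] upow_apply_add[OF u])
  then have "\<tau> (adj (upow u p o\<^sub>L upow v q) o\<^sub>L (upow u m o\<^sub>L upow v n)) = \<tau> (upow v (- q) o\<^sub>L (upow u (m - p) o\<^sub>L upow v n))"
    by simp
  also have "\<dots> = \<tau> ((upow u (m - p) o\<^sub>L upow v n) o\<^sub>L upow v (- q))"
    using upow_M[OF u uR] upow_M[OF v vR] by (intro tr_comm) auto
  also have "(upow u (m - p) o\<^sub>L upow v n) o\<^sub>L upow v (- q) = upow u (m - p) o\<^sub>L upow v (n - q)"
    by (intro blinfun_eqI) (simp add: upow_apply_add[OF v])
  also have "\<tau> (upow u (m - p) o\<^sub>L upow v (n - q)) = (if p = m \<and> q = n then 1 else 0)"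
    unfolding tr_fourier by auto
  finally show ?thesis .
qed

end

section \<open>Standard representations\<close>

text \<open>\<open>D\<close> is an index set and \<open>U\<close> need not be injective: the
  estimate makes \<open>L x\<close> depend on \<open>U x\<close> alone. In its uses \<open>U\<close>
  sends an operator of the factor to its vector, and \<open>L\<close> to the vector of its product
  with a fixed operator.\<close>

lemma dense_extension:
  fixes U L :: "'x \<Rightarrow> 'k::chilbert"
  assumes dense: "closure (U ` D) = UNIV"
    and add: "\<And>x y. x \<in> D \<Longrightarrow> y \<in> D \<Longrightarrow> \<exists>z\<in>D. U z = U x + U y \<and> L z = L x + L y"
    and scale: "\<And>a x. x \<in> D \<Longrightarrow> \<exists>z\<in>D. U z = a *\<^sub>C U x \<and> L z = a *\<^sub>C L x"
    and bound: "\<And>x. x \<in> D \<Longrightarrow> norm (L x) \<le> C * norm (U x)"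
  shows "\<exists>T\<in>bounded_ops. \<forall>x\<in>D. T \<cdot> (U x) = L x"
proof -
  have diff: "norm (L x - L y) \<le> C * norm (U x - U y)" if xy: "x \<in> D" "y \<in> D" for x y
  proof -
    obtain y' where y': "y' \<in> D" "U y' = (-1) *\<^sub>C U y" "L y' = (-1) *\<^sub>C L y" using scale xy by blast
    then obtain z where "z \<in> D" "U z = U x + U y'" "L z = L x + L y'" using add xy by blast
    then show ?thesis using bound[of z] y' by (simp add: scaleC_minus_one)
  qed
  \<comment> \<open>A limit common to all approximating sequences makes the extension well
    defined.\<close>
  have "\<exists>l. \<forall>t. (\<forall>n. t n \<in> D) \<longrightarrow> (\<lambda>n. U (t n)) \<longlonglongrightarrow> z \<longrightarrow> (\<lambda>n. L (t n)) \<longlonglongrightarrow> l" for z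
  proof -
    have "z \<in> closure (U ` D)" using dense by simp
    then obtain s' where s': "\<And>n. s' n \<in> U ` D" "s' \<longlonglongrightarrow> z" unfolding closure_sequential by blast
    then have "\<forall>n. \<exists>x\<in>D. s' n = U x" by auto
    then obtain s where s: "\<And>n. s n \<in> D" "\<And>n. s' n = U (s n)" by metis
    have "s' = (\<lambda>n. U (s n))" using s(2) by auto
    then have Us: "(\<lambda>n. U (s n)) \<longlonglongrightarrow> z" using s'(2) by simp
    have "Cauchy (\<lambda>n. L (s n))"
    proof (rule metric_CauchyI)
      fix e :: real assume e: "0 < e"
      have "Cauchy (\<lambda>n. U (s n))" using Us by (rule LIMSEQ_imp_Cauchy)
      moreover have "0 < e / (\<bar>C\<bar> + 1)" using e by simp
      ultimately obtain M where M: "\<And>m n. m \<ge> M \<Longrightarrow> n \<ge> M \<Longrightarrow> dist (U (s m)) (U (s n)) < e / (\<bar>C\<bar> + 1)"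
        using metric_CauchyD by blast
      have "dist (L (s m)) (L (s n)) < e" if "m \<ge> M" "n \<ge> M" for m n
      proof -
        have "dist (L (s m)) (L (s n)) \<le> C * dist (U (s m)) (U (s n))" using diff[OF s(1) s(1)] by (simp add: dist_norm)
        also have "\<dots> \<le> (\<bar>C\<bar> + 1) * dist (U (s m)) (U (s n))" by (intro mult_right_mono) auto
        also have "\<dots> < e" using M[OF that] by (simp add: pos_less_divide_eq mult.commute)
        finally show ?thesis .
      qed
      then show "\<exists>M. \<forall>m\<ge>M. \<forall>n\<ge>M. dist (L (s m)) (L (s n)) < e" by blast
    qed
    then obtain l where l: "(\<lambda>n. L (s n)) \<longlonglongrightarrow> l" using Cauchy_convergent convergent_def by blast
    have "(\<lambda>n. L (t n)) \<longlonglongrightarrow> l" if t: "\<And>n. t n \<in> D" "(\<lambda>n. U (t n)) \<longlonglongrightarrow> z" for t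
    proof -
      have "(\<lambda>n. C * norm (U (t n) - U (s n))) \<longlonglongrightarrow> C * norm (z - z)" by (intro tendsto_intros t Us)
      then have null: "(\<lambda>n. C * norm (U (t n) - U (s n))) \<longlonglongrightarrow> 0" by simp
      have "(\<lambda>n. L (t n) - L (s n)) \<longlonglongrightarrow> 0"
        by (rule Lim_null_comparison[OF always_eventually null]) (intro allI diff t(1) s(1))
      from tendsto_add[OF this l] show ?thesis by simp
    qed
    then show ?thesis by blast
  qed
  then obtain T where T: "\<And>z t. (\<And>n. t n \<in> D) \<Longrightarrow> (\<lambda>n. U (t n)) \<longlonglongrightarrow> z \<Longrightarrow> (\<lambda>n. L (t n)) \<longlonglongrightarrow> T z" by metis
  have seq: "\<exists>t. (\<forall>n. t n \<in> D) \<and> (\<lambda>n. U (t n)) \<longlonglongrightarrow> z" for z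
  proof -
    have "z \<in> closure (U ` D)" using dense by simp
    then obtain s' where s': "\<And>n. s' n \<in> U ` D" "s' \<longlonglongrightarrow> z" unfolding closure_sequential by blast
    then have "\<forall>n. \<exists>x\<in>D. s' n = U x" by auto
    then obtain s where "\<And>n. s n \<in> D" "\<And>n. s' n = U (s n)" by metis
    moreover have "s' = (\<lambda>n. U (s n))" using calculation(2) by auto
    ultimately show ?thesis using s'(2) by (intro exI[of _ s]) simp
  qed
  have T_add: "T (x + y) = T x + T y" for x y
  proof -
    obtain s t where s: "\<And>n. s n \<in> D" "(\<lambda>n. U (s n)) \<longlonglongrightarrow> x" and t: "\<And>n. t n \<in> D" "(\<lambda>n. U (t n)) \<longlonglongrightarrow> y"
      using seq by metis
    have "\<forall>n. \<exists>z\<in>D. U z = U (s n) + U (t n) \<and> L z = L (s n) + L (t n)" using add s(1) t(1) by blast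
    then obtain r where r: "\<And>n. r n \<in> D" "\<And>n. U (r n) = U (s n) + U (t n)" "\<And>n. L (r n) = L (s n) + L (t n)" by metis
    have "(\<lambda>n. L (r n)) \<longlonglongrightarrow> T (x + y)" by (rule T[OF r(1)]) (auto simp: r(2) intro!: tendsto_intros s t)
    moreover have "(\<lambda>n. L (r n)) \<longlonglongrightarrow> T x + T y" unfolding r(3) by (intro tendsto_intros T s t)
    ultimately show ?thesis by (rule LIMSEQ_unique)
  qed
  have T_scale: "T (a *\<^sub>C x) = a *\<^sub>C T x" for a x
  proof -
    obtain s where s: "\<And>n. s n \<in> D" "(\<lambda>n. U (s n)) \<longlonglongrightarrow> x" using seq by metis
    have "\<forall>n. \<exists>z\<in>D. U z = a *\<^sub>C U (s n) \<and> L z = a *\<^sub>C L (s n)" using scale s(1) by blast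
    then obtain r where r: "\<And>n. r n \<in> D" "\<And>n. U (r n) = a *\<^sub>C U (s n)" "\<And>n. L (r n) = a *\<^sub>C L (s n)" by metis
    have "(\<lambda>n. L (r n)) \<longlonglongrightarrow> T (a *\<^sub>C x)" by (rule T[OF r(1)]) (auto simp: r(2) intro!: tendsto_intros s)
    moreover have "(\<lambda>n. L (r n)) \<longlonglongrightarrow> a *\<^sub>C T x" unfolding r(3) by (intro tendsto_intros T s)
    ultimately show ?thesis by (rule LIMSEQ_unique)
  qed
  have T_bound: "norm (T x) \<le> C * norm x" for x
  proof -
    obtain s where s: "\<And>n. s n \<in> D" "(\<lambda>n. U (s n)) \<longlonglongrightarrow> x" using seq by metis
    have "(\<lambda>n. norm (L (s n))) \<longlonglongrightarrow> norm (T x)" by (intro tendsto_intros T s)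
    moreover have "(\<lambda>n. C * norm (U (s n))) \<longlonglongrightarrow> C * norm x" by (intro tendsto_intros s)
    ultimately show ?thesis by (rule LIMSEQ_le) (use bound s(1) in auto)
  qed
  have bl: "bounded_linear T"
    by (rule bounded_linear_intro[of T C]) (auto simp: T_add T_scale[of "of_real r" for r, unfolded scaleC_of_real] mult.commute intro: T_bound[THEN order_trans])
  have TU: "T (U x) = L x" if "x \<in> D" for x
    using T[of "\<lambda>_. x" "U x"] that by (simp add: LIMSEQ_const_iff)
  show ?thesis
    by (rule bexI[of _ "Blinfun T"]) (auto simp: bounded_linear_Blinfun_apply[OF bl] TU T_scale intro: bounded_opsI)
qed

lemma cyclic_proj_eq:
  fixes M :: "'h::chilbert oper set"
  assumes S: "csubspace ((\<lambda>T :: 'h oper. T \<cdot> \<xi>) ` M)" and P: "ortho_proj (closure ((\<lambda>T :: 'h oper. T \<cdot> \<xi>) ` M)) P"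
  shows "cyclic_proj M \<xi> = P"
  unfolding cyclic_proj_def
proof (rule the_equality)
  let ?S = "(\<lambda>T :: 'h oper. T \<cdot> \<xi>) ` M"
  have sub: "?S \<subseteq> closure ?S" by (rule closure_subset)
  show "P \<in> bounded_ops \<and> (\<forall>x. P \<cdot> x \<in> closure ?S \<and> (\<forall>T\<in>M. cinner (x - P \<cdot> x) (T \<cdot> \<xi>) = 0))"
    using P sub unfolding ortho_proj_def by blast
  fix Q assume Q: "Q \<in> bounded_ops \<and> (\<forall>x. Q \<cdot> x \<in> closure ?S \<and> (\<forall>T\<in>M. cinner (x - Q \<cdot> x) (T \<cdot> \<xi>) = 0))"
  show "Q = P"
  proof (rule blinfun_eqI, rule ortho_proj_eqI[symmetric, OF csubspace_closure[OF S] P])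
    fix x show "Q \<cdot> x \<in> closure ?S" using Q by blast
    fix k assume "k \<in> closure ?S"
    then obtain K where K: "\<And>n. K n \<in> ?S" "K \<longlonglongrightarrow> k" unfolding closure_sequential by blast
    have "cinner (x - Q \<cdot> x) (K n) = 0" for n using K(1)[of n] Q by auto
    moreover have "(\<lambda>n. cinner (x - Q \<cdot> x) (K n)) \<longlonglongrightarrow> cinner (x - Q \<cdot> x) k"
      by (intro tendsto_intros K)
    ultimately show "cinner (x - Q \<cdot> x) k = 0" by (simp add: LIMSEQ_const_iff)
  qed
qed

locale gns_rep = factor_trace M \<tau>
  for M :: "'h::chilbert oper set" and \<tau> +
  fixes \<pi> :: "'h oper \<Rightarrow> 'k::chilbert oper" and \<Omega> :: 'k
  assumes pi_bounded: "x \<in> M \<Longrightarrow> \<pi> x \<in> bounded_ops"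
    and pi_add: "x \<in> M \<Longrightarrow> y \<in> M \<Longrightarrow> \<pi> (x + y) = \<pi> x + \<pi> y"
    and pi_mult: "x \<in> M \<Longrightarrow> y \<in> M \<Longrightarrow> \<pi> (x o\<^sub>L y) = \<pi> x o\<^sub>L \<pi> y"
    and pi_scale: "x \<in> M \<Longrightarrow> \<pi> (scalar_op a o\<^sub>L x) = scalar_op a o\<^sub>L \<pi> x"
    and pi_adj: "x \<in> M \<Longrightarrow> \<pi> (adj x) = adj (\<pi> x)"
    and pi_dense: "closure ((\<lambda>x. (\<pi> x) \<cdot> \<Omega>) ` M) = UNIV"
    and pi_trace: "x \<in> M \<Longrightarrow> cinner (\<pi> x \<cdot> \<Omega>) \<Omega> = \<tau> x"
begin

definition gns_vec :: "'h oper \<Rightarrow> 'k" where "gns_vec x = (\<pi> x) \<cdot> \<Omega>"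

lemma gns_vec_pi: "x \<in> M \<Longrightarrow> y \<in> M \<Longrightarrow> (\<pi> x) \<cdot> (gns_vec y) = gns_vec (x o\<^sub>L y)"
  by (simp add: gns_vec_def pi_mult)

lemma gns_vec_add: "x \<in> M \<Longrightarrow> y \<in> M \<Longrightarrow> gns_vec (x + y) = gns_vec x + gns_vec y"
  by (simp add: gns_vec_def pi_add blinfun.add_left)

lemma gns_vec_scale: "x \<in> M \<Longrightarrow> gns_vec (scalar_op a o\<^sub>L x) = a *\<^sub>C gns_vec x"
  by (simp add: gns_vec_def pi_scale)

lemma gns_vec_diff: "x \<in> M \<Longrightarrow> y \<in> M \<Longrightarrow> gns_vec (x - y) = gns_vec x - gns_vec y"
  using gns_vec_add[of "x - y" y] by simp

lemma gns_vec_cinner: "x \<in> M \<Longrightarrow> y \<in> M \<Longrightarrow> cinner (gns_vec x) (gns_vec y) = \<tau> (adj y o\<^sub>L x)"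
  using pi_trace[of "adj y o\<^sub>L x"]
  by (simp add: gns_vec_def pi_mult pi_adj cinner_adj_left[OF pi_bounded])

lemma gns_vec_norm: "x \<in> M \<Longrightarrow> (norm (gns_vec x))\<^sup>2 = tsq x"
  using gns_vec_cinner[of x x] by (simp add: cinner_self tsq_eq flip: of_real_power)

lemma gns_vec_norm_adj: "x \<in> M \<Longrightarrow> norm (gns_vec (adj x)) = norm (gns_vec x)"
  using gns_vec_norm[of x] gns_vec_norm[of "adj x"] tsq_adj[of x]
  by (metis M_closed(1) norm_ge_zero power2_eq_imp_eq)

lemma gns_vec_dense: "closure (gns_vec ` M) = UNIV"
  using pi_dense by (simp add: gns_vec_def[abs_def])

lemma gns_vec_eq_0D: "x \<in> M \<Longrightarrow> gns_vec x = 0 \<Longrightarrow> x = 0"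
  using gns_vec_norm[of x] by (intro tr_faithful) auto

lemma dense_eqI:
  fixes A B :: "'k oper"
  assumes "\<And>x. x \<in> M \<Longrightarrow> A \<cdot> (gns_vec x) = B \<cdot> (gns_vec x)" shows "A = B"
proof (rule blinfun_eqI)
  fix z
  have "z \<in> closure (gns_vec ` M)" using gns_vec_dense by simp
  then obtain Z where Z: "\<And>n. Z n \<in> gns_vec ` M" "Z \<longlonglongrightarrow> z" unfolding closure_sequential by blast
  have "A \<cdot> (Z n) = B \<cdot> (Z n)" for n using Z(1)[of n] assms by auto
  then have "(\<lambda>n. A \<cdot> (Z n)) \<longlonglongrightarrow> B \<cdot> z"
    using Z(2) by (simp add: tendsto_intros)
  moreover have "(\<lambda>n. A \<cdot> (Z n)) \<longlonglongrightarrow> A \<cdot> z" by (intro tendsto_intros Z)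
  ultimately show "A \<cdot> z = B \<cdot> z" by (simp add: LIMSEQ_unique)
qed

text \<open>Unitality is not listed in \<open>standard_representation\<close>; it follows from
  density of the vectors \<open>gns_vec x\<close>.\<close>

lemma pi_id: "\<pi> id_blinfun = id_blinfun"
  by (rule dense_eqI) (simp add: gns_vec_pi)

lemma gns_vec_id: "gns_vec id_blinfun = \<Omega>" by (simp add: gns_vec_def pi_id)

lemma pi_unitary: "unitary_op a \<Longrightarrow> a \<in> M \<Longrightarrow> unitary_op (\<pi> a)"
  using pi_mult[of "adj a" a] pi_mult[of a "adj a"] by (auto simp: unitary_op_def pi_adj pi_id pi_bounded)

text \<open>Right multiplication by \<open>a\<close>, that is \<open>J a^* J\<close> for the modular
  conjugation \<open>J\<close>. For unitary \<open>a\<close> in \<open>M\<close> the trace property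
  makes it isometric, which gives its boundedness, and density makes the choice unique.\<close>

definition rmult :: "'h oper \<Rightarrow> 'k oper" where
  "rmult a = (SOME \<rho>. \<rho> \<in> bounded_ops \<and> (\<forall>x\<in>M. \<rho> \<cdot> (gns_vec x) = gns_vec (x o\<^sub>L a)))"

lemma rmult:
  assumes a: "unitary_op a" "a \<in> M"
  shows "rmult a \<in> bounded_ops" "x \<in> M \<Longrightarrow> (rmult a) \<cdot> (gns_vec x) = gns_vec (x o\<^sub>L a)"
proof -
  have "\<exists>T\<in>bounded_ops. \<forall>x\<in>M. T \<cdot> (gns_vec x) = gns_vec (x o\<^sub>L a)"
  proof (rule dense_extension[OF gns_vec_dense])
    show "\<exists>z\<in>M. gns_vec z = gns_vec x + gns_vec y \<and> gns_vec (z o\<^sub>L a) = gns_vec (x o\<^sub>L a) + gns_vec (y o\<^sub>L a)" if "x \<in> M" "y \<in> M" for x y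
      using that a by (intro bexI[of _ "x + y"]) (auto simp: gns_vec_add compose_distribs)
    show "\<exists>z\<in>M. gns_vec z = c *\<^sub>C gns_vec x \<and> gns_vec (z o\<^sub>L a) = c *\<^sub>C gns_vec (x o\<^sub>L a)" if "x \<in> M" for c x
    proof (intro bexI[of _ "scalar_op c o\<^sub>L x"] conjI)
      have "(scalar_op c o\<^sub>L x) o\<^sub>L a = scalar_op c o\<^sub>L (x o\<^sub>L a)" by (intro blinfun_eqI) simp
      then show "gns_vec ((scalar_op c o\<^sub>L x) o\<^sub>L a) = c *\<^sub>C gns_vec (x o\<^sub>L a)" using that a by (simp add: gns_vec_scale)
    qed (use that in \<open>auto simp: gns_vec_scale\<close>)
    show "norm (gns_vec (x o\<^sub>L a)) \<le> 1 * norm (gns_vec x)" if x: "x \<in> M" for x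
    proof -
      have "tsq (x o\<^sub>L a) = Re (\<tau> (adj a o\<^sub>L ((adj x o\<^sub>L x) o\<^sub>L a)))"
        using x a(2) unfolding tsq_def by (simp add: adj_compose) (simp add: blinfun_compose_assoc)
      also have "\<tau> (adj a o\<^sub>L ((adj x o\<^sub>L x) o\<^sub>L a)) = \<tau> (((adj x o\<^sub>L x) o\<^sub>L a) o\<^sub>L adj a)"
        using x a(2) by (intro tr_comm) auto
      also have "((adj x o\<^sub>L x) o\<^sub>L a) o\<^sub>L adj a = adj x o\<^sub>L x"
        using unitary_opD[OF a(1)] by (intro blinfun_eqI) simp
      finally have "(norm (gns_vec (x o\<^sub>L a)))\<^sup>2 = (norm (gns_vec x))\<^sup>2" using x a(2) by (simp add: gns_vec_norm tsq_def)
      then show ?thesis by (simp add: power2_eq_iff_nonneg)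
    qed
  qed
  then have "\<exists>\<rho>. \<rho> \<in> bounded_ops \<and> (\<forall>x\<in>M. \<rho> \<cdot> (gns_vec x) = gns_vec (x o\<^sub>L a))" by blast
  from someI_ex[OF this] show "rmult a \<in> bounded_ops" "x \<in> M \<Longrightarrow> (rmult a) \<cdot> (gns_vec x) = gns_vec (x o\<^sub>L a)"
    unfolding rmult_def by auto
qed

lemma rmult_pi:
  assumes a: "unitary_op a" "a \<in> M" and y: "y \<in> M"
  shows "rmult a \<cdot> \<pi> y \<cdot> z = (\<pi> y) \<cdot> rmult a \<cdot> z"
proof -
  have "rmult a o\<^sub>L \<pi> y = \<pi> y o\<^sub>L rmult a"
  proof (rule dense_eqI)
    fix x assume x: "x \<in> M"
    have "(y o\<^sub>L x) o\<^sub>L a = y o\<^sub>L (x o\<^sub>L a)" by (intro blinfun_eqI) simp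
    then show "(rmult a o\<^sub>L \<pi> y) \<cdot> (gns_vec x) = (\<pi> y o\<^sub>L rmult a) \<cdot> (gns_vec x)"
      using x a y by (simp add: gns_vec_pi rmult)
  qed
  then show ?thesis by (rule blinfun_pull)
qed

lemma rmult_commutant: "unitary_op a \<Longrightarrow> a \<in> M \<Longrightarrow> S \<subseteq> M \<Longrightarrow> rmult a \<in> commutant (\<pi> ` S)"
  by (rule commutantI) (auto intro!: blinfun_eqI simp: rmult rmult_pi subset_iff)

lemma rmult_Omega: "unitary_op a \<Longrightarrow> a \<in> M \<Longrightarrow> (rmult a) \<cdot> \<Omega> = gns_vec a"
  using rmult(2)[of a id_blinfun] by (simp add: gns_vec_id)

lemma rmult_unitary:
  assumes a: "unitary_op a" "a \<in> M"
  shows "unitary_op (rmult a)" "adj (rmult a) = rmult (adj a)"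
proof -
  have a': "unitary_op (adj a)" "adj a \<in> M" using a unitary_op_adj by auto
  have inv: "(x o\<^sub>L a) o\<^sub>L adj a = x" "(x o\<^sub>L adj a) o\<^sub>L a = x" for x :: "'h oper"
    using unitary_opD[OF a(1)] by (auto intro!: blinfun_eqI)
  have 1: "rmult (adj a) o\<^sub>L rmult a = id_blinfun" "rmult a o\<^sub>L rmult (adj a) = id_blinfun"
    by (rule dense_eqI, use a a' in \<open>simp add: rmult inv\<close>)+
  have iso: "cinner (rmult a \<cdot> x) (rmult a \<cdot> y) = cinner x y" for x y
  proof -
    have "adj (rmult a) o\<^sub>L rmult a = id_blinfun"
    proof (rule dense_eqI, rule cinner_ext_left)
      fix x z assume x: "x \<in> M"
      have "z \<in> closure (gns_vec ` M)" using gns_vec_dense by simp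
      then obtain Z where Z: "\<And>n. Z n \<in> gns_vec ` M" "Z \<longlonglongrightarrow> z" unfolding closure_sequential by blast
      have "cinner (rmult a \<cdot> (gns_vec x)) ((rmult a) \<cdot> (gns_vec y)) = cinner (gns_vec x) (gns_vec y)" if y: "y \<in> M" for y
      proof -
        have "\<tau> (adj (y o\<^sub>L a) o\<^sub>L (x o\<^sub>L a)) = \<tau> (adj a o\<^sub>L ((adj y o\<^sub>L x) o\<^sub>L a))"
          using y a(2) by (simp add: adj_compose) (simp add: blinfun_compose_assoc)
        also have "\<dots> = \<tau> (((adj y o\<^sub>L x) o\<^sub>L a) o\<^sub>L adj a)" using x y a(2) by (intro tr_comm) auto
        finally show ?thesis using x y a by (simp add: rmult gns_vec_cinner inv)
      qed
      then have "cinner (rmult a \<cdot> (gns_vec x)) ((rmult a) \<cdot> (Z n)) = cinner (gns_vec x) (Z n)" for n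
        using Z(1)[of n] by auto
      then have "(\<lambda>n. cinner (gns_vec x) (Z n)) \<longlonglongrightarrow> cinner (rmult a \<cdot> (gns_vec x)) ((rmult a) \<cdot> z)"
        using tendsto_cinner[OF tendsto_const, of "\<lambda>n. (rmult a) \<cdot> (Z n)" "rmult a \<cdot> z" sequentially "rmult a \<cdot> (gns_vec x)"] Z(2)
        by (simp add: blinfun.tendsto)
      moreover have "(\<lambda>n. cinner (gns_vec x) (Z n)) \<longlonglongrightarrow> cinner (gns_vec x) z" by (intro tendsto_intros Z)
      ultimately show "cinner ((adj (rmult a) o\<^sub>L rmult a) \<cdot> (gns_vec x)) z = cinner (id_blinfun \<cdot> (gns_vec x)) z"
        using rmult(1)[OF a] by (simp add: cinner_adj_left LIMSEQ_unique)
    qed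
    then have "adj (rmult a) \<cdot> rmult a \<cdot> x = x"
      by (metis blinfun_apply_blinfun_compose id_blinfun.rep_eq id_apply)
    then show ?thesis using adj_props(2)[OF adj_closed[OF rmult(1)[OF a]]] rmult(1)[OF a] by (metis cinner_adj_left)
  qed
  have 2: "rmult a \<cdot> rmult (adj a) \<cdot> y = y" for y
    using 1(2) by (metis blinfun_apply_blinfun_compose id_blinfun.rep_eq id_apply)
  show "adj (rmult a) = rmult (adj a)"
    by (rule adj_unique) (use iso 2 in metis)
  then show "unitary_op (rmult a)" using 1 rmult(1)[OF a] by (simp add: unitary_op_def)
qed

end

section \<open>The subfactor in the standard representation\<close>

text \<open>Unitarity gives \<open>cinner x y = \<alpha> * cnj \<beta> * cinner x y\<close>, and
  \<open>cnj \<beta>\<close> is the inverse of \<open>\<beta>\<close>.\<close>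

lemma eigen_orthogonal:
  assumes C: "unitary_op C" "C \<cdot> x = \<alpha> *\<^sub>C x" "C \<cdot> y = \<beta> *\<^sub>C y"
    and ne: "\<alpha> \<noteq> \<beta>" and \<beta>: "cmod \<beta> = 1"
  shows "cinner x y = 0"
proof (rule ccontr)
  assume nz: "cinner x y \<noteq> 0"
  have "cinner x y = \<alpha> * cnj \<beta> * cinner x y"
    using unitary_cinner[OF C(1), of x y] unfolding C(2,3) by (simp add: cinner_scaleC_left cinner_scaleC_right mult_ac)
  then have 1: "\<alpha> * cnj \<beta> = 1" using nz by simp
  have "cnj \<beta> * \<beta> = 1" using complex_norm_square[of \<beta>] \<beta> by (simp add: mult.commute)
  then have "\<alpha> * (cnj \<beta> * \<beta>) = \<alpha>" by simp
  then have "\<alpha> = \<beta>" using 1 by (simp add: mult.assoc[symmetric])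
  then show False using ne by simp
qed

lemma total_eqI:
  fixes A B :: "'k::chilbert oper"
  assumes A: "A \<in> bounded_ops" and B: "B \<in> bounded_ops"
    and total: "\<And>\<zeta>. (\<And>i. cinner \<zeta> (s i) = 0) \<Longrightarrow> \<zeta> = 0"
    and eq: "\<And>i. A \<cdot> (s i) = B \<cdot> (s i)"
  shows "A = B"
proof -
  have D: "A - B \<in> bounded_ops" using A B by auto
  have "adj (A - B) \<cdot> \<zeta> = 0" for \<zeta>
    by (rule total) (simp add: cinner_adj_left[OF D] blinfun.diff_left eq)
  then have "(A - B) \<cdot> x = 0" for x
    by (intro cinner_ext_left) (simp add: adj_props(2)[OF D])
  then show ?thesis by (intro blinfun_eqI) (simp add: blinfun.diff_left)
qed

locale rotation_gns = rotation_subalgebra R \<tau> v u l N w k + gns_rep R \<tau> \<pi> \<Omega>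
  for R :: "'h::chilbert oper set" and \<tau> v u l N w k
    and \<pi> :: "'h oper \<Rightarrow> 'k::chilbert oper" and \<Omega>
begin

lemma N_in_R: "x \<in> N \<Longrightarrow> x \<in> R" using N_R by auto

lemmas N_closed [intro] = von_neumann_algebraD(3-9)[OF N_vN]

lemma l_powi_inj: "l powi m = l powi n \<longleftrightarrow> m = n"
proof
  assume "l powi m = l powi n"
  then have "l powi (m - n) = 1" using l_nonzero by (simp add: power_int_diff)
  then show "m = n" using l_powi[of "m - n"] by auto
qed simp

lemma cmod_l_powi: "cmod (l powi m) = 1" using l1 by (simp add: norm_power_int)

lemma upow_v_R [intro, simp]: "upow v n \<in> R" and upow_u_R [intro, simp]: "upow u n \<in> R"
  and upow_w_R [intro, simp]: "upow w n \<in> R"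
  using upow_M v vR u uR w N_in_R by auto

lemma upow_w_N [intro]: "upow w n \<in> N"
  using upow_commutant[of w "commutant N"] w N_closed(1)[OF w(2)] by (simp add: von_neumann_algebraD(2)[OF N_vN])

definition b :: "int \<Rightarrow> int \<Rightarrow> 'k" where "b m n = gns_vec (upow u m o\<^sub>L upow v n)"

lemma b_0: "b 0 n = gns_vec (upow v n)" by (simp add: b_def)

lemma b_total: assumes "\<And>m n. cinner \<zeta> (b m n) = 0" shows "\<zeta> = 0"
proof -
  have alg: "cinner \<zeta> (gns_vec a) = 0" if "a \<in> rot_alg" for a using that
  proof (induction rule: rot_alg.induct)
    case (monomial c m n)
    have "gns_vec (scalar_op c o\<^sub>L (upow u m o\<^sub>L upow v n)) = c *\<^sub>C b m n"
      unfolding b_def by (intro gns_vec_scale) auto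
    then show ?case using assms by (simp add: cinner_scaleC_right)
  next
    case (add x y)
    then show ?case using rot_alg_R by (simp add: gns_vec_add cinner_add_right)
  qed
  have R0: "cinner \<zeta> (gns_vec x) = 0" if x: "x \<in> R" for x
  proof (rule ccontr)
    assume "cinner \<zeta> (gns_vec x) \<noteq> 0"
    then have p: "0 < cmod (cinner \<zeta> (gns_vec x))" by simp
    \<comment> \<open>Chosen so that the error \<open>norm \<zeta> * d\<close> stays below the
      modulus of the inner product; adding 1 avoids division by zero.\<close>
    define d where "d = cmod (cinner \<zeta> (gns_vec x)) / (norm \<zeta> + 1)"
    have n1: "norm \<zeta> + 1 > 0" using norm_ge_zero[of \<zeta>] by linarith
    have d: "0 < d" unfolding d_def using p n1 by simp
    then obtain a where a: "a \<in> rot_alg" "tsq (x - a) < d\<^sup>2" using rot_alg_density[OF x, of "d\<^sup>2"] by auto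
    then have aR: "a \<in> R" using rot_alg_R by auto
    have "(norm (gns_vec (x - a)))\<^sup>2 < d\<^sup>2" using a x aR by (simp add: gns_vec_norm)
    then have lt: "norm (gns_vec (x - a)) < d" using d by (simp add: power2_less_imp_less)
    have "cinner \<zeta> (gns_vec x) = cinner \<zeta> (gns_vec (x - a))"
      using alg[OF a(1)] x aR by (simp add: gns_vec_diff cinner_diff_right)
    then have "cmod (cinner \<zeta> (gns_vec x)) \<le> norm \<zeta> * norm (gns_vec (x - a))" by (simp add: cmod_cinner_le)
    also have "\<dots> \<le> norm \<zeta> * d" using lt by (intro mult_left_mono) auto
    also have "\<dots> < (norm \<zeta> + 1) * d" using d by simp
    also have "\<dots> = cmod (cinner \<zeta> (gns_vec x))" unfolding d_def using n1 by simp
    finally show False by simp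
  qed
  have "\<zeta> \<in> closure (gns_vec ` R)" using gns_vec_dense by simp
  then obtain Z where Z: "\<And>n. Z n \<in> gns_vec ` R" "Z \<longlonglongrightarrow> \<zeta>" unfolding closure_sequential by blast
  have "cinner \<zeta> (Z n) = 0" for n
  proof -
    obtain x where "x \<in> R" "Z n = gns_vec x" using Z(1)[of n] by blast
    then show ?thesis using R0 by simp
  qed
  moreover have "(\<lambda>n. cinner \<zeta> (Z n)) \<longlonglongrightarrow> cinner \<zeta> \<zeta>" by (intro tendsto_intros Z)
  ultimately have "cinner \<zeta> \<zeta> = 0" by (simp add: LIMSEQ_const_iff)
  then show ?thesis by simp
qed

lemma b_cinner: "cinner (b m n) (b p q) = (if p = m \<and> q = n then 1 else 0)"
  unfolding b_def using tr_orthonormal[of p q m n] by (subst gns_vec_cinner) auto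

subsection \<open>Conjugations and the projection onto the closure of \<open>N \<Omega>\<close>\<close>

text \<open>For unitary \<open>a\<close> this implements the conjugation of operators by
  \<open>a\<close> on their vectors.\<close>

definition cj :: "'h oper \<Rightarrow> 'k oper" where "cj a = \<pi> a o\<^sub>L rmult (adj a)"

lemma cj_vec:
  "unitary_op a \<Longrightarrow> a \<in> R \<Longrightarrow> x \<in> R \<Longrightarrow> (cj a) \<cdot> (gns_vec x) = gns_vec (a o\<^sub>L (x o\<^sub>L adj a))"
  by (simp add: cj_def rmult unitary_op_adj gns_vec_pi)

lemma cj_unitary: "unitary_op a \<Longrightarrow> a \<in> R \<Longrightarrow> unitary_op (cj a)"
  unfolding cj_def by (intro unitary_op_compose pi_unitary rmult_unitary unitary_op_adj) auto

lemma adj_cj: assumes a: "unitary_op a" "a \<in> R" shows "adj (cj a) = cj (adj a)"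
proof -
  have a': "unitary_op (adj a)" "adj a \<in> R" using a unitary_op_adj by auto
  have "adj (cj a) = rmult a o\<^sub>L \<pi> (adj a)"
    using a a' rmult[OF a'] rmult_unitary(2)[OF a'] by (simp add: cj_def adj_compose pi_bounded pi_adj)
  also have "\<dots> = \<pi> (adj a) o\<^sub>L rmult a" using a a' by (intro blinfun_eqI) (simp add: rmult_pi)
  finally show ?thesis using a by (simp add: cj_def)
qed

lemma conj_v_monomial:
  "upow v j o\<^sub>L ((upow u m o\<^sub>L upow v n) o\<^sub>L adj (upow v j)) = scalar_op (l powi (m * j)) o\<^sub>L (upow u m o\<^sub>L upow v n)"
  by (intro blinfun_eqI) (simp add: adj_upow[OF v] upow_apply_add[OF v] upow_rel)

lemma cj_v_b: "cj (upow v j) \<cdot> (b m n) = (l powi (m * j)) *\<^sub>C b m n"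
  unfolding b_def by (subst cj_vec) (auto simp: upow_unitary[OF v] conj_v_monomial gns_vec_scale)

lemma cj_v_b1: "cj v \<cdot> (b m n) = (l powi m) *\<^sub>C b m n"
  using cj_v_b[of 1 m n] by (simp add: v)

lemma vw: "v \<cdot> w \<cdot> x = l *\<^sub>C w \<cdot> v \<cdot> x"
  using arg_cong[OF w(3), of "\<lambda>T. T \<cdot> x"] by simp

lemma v_upow_w: "v \<cdot> upow w j \<cdot> x = (l powi j) *\<^sub>C (upow w j) \<cdot> v \<cdot> x"
proof -
  have "w \<cdot> v \<cdot> x = inverse l *\<^sub>C v \<cdot> w \<cdot> x" for x
    using vw l_nonzero by (simp add: scaleC_scaleC)
  then have "upow w j \<cdot> v \<cdot> x = (inverse l powi j) *\<^sub>C v \<cdot> upow w j \<cdot> x"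
    using upow_scaled_commute[OF w(1), of "inverse l" "blinfun_apply v"] l_nonzero by simp
  then show ?thesis using l_nonzero by (simp add: scaleC_scaleC power_int_inverse)
qed

lemma cj_w_b: "cj w \<cdot> (b 0 n) = (l powi (- n)) *\<^sub>C b 0 n"
proof -
  have *: "upow v n \<cdot> w \<cdot> x = (l powi n) *\<^sub>C w \<cdot> upow v n \<cdot> x" for x
    by (rule upow_scaled_commute[where u = "blinfun_apply w", OF v l_nonzero vw])
  have "w o\<^sub>L (upow v n o\<^sub>L adj w) = scalar_op (l powi (- n)) o\<^sub>L upow v n"
  proof (rule blinfun_eqI)
    fix x
    have "upow v n \<cdot> x = (l powi n) *\<^sub>C w \<cdot> upow v n \<cdot> adj w \<cdot> x"
      using *[of "adj w \<cdot> x"] by (simp add: unitary_opD[OF w(1)])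
    then show "(w o\<^sub>L (upow v n o\<^sub>L adj w)) \<cdot> x = (scalar_op (l powi (- n)) o\<^sub>L upow v n) \<cdot> x"
      using l_nonzero by (simp add: scaleC_scaleC power_int_minus)
  qed
  then show ?thesis unfolding b_0 using w N_in_R by (simp add: cj_vec gns_vec_scale)
qed

text \<open>\<open>b m n\<close> belongs to the eigenvalue \<open>l powi m\<close>, which differs
  from 1 for \<open>m \<noteq> 0\<close>. So the vectors fixed by conjugation with \<open>v\<close>
  form the closed span of the \<open>b 0 n\<close>.\<close>

lemma fixed_orthogonal: "cj v \<cdot> \<zeta> = \<zeta> \<Longrightarrow> m \<noteq> 0 \<Longrightarrow> cinner \<zeta> (b m n) = 0"
  by (rule eigen_orthogonal[OF cj_unitary[OF v vR] _ cj_v_b1, of \<zeta> 1])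
    (use l_powi in \<open>auto simp: cmod_l_powi\<close>)

definition M0 :: "'k set" where "M0 = closure (gns_vec ` N)"

lemma csubspace_vec_N: "csubspace (gns_vec ` N)"
  unfolding csubspace_def
proof (intro conjI ballI allI)
  have "gns_vec 0 = 0" using gns_vec_scale[of 0 0] by (simp add: blinfun.zero_left)
  then show "0 \<in> gns_vec ` N" by (metis N_closed(4) image_eqI)
  fix x assume "x \<in> gns_vec ` N"
  then obtain a where a: "a \<in> N" "x = gns_vec a" by blast
  show "c *\<^sub>C x \<in> gns_vec ` N" for c
    using a N_in_R by (intro image_eqI[of _ _ "scalar_op c o\<^sub>L a"]) (auto simp: gns_vec_scale)
  fix y assume "y \<in> gns_vec ` N"
  then obtain c where c: "c \<in> N" "y = gns_vec c" by blast
  show "x + y \<in> gns_vec ` N"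
    using a c N_in_R by (intro image_eqI[of _ _ "a + c"]) (auto simp: gns_vec_add)
qed

lemma M0: "csubspace M0" "closed M0" "x \<in> N \<Longrightarrow> gns_vec x \<in> M0"
  unfolding M0_def using csubspace_closure[OF csubspace_vec_N] subsetD[OF closure_subset imageI] by auto

text \<open>The Jones projection of \<open>N\<close>; the choice is harmless, as an orthogonal
  projection is determined by its range.\<close>

definition E :: "'k oper" where "E = (SOME P. ortho_proj M0 P)"

lemma E: "ortho_proj M0 E"
  unfolding E_def using ortho_proj_exists[OF M0(1,2)] by (rule someI_ex)

lemma E_bounded: "E \<in> bounded_ops" using ortho_projD(1)[OF E] .

lemma E_commuteI:
  assumes T: "T \<in> bounded_ops"
    and "\<And>x. x \<in> N \<Longrightarrow> T \<cdot> (gns_vec x) \<in> gns_vec ` N"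
    and "\<And>x. x \<in> N \<Longrightarrow> (adj T) \<cdot> (gns_vec x) \<in> gns_vec ` N"
  shows "E \<cdot> T \<cdot> x = T \<cdot> E \<cdot> x"
proof -
  have "S \<cdot> k \<in> M0" if "\<And>x. x \<in> N \<Longrightarrow> S \<cdot> (gns_vec x) \<in> gns_vec ` N" "k \<in> M0" for S k
    using that(2) unfolding M0_def
    by (rule blinfun_closure_invariant[rotated]) (use that(1) in \<open>auto intro: subsetD[OF closure_subset]\<close>)
  with assms have "E o\<^sub>L T = T o\<^sub>L E" by (intro ortho_proj_commute[OF M0(1) E T]) blast+
  then show ?thesis by (rule blinfun_pull)
qed

lemma E_pi: "x \<in> N \<Longrightarrow> E \<cdot> \<pi> x \<cdot> z = (\<pi> x) \<cdot> E \<cdot> z"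
  by (rule E_commuteI) (auto simp: pi_bounded N_in_R gns_vec_pi pi_adj[symmetric])

lemma E_commutant: "E \<in> commutant (\<pi> ` N)"
  by (rule commutantI[OF E_bounded]) (auto intro!: blinfun_eqI simp: E_pi)

lemma E_cj_v: "E \<cdot> cj v \<cdot> x = (cj v) \<cdot> E \<cdot> x"
proof (rule E_commuteI)
  show "cj v \<in> bounded_ops" using unitary_opD(1)[OF cj_unitary[OF v vR]] .
  show "cj v \<cdot> (gns_vec x) \<in> gns_vec ` N" if "x \<in> N" for x
    using that N_conj(1)[OF that] by (simp add: cj_vec v vR N_in_R)
  show "adj (cj v) \<cdot> (gns_vec x) \<in> gns_vec ` N" if "x \<in> N" for x
    using that N_conj(2)[OF that] unitary_opD(1)[OF v] by (simp add: adj_cj cj_vec v vR N_in_R unitary_op_adj)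
qed

lemma E_cj_w: "E \<cdot> cj w \<cdot> x = (cj w) \<cdot> E \<cdot> x"
proof (rule E_commuteI)
  have wR: "w \<in> R" using w N_in_R by auto
  show "cj w \<in> bounded_ops" using unitary_opD(1)[OF cj_unitary[OF w(1) wR]] .
  show "cj w \<cdot> (gns_vec x) \<in> gns_vec ` N" if "x \<in> N" for x
    using that w wR by (auto simp: cj_vec N_in_R)
  show "adj (cj w) \<cdot> (gns_vec x) \<in> gns_vec ` N" if "x \<in> N" for x
    using that w wR by (auto simp: adj_cj cj_vec N_in_R unitary_op_adj)
qed

text \<open>\<open>E (v\<^sup>j \<Omega>)\<close> is a joint eigenvector of the two conjugations with the eigenvalues of \<open>v\<^sup>j \<Omega>\<close>, which
  are simple.\<close>

lemma E_b_0: "E \<cdot> (b 0 j) = (if b 0 j \<in> M0 then b 0 j else 0)"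
proof (cases "b 0 j \<in> M0")
  case True
  then show ?thesis using ortho_proj_fixed[OF M0(1) E] by simp
next
  case False
  define \<zeta> where "\<zeta> = E \<cdot> (b 0 j)"
  have zM: "\<zeta> \<in> M0" unfolding \<zeta>_def by (rule ortho_projD(2)[OF E])
  have fix1: "cj v \<cdot> \<zeta> = \<zeta>" using E_cj_v[of "b 0 j"] by (simp add: \<zeta>_def cj_v_b1)
  have fix2: "cj w \<cdot> \<zeta> = (l powi (- j)) *\<^sub>C \<zeta>"
    using E_cj_w[of "b 0 j"] by (simp add: \<zeta>_def cj_w_b bounded_opsD[OF E_bounded])
  have 0: "cinner \<zeta> (b m n) = 0" if "(m, n) \<noteq> (0, j)" for m n
  proof (cases "m = 0")
    case True
    then have "n \<noteq> j" using that by simp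
    then have "l powi (- j) \<noteq> l powi (- n)" unfolding l_powi_inj by simp
    then show ?thesis unfolding True using w N_in_R
      by (intro eigen_orthogonal[OF cj_unitary[of w] fix2 cj_w_b]) (auto simp: cmod_l_powi)
  qed (rule fixed_orthogonal[OF fix1])
  define c where "c = cinner \<zeta> (b 0 j)"
  have "\<zeta> - c *\<^sub>C b 0 j = 0"
    by (rule b_total) (use 0 in \<open>auto simp: cinner_diff_left cinner_scaleC_left b_cinner c_def\<close>)
  then have z: "\<zeta> = c *\<^sub>C b 0 j" by simp
  have "c = 0"
  proof (rule ccontr)
    assume "c \<noteq> 0"
    then have "b 0 j = inverse c *\<^sub>C \<zeta>" by (simp add: z scaleC_scaleC)
    then show False using False csubspaceD(3)[OF M0(1) zM] by simp
  qed
  then show ?thesis using z False by (simp add: \<zeta>_def)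
qed

subsection \<open>The powers of \<open>v\<close> in the generated algebra\<close>

lemma M0_approx:
  assumes "\<zeta> \<in> M0"
  obtains y where "\<And>i::nat. y i \<in> N" "(\<lambda>i. gns_vec (y i)) \<longlonglongrightarrow> \<zeta>"
proof -
  obtain Z where Z: "\<And>n. Z n \<in> gns_vec ` N" "Z \<longlonglongrightarrow> \<zeta>" using assms unfolding M0_def closure_sequential by blast
  then have "\<forall>n. \<exists>y\<in>N. Z n = gns_vec y" by auto
  then obtain y where y: "\<And>n. y n \<in> N" "\<And>n. Z n = gns_vec (y n)" by metis
  then have "Z = (\<lambda>n. gns_vec (y n))" by auto
  then show thesis using that[OF y(1)] Z(2) by simp
qed

text \<open>The operators \<open>y i\<close> approach \<open>v^j\<close> in their vectors only and
  may be unbounded in norm, so no limit of operators is at hand. Commutation is tested on matrix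
  coefficients between vectors \<open>gns_vec a = rmult a \<Omega>\<close> with \<open>a\<close>
  unitary: right multiplications are bounded and commute with \<open>\<pi> (y i)\<close>, so that
  the limit is taken at \<open>\<Omega>\<close>, where it is known.\<close>

lemma commute_v_power:
  assumes j: "b 0 j \<in> M0" and x: "x \<in> commutant (\<pi> ` N)"
  shows "x o\<^sub>L \<pi> (upow v j) = \<pi> (upow v j) o\<^sub>L x"
proof -
  define s where "s i = b (fst i) (snd i)" for i
  have xb: "x \<in> bounded_ops" using x by (rule commutantD)
  have Vb: "\<pi> (upow v j) \<in> bounded_ops" by (auto intro: pi_bounded)
  obtain y where y: "\<And>i::nat. y i \<in> N" "(\<lambda>i. gns_vec (y i)) \<longlonglongrightarrow> gns_vec (upow v j)"
    using M0_approx[OF j] unfolding b_0 by blast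
  have yR: "y i \<in> R" for i using y(1) N_in_R by auto
  \<comment> \<open>The adjoint is isometric for the trace norm, so the adjoints converge too; they
    appear once \<open>\<pi> (y i)\<close> is moved to the other vector.\<close>
  have y': "(\<lambda>i. gns_vec (adj (y i))) \<longlonglongrightarrow> gns_vec (adj (upow v j))"
  proof -
    have "norm (gns_vec (adj (y i)) - gns_vec (adj (upow v j))) = norm (gns_vec (y i) - gns_vec (upow v j))" for i
      using gns_vec_norm_adj[of "y i - upow v j"] yR[of i]
      by (simp add: gns_vec_diff[symmetric] adj_diff)
    then show ?thesis using y(2) by (simp add: tendsto_iff dist_norm)
  qed
  have key: "cinner ((x o\<^sub>L \<pi> (upow v j)) \<cdot> (gns_vec a)) (gns_vec c) = cinner ((\<pi> (upow v j) o\<^sub>L x) \<cdot> (gns_vec a)) (gns_vec c)"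
    if a: "unitary_op a" "a \<in> R" and c: "unitary_op c" "c \<in> R" for a c
  proof -
    define A C where "A = rmult a" and "C = rmult c"
    note defs = A_def C_def
    have "cinner (x \<cdot> A \<cdot> (gns_vec (y i))) (C \<cdot> \<Omega>)
      = cinner (x \<cdot> A \<cdot> \<Omega>) (C \<cdot> (gns_vec (adj (y i))))" for i
    proof -
      have "A \<cdot> (gns_vec (y i)) = (\<pi> (y i)) \<cdot> A \<cdot> \<Omega>"
        unfolding defs gns_vec_def by (rule rmult_pi[OF a yR])
      moreover have "x \<cdot> \<pi> (y i) \<cdot> z = (\<pi> (y i)) \<cdot> x \<cdot> z" for z
        using y(1) by (intro commutant_apply[OF x]) auto
      moreover have "\<pi> (adj (y i)) \<cdot> C \<cdot> \<Omega> = C \<cdot> (gns_vec (adj (y i)))"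
        unfolding defs gns_vec_def using yR by (intro rmult_pi[OF c, symmetric]) auto
      ultimately show ?thesis
        using cinner_adj_right[OF pi_bounded[OF yR[of i]], of "x \<cdot> A \<cdot> \<Omega>" "C \<cdot> \<Omega>"]
        by (simp add: pi_adj[OF yR, symmetric])
    qed
    moreover have "(\<lambda>i. cinner (x \<cdot> A \<cdot> (gns_vec (y i))) (C \<cdot> \<Omega>))
      \<longlonglongrightarrow> cinner (x \<cdot> A \<cdot> (gns_vec (upow v j))) (C \<cdot> \<Omega>)"
      by (intro tendsto_intros y)
    moreover have "(\<lambda>i. cinner (x \<cdot> A \<cdot> \<Omega>) (C \<cdot> (gns_vec (adj (y i)))))
      \<longlonglongrightarrow> cinner (x \<cdot> A \<cdot> \<Omega>) (C \<cdot> (gns_vec (adj (upow v j))))"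
      by (intro tendsto_intros y')
    ultimately have "cinner (x \<cdot> A \<cdot> (gns_vec (upow v j))) (C \<cdot> \<Omega>)
      = cinner (x \<cdot> A \<cdot> \<Omega>) (C \<cdot> (gns_vec (adj (upow v j))))"
      by (simp add: LIMSEQ_unique)
    moreover have "A \<cdot> (gns_vec (upow v j)) = (\<pi> (upow v j)) \<cdot> A \<cdot> \<Omega>"
      unfolding defs gns_vec_def by (rule rmult_pi[OF a]) auto
    moreover have "C \<cdot> (gns_vec (adj (upow v j))) = (adj (\<pi> (upow v j))) \<cdot> C \<cdot> \<Omega>"
      unfolding defs gns_vec_def by (subst rmult_pi[OF c]) (auto simp: pi_adj)
    moreover have "A \<cdot> \<Omega> = gns_vec a" "C \<cdot> \<Omega> = gns_vec c"
      unfolding defs using rmult_Omega a c by auto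
    ultimately show ?thesis by (simp add: cinner_adj_right[OF Vb])
  qed
  have mono: "unitary_op (upow u m o\<^sub>L upow v n)" "upow u m o\<^sub>L upow v n \<in> R" for m n
    by (auto intro: unitary_op_compose upow_unitary u v)
  show ?thesis
  proof (rule total_eqI[of _ _ s])
    show "\<zeta> = 0" if "\<And>i. cinner \<zeta> (s i) = 0" for \<zeta>
      using that[of "(m, n)" for m n] by (intro b_total) (simp add: s_def)
    show "(x o\<^sub>L \<pi> (upow v j)) \<cdot> (s i) = (\<pi> (upow v j) o\<^sub>L x) \<cdot> (s i)" for i
    proof -
      have "(x o\<^sub>L \<pi> (upow v j)) \<cdot> (s i) - (\<pi> (upow v j) o\<^sub>L x) \<cdot> (s i) = 0"
        unfolding s_def by (rule b_total) (use key[OF mono mono] in \<open>simp add: cinner_diff_left b_def\<close>)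
      then show ?thesis by simp
    qed
  qed (use xb Vb in auto)
qed

text \<open>For the converse, \<open>E\<close> itself lies in the commutant and fixes
  \<open>\<Omega>\<close>. The description by commutation shows that the exponents form a group,
  which the closure of \<open>N \<Omega>\<close> does not reveal.\<close>

lemma b_0_in_M0_iff:
  "b 0 j \<in> M0 \<longleftrightarrow> (\<forall>x\<in>commutant (\<pi> ` N). x o\<^sub>L \<pi> (upow v j) = \<pi> (upow v j) o\<^sub>L x)"
proof
  assume "\<forall>x\<in>commutant (\<pi> ` N). x o\<^sub>L \<pi> (upow v j) = \<pi> (upow v j) o\<^sub>L x"
  then have "E o\<^sub>L \<pi> (upow v j) = \<pi> (upow v j) o\<^sub>L E" using E_commutant by blast
  from blinfun_pull[OF this, of \<Omega>] have "E \<cdot> (b 0 j) = (\<pi> (upow v j)) \<cdot> E \<cdot> \<Omega>"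
    by (simp add: b_0 gns_vec_def)
  also have "E \<cdot> \<Omega> = \<Omega>"
    using ortho_proj_fixed[OF M0(1) E M0(3)[OF N_closed(2)]] by (simp add: gns_vec_id)
  finally have "E \<cdot> (b 0 j) = b 0 j" by (simp add: b_0 gns_vec_def)
  then show "b 0 j \<in> M0" using ortho_projD(2)[OF E, of "b 0 j"] by simp
qed (use commute_v_power in blast)

lemma in_M0_group:
  "b 0 0 \<in> M0" "b 0 i \<in> M0 \<Longrightarrow> b 0 j \<in> M0 \<Longrightarrow> b 0 (i + j) \<in> M0" "b 0 j \<in> M0 \<Longrightarrow> b 0 (- j) \<in> M0"
proof -
  show "b 0 0 \<in> M0" using M0(3)[OF N_closed(2)] by (simp add: b_0)
  show "b 0 (i + j) \<in> M0" if "b 0 i \<in> M0" "b 0 j \<in> M0"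
    unfolding b_0_in_M0_iff
  proof
    fix x assume x: "x \<in> commutant (\<pi> ` N)"
    have e: "\<pi> (upow v (i + j)) = \<pi> (upow v i) o\<^sub>L \<pi> (upow v j)" by (simp add: upow_add[OF v] pi_mult)
    show "x o\<^sub>L \<pi> (upow v (i + j)) = \<pi> (upow v (i + j)) o\<^sub>L x"
      unfolding e using commute_v_power[OF that(1) x, THEN blinfun_pull] commute_v_power[OF that(2) x, THEN blinfun_pull]
      by (intro blinfun_eqI) simp
  qed
  show "b 0 (- j) \<in> M0" if "b 0 j \<in> M0"
    unfolding b_0_in_M0_iff
  proof
    fix x assume x: "x \<in> commutant (\<pi> ` N)"
    have "unitary_op (\<pi> (upow v j))" by (intro pi_unitary upow_unitary v) auto
    from commutes_adj_unitary[OF this commute_v_power[OF that x]]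
    show "x o\<^sub>L \<pi> (upow v (- j)) = \<pi> (upow v (- j)) o\<^sub>L x" by (simp add: pi_adj[symmetric] adj_upow[OF v])
  qed
qed

text \<open>The vector of \<open>k\<close> is fixed by \<open>E\<close> and by conjugation with
  \<open>v\<close>, so it lies in the closed span of those \<open>b 0 n\<close> that belong to
  \<open>M0\<close>. If \<open>b 0 0\<close> were the only one, faithfulness of the trace would make
  \<open>k\<close> a scalar.\<close>

lemma ex_in_M0: "\<exists>j. j \<noteq> 0 \<and> b 0 j \<in> M0"
proof (rule ccontr)
  assume "\<nexists>j. j \<noteq> 0 \<and> b 0 j \<in> M0"
  then have no: "b 0 j \<notin> M0" if "j \<noteq> 0" for j using that by blast
  have kR: "k \<in> R" using k N_in_R by auto
  have kM: "gns_vec k \<in> M0" using k by (intro M0)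
  have "v o\<^sub>L (k o\<^sub>L adj v) = k"
    using blinfun_pull[OF k(2)] by (intro blinfun_eqI) (simp add: unitary_opD[OF v])
  then have fixk: "cj v \<cdot> (gns_vec k) = gns_vec k" by (simp add: cj_vec v vR kR)
  define c where "c = cinner (gns_vec k) (b 0 0)"
  have "gns_vec k - c *\<^sub>C b 0 0 = 0"
  proof (rule b_total)
    fix m n :: int
    consider "m \<noteq> 0" | "m = 0" "n \<noteq> 0" | "m = 0" "n = 0" by blast
    then show "cinner (gns_vec k - c *\<^sub>C b 0 0) (b m n) = 0"
    proof cases
      case 1
      then show ?thesis using fixed_orthogonal[OF fixk 1] by (simp add: cinner_diff_left cinner_scaleC_left b_cinner)
    next
      case 2
      have "cinner (gns_vec k) (b 0 n) = cinner (E \<cdot> (gns_vec k)) (b 0 n)"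
        using ortho_proj_fixed[OF M0(1) E kM] by simp
      also have "\<dots> = cinner (gns_vec k) (E \<cdot> (b 0 n))" by (rule ortho_proj_cinner[OF M0(1) E])
      also have "\<dots> = 0" using no[OF 2(2)] by (simp add: E_b_0)
      finally show ?thesis using 2 by (simp add: cinner_diff_left cinner_scaleC_left b_cinner)
    qed (simp add: cinner_diff_left cinner_scaleC_left b_cinner c_def)
  qed
  then have "gns_vec (k - scalar_op c) = 0"
    using kR gns_vec_scale[of id_blinfun c] by (simp add: gns_vec_diff b_0)
  then have "k - scalar_op c = 0" using kR by (intro gns_vec_eq_0D) auto
  then show False using k(3) by (simp add: eq_iff_diff_eq_0[symmetric])
qed

lemma period_exists: "\<exists>n::nat. 0 < n \<and> (\<forall>j. b 0 j \<in> M0 \<longleftrightarrow> int n dvd j)"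
proof -
  obtain j where j: "j \<noteq> 0" "b 0 j \<in> M0" using ex_in_M0 by blast
  then have "\<exists>n. 0 < n \<and> b 0 (int n) \<in> M0"
    using in_M0_group(3)[OF j(2)] by (intro exI[of _ "nat \<bar>j\<bar>"]) (auto simp: abs_if)
  define n where "n = (LEAST n. 0 < n \<and> b 0 (int n) \<in> M0)"
  have n: "0 < n" "b 0 (int n) \<in> M0"
    using LeastI_ex[OF \<open>\<exists>n. 0 < n \<and> b 0 (int n) \<in> M0\<close>] by (auto simp: n_def)
  have min: "n \<le> k" if "0 < k" "b 0 (int k) \<in> M0" for k unfolding n_def using that by (intro Least_le) auto
  have mult: "b 0 (int n * q) \<in> M0" for q
  proof (induction q rule: int_induct[where k = 0])
    case base then show ?case using in_M0_group(1) by simp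
  next
    case (step1 i)
    then show ?case using in_M0_group(2)[OF step1(2) n(2)] by (simp add: algebra_simps)
  next
    case (step2 i)
    then show ?case using in_M0_group(2)[OF step2(2) in_M0_group(3)[OF n(2)]] by (simp add: algebra_simps)
  qed
  have "int n dvd j" if j: "b 0 j \<in> M0" for j
  proof (rule ccontr)
    assume nd: "\<not> int n dvd j"
    have "b 0 (j + int n * (- (j div int n))) \<in> M0" by (rule in_M0_group(2)[OF j mult])
    then have "b 0 (j mod int n) \<in> M0" by (simp add: minus_mult_div_eq_mod[symmetric])
    moreover have "0 < j mod int n" "j mod int n < int n"
      using nd n(1) pos_mod_sign[of "int n" j] pos_mod_bound[of "int n" j]
      by (auto simp: dvd_eq_mod_eq_0 order_le_less)
    ultimately have "n \<le> nat (j mod int n)" by (intro min) auto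
    then show False using \<open>j mod int n < int n\<close> \<open>0 < j mod int n\<close> by linarith
  qed
  moreover have "b 0 j \<in> M0" if "int n dvd j" for j using that mult by (auto elim: dvdE)
  ultimately show ?thesis using n(1) by blast
qed

text \<open>The positive generator of the group of exponents; it will turn out to be the
  index.\<close>

definition per :: nat where "per = (SOME n. 0 < n \<and> (\<forall>j. b 0 j \<in> M0 \<longleftrightarrow> int n dvd j))"

lemma per: "0 < per" "b 0 j \<in> M0 \<longleftrightarrow> int per dvd j"
  using someI_ex[OF period_exists] unfolding per_def[symmetric] by auto

subsection \<open>Irreducibility\<close>

text \<open>Since \<open>x\<close> commutes with left and right multiplication by
  \<open>v ^ per\<close> and by \<open>w\<close>, the vector \<open>x \<Omega>\<close> is fixed by
  both conjugations, and only multiples of \<open>\<Omega>\<close> are. Stated for operators on the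
  representation space, the lemma covers both the relative commutant of \<open>N\<close> and the
  center of the commutant of \<open>N\<close>.\<close>

lemma scalar_if_commutes:
  assumes x: "x \<in> bounded_ops" and x1: "x \<in> commutant (\<pi> ` N)"
    and x2: "\<And>a. unitary_op a \<Longrightarrow> a \<in> R \<Longrightarrow> x o\<^sub>L rmult a = rmult a o\<^sub>L x"
  shows "x \<in> range scalar_op"
proof -
  define \<xi> where "\<xi> = x \<cdot> \<Omega>"
  have fixed: "cj a \<cdot> \<xi> = \<xi>" if a: "unitary_op a" "a \<in> R" and xa: "x o\<^sub>L \<pi> a = \<pi> a o\<^sub>L x" for a
  proof -
    have a': "unitary_op (adj a)" "adj a \<in> R" using a unitary_op_adj by auto
    have "rmult (adj a) \<cdot> \<xi> = x \<cdot> (gns_vec (adj a))"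
      unfolding \<xi>_def rmult_Omega[OF a', symmetric] by (rule blinfun_pull[OF x2[OF a', symmetric]])
    then have "cj a \<cdot> \<xi> = x \<cdot> \<pi> a \<cdot> (gns_vec (adj a))"
      using blinfun_pull[OF xa] by (simp add: cj_def)
    also have "\<pi> a \<cdot> (gns_vec (adj a)) = \<Omega>"
      using a a' by (simp add: gns_vec_pi unitary_opD gns_vec_id)
    finally show ?thesis by (simp add: \<xi>_def)
  qed
  have fix1: "cj (upow v (int per)) \<cdot> \<xi> = \<xi>"
    by (rule fixed) (auto intro!: upow_unitary v commute_v_power x1 simp: per)
  have fix2: "cj w \<cdot> \<xi> = \<xi>"
    by (rule fixed) (use w N_in_R commutantD(2)[OF x1] in auto)
  have 0: "cinner \<xi> (b m n) = 0" if "(m, n) \<noteq> (0, 0)" for m n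
  proof (cases "m = 0")
    case True
    then have "n \<noteq> 0" using that by simp
    then have "1 \<noteq> l powi (- n)" using l_powi[of "- n"] by simp
    then show ?thesis unfolding True using w N_in_R fix2
      by (intro eigen_orthogonal[where x = \<xi> and \<alpha> = 1, OF cj_unitary[of w] _ cj_w_b]) (auto simp: cmod_l_powi)
  next
    case False
    then have "1 \<noteq> l powi (m * int per)" using l_powi[of "m * int per"] per(1) by simp
    then show ?thesis using fix1
      by (intro eigen_orthogonal[where x = \<xi> and \<alpha> = 1, OF cj_unitary[OF upow_unitary[OF v] upow_v_R] _ cj_v_b]) (auto simp: cmod_l_powi)
  qed
  define c where "c = cinner \<xi> (b 0 0)"
  have "\<xi> - c *\<^sub>C b 0 0 = 0"
    by (rule b_total) (use 0 in \<open>auto simp: cinner_diff_left cinner_scaleC_left b_cinner c_def\<close>)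
  then have xi: "\<xi> = c *\<^sub>C \<Omega>" by (simp add: b_0 gns_vec_id)
  define s where "s i = b (fst i) (snd i)" for i
  have "x = scalar_op c"
  proof (rule total_eqI[of _ _ s])
    show "\<zeta> = 0" if "\<And>i. cinner \<zeta> (s i) = 0" for \<zeta>
      using that[of "(m, n)" for m n] by (intro b_total) (simp add: s_def)
    show "x \<cdot> (s i) = (scalar_op c) \<cdot> (s i)" for i
    proof -
      define a where "a = upow u (fst i) o\<^sub>L upow v (snd i)"
      have a: "unitary_op a" "a \<in> R" unfolding a_def by (auto intro: unitary_op_compose upow_unitary u v)
      have s: "s i = (rmult a) \<cdot> \<Omega>" using rmult_Omega[OF a] by (simp add: s_def b_def a_def)
      have "x \<cdot> (s i) = (rmult a) \<cdot> \<xi>"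
        unfolding s \<xi>_def by (rule blinfun_pull[OF x2[OF a]])
      also have "\<dots> = c *\<^sub>C s i" by (simp add: xi s bounded_opsD[OF rmult(1)[OF a]])
      finally show ?thesis by simp
    qed
  qed (use x in auto)
  then show ?thesis by simp
qed

theorem irreducible: "commutant N \<inter> R = range scalar_op"
proof
  show "commutant N \<inter> R \<subseteq> range scalar_op"
  proof
    fix x assume x: "x \<in> commutant N \<inter> R"
    have "\<pi> x \<in> range scalar_op"
    proof (rule scalar_if_commutes)
      show "\<pi> x \<in> bounded_ops" using x by (auto intro: pi_bounded)
      show "\<pi> x \<in> commutant (\<pi> ` N)"
      proof (rule commutantI)
        fix A assume "A \<in> \<pi> ` N"
        then obtain y where y: "y \<in> N" "A = \<pi> y" by blast
        have "\<pi> x o\<^sub>L \<pi> y = \<pi> (x o\<^sub>L y)" "\<pi> y o\<^sub>L \<pi> x = \<pi> (y o\<^sub>L x)"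
          using x y N_in_R by (auto simp: pi_mult)
        moreover have "x o\<^sub>L y = y o\<^sub>L x" using x y commutantD(2)[of x N y] by auto
        ultimately show "\<pi> x o\<^sub>L A = A o\<^sub>L \<pi> x" using y by simp
      qed (use x in \<open>auto intro: pi_bounded\<close>)
      show "\<pi> x o\<^sub>L rmult a = rmult a o\<^sub>L \<pi> x" if "unitary_op a" "a \<in> R" for a
        using x that by (intro blinfun_eqI) (simp add: rmult_pi)
    qed
    then obtain c where c: "\<pi> x = scalar_op c" by blast
    have "gns_vec (scalar_op c) = c *\<^sub>C \<Omega>" using gns_vec_scale[of id_blinfun c] by (simp add: gns_vec_id)
    then have "gns_vec (x - scalar_op c) = 0" using x c by (simp add: gns_vec_diff) (simp add: gns_vec_def)
    then have "x - scalar_op c = 0" using x by (intro gns_vec_eq_0D) auto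
    then show "x \<in> range scalar_op" by simp
  qed
  have "N \<subseteq> bounded_ops" using von_neumann_algebraD(1)[OF N_vN] .
  then show "range scalar_op \<subseteq> commutant N \<inter> R" by (auto intro: commutant_algebra)
qed

lemma factor_N: "factor N"
  unfolding factor_def
proof
  show "von_neumann_algebra N" by (rule N_vN)
  have "range scalar_op \<subseteq> N" by auto
  then show "N \<inter> commutant N = range scalar_op" using irreducible N_R by auto
qed

end

section \<open>The index\<close>

context rotation_gns
begin

abbreviation N' :: "'k oper set" where "N' \<equiv> commutant (\<pi> ` N)"

lemma pi_N_bounded: "\<pi> ` N \<subseteq> bounded_ops"
  using N_in_R by (auto intro: pi_bounded)

lemma pi_N_adj: "A \<in> \<pi> ` N \<Longrightarrow> adj A \<in> \<pi> ` N"
  using N_in_R N_closed(1) by (auto simp: pi_adj[symmetric])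

lemma N'_bounded: "x \<in> N' \<Longrightarrow> x \<in> bounded_ops" by (rule commutantD)

lemma N'_adj: "x \<in> N' \<Longrightarrow> adj x \<in> N'"
  by (rule commutant_adj[OF pi_N_bounded pi_N_adj])

lemma N'_pi: "x \<in> N' \<Longrightarrow> y \<in> N \<Longrightarrow> x \<cdot> \<pi> y \<cdot> z = (\<pi> y) \<cdot> x \<cdot> z"
  by (rule commutant_apply) auto

lemma rmult_N': "unitary_op a \<Longrightarrow> a \<in> R \<Longrightarrow> rmult a \<in> N'"
  by (rule rmult_commutant[OF _ _ N_R])

definition rv :: "int \<Rightarrow> 'k oper" where "rv r = rmult (upow v r)"

lemma rv: "rv r \<in> N'" "rv r \<in> bounded_ops" "unitary_op (rv r)" "adj (rv r) = rv (- r)"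
  "x \<in> R \<Longrightarrow> (rv r) \<cdot> \<pi> x \<cdot> z = (\<pi> x) \<cdot> rv r \<cdot> z"
  "rv r \<cdot> (b 0 j) = b 0 (j + r)" "rv r \<cdot> \<Omega> = b 0 r"
  unfolding rv_def b_0
  by (auto intro!: rmult_N' rmult rmult_unitary upow_unitary v rmult_pi
      simp: rmult_unitary(2)[OF upow_unitary[OF v]] adj_upow[OF v] rmult upow_add[OF v, symmetric] upow_unitary[OF v] rmult_Omega)

text \<open>A total system adapted to \<open>N\<close>: since \<open>w\<close> lies in
  \<open>N\<close>, the projection \<open>E\<close> passes through \<open>\<pi> (upow w m)\<close>
  and acts on \<open>b 0 j\<close> alone.\<close>

definition bw :: "int \<Rightarrow> int \<Rightarrow> 'k" where "bw m j = (\<pi> (upow w m)) \<cdot> (b 0 j)"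

text \<open>The projection of \<open>\<zeta>\<close> to the fixed space of \<open>cj v\<close> is
  orthogonal to every \<open>b 0 n\<close> by assumption, and to the remaining basis vectors because
  it is fixed, so it vanishes.\<close>

lemma fixed_total:
  assumes \<eta>: "cj v \<cdot> \<eta> = \<eta>" and \<zeta>: "\<And>n. cinner \<zeta> (b 0 n) = 0"
  shows "cinner \<zeta> \<eta> = 0"
proof -
  define F where "F = {x. (cj v) \<cdot> x = x}"
  have cb: "cj v \<in> bounded_ops" using unitary_opD(1)[OF cj_unitary[OF v vR]] .
  have F: "csubspace F" unfolding csubspace_def F_def by (auto simp: blinfun.add_right bounded_opsD[OF cb])
  have "closed F" unfolding F_def
    by (rule closed_Collect_eq) (auto intro!: continuous_intros linear_continuous_on blinfun.bounded_linear_right)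
  then obtain P where P: "ortho_proj F P" using ortho_proj_exists[OF F] by blast
  have "P \<cdot> \<zeta> = 0"
  proof (rule b_total)
    fix m n
    have PF: "cj v \<cdot> P \<cdot> \<zeta> = P \<cdot> \<zeta>" using ortho_projD(2)[OF P, of \<zeta>] by (simp add: F_def)
    show "cinner (P \<cdot> \<zeta>) (b m n) = 0"
    proof (cases "m = 0")
      case True
      have "b 0 n \<in> F" by (simp add: F_def cj_v_b1)
      then have "cinner (\<zeta> - P \<cdot> \<zeta>) (b 0 n) = 0" by (rule ortho_projD(3)[OF P])
      then show ?thesis using \<zeta> True by (simp add: cinner_diff_left)
    qed (rule fixed_orthogonal[OF PF])
  qed
  moreover have "cinner (\<zeta> - P \<cdot> \<zeta>) \<eta> = 0" using \<eta> by (intro ortho_projD(3)[OF P]) (simp add: F_def)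
  ultimately show ?thesis by simp
qed

text \<open>\<open>u\<^sup>m = w\<^sup>m g\<close> with \<open>g\<close> commuting with \<open>v\<close>.\<close>

lemma bw_total: assumes z: "\<And>m j. cinner \<zeta> (bw m j) = 0" shows "\<zeta> = 0"
proof (rule b_total)
  fix m n
  define g where "g = upow w (- m) o\<^sub>L (upow u m o\<^sub>L upow v n)"
  have gR: "g \<in> R" unfolding g_def by auto
  have Wb: "\<pi> (upow w m) \<in> bounded_ops" by (auto intro: pi_bounded)
  have "upow w m o\<^sub>L g = upow u m o\<^sub>L upow v n"
    unfolding g_def using upow_apply_add[OF w(1), of m "- m"] by (intro blinfun_eqI) simp
  then have bg: "b m n = (\<pi> (upow w m)) \<cdot> (gns_vec g)" using gR by (simp add: b_def gns_vec_pi)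
  have "v o\<^sub>L (g o\<^sub>L adj v) = g"
  proof (rule blinfun_eqI)
    fix x
    have "v \<cdot> upow v n \<cdot> adj v \<cdot> x = (upow v n) \<cdot> x"
      using upow_apply_add[OF v, of n "-1" x] upow_apply_add[OF v, of 1 "n - 1" x] v by simp
    then show "(v o\<^sub>L (g o\<^sub>L adj v)) \<cdot> x = g \<cdot> x"
      using upow_rel[of 1 m] v l_nonzero
      by (simp add: g_def v_upow_w scaleC_scaleC bounded_opsD[OF upow_bounded_ops[OF w(1)]] power_int_minus)
  qed
  then have "cj v \<cdot> (gns_vec g) = gns_vec g" using gR by (simp add: cj_vec v vR)
  moreover have "cinner (adj (\<pi> (upow w m)) \<cdot> \<zeta>) (b 0 j) = 0" for j
    using z[of m j] by (simp add: cinner_adj_left[OF Wb] bw_def)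
  ultimately have "cinner (adj (\<pi> (upow w m)) \<cdot> \<zeta>) (gns_vec g) = 0" by (rule fixed_total)
  then show "cinner \<zeta> (b m n) = 0" by (simp add: bg cinner_adj_left[OF Wb])
qed

text \<open>The projection onto the closure of \<open>N v^r \<Omega>\<close>, unitarily equivalent
  to \<open>E\<close> inside the commutant of \<open>N\<close>.\<close>

definition e :: "nat \<Rightarrow> 'k oper" where "e r = rv (int r) o\<^sub>L (E o\<^sub>L rv (- int r))"

lemma e_bw: "e r \<cdot> (bw m j) = (if int per dvd j - int r then bw m j else 0)"
proof -
  have "e r \<cdot> (bw m j) = (\<pi> (upow w m)) \<cdot> rv (int r) \<cdot> E \<cdot> (b 0 (j - int r))"
    by (simp add: e_def bw_def rv E_pi upow_w_N)
  then show ?thesis by (simp add: E_b_0 per rv bw_def blinfun.zero_right)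
qed

lemma sum_e: "(\<Sum>r<per. e r) = id_blinfun"
proof (rule total_eqI[where s = "\<lambda>i. bw (fst i) (snd i)"])
  have "e r \<in> bounded_ops" for r unfolding e_def using rv(2) E_bounded by auto
  then have "(\<Sum>r<n. e r) \<in> bounded_ops" for n by (induction n) auto
  then show "(\<Sum>r<per. e r) \<in> bounded_ops" .
  show "\<zeta> = 0" if "\<And>i. cinner \<zeta> (bw (fst i) (snd i)) = 0" for \<zeta>
    using that[of "(m, j)" for m j] by (intro bw_total) simp
  fix i :: "int \<times> int"
  define j where "j = snd i"
  define r0 where "r0 = nat (j mod int per)"
  have "0 \<le> j mod int per" "j mod int per < int per" using per(1) by auto
  then have r0: "int r0 = j mod int per" "r0 < per" unfolding r0_def by linarith+
  \<comment> \<open>Among the residues below \<open>per\<close> only that of \<open>j\<close>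
    contributes, so each vector of the total system is caught by exactly one
    \<open>e r\<close>.\<close>
  have iff: "int per dvd j - int r \<longleftrightarrow> r = r0" if "r < per" for r
  proof -
    have "int per dvd j - int r \<longleftrightarrow> j mod int per = int r mod int per" by (rule mod_eq_dvd_iff[symmetric])
    also have "int r mod int per = int r" using that by simp
    finally show ?thesis using r0(1) by auto
  qed
  have "(\<Sum>r<per. e r) \<cdot> (bw (fst i) j) = (\<Sum>r<per. (e r) \<cdot> (bw (fst i) j))"
    by (rule blinfun.sum_left)
  also have "\<dots> = (\<Sum>r<per. if r = r0 then bw (fst i) j else 0)"
    by (intro sum.cong refl) (simp add: e_bw iff)
  also have "\<dots> = bw (fst i) j" using r0(2) by (simp add: sum.delta)
  finally show "(\<Sum>r<per. e r) \<cdot> (bw (fst i) (snd i)) = id_blinfun \<cdot> (bw (fst i) (snd i))" by (simp add: j_def)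
qed auto

text \<open>On the closure of \<open>N \<Omega>\<close> the commutant acts through right multiplications, so that its vector state at
  \<open>\<Omega>\<close> is tracial there.\<close>

lemma E_corner_symmetric:
  assumes a: "a \<in> N'" and c: "c \<in> N'"
  shows "cinner (E \<cdot> c \<cdot> \<Omega>) (adj a \<cdot> \<Omega>)
    = cinner (E \<cdot> a \<cdot> \<Omega>) (adj c \<cdot> \<Omega>)"
proof -
  note ab = N'_bounded[OF a] and cb = N'_bounded[OF c]
  obtain y where y: "\<And>i::nat. y i \<in> N" "(\<lambda>i. gns_vec (y i)) \<longlonglongrightarrow> E \<cdot> c \<cdot> \<Omega>"
    using M0_approx[OF ortho_projD(2)[OF E]] by blast
  have yR: "y i \<in> R" for i using y(1) N_in_R by auto
  have eq: "cinner (gns_vec (y i)) (adj a \<cdot> \<Omega>) = cinner (a \<cdot> \<Omega>) (gns_vec (adj (y i)))" for i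
  proof -
    have "cinner (gns_vec (y i)) (adj a \<cdot> \<Omega>) = cinner (a \<cdot> \<pi> (y i) \<cdot> \<Omega>) \<Omega>"
      by (simp add: cinner_adj_right[OF ab] gns_vec_def)
    also have "\<dots> = cinner (\<pi> (y i) \<cdot> a \<cdot> \<Omega>) \<Omega>" using N'_pi[OF a y(1)] by simp
    also have "\<dots> = cinner (a \<cdot> \<Omega>) (gns_vec (adj (y i)))"
      using yR[of i] by (simp add: gns_vec_def pi_adj cinner_adj_right pi_bounded)
    finally show ?thesis .
  qed
  have "Cauchy (\<lambda>i. gns_vec (adj (y i)))"
  proof -
    have "dist (gns_vec (adj (y i))) (gns_vec (adj (y j))) = dist (gns_vec (y i)) (gns_vec (y j))" for i j
      using gns_vec_norm_adj[of "y i - y j"] yR[of i] yR[of j]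
      by (simp add: dist_norm gns_vec_diff[symmetric] adj_diff)
    then show ?thesis using LIMSEQ_imp_Cauchy[OF y(2)] by (simp add: Cauchy_def)
  qed
  \<comment> \<open>\<open>\<kappa>\<close> is the image of \<open>E c \<Omega>\<close> under the
    conjugate linear isometry extending the adjoint; testing against \<open>N \<Omega>\<close> will
    identify it with the projection of \<open>adj c \<Omega>\<close>.\<close>
  then obtain \<kappa> where chi: "(\<lambda>i. gns_vec (adj (y i))) \<longlonglongrightarrow> \<kappa>" using Cauchy_convergent convergent_def by blast
  have "\<kappa> \<in> M0"
    by (rule closed_sequentially[OF M0(2) _ chi]) (use y(1) in \<open>auto intro: M0\<close>)
  have chi_vec: "cinner \<kappa> (gns_vec z) = cinner (adj c \<cdot> \<Omega>) (gns_vec z)" if z: "z \<in> N" for z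
  proof -
    have zR: "z \<in> R" and z': "adj z \<in> N" "adj z \<in> R" using z N_in_R by auto
    have "cinner (gns_vec (adj (y i))) (gns_vec z) = cinner (gns_vec (adj z)) (gns_vec (y i))" for i
      using zR yR[of i] by (simp add: gns_vec_cinner tr_comm)
    moreover have "(\<lambda>i. cinner (gns_vec (adj (y i))) (gns_vec z)) \<longlonglongrightarrow> cinner \<kappa> (gns_vec z)"
      by (intro tendsto_intros chi)
    moreover have "(\<lambda>i. cinner (gns_vec (adj z)) (gns_vec (y i))) \<longlonglongrightarrow> cinner (gns_vec (adj z)) (E \<cdot> c \<cdot> \<Omega>)"
      by (intro tendsto_intros y)
    ultimately have "cinner \<kappa> (gns_vec z) = cinner (gns_vec (adj z)) (E \<cdot> c \<cdot> \<Omega>)"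
      by (simp add: LIMSEQ_unique)
    also have "\<dots> = cinner (E \<cdot> (gns_vec (adj z))) (c \<cdot> \<Omega>)"
      by (rule ortho_proj_cinner(1)[OF M0(1) E, symmetric])
    also have "\<dots> = cinner (adj (\<pi> z) \<cdot> \<Omega>) (c \<cdot> \<Omega>)"
      using ortho_proj_fixed[OF M0(1) E M0(3)[OF z'(1)]] zR by (simp add: gns_vec_def pi_adj)
    also have "\<dots> = cinner \<Omega> (c \<cdot> \<pi> z \<cdot> \<Omega>)"
      using zR N'_pi[OF c z] by (simp add: cinner_adj_left pi_bounded)
    also have "\<dots> = cinner (adj c \<cdot> \<Omega>) (gns_vec z)" by (simp add: cinner_adj_left[OF cb] gns_vec_def)
    finally show ?thesis .
  qed
  have "E \<cdot> adj c \<cdot> \<Omega> = \<kappa>"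
  proof (rule ortho_proj_eqI[OF M0(1) E \<open>\<kappa> \<in> M0\<close>])
    fix k assume "k \<in> M0"
    then obtain z where z: "\<And>i::nat. z i \<in> N" "(\<lambda>i. gns_vec (z i)) \<longlonglongrightarrow> k" using M0_approx by blast
    have "(\<lambda>i. cinner (adj c \<cdot> \<Omega> - \<kappa>) (gns_vec (z i))) \<longlonglongrightarrow> cinner (adj c \<cdot> \<Omega> - \<kappa>) k"
      by (intro tendsto_intros z)
    moreover have "cinner (adj c \<cdot> \<Omega> - \<kappa>) (gns_vec (z i)) = 0" for i
      using chi_vec[OF z(1)] by (simp add: cinner_diff_left)
    ultimately show "cinner (adj c \<cdot> \<Omega> - \<kappa>) k = 0" by (simp add: LIMSEQ_const_iff)
  qed
  moreover have "(\<lambda>i. cinner (gns_vec (y i)) (adj a \<cdot> \<Omega>)) \<longlonglongrightarrow> cinner (E \<cdot> c \<cdot> \<Omega>) (adj a \<cdot> \<Omega>)"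
    by (intro tendsto_intros y)
  moreover have "(\<lambda>i. cinner (gns_vec (y i)) (adj a \<cdot> \<Omega>)) \<longlonglongrightarrow> cinner (a \<cdot> \<Omega>) \<kappa>"
    unfolding eq by (intro tendsto_intros chi)
  ultimately have "cinner (E \<cdot> c \<cdot> \<Omega>) (adj a \<cdot> \<Omega>) = cinner (a \<cdot> \<Omega>) (E \<cdot> adj c \<cdot> \<Omega>)"
    by (simp add: LIMSEQ_unique)
  then show ?thesis by (simp add: ortho_proj_cinner(1)[OF M0(1) E])
qed

text \<open>The vector state at \<open>\<Omega>\<close> has the trace property only across the
  corner of \<open>E\<close>. Averaging over the vectors \<open>v^r \<Omega>\<close>, one for each
  summand \<open>e r\<close> of the identity, makes it tracial on the whole commutant.\<close>

definition tr' :: "'k oper \<Rightarrow> complex" where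
  "tr' x = (\<Sum>r<per. cinner (x \<cdot> (b 0 (int r))) (b 0 (int r))) / of_nat per"

text \<open>Inserting the identity as the sum of the \<open>e r\<close> between \<open>x\<close> and
  \<open>y\<close> gives a double sum of matrix entries in the corner, and
  \<open>E_corner_symmetric\<close> exchanges \<open>x\<close> with \<open>y\<close> together with
  the two indices.\<close>

lemma tr'_comm:
  assumes x: "x \<in> N'" and y: "y \<in> N'"
  shows "tr' (x o\<^sub>L y) = tr' (y o\<^sub>L x)"
proof -
  define \<phi> where "\<phi> x y j r = cinner (E \<cdot> (rv (- int r) o\<^sub>L (y o\<^sub>L rv (int j))) \<cdot> \<Omega>)
    ((adj (rv (- int j) o\<^sub>L (x o\<^sub>L rv (int r)))) \<cdot> \<Omega>)" for x y j r
  have expand: "cinner ((x o\<^sub>L y) \<cdot> (b 0 (int j))) (b 0 (int j)) = (\<Sum>r<per. \<phi> x y j r)"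
    if x: "x \<in> N'" and y: "y \<in> N'" for x y j
  proof -
    note xb = N'_bounded[OF x]
    define \<zeta> where "\<zeta> = y \<cdot> (b 0 (int j))"
    have "cinner ((x o\<^sub>L y) \<cdot> (b 0 (int j))) (b 0 (int j)) = cinner ((\<Sum>r<per. e r) \<cdot> \<zeta>) (adj x \<cdot> (b 0 (int j)))"
      by (simp add: sum_e cinner_adj_right[OF xb] \<zeta>_def)
    also have "\<dots> = (\<Sum>r<per. cinner (e r \<cdot> \<zeta>) (adj x \<cdot> (b 0 (int j))))"
      by (simp add: blinfun.sum_left cinner_sum_left)
    also have "\<dots> = (\<Sum>r<per. \<phi> x y j r)"
    proof (intro sum.cong refl)
      fix r
      have "(adj (rv (- int j) o\<^sub>L (x o\<^sub>L rv (int r)))) \<cdot> \<Omega> = (adj (rv (int r))) \<cdot> adj x \<cdot> (b 0 (int j))"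
        using xb rv(2)[of "int r"] rv(2)[of "- int j"] rv(4)[of "- int j"] rv(7)[of "int j"] by (simp add: adj_compose)
      then show "cinner (e r \<cdot> \<zeta>) (adj x \<cdot> (b 0 (int j))) = \<phi> x y j r"
        by (simp add: \<phi>_def e_def \<zeta>_def cinner_adj_right[OF rv(2)] rv(7))
    qed
    finally show ?thesis .
  qed
  have sym: "\<phi> x y j r = \<phi> y x r j" for j r
    unfolding \<phi>_def using x y rv(1) by (intro E_corner_symmetric commutant_algebra)
  have "(\<Sum>j<per. \<Sum>r<per. \<phi> x y j r) = (\<Sum>r<per. \<Sum>j<per. \<phi> y x r j)"
    unfolding sym by (rule sum.swap)
  then show ?thesis unfolding tr'_def expand[OF x y] expand[OF y x] by simp
qed

lemma ultraweakly_continuous_finite: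
  fixes T :: "'k oper \<Rightarrow> complex" and \<xi> \<eta> :: "nat \<Rightarrow> 'k"
  assumes "\<And>x. x \<in> S \<Longrightarrow> T x = (\<Sum>r<n. cinner (x \<cdot> (\<xi> r)) (\<eta> r))"
  shows "ultraweakly_continuous S T"
  unfolding ultraweakly_continuous_def
proof (intro exI conjI ballI)
  define \<xi>' \<eta>' where "\<xi>' r = (if r < n then \<xi> r else 0)" and "\<eta>' r = (if r < n then \<eta> r else 0)" for r
  show "summable (\<lambda>i. (norm (\<xi>' i))\<^sup>2)" "summable (\<lambda>i. (norm (\<eta>' i))\<^sup>2)"
    by (rule summable_finite[of "{..<n}"]; simp add: \<xi>'_def \<eta>'_def)+
  fix x assume "x \<in> S"
  then have "T x = (\<Sum>r<n. cinner (x \<cdot> (\<xi>' r)) (\<eta>' r))" using assms by (simp add: \<xi>'_def \<eta>'_def)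
  then show "(\<lambda>i. cinner (x \<cdot> (\<xi>' i)) (\<eta>' i)) sums T x"
    using sums_finite[of "{..<n}" "\<lambda>i. cinner (x \<cdot> (\<xi>' i)) (\<eta>' i)"] by (simp add: \<xi>'_def)
qed

lemma nonneg_Reals_cinner: "cinner x x \<in> \<real>\<^sub>\<ge>\<^sub>0"
  by (simp add: cinner_self del: of_real_power)

lemma tracial_state_N': "tracial_state N' tr'"
  unfolding tracial_state_def
proof (intro conjI ballI allI)
  fix x y assume x: "x \<in> N'" and y: "y \<in> N'"
  show "tr' (x + y) = tr' x + tr' y"
    by (simp add: tr'_def blinfun.add_left cinner_add_left sum.distrib add_divide_distrib)
  show "tr' (x o\<^sub>L y) = tr' (y o\<^sub>L x)" using x y by (rule tr'_comm)
next
  fix a x assume x: "x \<in> N'"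
  show "tr' (scalar_op a o\<^sub>L x) = a * tr' x"
    by (simp add: tr'_def cinner_scaleC_left sum_distrib_left[symmetric])
next
  fix x assume x: "x \<in> N'"
  note xb = N'_bounded[OF x]
  have "tr' (adj x o\<^sub>L x) = of_real ((\<Sum>r<per. (norm (x \<cdot> (b 0 (int r))))\<^sup>2) / real per)"
    by (simp add: tr'_def cinner_adj_left[OF xb] cinner_self)
  moreover have "0 \<le> (\<Sum>r<per. (norm (x \<cdot> (b 0 (int r))))\<^sup>2) / real per"
    by (intro divide_nonneg_nonneg sum_nonneg) auto
  ultimately show "tr' (adj x o\<^sub>L x) \<in> \<real>\<^sub>\<ge>\<^sub>0" by (metis nonneg_Reals_of_real_iff)
next
  show "tr' id_blinfun = 1" using per(1) by (simp add: tr'_def b_cinner)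
  show "ultraweakly_continuous N' tr'"
  proof (rule ultraweakly_continuous_finite)
    fix x
    show "tr' x = (\<Sum>r<per. cinner (x \<cdot> ((1 / real per) *\<^sub>R b 0 (int r))) (b 0 (int r)))"
      by (simp add: tr'_def blinfun.scaleR_right cinner_scaleR_left sum_divide_distrib)
  qed
qed

lemma factor_N': "factor N'"
  unfolding factor_def
proof
  show "von_neumann_algebra N'"
    unfolding von_neumann_algebra_def using triple_commutant[OF pi_N_bounded] N'_adj by auto
  show "N' \<inter> commutant N' = range scalar_op"
  proof
    show "N' \<inter> commutant N' \<subseteq> range scalar_op"
    proof
      fix x assume x: "x \<in> N' \<inter> commutant N'"
      show "x \<in> range scalar_op"
        by (rule scalar_if_commutes) (use x rmult_N' in \<open>auto intro: commutantD\<close>)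
    qed
    show "range scalar_op \<subseteq> N' \<inter> commutant N'"
      by (auto intro!: commutant_algebra pi_N_bounded commutant_bounded_ops)
  qed
qed

text \<open>Existence of one trace guarantees that the one selected by \<open>vn_trace\<close> is
  normalized, so it is 1 at the identity, which is the cyclic projection of the commutant.\<close>

lemma tracial_state_pi_N: "tracial_state (\<pi> ` N) (\<lambda>y. cinner (y \<cdot> \<Omega>) \<Omega>)"
  unfolding tracial_state_def
proof (intro conjI ballI allI)
  fix A B assume "A \<in> \<pi> ` N" "B \<in> \<pi> ` N"
  then obtain x y where xy: "x \<in> R" "y \<in> R" "A = \<pi> x" "B = \<pi> y" using N_in_R by blast
  show "cinner ((A + B) \<cdot> \<Omega>) \<Omega> = cinner (A \<cdot> \<Omega>) \<Omega> + cinner (B \<cdot> \<Omega>) \<Omega>"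
    by (simp add: blinfun.add_left cinner_add_left)
  show "cinner ((A o\<^sub>L B) \<cdot> \<Omega>) \<Omega> = cinner ((B o\<^sub>L A) \<cdot> \<Omega>) \<Omega>"
    using pi_trace[of "x o\<^sub>L y"] pi_trace[of "y o\<^sub>L x"] tr_comm[OF xy(1,2)] xy by (simp add: pi_mult)
next
  fix a A show "cinner ((scalar_op a o\<^sub>L A) \<cdot> \<Omega>) \<Omega> = a * cinner (A \<cdot> \<Omega>) \<Omega>"
    by (simp add: cinner_scaleC_left)
next
  fix A assume "A \<in> \<pi> ` N"
  then have "A \<in> bounded_ops" using pi_N_bounded by auto
  then show "cinner ((adj A o\<^sub>L A) \<cdot> \<Omega>) \<Omega> \<in> \<real>\<^sub>\<ge>\<^sub>0"
    by (simp add: cinner_adj_left nonneg_Reals_cinner)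
next
  show "cinner (id_blinfun \<cdot> \<Omega>) \<Omega> = 1" using pi_trace[of id_blinfun] by (simp add: pi_id tr_id)
  show "ultraweakly_continuous (\<pi> ` N) (\<lambda>y. cinner (y \<cdot> \<Omega>) \<Omega>)"
    by (rule ultraweakly_continuous_finite[where n = 1 and \<xi> = "\<lambda>_. \<Omega>" and \<eta> = "\<lambda>_. \<Omega>"]) simp
qed

text \<open>The trace selected by \<open>vn_trace\<close> is not known to be \<open>tr'\<close>, so
  the value is forced by the axioms: \<open>per\<close> projections, unitarily equivalent to
  \<open>E\<close> in the commutant, add up to the identity.\<close>

lemma e_trace:
  assumes t: "tracial_state N' t" shows "of_nat per * t E = 1"
proof -
  have add: "t (x + y) = t x + t y" if "x \<in> N'" "y \<in> N'" for x y using t that by (simp add: tracial_state_def)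
  have comm: "t (x o\<^sub>L y) = t (y o\<^sub>L x)" if "x \<in> N'" "y \<in> N'" for x y using t that by (simp add: tracial_state_def)
  have eN: "e r \<in> N'" for r unfolding e_def by (intro commutant_algebra rv E_commutant)
  have te: "t (e r) = t E" for r
  proof -
    have "t (e r) = t ((E o\<^sub>L rv (- int r)) o\<^sub>L rv (int r))"
      unfolding e_def by (intro comm commutant_algebra rv E_commutant)
    also have "(E o\<^sub>L rv (- int r)) o\<^sub>L rv (int r) = E"
      using unitary_opD(4)[OF rv(3)[of "int r"]] by (intro blinfun_eqI) (simp add: rv(4))
    finally show ?thesis .
  qed
  have z: "t 0 = 0" using add[of 0 0] commutant_algebra(2)[of "\<pi> ` N"] by simp
  have "t (\<Sum>r<n. e r) = of_nat n * t E \<and> (\<Sum>r<n. e r) \<in> N'" for n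
  proof (induction n)
    case (Suc n)
    then show ?case using add[of "\<Sum>r<n. e r" "e n"] eN te by (auto simp: algebra_simps intro: commutant_algebra)
  qed (auto simp: z intro: commutant_algebra)
  from this[of per] show ?thesis using t by (simp add: sum_e tracial_state_def)
qed

text \<open>Right multiplications by the monomials already move \<open>\<Omega>\<close> through the
  whole basis, so \<open>\<Omega>\<close> is cyclic for the commutant and the numerator is 1. The
  denominator is the trace of the Jones projection, \<open>1 / per\<close>.\<close>

theorem coupling_constant_eq: "coupling_constant (\<pi> ` N) \<Omega> = ereal (real per)"
proof -
  have fin: "finite_factor N'" unfolding finite_factor_def using factor_N' tracial_state_N' by blast
  have im: "(\<lambda>T. T \<cdot> \<Omega>) ` (\<pi> ` N) = gns_vec ` N" by (simp add: image_image gns_vec_def)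
  have cyc: "cyclic_proj (\<pi> ` N) \<Omega> = E"
    by (rule cyclic_proj_eq) (use csubspace_vec_N E in \<open>simp_all add: im M0_def\<close>)
  have cyc': "cyclic_proj N' \<Omega> = id_blinfun"
  proof (rule cyclic_proj_eq)
    let ?S = "(\<lambda>T. T \<cdot> \<Omega>) ` N'"
    show S: "csubspace ?S"
      unfolding csubspace_def
    proof (intro conjI ballI allI)
      show "0 \<in> ?S" using commutant_algebra(2)[of "\<pi> ` N"] by (intro image_eqI[of _ _ 0]) (auto simp: blinfun.zero_left)
      fix x assume "x \<in> ?S"
      then obtain A where A: "A \<in> N'" "x = A \<cdot> \<Omega>" by blast
      show "a *\<^sub>C x \<in> ?S" for a
        using A by (intro image_eqI[of _ _ "scalar_op a o\<^sub>L A"]) (auto intro!: commutant_algebra pi_N_bounded)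
      fix y assume "y \<in> ?S"
      then obtain B where B: "B \<in> N'" "y = B \<cdot> \<Omega>" by blast
      show "x + y \<in> ?S"
        using A B by (intro image_eqI[of _ _ "A + B"]) (auto simp: blinfun.add_left intro!: commutant_algebra)
    qed
    have bS: "b m n \<in> ?S" for m n
    proof -
      have a: "unitary_op (upow u m o\<^sub>L upow v n)" "upow u m o\<^sub>L upow v n \<in> R"
        by (auto intro: unitary_op_compose upow_unitary u v)
      show ?thesis using rmult_Omega[OF a] rmult_N'[OF a] unfolding b_def by force
    qed
    have "closure ?S = UNIV"
    proof (rule closure_eq_UNIV_if_total[OF S])
      show "\<zeta> = 0" if "\<And>s. s \<in> ?S \<Longrightarrow> cinner \<zeta> s = 0" for \<zeta>
        by (rule b_total) (rule that[OF bS])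
    qed
    then show "ortho_proj (closure ?S) id_blinfun" by (simp add: ortho_proj_def)
  qed
  have "tracial_state (\<pi> ` N) (vn_trace (\<pi> ` N))"
    unfolding vn_trace_def by (rule someI[where P = "tracial_state (\<pi> ` N)", OF tracial_state_pi_N])
  then have 1: "vn_trace (\<pi> ` N) id_blinfun = 1" by (simp add: tracial_state_def)
  have "tracial_state N' (vn_trace N')" unfolding vn_trace_def by (rule someI[where P = "tracial_state N'", OF tracial_state_N'])
  then have "of_nat per * vn_trace N' E = 1" by (rule e_trace)
  then have "vn_trace N' E = of_real (1 / real per)" using per(1) by (simp add: field_simps)
  then have "Re (vn_trace N' E) = 1 / real per" by (simp only: Re_complex_of_real)
  then show ?thesis unfolding coupling_constant_def cyc cyc' using fin 1 by simp
qed

end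

section \<open>Existence of the standard representation\<close>

context rotation_factor
begin

text \<open>Enumerates the exponents of the monomials so that Fourier coefficients form a vector of
  \<open>ell2\<close>, the space on which \<open>jones_index\<close> seeks its
  representation.\<close>

definition mon_index :: "nat \<Rightarrow> int \<times> int" where
  "mon_index k = map_prod int_decode int_decode (prod_decode k)"

lemma bij_mon_index: "bij mon_index"
proof -
  have "bij (map_prod int_decode int_decode)"
    using bij_int_decode unfolding bij_def by (intro conjI prod.inj_map map_prod_surj) auto
  then have "bij (map_prod int_decode int_decode \<circ> prod_decode)" by (intro bij_comp bij_prod_decode)
  then show ?thesis by (simp add: mon_index_def[abs_def] comp_def)
qed

definition mon :: "nat \<Rightarrow> 'h oper" where
  "mon k = upow u (fst (mon_index k)) o\<^sub>L upow v (snd (mon_index k))"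

lemma mon_R [simp, intro]: "mon k \<in> R"
  unfolding mon_def by (intro M_closed upow_M u v uR vR)

lemma mon_orthonormal: "\<tau> (adj (mon j) o\<^sub>L mon k) = (if j = k then 1 else 0)"
proof -
  have "mon_index j = mon_index k \<longleftrightarrow> j = k" using bij_mon_index by (auto simp: bij_def inj_def)
  then show ?thesis unfolding mon_def tr_orthonormal by (simp add: prod_eq_iff)
qed

definition fcoef :: "'h oper \<Rightarrow> nat \<Rightarrow> complex" where "fcoef x k = \<tau> (adj (mon k) o\<^sub>L x)"

definition fpart :: "'h oper \<Rightarrow> nat \<Rightarrow> 'h oper" where
  "fpart x K = (\<Sum>k<K. scalar_op (fcoef x k) o\<^sub>L mon k)"

lemma fpart_R: "fpart x K \<in> R"
  unfolding fpart_def by (induction K) auto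

lemma fcoef_add: "x \<in> R \<Longrightarrow> y \<in> R \<Longrightarrow> fcoef (x + y) k = fcoef x k + fcoef y k"
  by (simp add: fcoef_def compose_distribs tr_add)

lemma fcoef_diff: "x \<in> R \<Longrightarrow> y \<in> R \<Longrightarrow> fcoef (x - y) k = fcoef x k - fcoef y k"
  by (simp add: fcoef_def compose_distribs tr_diff)

lemma fcoef_scale: assumes x: "x \<in> R" shows "fcoef (scalar_op a o\<^sub>L x) k = a * fcoef x k"
proof -
  have "adj (mon k) o\<^sub>L (scalar_op a o\<^sub>L x) = scalar_op a o\<^sub>L (adj (mon k) o\<^sub>L x)"
    by (intro blinfun_eqI) (simp add: bounded_opsD)
  then show ?thesis using x by (simp add: fcoef_def tr_scale)
qed

lemma fcoef_mon: "fcoef (mon j) k = (if k = j then 1 else 0)"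
  by (simp add: fcoef_def mon_orthonormal)

lemma fcoef_fpart: "fcoef (fpart x K) k = (if k < K then fcoef x k else 0)"
proof (induction K)
  case 0
  have "adj (mon k) o\<^sub>L 0 = 0" by (intro blinfun_eqI) simp
  then show ?case by (simp add: fpart_def fcoef_def)
next
  case (Suc K)
  have "fpart x (Suc K) = fpart x K + (scalar_op (fcoef x K) o\<^sub>L mon K)" by (simp add: fpart_def)
  then show ?case using Suc fpart_R by (auto simp: fcoef_add fcoef_scale fcoef_mon less_Suc_eq)
qed

text \<open>Pythagoras: each step removes the component along a unit vector orthogonal to the
  earlier ones.\<close>

lemma tsq_fpart:
  assumes x: "x \<in> R" shows "tsq (x - fpart x K) = tsq x - (\<Sum>k<K. (cmod (fcoef x k))\<^sup>2)"
proof (induction K)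
  case (Suc K)
  define y where "y = x - fpart x K"
  have y: "y \<in> R" unfolding y_def using x fpart_R by auto
  have c: "\<tau> (adj (mon K) o\<^sub>L y) = fcoef x K"
    using fcoef_diff[OF x fpart_R, of x K K] by (simp add: fcoef_fpart) (simp add: fcoef_def y_def)
  have t1: "tsq (mon K) = 1" by (simp add: tsq_def mon_orthonormal)
  have "x - fpart x (Suc K) = y - (scalar_op (fcoef x K) o\<^sub>L mon K)" by (simp add: fpart_def y_def)
  then have "tsq (x - fpart x (Suc K)) = tsq y - 2 * Re (cnj (fcoef x K) * fcoef x K) + (cmod (fcoef x K))\<^sup>2"
    using tsq_diff_scaled[OF y mon_R] by (simp add: c t1)
  also have "cnj (fcoef x K) * fcoef x K = of_real ((cmod (fcoef x K))\<^sup>2)"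
    unfolding complex_norm_square by (rule mult.commute)
  finally show ?case using Suc by (simp add: y_def)
qed (simp add: fpart_def)

lemma fpart_diff:
  assumes "x \<in> R" "y \<in> R" shows "fpart (x - y) K = fpart x K - fpart y K"
  using assms unfolding fpart_def sum_subtractf[symmetric]
  by (intro sum.cong refl blinfun_eqI) (simp add: fcoef_diff blinfun.diff_left scaleC_diff_left)

lemma fpart_rot_alg: "a \<in> rot_alg \<Longrightarrow> \<exists>K0. \<forall>K\<ge>K0. fpart a K = a"
proof (induction rule: rot_alg.induct)
  case (monomial c m n)
  obtain j where j: "mon_index j = (m, n)" using bij_mon_index by (metis bij_pointE)
  have mj: "upow u m o\<^sub>L upow v n = mon j" by (simp add: mon_def j)
  have "fpart (scalar_op c o\<^sub>L mon j) K = scalar_op c o\<^sub>L mon j" if "K \<ge> Suc j" for K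
  proof -
    have "fpart (scalar_op c o\<^sub>L mon j) K = (\<Sum>k<K. if k = j then scalar_op c o\<^sub>L mon j else 0)"
      unfolding fpart_def
    proof (intro sum.cong refl)
      fix k
      have "scalar_op 0 o\<^sub>L mon k = 0" by (intro blinfun_eqI) simp
      then show "scalar_op (fcoef (scalar_op c o\<^sub>L mon j) k) o\<^sub>L mon k = (if k = j then scalar_op c o\<^sub>L mon j else 0)"
        by (simp add: fcoef_scale fcoef_mon)
    qed
    then show ?thesis using that by (simp add: sum.delta)
  qed
  then show ?case unfolding mj by blast
next
  case (add x y)
  then obtain K1 K2 where K: "\<And>K. K \<ge> K1 \<Longrightarrow> fpart x K = x" "\<And>K. K \<ge> K2 \<Longrightarrow> fpart y K = y" by blast
  have "fpart (x + y) K = x + y" if "K \<ge> max K1 K2" for K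
  proof -
    have "fpart (x + y) K = fpart x K + fpart y K"
      using rot_alg_R[OF add(1)] rot_alg_R[OF add(2)] unfolding fpart_def sum.distrib[symmetric]
      by (intro sum.cong refl blinfun_eqI) (simp add: fcoef_add blinfun.add_left scaleC_add_left)
    then show ?thesis using K that by simp
  qed
  then show ?case by blast
qed

text \<open>Parseval from density: once \<open>K\<close> is so large that \<open>a\<close> equals
  its own partial sum, \<open>x - fpart x K\<close> arises from \<open>x - a\<close> by removing
  components, so its square norm is at most \<open>tsq (x - a)\<close>.\<close>

lemma fcoef_sums: assumes x: "x \<in> R" shows "(\<lambda>k. (cmod (fcoef x k))\<^sup>2) sums tsq x"
  unfolding sums_def
proof (rule LIMSEQ_I)
  fix e :: real assume "0 < e"
  then obtain a where a: "a \<in> rot_alg" "tsq (x - a) < e" using rot_alg_density[OF x] by blast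
  obtain K0 where K0: "\<And>K. K \<ge> K0 \<Longrightarrow> fpart a K = a" using fpart_rot_alg[OF a(1)] by blast
  have aR: "a \<in> R" "x - a \<in> R" using a rot_alg_R x by auto
  have "norm ((\<Sum>k<K. (cmod (fcoef x k))\<^sup>2) - tsq x) < e" if "K \<ge> K0" for K
  proof -
    have eq: "(x - a) - fpart (x - a) K = x - fpart x K"
      using K0[OF that] fpart_diff[OF x aR(1)] by simp
    then have "tsq (x - fpart x K) \<le> tsq (x - a)"
      using tsq_fpart[OF aR(2), of K] sum_nonneg[of "{..<K}" "\<lambda>k. (cmod (fcoef (x - a) k))\<^sup>2"]
      unfolding eq by simp
    moreover have "0 \<le> tsq (x - fpart x K)" using x fpart_R by (intro tsq_nonneg) auto
    ultimately show ?thesis using tsq_fpart[OF x, of K] a(2) by simp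
  qed
  then show "\<exists>no. \<forall>n\<ge>no. norm ((\<Sum>k<n. (cmod (fcoef x k))\<^sup>2) - tsq x) < e" by blast
qed

definition fvec :: "'h oper \<Rightarrow> ell2" where "fvec x = Abs_ell2 (fcoef x)"

lemma fvec_coeff: "x \<in> R \<Longrightarrow> ell2_coeff (fvec x) = fcoef x"
  using fcoef_sums[of x] by (simp add: fvec_def Abs_ell2_inverse square_summable_def sums_iff)

lemma fvec_norm: "x \<in> R \<Longrightarrow> (norm (fvec x))\<^sup>2 = tsq x"
  using fcoef_sums[of x] by (simp add: norm_ell2_sq fvec_coeff sums_iff)

lemma ell2_eqI: "(\<And>k. ell2_coeff x k = ell2_coeff y k) \<Longrightarrow> x = y"
  by (simp add: ell2_coeff_inject[symmetric] fun_eq_iff)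

lemma fvec_add: "x \<in> R \<Longrightarrow> y \<in> R \<Longrightarrow> fvec (x + y) = fvec x + fvec y"
  by (rule ell2_eqI) (simp add: fvec_coeff plus_ell2.rep_eq fcoef_add)

lemma fvec_scale: "x \<in> R \<Longrightarrow> fvec (scalar_op a o\<^sub>L x) = a *\<^sub>C fvec x"
  by (rule ell2_eqI) (simp add: fvec_coeff scaleC_ell2.rep_eq fcoef_scale)

lemma fvec_diff: "x \<in> R \<Longrightarrow> y \<in> R \<Longrightarrow> fvec (x - y) = fvec x - fvec y"
  using fvec_add[of "x - y" y] by simp

text \<open>Comparing the two expansions of \<open>tsq (x - t y)\<close> for \<open>t = 1\<close>
  and \<open>t = \<i>\<close> recovers the real and imaginary parts from norms, with no
  rearrangement of series.\<close>

lemma fvec_cinner: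
  assumes x: "x \<in> R" and y: "y \<in> R" shows "cinner (fvec x) (fvec y) = \<tau> (adj y o\<^sub>L x)"
proof -
  have "Re (cnj t * cinner (fvec x) (fvec y)) = Re (cnj t * \<tau> (adj y o\<^sub>L x))" for t
  proof -
    have "tsq (x - (scalar_op t o\<^sub>L y)) = (norm (fvec x - t *\<^sub>C fvec y))\<^sup>2"
      using x y by (simp add: fvec_norm[symmetric] fvec_diff fvec_scale)
    then show ?thesis
      using tsq_diff_scaled[OF x y, of t] fvec_norm[OF x] fvec_norm[OF y]
      by (simp add: norm_diff_sq cinner_scaleC_right power_mult_distrib)
  qed
  from this[of 1] this[of \<i>] show ?thesis by (simp add: complex_eq_iff)
qed

lemma fvec_total: assumes "\<And>k. cinner \<zeta> (fvec (mon k)) = 0" shows "\<zeta> = 0"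
proof (rule ell2_eqI)
  fix k
  have "cinner \<zeta> (fvec (mon k)) = (\<Sum>j. if j = k then ell2_coeff \<zeta> k else 0)"
    unfolding cinner_ell2_def l2_inner_def by (rule suminf_cong) (simp add: fvec_coeff fcoef_mon)
  also have "\<dots> = (\<Sum>j\<in>{k}. if j = k then ell2_coeff \<zeta> k else 0)" by (rule suminf_finite) auto
  finally show "ell2_coeff \<zeta> k = ell2_coeff 0 k" using assms by (simp add: zero_ell2.rep_eq)
qed

lemma fvec_dense: "closure (fvec ` R) = UNIV"
proof -
  have S: "csubspace (fvec ` R)"
    unfolding csubspace_def
  proof (intro conjI ballI allI)
    have "fvec 0 = 0" using fvec_scale[of 0 0] by (simp add: blinfun.zero_left)
    then show "0 \<in> fvec ` R" by (metis M_closed(4) image_eqI)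
    fix p assume "p \<in> fvec ` R"
    then obtain x where x: "x \<in> R" "p = fvec x" by blast
    show "a *\<^sub>C p \<in> fvec ` R" for a
      using x by (intro image_eqI[of _ _ "scalar_op a o\<^sub>L x"]) (auto simp: fvec_scale)
    fix q assume "q \<in> fvec ` R"
    then obtain y where y: "y \<in> R" "q = fvec y" by blast
    show "p + q \<in> fvec ` R" using x y by (intro image_eqI[of _ _ "x + y"]) (auto simp: fvec_add)
  qed
  show ?thesis
    by (rule closure_eq_UNIV_if_total[OF S]) (rule fvec_total, simp)
qed

text \<open>\<open>jones_index\<close> selects a standard representation by choice, so one on
  \<open>ell2\<close> has to exist. Left multiplications extend from the vectors of the factor
  thanks to \<open>tsq_mult_le\<close>.\<close>

lemma gns_rep_exists: "\<exists>\<pi> (\<Omega>::ell2). gns_rep R \<tau> \<pi> \<Omega>"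
proof -
  have "\<exists>T\<in>bounded_ops. \<forall>y\<in>R. T \<cdot> (fvec y) = fvec (x o\<^sub>L y)" if x: "x \<in> R" for x
  proof (rule dense_extension[OF fvec_dense])
    show "\<exists>z\<in>R. fvec z = fvec y + fvec y' \<and> fvec (x o\<^sub>L z) = fvec (x o\<^sub>L y) + fvec (x o\<^sub>L y')" if "y \<in> R" "y' \<in> R" for y y'
      using that x by (intro bexI[of _ "y + y'"]) (auto simp: fvec_add compose_distribs)
    show "\<exists>z\<in>R. fvec z = c *\<^sub>C fvec y \<and> fvec (x o\<^sub>L z) = c *\<^sub>C fvec (x o\<^sub>L y)" if "y \<in> R" for c y
    proof (intro bexI[of _ "scalar_op c o\<^sub>L y"] conjI)
      have "x o\<^sub>L (scalar_op c o\<^sub>L y) = scalar_op c o\<^sub>L (x o\<^sub>L y)" using x by (intro blinfun_eqI) (simp add: bounded_opsD)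
      then show "fvec (x o\<^sub>L (scalar_op c o\<^sub>L y)) = c *\<^sub>C fvec (x o\<^sub>L y)" using that x by (simp add: fvec_scale)
    qed (use that in \<open>auto simp: fvec_scale\<close>)
    show "norm (fvec (x o\<^sub>L y)) \<le> norm x * norm (fvec y)" if y: "y \<in> R" for y
    proof (rule power2_le_imp_le)
      show "(norm (fvec (x o\<^sub>L y)))\<^sup>2 \<le> (norm x * norm (fvec y))\<^sup>2"
        using tsq_mult_le[OF x y] x y by (simp add: fvec_norm power_mult_distrib)
    qed simp
  qed
  then have "\<forall>x. \<exists>T. x \<in> R \<longrightarrow> T \<in> bounded_ops \<and> (\<forall>y\<in>R. T \<cdot> (fvec y) = fvec (x o\<^sub>L y))" by blast
  from choice[OF this] obtain \<pi> where pi: "\<And>x. x \<in> R \<Longrightarrow> \<pi> x \<in> bounded_ops"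
    "\<And>x y. x \<in> R \<Longrightarrow> y \<in> R \<Longrightarrow> (\<pi> x) \<cdot> (fvec y) = fvec (x o\<^sub>L y)" by blast
  have eqI: "A = B" if "A \<in> bounded_ops" "B \<in> bounded_ops"
    "\<And>y. y \<in> R \<Longrightarrow> A \<cdot> (fvec y) = B \<cdot> (fvec y)" for A B :: "ell2 oper"
    by (rule total_eqI[where s = "\<lambda>k. fvec (mon k)", OF that(1,2) fvec_total that(3)]) auto
  have Omega: "\<pi> x \<cdot> (fvec id_blinfun) = fvec x" if "x \<in> R" for x using pi(2)[OF that, of id_blinfun] by simp
  have "gns_rep R \<tau> \<pi> (fvec id_blinfun)"
  proof unfold_locales
    fix x y a assume x: "x \<in> R"
    show "\<pi> x \<in> bounded_ops" using x by (rule pi)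
    show "cinner (\<pi> x \<cdot> (fvec id_blinfun)) (fvec id_blinfun) = \<tau> x"
      using x by (simp add: Omega fvec_cinner)
    show "\<pi> (scalar_op a o\<^sub>L x) = scalar_op a o\<^sub>L \<pi> x"
      using x pi(1) by (intro eqI) (auto simp: pi(2) fvec_scale blinfun_compose_assoc)
    show "\<pi> (adj x) = adj (\<pi> x)"
    proof (rule adj_unique[symmetric])
      fix p q
      have "adj (\<pi> (adj x)) = \<pi> x"
      proof (rule eqI)
        fix y assume y: "y \<in> R"
        show "adj (\<pi> (adj x)) \<cdot> (fvec y) = (\<pi> x) \<cdot> (fvec y)"
        proof -
          have "adj (\<pi> (adj x)) \<cdot> (fvec y) - (\<pi> x) \<cdot> (fvec y) = 0"
          proof (rule cinner_ext_left)
            fix z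
            have "z \<in> closure (fvec ` R)" using fvec_dense by simp
            then obtain Z where Z: "\<And>n. Z n \<in> fvec ` R" "Z \<longlonglongrightarrow> z" unfolding closure_sequential by blast
            let ?d = "adj (\<pi> (adj x)) \<cdot> (fvec y) - (\<pi> x) \<cdot> (fvec y)"
            have "cinner ?d (Z n) = 0" for n
            proof -
              obtain t where t: "t \<in> R" "Z n = fvec t" using Z(1)[of n] by blast
              have "adj (adj x o\<^sub>L t) o\<^sub>L y = adj t o\<^sub>L (x o\<^sub>L y)"
                using x t by (simp add: adj_compose) (simp add: blinfun_compose_assoc)
              then show ?thesis using x y t pi(1)[of "adj x"]
                by (simp add: cinner_diff_left cinner_adj_left pi(2) fvec_cinner)
            qed
            moreover have "(\<lambda>n. cinner ?d (Z n)) \<longlonglongrightarrow> cinner ?d z" by (intro tendsto_intros Z)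
            ultimately show "cinner ?d z = cinner 0 z" by (simp add: LIMSEQ_const_iff)
          qed
          then show ?thesis by simp
        qed
      qed (use x pi(1) in auto)
      then show "cinner (\<pi> x \<cdot> p) q = cinner p (\<pi> (adj x) \<cdot> q)"
        using cinner_adj_left[OF pi(1)[OF M_closed(1)[OF x]], of p q] by simp
    qed
    assume y: "y \<in> R"
    show "\<pi> (x + y) = \<pi> x + \<pi> y"
      using x y pi(1) by (intro eqI) (auto simp: pi(2) blinfun.add_left compose_distribs fvec_add)
    show "\<pi> (x o\<^sub>L y) = \<pi> x o\<^sub>L \<pi> y"
      using x y pi(1) by (intro eqI) (auto simp: pi(2) blinfun_compose_assoc)
  next
    have "(\<lambda>x. (\<pi> x) \<cdot> (fvec id_blinfun)) ` R = fvec ` R" using Omega by (intro image_cong) auto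
    then show "closure ((\<lambda>x. (\<pi> x) \<cdot> (fvec id_blinfun)) ` R) = UNIV" using fvec_dense by simp
  qed
  then show ?thesis by blast
qed

end

lemma (in factor_trace) gns_rep_iff_standard:
  assumes "\<tau> = vn_trace M"
  shows "gns_rep M \<tau> \<pi> \<Omega> \<longleftrightarrow> standard_representation M \<pi> \<Omega>"
  using assms factor_trace_axioms
  unfolding gns_rep_def gns_rep_axioms_def standard_representation_def by auto

lemma circle_exp_irrational:
  assumes "\<theta> \<notin> \<rat>" "k \<noteq> 0" shows "circle_exp \<theta> powi k \<noteq> 1"
proof
  assume "circle_exp \<theta> powi k = 1"
  then have "exp (2 * of_real pi * \<i> * complex_of_real (of_int k * \<theta>)) = 1"
    unfolding circle_exp_powi by (simp add: circle_exp_def)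
  then obtain n :: int where "2 * pi * (of_int k * \<theta>) = of_int (2 * n) * pi" by (auto simp: exp_eq_1)
  then have "of_int k * \<theta> = of_int n" by simp
  then have "\<theta> = of_int n / of_int k" using assms(2) by (simp add: field_simps)
  then have "\<theta> \<in> \<rat>" by simp
  with assms(1) show False ..
qed

theorem corollary4p3:
  fixes R :: "('h::chilbert) oper set"
    and u v :: "'h oper"
    and \<theta> :: real
    and f :: "complex \<Rightarrow> complex"
  assumes "II1_factor R" and "hyperfinite R"
    and "0 < \<theta>" and "\<theta> < 1" and "\<theta> \<notin> \<rat>"
    and "unitary_op u" and "unitary_op v"
    and "u \<in> R" and "v \<in> R"
    and "R = commutant (commutant {u, v})"
    and "v o\<^sub>L u = scalar_op (exp (2 * of_real pi * \<i> * of_real \<theta>)) o\<^sub>L (u o\<^sub>L v)"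
    and "f \<in> Linfty_circle"
    and "AE z in circle_measure. f z \<noteq> 0"
    and "borel_calculus (\<lambda>z. complex_of_real (cmod (f z))) v \<notin> range scalar_op"
  shows "irreducible_subfactor R (Wstar (u o\<^sub>L borel_calculus f v)) \<and>
    (\<exists>n::nat. 0 < n \<and>
       jones_index R (Wstar (u o\<^sub>L borel_calculus f v)) = ereal (real n))"
proof -
  have ex: "\<exists>\<tau>. tracial_state R \<tau>" and fac: "factor R"
    using assms(1) by (auto simp: II1_factor_def finite_factor_def)
  have tr: "tracial_state R (vn_trace R)" unfolding vn_trace_def using ex by (rule someI_ex)
  interpret rotation_factor R "vn_trace R" v u "circle_exp \<theta>"
    by unfold_locales
      (use assms fac tr circle_exp_irrational in \<open>auto simp: circle_exp_simps circle_exp_def[symmetric]\<close>)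
  define N where "N = Wstar (u o\<^sub>L borel_calculus f v)"
  obtain w k where "rotation_subalgebra R (vn_trace R) v u (circle_exp \<theta>) N w k"
    using rotation_subalgebra_Wstar[OF assms(12-14)] unfolding N_def by blast
  then interpret N: rotation_subalgebra R "vn_trace R" v u "circle_exp \<theta>" N w k .
  \<comment> \<open>Whichever pair is selected, it is a standard representation, and the computation
    of the coupling constant applies to it.\<close>
  define p where "p = (SOME (\<pi>, \<Omega>). standard_representation R \<pi> (\<Omega> :: ell2))"
  define \<pi> \<Omega> where "\<pi> = fst p" and "\<Omega> = snd p"
  have "\<exists>p. case p of (\<pi>, \<Omega>) \<Rightarrow> standard_representation R \<pi> (\<Omega> :: ell2)"
    using gns_rep_exists gns_rep_iff_standard[OF refl] by auto
  from someI_ex[OF this] have "standard_representation R \<pi> \<Omega>"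
    unfolding p_def[symmetric] \<pi>_def \<Omega>_def by (simp add: case_prod_beta)
  then have "gns_rep R (vn_trace R) \<pi> \<Omega>" by (simp add: gns_rep_iff_standard[OF refl])
  then interpret gns_rep R "vn_trace R" \<pi> \<Omega> .
  interpret rotation_gns R "vn_trace R" v u "circle_exp \<theta>" N w k \<pi> \<Omega> by unfold_locales
  have "irreducible_subfactor R N"
    unfolding irreducible_subfactor_def using factor_N N.N_R irreducible by blast
  moreover have "jones_index R N = coupling_constant (\<pi> ` N) \<Omega>"
    unfolding jones_index_def p_def[symmetric] by (simp add: case_prod_beta \<pi>_def \<Omega>_def)
  ultimately show ?thesis using coupling_constant_eq per(1) unfolding N_def by auto
qed

end
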